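(* Let $(R,\mathfrak{m},k)$ be a commutative Noetherian local ring. Assume that to each totally reflexive $R$-module $G$ there is assigned a big Cohen-Macaulay $R$-module $B_G$ such that $\operatorname{Soc}(B_G\otimes_R G)=0$. If there exists a non-exact complex $$\mathcal{G}: \quad 0\to G_s\to G_{s-1}\to\cdots\to G_0\to 0$$ of totally reflexive $R$-modules all of whose homology modules have finite length, then $s\ge \dim R$.
   Context: A finitely generated $R$-module $M$ is totally reflexive if there is an exact complex $F=\cdots\to F_2\xrightarrow{d_2}F_1\xrightarrow{d_1}F_0\xrightarrow{d_0}F_{-1}\to\cdots$ of finitely generated free $R$-modules such that $\operatorname{Hom}_R(F,R)$ is exact and $M\cong\operatorname{im} d_0$. A (not necessarily finitely generated) $R$-module $B$ is big Cohen-Macaulay if there exists a system of parameters $\mathbf{x}=x_1,\ldots,x_n$ of $R$ that is a $B$-regular sequence (regularity includes $B\neq(\mathbf{x})B$). For an $R$-module $M$, $\operatorname{Soc}(M):=(0:_M\mathfrak{m})=\{m\in M : \mathfrak{m}m=0\}$. A complex is non-exact if at least one of its homology modules is non-zero. *)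

theory Defs
  imports "HOL-Algebra.Algebra" "HOL-Library.Extended_Nat"
begin

section \<open>Rings and ideals\<close>

locale noetherian_local_ring = noetherian_ring R + cring R for R (structure) +
  fixes \<mm> :: "'a set"
  assumes maximal: "maximalideal \<mm> R"
    and maximal_unique: "maximalideal J R \<Longrightarrow> J = \<mm>"

text \<open>The supremum of the lengths \<open>n\<close> of strict chains \<open>N 0 \<subset> \<dots> \<subset> N n\<close> in a family of sets.\<close>

definition chain_length :: "'x set set \<Rightarrow> enat" where
  "chain_length \<S> = Sup {enat n |n. \<exists>N :: nat \<Rightarrow> 'x set.
     (\<forall>i\<le>n. N i \<in> \<S>) \<and> (\<forall>i<n. N i \<subset> N (Suc i))}"

definition krull_dim :: "('a, 'c) ring_scheme \<Rightarrow> enat" where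
  "krull_dim R = chain_length {P. primeideal P R}"

definition radical :: "('a, 'c) ring_scheme \<Rightarrow> 'a set \<Rightarrow> 'a set" where
  "radical R I = {a \<in> carrier R. \<exists>k::nat. a [^]\<^bsub>R\<^esub> k \<in> I}"

text \<open>For the maximal ideal \<open>\<mm>\<close>, an ideal is \<open>\<mm>\<close>-primary iff its radical is \<open>\<mm>\<close>.\<close>

definition system_of_parameters :: "('a, 'c) ring_scheme \<Rightarrow> 'a set \<Rightarrow> 'a list \<Rightarrow> bool" where
  "system_of_parameters R \<mm> xs \<longleftrightarrow>
     set xs \<subseteq> \<mm> \<and> enat (length xs) = krull_dim R \<and> radical R (Idl\<^bsub>R\<^esub> (set xs)) = \<mm>"


section \<open>Modules\<close>

text \<open>
  The record type of modules extends that of rings; the locale \<^locale>\<open>module\<close> ignores the fields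
  \<^const>\<open>monoid.mult\<close> and \<^const>\<open>monoid.one\<close> of a module, and they are left undefined in the constructions below.
\<close>

definition submodule_span :: "('a, 'c) ring_scheme \<Rightarrow> ('a, 'm) module \<Rightarrow> 'm set \<Rightarrow> 'm set" where
  "submodule_span R M S = \<Inter>{N. submodule N R M \<and> S \<subseteq> N}"

definition fin_gen :: "('a, 'c) ring_scheme \<Rightarrow> ('a, 'm) module \<Rightarrow> bool" where
  "fin_gen R M \<longleftrightarrow> (\<exists>S. finite S \<and> S \<subseteq> carrier M \<and> submodule_span R M S = carrier M)"

definition module_length :: "('a, 'c) ring_scheme \<Rightarrow> ('a, 'm) module \<Rightarrow> enat" where
  "module_length R M = chain_length {N. submodule N R M}"

definition finite_length :: "('a, 'c) ring_scheme \<Rightarrow> ('a, 'm) module \<Rightarrow> bool" where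
  "finite_length R M \<longleftrightarrow> module_length R M < \<infinity>"

definition mod_hom ::
    "('a, 'c) ring_scheme \<Rightarrow> ('a, 'm) module \<Rightarrow> ('a, 'n) module \<Rightarrow> ('m \<Rightarrow> 'n) set" where
  "mod_hom R M N = {f \<in> carrier M \<rightarrow> carrier N.
     (\<forall>x\<in>carrier M. \<forall>y\<in>carrier M. f (x \<oplus>\<^bsub>M\<^esub> y) = f x \<oplus>\<^bsub>N\<^esub> f y) \<and>
     (\<forall>a\<in>carrier R. \<forall>x\<in>carrier M. f (a \<odot>\<^bsub>M\<^esub> x) = a \<odot>\<^bsub>N\<^esub> f x)}"

definition mod_iso ::
    "('a, 'c) ring_scheme \<Rightarrow> ('a, 'm) module \<Rightarrow> ('a, 'n) module \<Rightarrow> bool" where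
  "mod_iso R M N \<longleftrightarrow> (\<exists>f\<in>mod_hom R M N. bij_betw f (carrier M) (carrier N))"

definition zero_module :: "('a, 'm) module \<Rightarrow> bool" where
  "zero_module M \<longleftrightarrow> carrier M = {\<zero>\<^bsub>M\<^esub>}"

definition regular_module :: "('a, 'c) ring_scheme \<Rightarrow> ('a, 'a) module" where
  "regular_module R = \<lparr>carrier = carrier R, monoid.mult = undefined, monoid.one = undefined,
     ring.zero = \<zero>\<^bsub>R\<^esub>, ring.add = (\<oplus>\<^bsub>R\<^esub>), module.smult = (\<otimes>\<^bsub>R\<^esub>)\<rparr>"

definition quot_module :: "('a, 'm) module \<Rightarrow> 'm set \<Rightarrow> ('a, 'm set) module" where
  "quot_module M N = \<lparr>carrier = a_rcosets\<^bsub>M\<^esub> N, monoid.mult = undefined, monoid.one = undefined,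
     ring.zero = N, ring.add = (\<lambda>U V. U <+>\<^bsub>M\<^esub> V), module.smult = (\<lambda>a U. \<Union>x\<in>U. N +>\<^bsub>M\<^esub> (a \<odot>\<^bsub>M\<^esub> x))\<rparr>"

text \<open>Elements of the free module on \<open>S\<close> are functions of finite support contained in \<open>S\<close>.\<close>

definition free_module :: "('a, 'c) ring_scheme \<Rightarrow> 's set \<Rightarrow> ('a, 's \<Rightarrow> 'a) module" where
  "free_module R S = \<lparr>carrier = {f. (\<forall>s. f s \<in> carrier R) \<and> (\<forall>s. s \<notin> S \<longrightarrow> f s = \<zero>\<^bsub>R\<^esub>) \<and>
                                  finite {s. f s \<noteq> \<zero>\<^bsub>R\<^esub>}},
     monoid.mult = undefined, monoid.one = undefined,
     ring.zero = (\<lambda>s. \<zero>\<^bsub>R\<^esub>), ring.add = (\<lambda>f g s. f s \<oplus>\<^bsub>R\<^esub> g s), module.smult = (\<lambda>a f s. a \<otimes>\<^bsub>R\<^esub> f s)\<rparr>"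

definition basis_elt :: "('a, 'c) ring_scheme \<Rightarrow> 's \<Rightarrow> 's \<Rightarrow> 'a" where
  "basis_elt R s = (\<lambda>t. if t = s then \<one>\<^bsub>R\<^esub> else \<zero>\<^bsub>R\<^esub>)"

text \<open>The maps are made extensional so that equal homomorphisms are equal as HOL functions.\<close>

definition Hom_module ::
    "('a, 'c) ring_scheme \<Rightarrow> ('a, 'm) module \<Rightarrow> ('a, 'n) module \<Rightarrow> ('a, 'm \<Rightarrow> 'n) module" where
  "Hom_module R M N = \<lparr>carrier = mod_hom R M N \<inter> extensional (carrier M),
     monoid.mult = undefined, monoid.one = undefined,
     ring.zero = (\<lambda>x\<in>carrier M. \<zero>\<^bsub>N\<^esub>),
     ring.add = (\<lambda>f g. \<lambda>x\<in>carrier M. f x \<oplus>\<^bsub>N\<^esub> g x),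
     module.smult = (\<lambda>a f. \<lambda>x\<in>carrier M. a \<odot>\<^bsub>N\<^esub> f x)\<rparr>"

text \<open>
  The tensor product over a commutative ring \<open>R\<close>: the free module on \<open>carrier M \<times> carrier N\<close>
  modulo the relations of bilinearity.
\<close>

definition bilinear_relations ::
    "('a, 'c) ring_scheme \<Rightarrow> ('a, 'm) module \<Rightarrow> ('a, 'n) module \<Rightarrow> ('m \<times> 'n \<Rightarrow> 'a) set" where
  "bilinear_relations R M N =
    (let F = free_module R (carrier M \<times> carrier N); e = (\<lambda>x y. basis_elt R (x, y)) in
      {e (x \<oplus>\<^bsub>M\<^esub> x') y \<ominus>\<^bsub>F\<^esub> (e x y \<oplus>\<^bsub>F\<^esub> e x' y) |x x' y.
          x \<in> carrier M \<and> x' \<in> carrier M \<and> y \<in> carrier N} \<union>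
      {e x (y \<oplus>\<^bsub>N\<^esub> y') \<ominus>\<^bsub>F\<^esub> (e x y \<oplus>\<^bsub>F\<^esub> e x y') |x y y'.
          x \<in> carrier M \<and> y \<in> carrier N \<and> y' \<in> carrier N} \<union>
      {e (a \<odot>\<^bsub>M\<^esub> x) y \<ominus>\<^bsub>F\<^esub> a \<odot>\<^bsub>F\<^esub> e x y |a x y.
          a \<in> carrier R \<and> x \<in> carrier M \<and> y \<in> carrier N} \<union>
      {e x (a \<odot>\<^bsub>N\<^esub> y) \<ominus>\<^bsub>F\<^esub> a \<odot>\<^bsub>F\<^esub> e x y |a x y.
          a \<in> carrier R \<and> x \<in> carrier M \<and> y \<in> carrier N})"

definition tensor_module ::
    "('a, 'c) ring_scheme \<Rightarrow> ('a, 'm) module \<Rightarrow> ('a, 'n) module \<Rightarrow> ('a, ('m \<times> 'n \<Rightarrow> 'a) set) module"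
  where
  "tensor_module R M N =
    (let F = free_module R (carrier M \<times> carrier N) in
       quot_module F (submodule_span R F (bilinear_relations R M N)))"

definition socle :: "'a set \<Rightarrow> ('a, 'm) module \<Rightarrow> 'm set" where
  "socle \<mm> M = {x \<in> carrier M. \<forall>a\<in>\<mm>. a \<odot>\<^bsub>M\<^esub> x = \<zero>\<^bsub>M\<^esub>}"


section \<open>Big Cohen-Macaulay modules\<close>

definition ideal_smult ::
    "('a, 'c) ring_scheme \<Rightarrow> 'a set \<Rightarrow> ('a, 'm) module \<Rightarrow> 'm set" where
  "ideal_smult R I M = submodule_span R M {a \<odot>\<^bsub>M\<^esub> x |a x. a \<in> I \<and> x \<in> carrier M}"

definition nonzerodivisor_on :: "'a \<Rightarrow> ('a, 'm) module \<Rightarrow> bool" where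
  "nonzerodivisor_on a M \<longleftrightarrow> (\<forall>x\<in>carrier M. a \<odot>\<^bsub>M\<^esub> x = \<zero>\<^bsub>M\<^esub> \<longrightarrow> x = \<zero>\<^bsub>M\<^esub>)"

definition regular_sequence :: "('a, 'c) ring_scheme \<Rightarrow> ('a, 'm) module \<Rightarrow> 'a list \<Rightarrow> bool" where
  "regular_sequence R M xs \<longleftrightarrow>
     set xs \<subseteq> carrier R \<and>
     (\<forall>i<length xs. nonzerodivisor_on (xs ! i)
        (quot_module M (ideal_smult R (Idl\<^bsub>R\<^esub> (set (take i xs))) M))) \<and>
     carrier M \<noteq> ideal_smult R (Idl\<^bsub>R\<^esub> (set xs)) M"

definition big_cohen_macaulay ::
    "('a, 'c) ring_scheme \<Rightarrow> 'a set \<Rightarrow> ('a, 'b) module \<Rightarrow> bool" where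
  "big_cohen_macaulay R \<mm> B \<longleftrightarrow>
     module R B \<and> (\<exists>xs. system_of_parameters R \<mm> xs \<and> regular_sequence R B xs)"


section \<open>Complexes\<close>

text \<open>Complexes are indexed by the integers, with differentials \<open>d i : C i \<rightarrow> C (i - 1)\<close>.\<close>

definition chain_complex ::
    "('a, 'c) ring_scheme \<Rightarrow> (int \<Rightarrow> ('a, 'm) module) \<Rightarrow> (int \<Rightarrow> 'm \<Rightarrow> 'm) \<Rightarrow> bool" where
  "chain_complex R C d \<longleftrightarrow>
     (\<forall>i. module R (C i)) \<and>
     (\<forall>i. d i \<in> mod_hom R (C i) (C (i - 1))) \<and>
     (\<forall>i. \<forall>x\<in>carrier (C i). d (i - 1) (d i x) = \<zero>\<^bsub>C (i - 2)\<^esub>)"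

definition cycles ::
    "(int \<Rightarrow> ('a, 'm) module) \<Rightarrow> (int \<Rightarrow> 'm \<Rightarrow> 'm) \<Rightarrow> int \<Rightarrow> 'm set" where
  "cycles C d i = {x \<in> carrier (C i). d i x = \<zero>\<^bsub>C (i - 1)\<^esub>}"

definition boundaries ::
    "(int \<Rightarrow> ('a, 'm) module) \<Rightarrow> (int \<Rightarrow> 'm \<Rightarrow> 'm) \<Rightarrow> int \<Rightarrow> 'm set" where
  "boundaries C d i = d (i + 1) ` carrier (C (i + 1))"

definition homology ::
    "(int \<Rightarrow> ('a, 'm) module) \<Rightarrow> (int \<Rightarrow> 'm \<Rightarrow> 'm) \<Rightarrow> int \<Rightarrow> ('a, 'm set) module" where
  "homology C d i = quot_module ((C i)\<lparr>carrier := cycles C d i\<rparr>) (boundaries C d i)"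

definition exact_complex ::
    "('a, 'c) ring_scheme \<Rightarrow> (int \<Rightarrow> ('a, 'm) module) \<Rightarrow> (int \<Rightarrow> 'm \<Rightarrow> 'm) \<Rightarrow> bool" where
  "exact_complex R C d \<longleftrightarrow> chain_complex R C d \<and> (\<forall>i. zero_module (homology C d i))"

text \<open>
  \<open>Hom\<^sub>R(C, N)\<close>, regraded homologically: the term in degree \<open>i\<close> is \<open>Hom\<^sub>R(C\<^sub>-\<^sub>i, N)\<close>, and
  the differential out of it is precomposition with \<open>d (1 - i) : C (1 - i) \<rightarrow> C (- i)\<close>.
\<close>

definition Hom_complex ::
    "('a, 'c) ring_scheme \<Rightarrow> (int \<Rightarrow> ('a, 'm) module) \<Rightarrow> ('a, 'n) module \<Rightarrow>
     int \<Rightarrow> ('a, 'm \<Rightarrow> 'n) module" where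
  "Hom_complex R C N i = Hom_module R (C (- i)) N"

definition Hom_diff ::
    "(int \<Rightarrow> ('a, 'm) module) \<Rightarrow> (int \<Rightarrow> 'm \<Rightarrow> 'm) \<Rightarrow> int \<Rightarrow> ('m \<Rightarrow> 'n) \<Rightarrow> 'm \<Rightarrow> 'n" where
  "Hom_diff C d i f = (\<lambda>x\<in>carrier (C (1 - i)). f (d (1 - i) x))"

text \<open>
  Every finitely generated free module is isomorphic to some \<open>R\<^sup>n\<close>, here
  \<^term>\<open>free_module R {..<n::nat}\<close>; this form avoids quantifying over a carrier type.
\<close>

definition totally_reflexive :: "('a, 'c) ring_scheme \<Rightarrow> ('a, 'm) module \<Rightarrow> bool" where
  "totally_reflexive R M \<longleftrightarrow>
     module R M \<and> fin_gen R M \<and>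
     (\<exists>(n :: int \<Rightarrow> nat) d.
        let F = (\<lambda>i. free_module R {..<n i}) in
          exact_complex R F d \<and>
          exact_complex R (Hom_complex R F (regular_module R)) (Hom_diff F d) \<and>
          mod_iso R M ((F (- 1))\<lparr>carrier := d 0 ` carrier (F 0)\<rparr>))"

text \<open>
  HOL cannot quantify over modules with arbitrary carrier type inside a statement. The carrier type
  below suffices for finitely generated modules: it is the one of the quotients
  \<^term>\<open>quot_module (free_module R {..<n::nat}) N\<close> of \<open>R\<^sup>n\<close>, so every finitely generated \<open>R\<close>-module,
  on whatever carrier, is isomorphic to one of this type.
\<close>

type_synonym 'a fg_module = "('a, (nat \<Rightarrow> 'a) set) module"

end

theory Submission
  imports Defs
begin

text \<open>
  Assume \<open>n = dim R > s\<close>. A nonzero homology class of the given complex \<open>G\<close> is carried into \<open>B \<otimes> Q\<close>, for a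
  complex \<open>Q\<close> of finitely generated free modules and a suitable big Cohen-Macaulay module \<open>B\<close>, and the
  class is shown to vanish there.

  Each \<open>G\<^sub>i\<close> is a syzygy in a totally acyclic complex of free modules. These complexes are
  glued by iterated mapping cones along extensions of the differentials of \<open>G\<close>. The result is a totally
  acyclic complex \<open>T\<close> with a subcomplex \<open>L\<close>, zero above degree \<open>s\<close>, and a quasi-isomorphism \<open>G \<rightarrow> L\<close>
  (\<open>coresolves_exists\<close>). The quotient \<open>Q = T / L\<close> is zero below degree \<open>1\<close>, and exactness of \<open>T\<close> gives
  \<open>H\<^sub>j\<^sub>+\<^sub>1(Q) \<cong> H\<^sub>j(L) \<cong> H\<^sub>j(G)\<close>.

  Let \<open>t\<close> be the least degree with \<open>H\<^sub>t(G) \<noteq> 0\<close>. Then \<open>Q\<close> is contractible up to degree \<open>t\<close>,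
  so that \<open>H\<^sub>t\<^sub>+\<^sub>1(Q)\<close> is the cokernel of a matrix over \<open>R\<close>. By a form of Nakayama's lemma there is a nonzero
  class \<open>u\<close> in \<open>H\<^sub>t\<^sub>+\<^sub>1(B \<otimes> Q)\<close> for every module \<open>B\<close> with \<open>\<mm>B \<noteq> B\<close> (\<open>base_change_cycle\<close>).

  A power of each element of \<open>\<mm>\<close> annihilates the homology of \<open>G\<close>. As \<open>T\<close> and its dual are exact,
  a power is then null-homotopic on \<open>Q\<close> up to any given degree and on \<open>L\<close> from any given degree upwards
  (\<open>cone_homotopies\<close>). Homotopies survive base change, so that \<open>B \<otimes> L\<close> and \<open>B \<otimes> Q\<close> have torsion homology
  in these ranges; in particular \<open>u\<close> is torsion.

  Let \<open>B\<close> be the module assigned to \<open>N = coker (T\<^sub>t\<^sub>+\<^sub>2 \<rightarrow> T\<^sub>t\<^sub>+\<^sub>1)\<close>, which is totally reflexive. Each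
  \<open>B \<otimes> L\<^sub>j\<close> has depth at least \<open>n\<close>, and an acyclicity argument in the manner of Peskine and Szpiro, descending from
  degree \<open>s\<close>, gives depth at least \<open>n - s + t + 1 \<ge> 2\<close> for the cokernel of \<open>B \<otimes> L\<^sub>t\<^sub>+\<^sub>2 \<rightarrow> B \<otimes> L\<^sub>t\<^sub>+\<^sub>1\<close>
  (\<open>acyclicity_tail\<close>). The hypothesis \<open>Soc (B \<otimes> N) = 0\<close> says that \<open>B \<otimes> N\<close> has depth at least \<open>1\<close>. The
  cokernel of \<open>B \<otimes> Q\<^sub>t\<^sub>+\<^sub>2 \<rightarrow> B \<otimes> Q\<^sub>t\<^sub>+\<^sub>1\<close> is the quotient of the second module by the first, hence has depth
  at least \<open>1\<close> and no torsion element other than \<open>0\<close> (\<open>acyclicity\<close>). This contradicts the choice of \<open>u\<close>.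
\<close>

section \<open>Families of module elements\<close>

locale rmodule = module R M for R :: "('a, 'c) ring_scheme" (structure) and M :: "('a, 'm) module" (structure)

text \<open>
  The direct sum of copies of \<open>N\<close> indexed by \<open>S\<close>, that is, the tensor product of
  \<open>N\<close> with the free module on \<open>S\<close>. Its elements are functions on the whole index type, so that
  the sums over different \<open>S\<close> are all submodules of \<open>vspace N\<close> and one addition serves for all
  of them.
\<close>

definition vec_module :: "('a, 'm) module \<Rightarrow> 's set \<Rightarrow> ('a, 's \<Rightarrow> 'm) module" where
  "vec_module N S = \<lparr>carrier = {f. (\<forall>s. f s \<in> carrier N) \<and> (\<forall>s. s \<notin> S \<longrightarrow> f s = \<zero>\<^bsub>N\<^esub>) \<and>
                                  finite {s. f s \<noteq> \<zero>\<^bsub>N\<^esub>}},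
     monoid.mult = undefined, monoid.one = undefined,
     ring.zero = (\<lambda>s. \<zero>\<^bsub>N\<^esub>), ring.add = (\<lambda>f g s. f s \<oplus>\<^bsub>N\<^esub> g s), module.smult = (\<lambda>a f s. a \<odot>\<^bsub>N\<^esub> f s)\<rparr>"

abbreviation vecs :: "('a, 'm) module \<Rightarrow> 's set \<Rightarrow> ('s \<Rightarrow> 'm) set" where
  "vecs N S \<equiv> carrier (vec_module N S)"

abbreviation vspace :: "('a, 'm) module \<Rightarrow> ('a, 's \<Rightarrow> 'm) module" where
  "vspace N \<equiv> vec_module N UNIV"

lemma vec_module_regular: "vec_module (regular_module R) S = free_module R S"
  by (simp add: vec_module_def free_module_def regular_module_def)

lemma vec_simps [simp]:
  "(f \<oplus>\<^bsub>vec_module N S\<^esub> g) s = f s \<oplus>\<^bsub>N\<^esub> g s"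
  "\<zero>\<^bsub>vec_module N S\<^esub> s = \<zero>\<^bsub>N\<^esub>"
  "(a \<odot>\<^bsub>vec_module N S\<^esub> f) s = a \<odot>\<^bsub>N\<^esub> f s"
  by (simp_all add: vec_module_def)

lemma vecsD:
  assumes "v \<in> vecs N S"
  shows "v s \<in> carrier N" "s \<notin> S \<Longrightarrow> v s = \<zero>\<^bsub>N\<^esub>" "finite {s. v s \<noteq> \<zero>\<^bsub>N\<^esub>}" "{s. v s \<noteq> \<zero>\<^bsub>N\<^esub>} \<subseteq> S"
  using assms by (auto simp: vec_module_def )

lemma vecsI:
  assumes "\<And>s. v s \<in> carrier N" "\<And>s. s \<notin> S \<Longrightarrow> v s = \<zero>\<^bsub>N\<^esub>" "finite {s. v s \<noteq> \<zero>\<^bsub>N\<^esub>}"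
  shows "v \<in> vecs N S"
  using assms by (auto simp: vec_module_def )

lemma vecsI_fin:
  assumes "\<And>s. v s \<in> carrier N" "\<And>s. s \<notin> S \<Longrightarrow> v s = \<zero>\<^bsub>N\<^esub>" "finite S"
  shows "v \<in> vecs N S"
proof (rule vecsI)
  show "finite {s. v s \<noteq> \<zero>\<^bsub>N\<^esub>}" by (rule finite_subset[OF _ assms(3)]) (use assms(2) in auto)
qed (use assms(1,2) in auto)

lemma vecs_mono: "v \<in> vecs N S \<Longrightarrow> S \<subseteq> S' \<Longrightarrow> v \<in> vecs N S'"
  by (auto simp: vec_module_def )

lemma vecs_UNIV [simp]: "v \<in> vecs N S \<Longrightarrow> v \<in> vecs N UNIV"
  by (rule vecs_mono) auto

context rmodule
begin

lemma vec_module_module: "module R (vec_module M S)"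
proof (rule moduleI)
  show "cring R" by (rule R.is_cring)
  have add: "f \<oplus>\<^bsub>vec_module M S\<^esub> g \<in> vecs M S" if f: "f \<in> vecs M S" and g: "g \<in> vecs M S" for f g
  proof (rule vecsI)
    show "finite {s. (f \<oplus>\<^bsub>vec_module M S\<^esub> g) s \<noteq> \<zero>\<^bsub>M\<^esub>}"
      by (rule finite_subset[of _ "{s. f s \<noteq> \<zero>\<^bsub>M\<^esub>} \<union> {s. g s \<noteq> \<zero>\<^bsub>M\<^esub>}"])
         (use vecsD(3)[OF f] vecsD(3)[OF g] in auto)
  qed (use vecsD(1,2)[OF f] vecsD(1,2)[OF g] in auto)
  show "abelian_group (vec_module M S)"
  proof (rule abelian_groupI)
    show "\<exists>y\<in>vecs M S. y \<oplus>\<^bsub>vec_module M S\<^esub> x = \<zero>\<^bsub>vec_module M S\<^esub>" if x: "x \<in> vecs M S" for x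
    proof (rule bexI[of _ "\<lambda>s. \<ominus>\<^bsub>M\<^esub> x s"])
      show "(\<lambda>s. \<ominus>\<^bsub>M\<^esub> x s) \<oplus>\<^bsub>vec_module M S\<^esub> x = \<zero>\<^bsub>vec_module M S\<^esub>"
        by (rule ext) (use vecsD(1)[OF x] in \<open>auto simp: M.l_neg\<close>)
      show "(\<lambda>s. \<ominus>\<^bsub>M\<^esub> x s) \<in> vecs M S"
      proof (rule vecsI)
        show "finite {s. \<ominus>\<^bsub>M\<^esub> x s \<noteq> \<zero>\<^bsub>M\<^esub>}"
          by (rule finite_subset[of _ "{s. x s \<noteq> \<zero>\<^bsub>M\<^esub>}"]) (use vecsD(3)[OF x] in auto)
      qed (use vecsD(1,2)[OF x] in auto)
    qed
    show "\<zero>\<^bsub>vec_module M S\<^esub> \<in> vecs M S" by (rule vecsI) auto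
    show "x \<oplus>\<^bsub>vec_module M S\<^esub> y \<oplus>\<^bsub>vec_module M S\<^esub> z = x \<oplus>\<^bsub>vec_module M S\<^esub> (y \<oplus>\<^bsub>vec_module M S\<^esub> z)"
      if "x \<in> vecs M S" "y \<in> vecs M S" "z \<in> vecs M S" for x y z
      by (rule ext) (use that[THEN vecsD(1)] in \<open>simp add: M.a_assoc\<close>)
    show "x \<oplus>\<^bsub>vec_module M S\<^esub> y = y \<oplus>\<^bsub>vec_module M S\<^esub> x"
      if "x \<in> vecs M S" "y \<in> vecs M S" for x y
      by (rule ext) (use that[THEN vecsD(1)] in \<open>simp add: M.a_comm\<close>)
    show "\<zero>\<^bsub>vec_module M S\<^esub> \<oplus>\<^bsub>vec_module M S\<^esub> x = x" if "x \<in> vecs M S" for x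
      by (rule ext) (use that[THEN vecsD(1)] in simp)
  qed (rule add)
  show "a \<odot>\<^bsub>vec_module M S\<^esub> x \<in> vecs M S" if a: "a \<in> carrier R" and x: "x \<in> vecs M S" for a x
  proof (rule vecsI)
    show "finite {s. (a \<odot>\<^bsub>vec_module M S\<^esub> x) s \<noteq> \<zero>\<^bsub>M\<^esub>}"
      by (rule finite_subset[of _ "{s. x s \<noteq> \<zero>\<^bsub>M\<^esub>}"]) (use a vecsD(3)[OF x] in auto)
  qed (use a vecsD(1,2)[OF x] in auto)
  show "(a \<oplus> b) \<odot>\<^bsub>vec_module M S\<^esub> x = a \<odot>\<^bsub>vec_module M S\<^esub> x \<oplus>\<^bsub>vec_module M S\<^esub> b \<odot>\<^bsub>vec_module M S\<^esub> x"
    if "a \<in> carrier R" "b \<in> carrier R" "x \<in> vecs M S" for a b x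
    by (rule ext) (use that vecsD(1)[OF that(3)] in \<open>simp add: smult_l_distr\<close>)
  show "a \<odot>\<^bsub>vec_module M S\<^esub> (x \<oplus>\<^bsub>vec_module M S\<^esub> y)
      = a \<odot>\<^bsub>vec_module M S\<^esub> x \<oplus>\<^bsub>vec_module M S\<^esub> a \<odot>\<^bsub>vec_module M S\<^esub> y"
    if "a \<in> carrier R" "x \<in> vecs M S" "y \<in> vecs M S" for a x y
    by (rule ext) (use that vecsD(1)[OF that(2)] vecsD(1)[OF that(3)] in \<open>simp add: smult_r_distr\<close>)
  show "(a \<otimes> b) \<odot>\<^bsub>vec_module M S\<^esub> x = a \<odot>\<^bsub>vec_module M S\<^esub> (b \<odot>\<^bsub>vec_module M S\<^esub> x)"
    if "a \<in> carrier R" "b \<in> carrier R" "x \<in> vecs M S" for a b x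
    by (rule ext) (use that vecsD(1)[OF that(3)] in \<open>simp add: smult_assoc1\<close>)
  show "\<one> \<odot>\<^bsub>vec_module M S\<^esub> x = x" if "x \<in> vecs M S" for x
    by (rule ext) (use vecsD(1)[OF that] in simp)
qed

lemma vecs_submodule: "submodule (vecs M S) R (vspace M)"
proof -
  interpret W: module R "vspace M" by (rule vec_module_module)
  interpret V: module R "vec_module M S" by (rule vec_module_module)
  have "(vspace M)\<lparr>carrier := vecs M S\<rparr> = vec_module M S"
    by (simp add: vec_module_def)
  then show ?thesis
    by (intro W.module_incl_imp_submodule) (auto simp: V.module_axioms)
qed

lemma vec_neg: 
  assumes v: "v \<in> vecs M UNIV"
  shows "(\<ominus>\<^bsub>vspace M\<^esub> v) i = \<ominus>\<^bsub>M\<^esub> v i"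
proof -
  interpret W: module R "vspace M" by (rule vec_module_module)
  have "\<ominus>\<^bsub>vspace M\<^esub> v \<oplus>\<^bsub>vspace M\<^esub> v = \<zero>\<^bsub>vspace M\<^esub>"
    using v by (rule W.M.l_neg)
  then have "(\<ominus>\<^bsub>vspace M\<^esub> v) i \<oplus>\<^bsub>M\<^esub> v i = \<zero>\<^bsub>M\<^esub>"
    by (metis vec_simps(1,2))
  moreover have "(\<ominus>\<^bsub>vspace M\<^esub> v) i \<in> carrier M" using v W.M.a_inv_closed vecsD(1) by metis
  ultimately show ?thesis using vecsD(1)[OF v] by (metis M.minus_equality)
qed

lemma vec_minus: 
  assumes v: "v \<in> vecs M UNIV" "w \<in> vecs M UNIV"
  shows "(v \<ominus>\<^bsub>vspace M\<^esub> w) i = v i \<ominus>\<^bsub>M\<^esub> w i"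
  using vec_neg[OF v(2)] by (simp add: a_minus_def)

end

section \<open>Matrices and their action on families\<close>

text \<open>
  Matrices are functions on the whole index types that vanish outside \<open>U \<times> Y\<close>. Matrices of different
  formats can then be added, and a block matrix is the sum of its blocks.
\<close>

definition Mat :: "('a, 'c) ring_scheme \<Rightarrow> 'i set \<Rightarrow> 'j set \<Rightarrow> ('i \<Rightarrow> 'j \<Rightarrow> 'a) set" where
  "Mat R U Y = {A. (\<forall>i j. A i j \<in> carrier R) \<and> (\<forall>i j. A i j \<noteq> \<zero>\<^bsub>R\<^esub> \<longrightarrow> i \<in> U \<and> j \<in> Y) \<and>
                   finite {i. \<exists>j. A i j \<noteq> \<zero>\<^bsub>R\<^esub>} \<and> finite {j. \<exists>i. A i j \<noteq> \<zero>\<^bsub>R\<^esub>}}"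

text \<open>
  The homomorphism that the matrix \<open>A\<close> induces on families in \<open>N\<close>, the base change to
  \<open>N\<close> of the map of free \<open>R\<close>-modules given by \<open>A\<close>. The support of \<open>v\<close>
  serves as range of summation because the formula should not depend on the format of \<open>A\<close>.
\<close>

definition lin :: "('a, 'm) module \<Rightarrow> ('i \<Rightarrow> 'j \<Rightarrow> 'a) \<Rightarrow> ('j \<Rightarrow> 'm) \<Rightarrow> 'i \<Rightarrow> 'm" where
  "lin N A v = (\<lambda>i. \<Oplus>\<^bsub>N\<^esub>j\<in>{j. v j \<noteq> \<zero>\<^bsub>N\<^esub>}. A i j \<odot>\<^bsub>N\<^esub> v j)"

abbreviation rlin :: "('a, 'c) ring_scheme \<Rightarrow> ('i \<Rightarrow> 'j \<Rightarrow> 'a) \<Rightarrow> ('j \<Rightarrow> 'a) \<Rightarrow> 'i \<Rightarrow> 'a" where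
  "rlin R \<equiv> lin (regular_module R)"

definition mm :: "('a, 'c) ring_scheme \<Rightarrow> ('i \<Rightarrow> 'j \<Rightarrow> 'a) \<Rightarrow> ('j \<Rightarrow> 'k \<Rightarrow> 'a) \<Rightarrow> 'i \<Rightarrow> 'k \<Rightarrow> 'a" where
  "mm R A B = (\<lambda>i k. rlin R A (\<lambda>j. B j k) i)"

definition madd :: "('a, 'c) ring_scheme \<Rightarrow> ('i \<Rightarrow> 'j \<Rightarrow> 'a) \<Rightarrow> ('i \<Rightarrow> 'j \<Rightarrow> 'a) \<Rightarrow> 'i \<Rightarrow> 'j \<Rightarrow> 'a" where
  "madd R A B = (\<lambda>i j. A i j \<oplus>\<^bsub>R\<^esub> B i j)"

definition msmult :: "('a, 'c) ring_scheme \<Rightarrow> 'a \<Rightarrow> ('i \<Rightarrow> 'j \<Rightarrow> 'a) \<Rightarrow> 'i \<Rightarrow> 'j \<Rightarrow> 'a" where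
  "msmult R c A = (\<lambda>i j. c \<otimes>\<^bsub>R\<^esub> A i j)"

definition mneg :: "('a, 'c) ring_scheme \<Rightarrow> ('i \<Rightarrow> 'j \<Rightarrow> 'a) \<Rightarrow> 'i \<Rightarrow> 'j \<Rightarrow> 'a" where
  "mneg R A = (\<lambda>i j. \<ominus>\<^bsub>R\<^esub> A i j)"

definition mzero :: "('a, 'c) ring_scheme \<Rightarrow> 'i \<Rightarrow> 'j \<Rightarrow> 'a" where
  "mzero R = (\<lambda>i j. \<zero>\<^bsub>R\<^esub>)"

definition mid :: "('a, 'c) ring_scheme \<Rightarrow> 'i set \<Rightarrow> 'i \<Rightarrow> 'i \<Rightarrow> 'a" where
  "mid R S = (\<lambda>i j. if i = j \<and> i \<in> S then \<one>\<^bsub>R\<^esub> else \<zero>\<^bsub>R\<^esub>)"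

definition tr :: "('i \<Rightarrow> 'j \<Rightarrow> 'a) \<Rightarrow> 'j \<Rightarrow> 'i \<Rightarrow> 'a" where
  "tr A = (\<lambda>i j. A j i)"

definition mres :: "('a, 'c) ring_scheme \<Rightarrow> 'i set \<Rightarrow> 'j set \<Rightarrow> ('i \<Rightarrow> 'j \<Rightarrow> 'a) \<Rightarrow> 'i \<Rightarrow> 'j \<Rightarrow> 'a" where
  "mres R U Y A = (\<lambda>i j. if i \<in> U \<and> j \<in> Y then A i j else \<zero>\<^bsub>R\<^esub>)"

lemma tr_tr [simp]: "tr (tr A) = A"
  by (simp add: tr_def)

lemma MatD:
  assumes "A \<in> Mat R U Y"
  shows "A i j \<in> carrier R" "i \<notin> U \<Longrightarrow> A i j = \<zero>\<^bsub>R\<^esub>" "j \<notin> Y \<Longrightarrow> A i j = \<zero>\<^bsub>R\<^esub>"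
    "finite {i. \<exists>j. A i j \<noteq> \<zero>\<^bsub>R\<^esub>}" "finite {j. \<exists>i. A i j \<noteq> \<zero>\<^bsub>R\<^esub>}"
  using assms by (auto simp: Mat_def)

lemma MatI:
  assumes "\<And>i j. A i j \<in> carrier R" "\<And>i j. i \<notin> U \<Longrightarrow> A i j = \<zero>\<^bsub>R\<^esub>" "\<And>i j. j \<notin> Y \<Longrightarrow> A i j = \<zero>\<^bsub>R\<^esub>"
    "finite {i. \<exists>j. A i j \<noteq> \<zero>\<^bsub>R\<^esub>}" "finite {j. \<exists>i. A i j \<noteq> \<zero>\<^bsub>R\<^esub>}"
  shows "A \<in> Mat R U Y"
  unfolding Mat_def using assms by blast

lemma MatI_fin:
  assumes "\<And>i j. A i j \<in> carrier R" "\<And>i j. i \<notin> U \<or> j \<notin> Y \<Longrightarrow> A i j = \<zero>\<^bsub>R\<^esub>" "finite U" "finite Y"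
  shows "A \<in> Mat R U Y"
proof -
  have "{i. \<exists>j. A i j \<noteq> \<zero>\<^bsub>R\<^esub>} \<subseteq> U" "{j. \<exists>i. A i j \<noteq> \<zero>\<^bsub>R\<^esub>} \<subseteq> Y"
    using assms(2) by auto
  then have "finite {i. \<exists>j. A i j \<noteq> \<zero>\<^bsub>R\<^esub>}" "finite {j. \<exists>i. A i j \<noteq> \<zero>\<^bsub>R\<^esub>}"
    using finite_subset assms(3,4) by metis+
  moreover have "\<forall>i j. A i j \<noteq> \<zero>\<^bsub>R\<^esub> \<longrightarrow> i \<in> U \<and> j \<in> Y" using assms(2) by blast
  ultimately show ?thesis using assms(1) by (auto simp: Mat_def)
qed

lemma Mat_mono: "A \<in> Mat R U Y \<Longrightarrow> U \<subseteq> U' \<Longrightarrow> Y \<subseteq> Y' \<Longrightarrow> A \<in> Mat R U' Y'"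
  unfolding Mat_def by blast

lemma tr_Mat: "A \<in> Mat R U Y \<Longrightarrow> tr A \<in> Mat R Y U"
  by (auto simp: Mat_def tr_def)

lemma tr_Mat_iff [simp]: "tr A \<in> Mat R Y U \<longleftrightarrow> A \<in> Mat R U Y"
  using tr_Mat[of A R U Y] tr_Mat[of "tr A" R Y U] by auto

lemma regular_simps [simp]:
  "carrier (regular_module R) = carrier R" "\<zero>\<^bsub>regular_module R\<^esub> = \<zero>\<^bsub>R\<^esub>"
  "a \<oplus>\<^bsub>regular_module R\<^esub> b = a \<oplus>\<^bsub>R\<^esub> b" "a \<odot>\<^bsub>regular_module R\<^esub> b = a \<otimes>\<^bsub>R\<^esub> b"
  by (simp_all add: regular_module_def)

lemma col_vecs:
  assumes A: "A \<in> Mat R U Y"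
  shows "(\<lambda>i. A i k) \<in> vecs (regular_module R) U"
proof (rule vecsI)
  show "finite {s. A s k \<noteq> \<zero>\<^bsub>regular_module R\<^esub>}"
    by (rule finite_subset[OF _ MatD(4)[OF A]]) auto
qed (use MatD(1,2)[OF A] in simp_all)

lemma (in cring) regular_rmodule: "rmodule R (regular_module R)"
  unfolding rmodule_def
proof (rule moduleI)
  show "abelian_group (regular_module R)"
    by (rule abelian_groupI) (auto simp: a_ac intro: bexI[of _ "\<ominus> _"] l_neg a_inv_closed)
qed (auto simp: is_cring l_distr r_distr m_assoc)

context cring
begin

lemma regular_neg: "a \<in> carrier R \<Longrightarrow> \<ominus>\<^bsub>regular_module R\<^esub> a = \<ominus> a"
proof -
  interpret rmodule R "regular_module R" by (rule regular_rmodule)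
  assume a: "a \<in> carrier R"
  then have "\<ominus>\<^bsub>regular_module R\<^esub> a \<oplus> a = \<zero>" using M.l_neg[of a] by simp
  then show ?thesis using abelian_group.minus_equality[OF is_abelian_group, of "\<ominus>\<^bsub>regular_module R\<^esub> a" a]
    a M.a_inv_closed[of a] by simp
qed

lemma Mat_madd: "A \<in> Mat R U Y \<Longrightarrow> B \<in> Mat R U Y \<Longrightarrow> madd R A B \<in> Mat R U Y"
proof -
  assume A: "A \<in> Mat R U Y" and B: "B \<in> Mat R U Y"
  have "{i. \<exists>j. madd R A B i j \<noteq> \<zero>} \<subseteq> {i. \<exists>j. A i j \<noteq> \<zero>} \<union> {i. \<exists>j. B i j \<noteq> \<zero>}"
    "{j. \<exists>i. madd R A B i j \<noteq> \<zero>} \<subseteq> {j. \<exists>i. A i j \<noteq> \<zero>} \<union> {j. \<exists>i. B i j \<noteq> \<zero>}"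
    using MatD(1)[OF A] MatD(1)[OF B] by (auto simp: madd_def)
  then have "finite {i. \<exists>j. madd R A B i j \<noteq> \<zero>}" "finite {j. \<exists>i. madd R A B i j \<noteq> \<zero>}"
    using MatD(4,5)[OF A] MatD(4,5)[OF B] by (meson finite_UnI finite_subset)+
  moreover have "i \<in> U \<and> j \<in> Y" if "madd R A B i j \<noteq> \<zero>" for i j
    using that MatD(2)[OF A, of i j] MatD(3)[OF A, of j i] MatD(2)[OF B, of i j] MatD(3)[OF B, of j i]
    by (cases "i \<in> U"; cases "j \<in> Y"; simp add: madd_def)
  ultimately show ?thesis
    using MatD(1)[OF A] MatD(1)[OF B] by (auto simp: Mat_def madd_def)
qed

lemma Mat_mapped:
  assumes A: "A \<in> Mat R U Y" and g: "\<And>x. x \<in> carrier R \<Longrightarrow> g x \<in> carrier R" "g \<zero> = \<zero>"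
  shows "(\<lambda>i j. g (A i j)) \<in> Mat R U Y"
proof -
  have "finite {i. \<exists>j. g (A i j) \<noteq> \<zero>}"
    by (rule finite_subset[OF _ MatD(4)[OF A]]) (use g(2) in \<open>auto; metis\<close>)
  moreover have "finite {j. \<exists>i. g (A i j) \<noteq> \<zero>}"
    by (rule finite_subset[OF _ MatD(5)[OF A]]) (use g(2) in \<open>auto; metis\<close>)
  moreover have "i \<in> U \<and> j \<in> Y" if "g (A i j) \<noteq> \<zero>" for i j
    using that MatD(2)[OF A, of i j] MatD(3)[OF A, of j i] g(2) by (cases "i \<in> U"; cases "j \<in> Y") auto
  ultimately show ?thesis using MatD(1)[OF A] g by (auto simp: Mat_def)
qed

lemma Mat_mneg: "A \<in> Mat R U Y \<Longrightarrow> mneg R A \<in> Mat R U Y"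
  unfolding mneg_def by (rule Mat_mapped) auto

lemma Mat_msmult: "c \<in> carrier R \<Longrightarrow> A \<in> Mat R U Y \<Longrightarrow> msmult R c A \<in> Mat R U Y"
  unfolding msmult_def by (rule Mat_mapped) auto

lemma Mat_mzero [simp]: "mzero R \<in> Mat R U Y"
  by (auto simp: Mat_def mzero_def)

lemma Mat_mid: "finite S \<Longrightarrow> mid R S \<in> Mat R S S"
  by (rule MatI_fin) (auto simp: mid_def)

lemma Mat_mres:
  assumes A: "A \<in> Mat R U' Y'"
  shows "mres R U Y A \<in> Mat R (U \<inter> U') (Y \<inter> Y')"
proof -
  have "finite {i. \<exists>j. mres R U Y A i j \<noteq> \<zero>}"
    by (rule finite_subset[OF _ MatD(4)[OF A]]) (auto simp: mres_def)
  moreover have "finite {j. \<exists>i. mres R U Y A i j \<noteq> \<zero>}"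
    by (rule finite_subset[OF _ MatD(5)[OF A]]) (auto simp: mres_def)
  moreover have "i \<in> U \<inter> U' \<and> j \<in> Y \<inter> Y'" if "mres R U Y A i j \<noteq> \<zero>" for i j
    using that MatD(2)[OF A, of i j] MatD(3)[OF A, of j i] by (auto simp: mres_def split: if_splits)
  ultimately show ?thesis using MatD(1)[OF A] by (auto simp: Mat_def mres_def)
qed

end

context rmodule
begin

lemma finsum_swap:
  assumes "finite I" "finite J" "\<And>i j. i \<in> I \<Longrightarrow> j \<in> J \<Longrightarrow> f i j \<in> carrier M"
  shows "(\<Oplus>\<^bsub>M\<^esub>i\<in>I. \<Oplus>\<^bsub>M\<^esub>j\<in>J. f i j) = (\<Oplus>\<^bsub>M\<^esub>j\<in>J. \<Oplus>\<^bsub>M\<^esub>i\<in>I. f i j)"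
  using assms(1,3)
proof (induction I)
  case empty
  then show ?case by (simp add: M.add.finprod_one)
next
  case (insert x F)
  have "(\<Oplus>\<^bsub>M\<^esub>i\<in>insert x F. \<Oplus>\<^bsub>M\<^esub>j\<in>J. f i j) = (\<Oplus>\<^bsub>M\<^esub>j\<in>J. f x j) \<oplus>\<^bsub>M\<^esub> (\<Oplus>\<^bsub>M\<^esub>i\<in>F. \<Oplus>\<^bsub>M\<^esub>j\<in>J. f i j)"
    using insert by (intro M.finsum_insert) (auto intro!: M.finsum_closed)
  also have "\<dots> = (\<Oplus>\<^bsub>M\<^esub>j\<in>J. f x j) \<oplus>\<^bsub>M\<^esub> (\<Oplus>\<^bsub>M\<^esub>j\<in>J. \<Oplus>\<^bsub>M\<^esub>i\<in>F. f i j)"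
    using insert by simp
  also have "\<dots> = (\<Oplus>\<^bsub>M\<^esub>j\<in>J. f x j \<oplus>\<^bsub>M\<^esub> (\<Oplus>\<^bsub>M\<^esub>i\<in>F. f i j))"
    using insert by (intro M.finsum_addf[symmetric]) (auto intro!: M.finsum_closed)
  also have "\<dots> = (\<Oplus>\<^bsub>M\<^esub>j\<in>J. \<Oplus>\<^bsub>M\<^esub>i\<in>insert x F. f i j)"
    using insert by (intro M.finsum_cong') (auto intro!: M.finsum_closed M.finsum_insert[symmetric])
  finally show ?case .
qed

lemma finsum_smult_rdistr:
  assumes "finite I" "x \<in> carrier M" "f \<in> I \<rightarrow> carrier R"
  shows "(\<Oplus>i\<in>I. f i) \<odot>\<^bsub>M\<^esub> x = (\<Oplus>\<^bsub>M\<^esub>i\<in>I. f i \<odot>\<^bsub>M\<^esub> x)"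
  using assms(1,3)
proof (induction I)
  case (insert y F)
  then show ?case using assms(2)
    by (simp add: Pi_def R.finsum_closed M.finsum_closed smult_l_distr)
qed (use assms in simp)

lemma finsum_regular: "finsum (regular_module R) f S = finsum R f S"
  by (simp add: finsum_def finprod_def regular_module_def)

lemma lin_eq:
  assumes v: "v \<in> vecs M UNIV" and A: "\<And>i j. A i j \<in> carrier R" and S: "finite S" "{j. v j \<noteq> \<zero>\<^bsub>M\<^esub>} \<subseteq> S"
  shows "lin M A v i = (\<Oplus>\<^bsub>M\<^esub>j\<in>S. A i j \<odot>\<^bsub>M\<^esub> v j)"
  unfolding lin_def
proof (rule M.add.finprod_mono_neutral_cong_left)
qed (use S A vecsD(1)[OF v] in auto)

lemma lin_eq':
  assumes v: "v \<in> vecs M Z" and A: "A \<in> Mat R U Y" and S: "finite S" "{j. v j \<noteq> \<zero>\<^bsub>M\<^esub>} \<subseteq> S"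
  shows "lin M A v i = (\<Oplus>\<^bsub>M\<^esub>j\<in>S. A i j \<odot>\<^bsub>M\<^esub> v j)"
  by (rule lin_eq) (use vecs_UNIV[OF v] S MatD(1)[OF A] in auto)

lemma lin_eq_cols:
  assumes v: "v \<in> vecs M Z" and A: "A \<in> Mat R U Y" and S: "finite S" "\<And>i j. j \<notin> S \<Longrightarrow> A i j = \<zero>"
  shows "lin M A v i = (\<Oplus>\<^bsub>M\<^esub>j\<in>S. A i j \<odot>\<^bsub>M\<^esub> v j)"
proof -
  have fin: "finite (S \<union> {j. v j \<noteq> \<zero>\<^bsub>M\<^esub>})" using S vecsD(3)[OF v] by auto
  have "lin M A v i = (\<Oplus>\<^bsub>M\<^esub>j\<in>S \<union> {j. v j \<noteq> \<zero>\<^bsub>M\<^esub>}. A i j \<odot>\<^bsub>M\<^esub> v j)"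
    by (rule lin_eq'[OF v A fin]) auto
  also have "\<dots> = (\<Oplus>\<^bsub>M\<^esub>j\<in>S. A i j \<odot>\<^bsub>M\<^esub> v j)"
    by (rule M.add.finprod_mono_neutral_cong_right)
       (use fin S MatD(1)[OF A] vecsD(1)[OF v] in auto)
  finally show ?thesis .
qed

lemma lin_entry:
  assumes v: "v \<in> vecs M Z" and A: "A \<in> Mat R U Y"
  shows "lin M A v i \<in> carrier M"
  unfolding lin_def by (rule M.finsum_closed) (use vecsD(1)[OF v] MatD(1)[OF A] in auto)

lemma lin_closed:
  assumes v: "v \<in> vecs M Z" and A: "A \<in> Mat R U Y"
  shows "lin M A v \<in> vecs M U"
proof (rule vecsI)
  have z: "lin M A v i = \<zero>\<^bsub>M\<^esub>" if "\<And>j. A i j = \<zero>" for i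
    unfolding lin_def using that vecsD(1)[OF v] by (intro M.add.finprod_one_eqI) auto
  show "lin M A v s \<in> carrier M" for s by (rule lin_entry[OF v A])
  show "lin M A v s = \<zero>\<^bsub>M\<^esub>" if "s \<notin> U" for s
    by (rule z) (use MatD(2)[OF A that] in auto)
  show "finite {s. lin M A v s \<noteq> \<zero>\<^bsub>M\<^esub>}"
    by (rule finite_subset[OF _ MatD(4)[OF A]]) (use z in auto)
qed

lemma lin_off:
  assumes v: "v \<in> vecs M Z" and A: "A \<in> Mat R U Y" and "Z \<inter> Y = {}"
  shows "lin M A v = \<zero>\<^bsub>vspace M\<^esub>"
proof (rule ext)
  fix i
  have "A i j \<odot>\<^bsub>M\<^esub> v j = \<zero>\<^bsub>M\<^esub>" for j
  proof (cases "j \<in> Y")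
    case True
    then have "v j = \<zero>\<^bsub>M\<^esub>" using assms(3) vecsD(2)[OF v, of j] by auto
    then show ?thesis using MatD(1)[OF A] by simp
  next
    case False
    then show ?thesis using MatD(3)[OF A] vecsD(1)[OF v] by simp
  qed
  then show "lin M A v i = \<zero>\<^bsub>vspace M\<^esub> i"
    unfolding lin_def by (simp add: M.add.finprod_one_eqI)
qed

lemma lin_add:
  assumes v: "v \<in> vecs M UNIV" and w: "w \<in> vecs M UNIV" and A: "A \<in> Mat R U Y"
  shows "lin M A (v \<oplus>\<^bsub>vspace M\<^esub> w) = lin M A v \<oplus>\<^bsub>vspace M\<^esub> lin M A w"
proof (rule ext)
  fix i
  interpret W: module R "vspace M" by (rule vec_module_module)
  let ?S = "{j. v j \<noteq> \<zero>\<^bsub>M\<^esub>} \<union> {j. w j \<noteq> \<zero>\<^bsub>M\<^esub>}"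
  have S: "finite ?S" using vecsD(3)[OF v] vecsD(3)[OF w] by auto
  note c = vecsD(1)[OF v] vecsD(1)[OF w] MatD(1)[OF A]
  have "lin M A (v \<oplus>\<^bsub>vspace M\<^esub> w) i = (\<Oplus>\<^bsub>M\<^esub>j\<in>?S. A i j \<odot>\<^bsub>M\<^esub> (v j \<oplus>\<^bsub>M\<^esub> w j))"
    by (subst lin_eq'[OF W.M.a_closed[OF v w] A S]) auto
  also have "\<dots> = (\<Oplus>\<^bsub>M\<^esub>j\<in>?S. A i j \<odot>\<^bsub>M\<^esub> v j \<oplus>\<^bsub>M\<^esub> A i j \<odot>\<^bsub>M\<^esub> w j)"
    by (rule M.finsum_cong') (use c in \<open>auto simp: smult_r_distr\<close>)
  also have "\<dots> = (\<Oplus>\<^bsub>M\<^esub>j\<in>?S. A i j \<odot>\<^bsub>M\<^esub> v j) \<oplus>\<^bsub>M\<^esub> (\<Oplus>\<^bsub>M\<^esub>j\<in>?S. A i j \<odot>\<^bsub>M\<^esub> w j)"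
    by (rule M.finsum_addf) (use c in auto)
  also have "\<dots> = (lin M A v \<oplus>\<^bsub>vspace M\<^esub> lin M A w) i"
    by (simp add: lin_eq'[OF v A S] lin_eq'[OF w A S])
  finally show "lin M A (v \<oplus>\<^bsub>vspace M\<^esub> w) i = (lin M A v \<oplus>\<^bsub>vspace M\<^esub> lin M A w) i" .
qed

lemma lin_smult:
  assumes c: "c \<in> carrier R" and v: "v \<in> vecs M UNIV" and A: "A \<in> Mat R U Y"
  shows "lin M A (c \<odot>\<^bsub>vspace M\<^esub> v) = c \<odot>\<^bsub>vspace M\<^esub> lin M A v"
proof (rule ext)
  fix i
  interpret W: module R "vspace M" by (rule vec_module_module)
  let ?S = "{j. v j \<noteq> \<zero>\<^bsub>M\<^esub>}"
  have S: "finite ?S" using vecsD(3)[OF v] by auto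
  note cl = vecsD(1)[OF v] MatD(1)[OF A] c
  have "lin M A (c \<odot>\<^bsub>vspace M\<^esub> v) i = (\<Oplus>\<^bsub>M\<^esub>j\<in>?S. A i j \<odot>\<^bsub>M\<^esub> (c \<odot>\<^bsub>M\<^esub> v j))"
    by (subst lin_eq'[OF W.smult_closed[OF c v] A S]) (use c in auto)
  also have "\<dots> = (\<Oplus>\<^bsub>M\<^esub>j\<in>?S. c \<odot>\<^bsub>M\<^esub> (A i j \<odot>\<^bsub>M\<^esub> v j))"
    by (rule M.finsum_cong') (use cl in \<open>auto simp: smult_assoc1[symmetric] R.m_comm\<close>)
  also have "\<dots> = c \<odot>\<^bsub>M\<^esub> (\<Oplus>\<^bsub>M\<^esub>j\<in>?S. A i j \<odot>\<^bsub>M\<^esub> v j)"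
    by (rule finsum_smult_ldistr[symmetric]) (use cl S in auto)
  finally show "lin M A (c \<odot>\<^bsub>vspace M\<^esub> v) i = (c \<odot>\<^bsub>vspace M\<^esub> lin M A v) i"
    by (simp add: lin_eq'[OF v A S])
qed

lemma lin_zero:
  "lin M A \<zero>\<^bsub>vspace M\<^esub> = \<zero>\<^bsub>vspace M\<^esub>"
  by (rule ext) (simp add: lin_def)

lemma lin_neg:
  assumes v: "v \<in> vecs M UNIV" and A: "A \<in> Mat R U Y"
  shows "lin M A (\<ominus>\<^bsub>vspace M\<^esub> v) = \<ominus>\<^bsub>vspace M\<^esub> lin M A v"
proof -
  interpret W: module R "vspace M" by (rule vec_module_module)
  note l = vecs_UNIV[OF lin_closed[OF _ A]]
  have "lin M A (\<ominus>\<^bsub>vspace M\<^esub> v) \<oplus>\<^bsub>vspace M\<^esub> lin M A v = \<zero>\<^bsub>vspace M\<^esub>"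
    using v A by (simp add: lin_add[OF _ _ A, symmetric] W.M.l_neg lin_zero)
  then show ?thesis using v l by (metis W.M.minus_equality W.M.a_inv_closed)
qed

lemma lin_minus:
  assumes v: "v \<in> vecs M UNIV" and w: "w \<in> vecs M UNIV" and A: "A \<in> Mat R U Y"
  shows "lin M A (v \<ominus>\<^bsub>vspace M\<^esub> w) = lin M A v \<ominus>\<^bsub>vspace M\<^esub> lin M A w"
proof -
  interpret W: module R "vspace M" by (rule vec_module_module)
  show ?thesis using assms by (simp add: a_minus_def lin_add lin_neg)
qed

lemma lin_mm:
  assumes v: "v \<in> vecs M UNIV" and A: "A \<in> Mat R U Y" and B: "B \<in> Mat R Y' Z"
  shows "lin M (mm R A B) v = lin M A (lin M B v)"
proof (rule ext)
  fix i
  interpret reg: rmodule R "regular_module R" by (rule R.regular_rmodule)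
  let ?K = "{k. v k \<noteq> \<zero>\<^bsub>M\<^esub>}" and ?J = "{j. \<exists>k. B j k \<noteq> \<zero>}"
  have K: "finite ?K" using vecsD(3)[OF v] by auto
  have J: "finite ?J" using MatD(4)[OF B] by auto
  note cl = vecsD(1)[OF v] MatD(1)[OF A] MatD(1)[OF B]
  have mm: "mm R A B i k = (\<Oplus>j\<in>?J. A i j \<otimes> B j k)" for k
    unfolding mm_def by (subst reg.lin_eq'[OF col_vecs[OF B] A J]) (auto simp: finsum_regular)
  have "mm R A B i k \<in> carrier R" for i k
    unfolding mm_def using reg.lin_entry[OF col_vecs[OF B] A] by simp
  then have "lin M (mm R A B) v i = (\<Oplus>\<^bsub>M\<^esub>k\<in>?K. mm R A B i k \<odot>\<^bsub>M\<^esub> v k)"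
    by (intro lin_eq[OF v _ K]) auto
  also have "\<dots> = (\<Oplus>\<^bsub>M\<^esub>k\<in>?K. \<Oplus>\<^bsub>M\<^esub>j\<in>?J. A i j \<odot>\<^bsub>M\<^esub> (B j k \<odot>\<^bsub>M\<^esub> v k))"
  proof (rule M.finsum_cong'[OF refl])
    show "mm R A B i k \<odot>\<^bsub>M\<^esub> v k = (\<Oplus>\<^bsub>M\<^esub>j\<in>?J. A i j \<odot>\<^bsub>M\<^esub> (B j k \<odot>\<^bsub>M\<^esub> v k))" for k
      unfolding mm using cl J
      by (subst finsum_smult_rdistr) (auto intro!: M.finsum_cong' simp: smult_assoc1)
  qed (use cl in \<open>auto intro!: M.finsum_closed\<close>)
  also have "\<dots> = (\<Oplus>\<^bsub>M\<^esub>j\<in>?J. \<Oplus>\<^bsub>M\<^esub>k\<in>?K. A i j \<odot>\<^bsub>M\<^esub> (B j k \<odot>\<^bsub>M\<^esub> v k))"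
    by (rule finsum_swap[OF K J]) (use cl in auto)
  also have "\<dots> = (\<Oplus>\<^bsub>M\<^esub>j\<in>?J. A i j \<odot>\<^bsub>M\<^esub> lin M B v j)"
    using cl K by (intro M.finsum_cong') (auto simp: lin_def intro!: M.finsum_closed finsum_smult_ldistr[symmetric])
  also have "\<dots> = lin M A (lin M B v) i"
  proof (rule lin_eq'[OF lin_closed[OF v B] A J, symmetric])
    show "{j. lin M B v j \<noteq> \<zero>\<^bsub>M\<^esub>} \<subseteq> ?J"
    proof
      fix j assume "j \<in> {j. lin M B v j \<noteq> \<zero>\<^bsub>M\<^esub>}"
      then show "j \<in> ?J"
        using cl by (auto simp: lin_def intro: ccontr M.add.finprod_one_eqI)
    qed
  qed
  finally show "lin M (mm R A B) v i = lin M A (lin M B v) i" .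
qed

lemma lin_madd:
  assumes v: "v \<in> vecs M UNIV" and A: "A \<in> Mat R U Y" and B: "B \<in> Mat R U' Y'"
  shows "lin M (madd R A B) v = lin M A v \<oplus>\<^bsub>vspace M\<^esub> lin M B v"
proof (rule ext)
  fix i
  note c = vecsD(1)[OF v] MatD(1)[OF A] MatD(1)[OF B]
  show "lin M (madd R A B) v i = (lin M A v \<oplus>\<^bsub>vspace M\<^esub> lin M B v) i"
    unfolding lin_def vec_simps
    by (subst M.finsum_addf[symmetric])
       (use c in \<open>auto simp: madd_def smult_l_distr intro!: M.finsum_cong'\<close>)
qed

lemma lin_msmult:
  assumes v: "v \<in> vecs M UNIV" and A: "A \<in> Mat R U Y" and c: "c \<in> carrier R"
  shows "lin M (msmult R c A) v = c \<odot>\<^bsub>vspace M\<^esub> lin M A v"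
proof (rule ext)
  fix i
  note cl = vecsD(1)[OF v] MatD(1)[OF A] c
  show "lin M (msmult R c A) v i = (c \<odot>\<^bsub>vspace M\<^esub> lin M A v) i"
    unfolding lin_def vec_simps
    by (subst finsum_smult_ldistr)
       (use cl vecsD(3)[OF v] in \<open>auto simp: msmult_def smult_assoc1 intro!: M.finsum_cong'\<close>)
qed

lemma lin_mneg:
  assumes v: "v \<in> vecs M UNIV" and A: "A \<in> Mat R U Y"
  shows "lin M (mneg R A) v = \<ominus>\<^bsub>vspace M\<^esub> lin M A v"
proof -
  interpret W: module R "vspace M" by (rule vec_module_module)
  have "mneg R A = msmult R (\<ominus> \<one>) A"
    unfolding mneg_def msmult_def
    by (intro ext) (use MatD(1)[OF A] R.l_minus[of \<one>] in auto)
  then show ?thesis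
    using lin_msmult[OF v A, of "\<ominus> \<one>"] W.smult_l_minus[of \<one> "lin M A v"] lin_closed[OF v A]
    by (auto simp: vecs_UNIV)
qed

lemma lin_mzero:
  assumes v: "v \<in> vecs M UNIV"
  shows "lin M (mzero R) v = \<zero>\<^bsub>vspace M\<^esub>"
  by (rule lin_off[OF v Mat_mzero[of UNIV "{}"]]) simp

lemma lin_mid:
  assumes v: "v \<in> vecs M S"
  shows "lin M (mid R S) v = v"
proof (rule ext)
  fix i
  have "lin M (mid R S) v i = (\<Oplus>\<^bsub>M\<^esub>j\<in>{j. v j \<noteq> \<zero>\<^bsub>M\<^esub>}. if i = j then v j else \<zero>\<^bsub>M\<^esub>)"
    unfolding lin_def
    by (rule M.finsum_cong') (use vecsD(1,4)[OF v] in \<open>auto simp: mid_def\<close>)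
  also have "\<dots> = v i"
  proof (cases "v i = \<zero>\<^bsub>M\<^esub>")
    case True then show ?thesis
      by (auto intro!: M.add.finprod_one_eqI)
  next
    case False then show ?thesis
      by (subst M.finsum_singleton) (use vecsD(1,3)[OF v] in auto)
  qed
  finally show "lin M (mid R S) v i = v i" .
qed

end
sublocale cring \<subseteq> reg: rmodule R "regular_module R"
  by (rule regular_rmodule)

lemma col_mm: "(\<lambda>i. mm R A B i k) = rlin R A (\<lambda>j. B j k)"
  by (simp add: mm_def)

context cring
begin

abbreviation (input) rvecs :: "'s set \<Rightarrow> ('s \<Rightarrow> 'a) set" where
  "rvecs S \<equiv> vecs (regular_module R) S"

lemma mm_eq:
  assumes A: "A \<in> Mat R U Y" and B: "B \<in> Mat R Y' Z" and J: "finite J" "{j. \<exists>k. B j k \<noteq> \<zero>} \<subseteq> J"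
  shows "mm R A B i k = (\<Oplus>j\<in>J. A i j \<otimes> B j k)"
  unfolding mm_def by (subst reg.lin_eq'[OF col_vecs[OF B] A J(1)]) (use J in \<open>auto simp: reg.finsum_regular\<close>)

lemma mm_eq':
  assumes A: "A \<in> Mat R U Y" and B: "B \<in> Mat R Y' Z" and J: "finite J" "{j. \<exists>i. A i j \<noteq> \<zero>} \<subseteq> J"
  shows "mm R A B i k = (\<Oplus>j\<in>J. A i j \<otimes> B j k)"
  unfolding mm_def by (subst reg.lin_eq_cols[OF col_vecs[OF B] A J(1)]) (use J in \<open>auto simp: reg.finsum_regular\<close>)

lemma mm_tr:
  assumes A: "A \<in> Mat R U Y" and B: "B \<in> Mat R Y' Z"
  shows "tr (mm R A B) = mm R (tr B) (tr A)"
proof (intro ext)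
  fix k i
  let ?J = "{j. \<exists>i. A i j \<noteq> \<zero>}"
  have J: "finite ?J" by (rule MatD(5)[OF A])
  have "mm R (tr B) (tr A) k i = (\<Oplus>j\<in>?J. B j k \<otimes> A i j)"
    by (subst mm_eq[OF tr_Mat[OF B] tr_Mat[OF A] J]) (auto simp: tr_def)
  also have "\<dots> = (\<Oplus>j\<in>?J. A i j \<otimes> B j k)"
    by (rule finsum_cong') (use MatD(1)[OF A] MatD(1)[OF B] in \<open>auto simp: m_comm\<close>)
  also have "\<dots> = mm R A B i k"
    by (rule mm_eq'[OF A B J order_refl, symmetric])
  finally show "tr (mm R A B) k i = mm R (tr B) (tr A) k i" by (simp add: tr_def)
qed

lemma Mat_mm:
  assumes A: "A \<in> Mat R U Y" and B: "B \<in> Mat R Y' Z"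
  shows "mm R A B \<in> Mat R U Z"
proof -
  have c: "(\<lambda>i. mm R A B i k) \<in> rvecs U" for k
    unfolding col_mm by (rule reg.lin_closed[OF col_vecs[OF B] A])
  have r: "(\<lambda>k. mm R A B i k) \<in> rvecs Z" for i
  proof -
    have "(\<lambda>k. mm R A B i k) = (\<lambda>k. mm R (tr B) (tr A) k i)"
      by (simp add: mm_tr[OF A B, symmetric]) (simp add: tr_def)
    then show ?thesis
      unfolding col_mm by (simp add: reg.lin_closed[OF col_vecs[OF tr_Mat[OF A]] tr_Mat[OF B]])
  qed
  have 1: "mm R A B i k = \<zero>" if "\<forall>j. A i j = \<zero>" for i k
    unfolding mm_def lin_def reg.finsum_regular using that MatD(1)[OF B]
    by (intro add.finprod_one_eqI) simp
  have 2: "mm R A B i k = \<zero>" if "\<forall>j. B j k = \<zero>" for i k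
    unfolding mm_def lin_def reg.finsum_regular using that MatD(1)[OF A]
    by (intro add.finprod_one_eqI) simp
  have "finite {i. \<exists>k. mm R A B i k \<noteq> \<zero>}"
    by (rule finite_subset[OF _ MatD(4)[OF A]]) (use 1 in blast)
  moreover have "finite {k. \<exists>i. mm R A B i k \<noteq> \<zero>}"
    by (rule finite_subset[OF _ MatD(5)[OF B]]) (use 2 in blast)
  ultimately show ?thesis
    using vecsD(1)[OF c] vecsD(2)[OF c] vecsD(2)[OF r] by (intro MatI) auto
qed

lemma mat_colI: "(\<And>k. (\<lambda>i. A i k) = (\<lambda>i. B i k)) \<Longrightarrow> A = B"
  by (metis ext)

lemma tr_eq_iff: "tr A = tr B \<longleftrightarrow> A = B"
  by (metis tr_tr)

lemma tr_mzero [simp]: "tr (mzero R) = mzero R"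
  by (simp add: tr_def mzero_def)

lemma tr_mneg: "tr (mneg R A) = mneg R (tr A)"
  by (simp add: tr_def mneg_def)

lemma tr_msmult: "tr (msmult R c A) = msmult R c (tr A)"
  by (simp add: tr_def msmult_def)

lemma tr_madd: "tr (madd R A B) = madd R (tr A) (tr B)"
  by (simp add: tr_def madd_def)

lemma col_msmult: "(\<lambda>i. msmult R c A i k) = c \<odot>\<^bsub>vspace (regular_module R)\<^esub> (\<lambda>i. A i k)"
  by (rule ext) (simp add: msmult_def)

lemma col_mneg:
  assumes "A \<in> Mat R U Y"
  shows "(\<lambda>i. mneg R A i k) = \<ominus>\<^bsub>vspace (regular_module R)\<^esub> (\<lambda>i. A i k)"
  by (rule ext) (use reg.vec_neg[OF vecs_UNIV[OF col_vecs[OF assms]]] MatD(1)[OF assms] in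
      \<open>simp add: mneg_def regular_neg\<close>)

lemma col_mzero: "(\<lambda>i. mzero R i k) = \<zero>\<^bsub>vspace (regular_module R)\<^esub>"
  by (rule ext) (simp add: mzero_def)

lemma mm_assoc:
  assumes A: "A \<in> Mat R U Y" and B: "B \<in> Mat R Y' Z" and C: "C \<in> Mat R Z' K"
  shows "mm R (mm R A B) C = mm R A (mm R B C)"
  by (rule mat_colI) (simp only: col_mm reg.lin_mm[OF vecs_UNIV[OF col_vecs[OF C]] A B])

lemma mm_mneg_right:
  assumes A: "A \<in> Mat R U Y" and B: "B \<in> Mat R Y' Z"
  shows "mm R A (mneg R B) = mneg R (mm R A B)"
  by (rule mat_colI)
     (simp only: col_mm col_mneg[OF B] col_mneg[OF Mat_mm[OF A B]] reg.lin_neg[OF vecs_UNIV[OF col_vecs[OF B]] A])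

lemma mm_mneg_left:
  assumes A: "A \<in> Mat R U Y" and B: "B \<in> Mat R Y' Z"
  shows "mm R (mneg R A) B = mneg R (mm R A B)"
  by (rule mat_colI)
     (simp only: col_mm col_mneg[OF B] col_mneg[OF Mat_mm[OF A B]] reg.lin_mneg[OF vecs_UNIV[OF col_vecs[OF B]] A])

lemma mneg_mneg: "A \<in> Mat R U Y \<Longrightarrow> mneg R (mneg R A) = A"
  by (intro ext) (auto simp: mneg_def MatD(1))

lemma mneg_mzero [simp]: "mneg R (mzero R) = mzero R"
  by (simp add: mneg_def mzero_def)

lemma mm_mzero_right: "A \<in> Mat R U Y \<Longrightarrow> mm R A (mzero R) = mzero R"
  by (rule mat_colI) (simp only: col_mm col_mzero reg.lin_zero)

lemma mm_mzero_left: "B \<in> Mat R U Y \<Longrightarrow> mm R (mzero R) B = mzero R"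
  by (rule mat_colI) (simp only: col_mm col_mzero reg.lin_mzero[OF vecs_UNIV[OF col_vecs]])

end

section \<open>Complexes of finite free modules\<close>

text \<open>
  A complex of finitely generated free modules is given by finite bases \<open>I j\<close> and matrices. Its base change
  to a module \<open>N\<close> has the terms \<open>vecs N (I j)\<close> and the differentials \<open>lin N (D j)\<close>.
\<close>

definition cx :: "('a, 'c) ring_scheme \<Rightarrow> (int \<Rightarrow> 'i set) \<Rightarrow> (int \<Rightarrow> 'i \<Rightarrow> 'i \<Rightarrow> 'a) \<Rightarrow> bool" where
  "cx R I D \<longleftrightarrow> (\<forall>j. finite (I j) \<and> D j \<in> Mat R (I (j - 1)) (I j) \<and> mm R (D (j - 1)) (D j) = mzero R)"

text \<open>
  The element \<open>c\<close> annihilates the homology in degree \<open>j\<close>; for \<open>c = \<one>\<close> this is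
  exactness in degree \<open>j\<close>.
\<close>

definition kills :: "('a, 'c) ring_scheme \<Rightarrow> 'a \<Rightarrow> (int \<Rightarrow> 'i set) \<Rightarrow> (int \<Rightarrow> 'i \<Rightarrow> 'i \<Rightarrow> 'a) \<Rightarrow> int \<Rightarrow> bool" where
  "kills R c I D j \<longleftrightarrow> (\<forall>v\<in>vecs (regular_module R) (I j).
     rlin R (D j) v = \<zero>\<^bsub>vspace (regular_module R)\<^esub> \<longrightarrow>
     (\<exists>w\<in>vecs (regular_module R) (I (j + 1)).
        rlin R (D (j + 1)) w = c \<odot>\<^bsub>vspace (regular_module R)\<^esub> v))"

definition dual_index :: "(int \<Rightarrow> 'i set) \<Rightarrow> int \<Rightarrow> 'i set" where
  "dual_index I = (\<lambda>j. I (- j))"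

text \<open>
  The dual complex, regraded such that its differentials lower the degree again.
\<close>

definition dual_diff :: "(int \<Rightarrow> 'i \<Rightarrow> 'i \<Rightarrow> 'a) \<Rightarrow> int \<Rightarrow> 'i \<Rightarrow> 'i \<Rightarrow> 'a" where
  "dual_diff D = (\<lambda>j. tr (D (1 - j)))"

lemma dual_dual [simp]: "dual_index (dual_index I) = I" "dual_diff (dual_diff D) = D"
  by (simp_all add: dual_index_def dual_diff_def fun_eq_iff)

lemma cxD:
  assumes "cx R I D"
  shows "finite (I j)" "D j \<in> Mat R (I (j - 1)) (I j)" "mm R (D (j - 1)) (D j) = mzero R"
  using assms by (auto simp: cx_def)

lemma cxD':
  assumes "cx R I D"
  shows "D (j + 1) \<in> Mat R (I j) (I (j + 1))" "mm R (D j) (D (j + 1)) = mzero R"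
  using cxD(2,3)[OF assms, of "j + 1"] by auto

lemma (in cring) cx_dual:
  assumes C: "cx R I D"
  shows "cx R (dual_index I) (dual_diff D)"
  unfolding cx_def
proof (intro allI conjI)
  fix j
  show "finite (dual_index I j)" using cxD(1)[OF C] by (simp add: dual_index_def)
  show "dual_diff D j \<in> Mat R (dual_index I (j - 1)) (dual_index I j)"
    using cxD(2)[OF C, of "1 - j"] by (simp add: dual_index_def dual_diff_def)
  have "mm R (tr (D (2 - j))) (tr (D (1 - j))) = tr (mm R (D (1 - j)) (D (2 - j)))"
    using mm_tr[OF cxD(2)[OF C] cxD(2)[OF C]] by simp
  also have "\<dots> = mzero R" using cxD'(2)[OF C, of "1 - j"] by simp
  finally show "mm R (dual_diff D (j - 1)) (dual_diff D j) = mzero R"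
    by (simp add: dual_diff_def algebra_simps)
qed

context rmodule
begin

lemma lin_DD:
  assumes C: "cx R I D" and v: "v \<in> vecs M UNIV"
  shows "lin M (D j) (lin M (D (j + 1)) v) = \<zero>\<^bsub>vspace M\<^esub>"
  using lin_mm[OF v cxD(2)[OF C, of j] cxD'(1)[OF C, of j], symmetric] cxD'(2)[OF C, of j]
  by (simp add: lin_mzero[OF v])

lemma vecs_split:
  assumes v: "v \<in> vecs M (S \<union> T)" and "S \<inter> T = {}"
  obtains a b where "a \<in> vecs M S" "b \<in> vecs M T" "v = a \<oplus>\<^bsub>vspace M\<^esub> b"
proof -
  let ?a = "\<lambda>i. if i \<in> S then v i else \<zero>\<^bsub>M\<^esub>" and ?b = "\<lambda>i. if i \<in> T then v i else \<zero>\<^bsub>M\<^esub>"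
  have "?a \<in> vecs M S"
  proof (rule vecsI)
    show "finite {s. ?a s \<noteq> \<zero>\<^bsub>M\<^esub>}" by (rule finite_subset[OF _ vecsD(3)[OF v]]) auto
  qed (use vecsD(1)[OF v] in auto)
  moreover have "?b \<in> vecs M T"
  proof (rule vecsI)
    show "finite {s. ?b s \<noteq> \<zero>\<^bsub>M\<^esub>}" by (rule finite_subset[OF _ vecsD(3)[OF v]]) auto
  qed (use vecsD(1)[OF v] in auto)
  moreover have "v = ?a \<oplus>\<^bsub>vspace M\<^esub> ?b"
    by (rule ext) (use vecsD(1)[OF v] vecsD(2)[OF v] assms(2) in auto)
  ultimately show thesis by (rule that)
qed

lemma vecs_disjoint_eq:
  assumes "a \<in> vecs M S" "a' \<in> vecs M S" "b \<in> vecs M T" "b' \<in> vecs M T" "S \<inter> T = {}"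
    and eq: "a \<oplus>\<^bsub>vspace M\<^esub> b = a' \<oplus>\<^bsub>vspace M\<^esub> b'"
  shows "a = a'" "b = b'"
proof -
  have p: "a i \<oplus>\<^bsub>M\<^esub> b i = a' i \<oplus>\<^bsub>M\<^esub> b' i" for i using fun_cong[OF eq, of i] by simp
  note c = assms(1-4)[THEN vecsD(1)]
  have "a i = a' i \<and> b i = b' i" for i
  proof (cases "i \<in> T")
    case True
    then have "i \<notin> S" using assms(5) by auto
    then have "a i = \<zero>\<^bsub>M\<^esub>" "a' i = \<zero>\<^bsub>M\<^esub>" using assms(1,2)[THEN vecsD(2)] by auto
    then show ?thesis using p[of i] c by simp
  next
    case False
    then have "b i = \<zero>\<^bsub>M\<^esub>" "b' i = \<zero>\<^bsub>M\<^esub>" using assms(3,4)[THEN vecsD(2)] by auto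
    then show ?thesis using p[of i] c by simp
  qed
  then show "a = a'" "b = b'" by auto
qed

end

lemma zero_vecs: "rmodule R N \<Longrightarrow> \<zero>\<^bsub>vspace N\<^esub> \<in> vecs N S"
proof -
  assume "rmodule R N"
  then interpret rmodule R N .
  interpret W: module R "vec_module N S" by (rule vec_module_module)
  show ?thesis using W.M.zero_closed by (simp add: vec_module_def)
qed

context rmodule
begin

lemma vecs_ops:
  "\<zero>\<^bsub>vspace M\<^esub> \<in> vecs M S"
  "v \<in> vecs M S \<Longrightarrow> w \<in> vecs M S \<Longrightarrow> v \<oplus>\<^bsub>vspace M\<^esub> w \<in> vecs M S"
  "v \<in> vecs M S \<Longrightarrow> w \<in> vecs M S \<Longrightarrow> v \<ominus>\<^bsub>vspace M\<^esub> w \<in> vecs M S"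
  "v \<in> vecs M S \<Longrightarrow> \<ominus>\<^bsub>vspace M\<^esub> v \<in> vecs M S"
  "c \<in> carrier R \<Longrightarrow> v \<in> vecs M S \<Longrightarrow> c \<odot>\<^bsub>vspace M\<^esub> v \<in> vecs M S"
proof -
  interpret W: module R "vspace M" by (rule vec_module_module)
  note s = W.submoduleE[OF vecs_submodule]
  show "\<zero>\<^bsub>vspace M\<^esub> \<in> vecs M S" using zero_vecs rmodule_axioms by blast
  show "v \<in> vecs M S \<Longrightarrow> w \<in> vecs M S \<Longrightarrow> v \<oplus>\<^bsub>vspace M\<^esub> w \<in> vecs M S"
    "v \<in> vecs M S \<Longrightarrow> w \<in> vecs M S \<Longrightarrow> v \<ominus>\<^bsub>vspace M\<^esub> w \<in> vecs M S"
    "v \<in> vecs M S \<Longrightarrow> \<ominus>\<^bsub>vspace M\<^esub> v \<in> vecs M S"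
    "c \<in> carrier R \<Longrightarrow> v \<in> vecs M S \<Longrightarrow> c \<odot>\<^bsub>vspace M\<^esub> v \<in> vecs M S"
    unfolding a_minus_def by (blast intro: s(3-5))+
qed

end

context cring
begin

text \<open>
  Each column of \<open>H\<close> is a cycle, so its multiple by \<open>c\<close> is a boundary.
\<close>

lemma mat_lift:
  assumes k: "kills R c I D j" and c: "c \<in> carrier R" and C: "cx R I D"
    and H: "H \<in> Mat R (I j) S" and z: "mm R (D j) H = mzero R"
  shows "\<exists>f\<in>Mat R (I (j + 1)) S. mm R (D (j + 1)) f = msmult R c H"
proof -
  let ?rW = "vspace (regular_module R)"
  let ?Z = "{k. \<exists>i. H i k \<noteq> \<zero>}"
  have "\<exists>w\<in>rvecs (I (j + 1)). rlin R (D (j + 1)) w = c \<odot>\<^bsub>?rW\<^esub> (\<lambda>i. H i k)" for k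
  proof -
    have "rlin R (D j) (\<lambda>i. H i k) = \<zero>\<^bsub>?rW\<^esub>"
      using z by (simp only: col_mm[symmetric] col_mzero)
    then show ?thesis using k col_vecs[OF H, of k] by (auto simp: kills_def)
  qed
  then obtain w where w: "\<And>k. w k \<in> rvecs (I (j + 1))"
      "\<And>k. rlin R (D (j + 1)) (w k) = c \<odot>\<^bsub>?rW\<^esub> (\<lambda>i. H i k)"
    by metis
  define f where "f = (\<lambda>i k. if k \<in> ?Z then w k i else \<zero>)"
  have colf: "(\<lambda>i. f i k) = (if k \<in> ?Z then w k else \<zero>\<^bsub>?rW\<^esub>)" for k
    by (rule ext) (simp add: f_def)
  have "f \<in> Mat R (I (j + 1)) ?Z"
  proof (rule MatI_fin)
    show "f i k \<in> carrier R" for i k using vecsD(1)[OF w(1)] by (auto simp: f_def)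
    show "f i k = \<zero>" if "i \<notin> I (j + 1) \<or> k \<notin> ?Z" for i k
      using that vecsD(2)[OF w(1)] by (auto simp: f_def)
  qed (use MatD(5)[OF H] cxD(1)[OF C] in auto)
  moreover have "?Z \<subseteq> S" using MatD(3)[OF H] by blast
  ultimately have "f \<in> Mat R (I (j + 1)) S" by (rule Mat_mono[OF _ order_refl])
  moreover have "mm R (D (j + 1)) f = msmult R c H"
  proof (rule mat_colI)
    fix k
    show "(\<lambda>i. mm R (D (j + 1)) f i k) = (\<lambda>i. msmult R c H i k)"
    proof (cases "k \<in> ?Z")
      case True
      then show ?thesis by (simp only: col_mm col_msmult colf w(2) if_True)
    next
      case False
      then have "(\<lambda>i. H i k) = \<zero>\<^bsub>?rW\<^esub>" by auto
      then have "(\<lambda>i. msmult R c H i k) = \<zero>\<^bsub>?rW\<^esub>"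
        by (simp only: col_msmult) (use c in auto)
      then show ?thesis using False by (simp only: col_mm colf if_False reg.lin_zero)
    qed
  qed
  ultimately show ?thesis by blast
qed

lemma mat_lift_exact:
  assumes "kills R \<one> I D j" "cx R I D"
    and H: "H \<in> Mat R (I j) S" "mm R (D j) H = mzero R"
  shows "\<exists>f\<in>Mat R (I (j + 1)) S. mm R (D (j + 1)) f = H"
proof -
  have "msmult R \<one> H = H" unfolding msmult_def using MatD(1)[OF H(1)] by simp
  then show ?thesis using mat_lift[OF assms(1) one_closed assms(2) H] by simp
qed

text \<open>
  The transposed form of lifting: a map out of \<open>I j\<close> that vanishes on boundaries extends over the
  differential \<open>D j\<close> when the dual complex is exact.
\<close>

lemma mat_extend_exact:
  assumes ex: "kills R \<one> (dual_index I) (dual_diff D) (- j)" and C: "cx R I D"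
    and H: "H \<in> Mat R S (I j)" "mm R H (D (j + 1)) = mzero R"
  shows "\<exists>f\<in>Mat R S (I (j - 1)). mm R f (D j) = H"
proof -
  have "mm R (dual_diff D (- j)) (tr H) = mzero R"
    using mm_tr[OF H(1) cxD'(1)[OF C, of j], symmetric] H(2) by (simp add: dual_diff_def add.commute[of 1 j])
  moreover have "tr H \<in> Mat R (dual_index I (- j)) S" using H(1) by (simp add: dual_index_def)
  ultimately obtain f where f: "f \<in> Mat R (dual_index I (- j + 1)) S" "mm R (dual_diff D (- j + 1)) f = tr H"
    using mat_lift_exact[OF ex cx_dual[OF C]] by blast
  have f1: "tr f \<in> Mat R S (I (j - 1))" using f(1) by (simp add: dual_index_def)
  moreover have "tr (mm R (tr f) (D j)) = tr H"
    using mm_tr[OF f1 cxD(2)[OF C]] f(2) by (simp add: dual_diff_def)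
  ultimately show ?thesis by (metis tr_tr)
qed

text \<open>
  A map in one degree is continued to all higher degrees. Each step lifts \<open>- f j E (j + 1)\<close> along
  \<open>D j\<close>, which is possible because \<open>D (j - 1)\<close> annihilates it by the previous step; the second
  condition on \<open>f0\<close> starts the recursion.
\<close>

lemma extend_left:
  assumes C: "cx R I D" and C': "cx R J E" and ex: "\<And>j. j \<ge> k \<Longrightarrow> kills R \<one> I D (j - 1)"
    and f0: "f0 \<in> Mat R (I (k - 1)) (J k)" "mm R (D (k - 1)) (mm R f0 (E (k + 1))) = mzero R"
  shows "\<exists>f. f k = f0 \<and> (\<forall>j\<ge>k. f j \<in> Mat R (I (j - 1)) (J j) \<and>
           mm R (D j) (f (j + 1)) = mneg R (mm R (f j) (E (j + 1))))"
proof -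
  define P where "P n g \<longleftrightarrow> g \<in> Mat R (I (k + int n - 1)) (J (k + int n)) \<and>
    mm R (D (k + int n - 1)) (mm R g (E (k + int n + 1))) = mzero R \<and> (n = 0 \<longrightarrow> g = f0)" for n g
  define Q where "Q n g g' \<longleftrightarrow> mm R (D (k + int n)) g' = mneg R (mm R g (E (k + int n + 1)))" for n g g'
  have "\<exists>f. \<forall>n. P n (f n) \<and> Q n (f n) (f (Suc n))"
  proof (rule dependent_nat_choice)
    show "\<exists>x. P 0 x" using f0 by (auto simp: P_def)
    fix g n assume P: "P n g"
    let ?j = "k + int n"
    have g: "g \<in> Mat R (I (?j - 1)) (J ?j)" using P by (simp add: P_def)
    have gE: "mm R g (E (?j + 1)) \<in> Mat R (I (?j - 1)) (J (?j + 1))"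
      by (rule Mat_mm[OF g cxD'(1)[OF C']])
    have "mm R (D (?j - 1)) (mneg R (mm R g (E (?j + 1)))) = mzero R"
      using P by (simp add: mm_mneg_right[OF cxD(2)[OF C] gE] P_def)
    then obtain g' where g': "g' \<in> Mat R (I (?j - 1 + 1)) (J (?j + 1))"
        "mm R (D (?j - 1 + 1)) g' = mneg R (mm R g (E (?j + 1)))"
      using mat_lift_exact[OF ex C Mat_mneg[OF gE]] by force
    have g1: "g' \<in> Mat R (I ?j) (J (?j + 1))" and g2: "mm R (D ?j) g' = mneg R (mm R g (E (?j + 1)))"
      using g' by simp_all
    have "mm R (D ?j) (mm R g' (E (?j + 2))) = mm R (mneg R (mm R g (E (?j + 1)))) (E (?j + 2))"
      using mm_assoc[OF cxD(2)[OF C] g1 cxD(2)[OF C'], of ?j "?j + 2"] g2 by simp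
    also have "\<dots> = mneg R (mm R g (mm R (E (?j + 1)) (E (?j + 2))))"
      using mm_mneg_left[OF gE cxD(2)[OF C']] mm_assoc[OF g cxD(2)[OF C'] cxD(2)[OF C']] by simp
    also have "mm R (E (?j + 1)) (E (?j + 2)) = mzero R"
      using cxD(3)[OF C', of "?j + 2"] by (simp add: algebra_simps)
    finally have "mm R (D ?j) (mm R g' (E (?j + 2))) = mzero R" by (simp add: mm_mzero_right[OF g])
    then have "P (Suc n) g'" using g1 by (simp add: P_def algebra_simps)
    moreover have "Q n g g'" using g2 by (simp add: Q_def)
    ultimately show "\<exists>y. P (Suc n) y \<and> Q n g y" by blast
  qed
  then obtain f where f: "\<And>n. P n (f n)" "\<And>n. Q n (f n) (f (Suc n))" by blast
  define f' where "f' j = f (nat (j - k))" for j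
  have "f' j \<in> Mat R (I (j - 1)) (J j)" "mm R (D j) (f' (j + 1)) = mneg R (mm R (f' j) (E (j + 1)))"
    if "j \<ge> k" for j
  proof -
    have n: "k + int (nat (j - k)) = j" "nat (j + 1 - k) = Suc (nat (j - k))" using that by auto
    show "f' j \<in> Mat R (I (j - 1)) (J j)"
      using f(1)[of "nat (j - k)"] unfolding P_def f'_def n(1) by blast
    show "mm R (D j) (f' (j + 1)) = mneg R (mm R (f' j) (E (j + 1)))"
      using f(2)[of "nat (j - k)"] unfolding Q_def f'_def n .
  qed
  moreover have "f' k = f0" using f(1)[of 0] by (simp add: P_def f'_def)
  ultimately show ?thesis by blast
qed

text \<open>
  The counterpart in lower degrees, where each step extends a map by exactness of the dual of \<open>J\<close>.
\<close>

lemma extend_right: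
  assumes C: "cx R I D" and C': "cx R J E"
    and ex: "\<And>j. j \<le> k \<Longrightarrow> kills R \<one> (dual_index J) (dual_diff E) (- j)"
    and f0: "f0 \<in> Mat R (I (k - 1)) (J k)" "mm R (D (k - 1)) (mm R f0 (E (k + 1))) = mzero R"
  shows "\<exists>f. f k = f0 \<and> (\<forall>j\<le>k. f j \<in> Mat R (I (j - 1)) (J j) \<and>
           mm R (f (j - 1)) (E j) = mneg R (mm R (D (j - 1)) (f j)))"
proof -
  let ?k = "1 - k"
  have ex': "kills R \<one> (dual_index J) (dual_diff E) (j - 1)" if "j \<ge> ?k" for j
    using ex[of "1 - j"] that by simp
  have f0': "tr f0 \<in> Mat R (dual_index J (?k - 1)) (dual_index I ?k)"
    using f0(1) by (simp add: dual_index_def)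
  have fE: "mm R f0 (E (k + 1)) \<in> Mat R (I (k - 1)) (J (k + 1))"
    by (rule Mat_mm[OF f0(1) cxD'(1)[OF C']])
  have Df: "mm R (D (k - 1)) f0 \<in> Mat R (I (k - 2)) (J k)"
    using Mat_mm[OF cxD(2)[OF C] f0(1), of "k - 1"] by simp
  have "tr (mm R (D (k - 1)) (mm R f0 (E (k + 1)))) = tr (mm R (mm R (D (k - 1)) f0) (E (k + 1)))"
    using mm_assoc[OF cxD(2)[OF C] f0(1) cxD'(1)[OF C']] by simp
  also have "\<dots> = mm R (tr (E (k + 1))) (mm R (tr f0) (tr (D (k - 1))))"
    by (simp add: mm_tr[OF Df cxD'(1)[OF C']] mm_tr[OF cxD(2)[OF C] f0(1)])
  finally have z: "mm R (dual_diff E (?k - 1)) (mm R (tr f0) (dual_diff D (?k + 1))) = mzero R"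
    using f0(2) by (simp add: dual_diff_def algebra_simps)
  obtain g where g: "g ?k = tr f0"
    "\<And>j. j \<ge> ?k \<Longrightarrow> g j \<in> Mat R (dual_index J (j - 1)) (dual_index I j)"
    "\<And>j. j \<ge> ?k \<Longrightarrow> mm R (dual_diff E j) (g (j + 1)) = mneg R (mm R (g j) (dual_diff D (j + 1)))"
    using extend_left[OF cx_dual[OF C'] cx_dual[OF C] ex' f0' z] by auto
  define f where "f j = tr (g (1 - j))" for j
  have fM: "f j \<in> Mat R (I (j - 1)) (J j)" if "j \<le> k" for j
    using g(2)[of "1 - j"] that by (simp add: f_def dual_index_def)
  have fE: "mm R (f (j - 1)) (E j) = mneg R (mm R (D (j - 1)) (f j))" if j: "j \<le> k" for j
  proof -
    have f1: "f (j - 1) \<in> Mat R (I (j - 2)) (J (j - 1))" using fM[of "j - 1"] j by simp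
    have "tr (mm R (f (j - 1)) (E j)) = mm R (dual_diff E (1 - j)) (g (1 - j + 1))"
      using mm_tr[OF f1 cxD(2)[OF C']] by (simp add: f_def dual_diff_def)
    also have "\<dots> = mneg R (mm R (g (1 - j)) (dual_diff D (1 - j + 1)))" using g(3)[of "1 - j"] j by simp
    also have "\<dots> = tr (mneg R (mm R (D (j - 1)) (f j)))"
      using mm_tr[OF cxD(2)[OF C] fM[OF j]] by (simp add: tr_mneg f_def dual_diff_def)
    finally show ?thesis by (simp only: tr_eq_iff)
  qed
  have "f k = f0" using g(1) by (simp add: f_def)
  then show ?thesis using fM fE by blast
qed

end

section \<open>Mapping cones\<close>

definition cone_diff where
  "cone_diff R D f E = (\<lambda>j. madd R (madd R (D j) (f j)) (E j))"

text \<open>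
  Here \<open>f\<close> anticommutes with the differentials: the sign of the usual mapping cone is part of
  \<open>f\<close>. Then the cone is an extension of \<open>J\<close> by \<open>I\<close> without a shift of degrees, and
  its differential is the sum of the blocks \<open>D\<close>, \<open>f\<close> and \<open>E\<close>.
\<close>

definition cone :: "('a, 'c) ring_scheme \<Rightarrow> (int \<Rightarrow> 'i set) \<Rightarrow> (int \<Rightarrow> 'i \<Rightarrow> 'i \<Rightarrow> 'a) \<Rightarrow> (int \<Rightarrow> 'i \<Rightarrow> 'i \<Rightarrow> 'a)
    \<Rightarrow> (int \<Rightarrow> 'i set) \<Rightarrow> (int \<Rightarrow> 'i \<Rightarrow> 'i \<Rightarrow> 'a) \<Rightarrow> bool" where
  "cone R I D f J E \<longleftrightarrow> cx R I D \<and> cx R J E \<and> (\<forall>j. I j \<inter> J j = {}) \<and>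
     (\<forall>j. f j \<in> Mat R (I (j - 1)) (J j)) \<and> (\<forall>j. mm R (f (j - 1)) (E j) = mneg R (mm R (D (j - 1)) (f j)))"

lemma coneD:
  assumes "cone R I D f J E"
  shows "cx R I D" "cx R J E" "I j \<inter> J j = {}" "f j \<in> Mat R (I (j - 1)) (J j)"
    "f (j + 1) \<in> Mat R (I j) (J (j + 1))"
    "mm R (f (j - 1)) (E j) = mneg R (mm R (D (j - 1)) (f j))"
    "mm R (f j) (E (j + 1)) = mneg R (mm R (D j) (f (j + 1)))"
proof -
  have all: "\<forall>j. f j \<in> Mat R (I (j - 1)) (J j)" "\<forall>j. mm R (f (j - 1)) (E j) = mneg R (mm R (D (j - 1)) (f j))"
    using assms by (auto simp: cone_def)
  show "f (j + 1) \<in> Mat R (I j) (J (j + 1))" using all(1)[rule_format, of "j + 1"] by simp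
  show "mm R (f j) (E (j + 1)) = mneg R (mm R (D j) (f (j + 1)))" using all(2)[rule_format, of "j + 1"] by simp
qed (use assms in \<open>auto simp: cone_def\<close>)

context rmodule
begin

lemma lin_zero_sum:
  assumes "a \<in> vecs M UNIV"
  shows "a \<oplus>\<^bsub>vspace M\<^esub> \<zero>\<^bsub>vspace M\<^esub> = a" "\<zero>\<^bsub>vspace M\<^esub> \<oplus>\<^bsub>vspace M\<^esub> a = a"
proof -
  interpret W: module R "vspace M" by (rule vec_module_module)
  show "a \<oplus>\<^bsub>vspace M\<^esub> \<zero>\<^bsub>vspace M\<^esub> = a" "\<zero>\<^bsub>vspace M\<^esub> \<oplus>\<^bsub>vspace M\<^esub> a = a"
    using assms W.M.r_zero W.M.l_zero by auto
qed

lemma cone_diff_apply: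
  assumes C: "cone R I D f J E" and a: "a \<in> vecs M (I j)" and b: "b \<in> vecs M (J j)"
  shows "lin M (cone_diff R D f E j) (a \<oplus>\<^bsub>vspace M\<^esub> b)
       = (lin M (D j) a \<oplus>\<^bsub>vspace M\<^esub> lin M (f j) b) \<oplus>\<^bsub>vspace M\<^esub> lin M (E j) b"
    "lin M (cone_diff R D f E j) a = lin M (D j) a"
    "lin M (cone_diff R D f E j) b = lin M (f j) b \<oplus>\<^bsub>vspace M\<^esub> lin M (E j) b"
proof -
  note D = cxD(2)[OF coneD(1)[OF C], of j] and E = cxD(2)[OF coneD(2)[OF C], of j] and f = coneD(4)[OF C, of j]
    and disj = coneD(3)[OF C, of j]
  have Df: "madd R (D j) (f j) \<in> Mat R (I (j - 1)) (I j \<union> J j)"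
    by (rule Mat_madd) (use D f Mat_mono in blast)+
  have CM: "cone_diff R D f E j \<in> Mat R (I (j - 1) \<union> J (j - 1)) (I j \<union> J j)"
    unfolding cone_diff_def by (rule Mat_madd) (use Df E Mat_mono in blast)+
  have gen: "lin M (cone_diff R D f E j) v
       = (lin M (D j) v \<oplus>\<^bsub>vspace M\<^esub> lin M (f j) v) \<oplus>\<^bsub>vspace M\<^esub> lin M (E j) v"
    if "v \<in> vecs M UNIV" for v
    unfolding cone_diff_def by (simp add: lin_madd[OF that Df E] lin_madd[OF that D f])
  have z: "lin M (f j) a = \<zero>\<^bsub>vspace M\<^esub>" "lin M (E j) a = \<zero>\<^bsub>vspace M\<^esub>" "lin M (D j) b = \<zero>\<^bsub>vspace M\<^esub>"
    using lin_off[OF a f disj] lin_off[OF a E disj] lin_off[OF b D] disj by (simp_all add: Int_commute)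
  note uni = vecs_UNIV[OF lin_closed[OF a D]] vecs_UNIV[OF lin_closed[OF b f]] vecs_UNIV[OF lin_closed[OF b E]]
  show 1: "lin M (cone_diff R D f E j) a = lin M (D j) a"
    using gen[OF vecs_UNIV[OF a]] by (simp add: z lin_zero_sum uni)
  show 2: "lin M (cone_diff R D f E j) b = lin M (f j) b \<oplus>\<^bsub>vspace M\<^esub> lin M (E j) b"
    using gen[OF vecs_UNIV[OF b]] by (simp add: z lin_zero_sum uni)
  interpret W: module R "vspace M" by (rule vec_module_module)
  show "lin M (cone_diff R D f E j) (a \<oplus>\<^bsub>vspace M\<^esub> b)
       = (lin M (D j) a \<oplus>\<^bsub>vspace M\<^esub> lin M (f j) b) \<oplus>\<^bsub>vspace M\<^esub> lin M (E j) b"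
    using lin_add[OF vecs_UNIV[OF a] vecs_UNIV[OF b] CM] uni by (simp add: 1 2 W.M.a_assoc)
qed

lemma cone_anticomm:
  assumes C: "cone R I D f J E" and w: "w \<in> vecs M UNIV"
  shows "lin M (f j) (lin M (E (j + 1)) w) = \<ominus>\<^bsub>vspace M\<^esub> lin M (D j) (lin M (f (j + 1)) w)"
proof -
  note D = cxD(2)[OF coneD(1)[OF C], of j] and E = cxD'(1)[OF coneD(2)[OF C], of j] and f = coneD(4)[OF C, of j]
    and f' = coneD(5)[OF C, of j]
  show ?thesis
    by (simp add: lin_mm[OF w f E, symmetric] lin_mm[OF w D f', symmetric] coneD(7)[OF C]
        lin_mneg[OF w Mat_mm[OF D f']])
qed

end

context cring
begin

lemma lin_basis:
  assumes A: "A \<in> Mat R U S" and S: "finite S"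
  shows "rlin R A (\<lambda>i. mid R S i k) = (\<lambda>i. A i k)"
proof (rule ext)
  fix i
  have v: "(\<lambda>i. mid R S i k) \<in> rvecs S" by (rule col_vecs[OF Mat_mid[OF S]])
  have "rlin R A (\<lambda>i. mid R S i k) i = (\<Oplus>j\<in>S. A i j \<otimes> mid R S j k)"
    by (subst reg.lin_eq'[OF v A S])
       (use vecsD(4)[OF v] in \<open>auto simp: reg.finsum_regular\<close>)
  also have "\<dots> = (\<Oplus>j\<in>S. if k = j then A i j else \<zero>)"
    by (rule finsum_cong') (use MatD(1)[OF A] in \<open>auto simp: mid_def\<close>)
  also have "\<dots> = A i k"
  proof (cases "k \<in> S")
    case True
    then show ?thesis by (subst finsum_singleton) (use MatD(1)[OF A] S in auto)
  next
    case False
    then have "(\<Oplus>j\<in>S. if k = j then A i j else \<zero>) = \<zero>" by (intro add.finprod_one_eqI) auto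
    then show ?thesis using MatD(3)[OF A False] by simp
  qed
  finally show "rlin R A (\<lambda>i. mid R S i k) i = A i k" .
qed

lemma mat_vec_eqI:
  assumes A: "A \<in> Mat R U S" and B: "B \<in> Mat R Y S" and "finite S"
    and eq: "\<And>v. v \<in> rvecs S \<Longrightarrow> rlin R A v = rlin R B v"
  shows "A = B"
  using eq[OF col_vecs[OF Mat_mid[OF assms(3)]]] lin_basis[OF A assms(3)] lin_basis[OF B assms(3)]
  by (intro mat_colI) simp

lemma cone_cx:
  assumes C: "cone R I D f J E"
  shows "cx R (\<lambda>j. I j \<union> J j) (cone_diff R D f E)"
  unfolding cx_def
proof (intro allI conjI)
  interpret W: module R "vspace (regular_module R)" by (rule reg.vec_module_module)
  fix j
  note c1 = coneD(1)[OF C] and c2 = coneD(2)[OF C]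
  show fin: "finite (I j \<union> J j)" using cxD(1)[OF c1] cxD(1)[OF c2] by auto
  have "madd R (D j) (f j) \<in> Mat R (I (j - 1)) (I j \<union> J j)" for j
    by (rule Mat_madd) (use cxD(2)[OF c1] coneD(4)[OF C] Mat_mono in blast)+
  then show CM: "cone_diff R D f E j \<in> Mat R (I (j - 1) \<union> J (j - 1)) (I j \<union> J j)" for j
    unfolding cone_diff_def by (rule_tac Mat_madd) (use cxD(2)[OF c2] Mat_mono in blast)+
  show "mm R (cone_diff R D f E (j - 1)) (cone_diff R D f E j) = mzero R"
  proof (rule mat_vec_eqI[OF Mat_mm[OF CM CM] Mat_mzero fin])
    fix v assume v: "v \<in> rvecs (I j \<union> J j)"
    obtain a b where a: "a \<in> rvecs (I j)" and b: "b \<in> rvecs (J j)" and vab: "v = a \<oplus>\<^bsub>vspace (regular_module R)\<^esub> b"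
      using reg.vecs_split[OF v coneD(3)[OF C]] .
    let ?l = "rlin R"
    note Da = reg.lin_closed[OF a cxD(2)[OF c1, of j]] and fb = reg.lin_closed[OF b coneD(4)[OF C, of j]]
      and Eb = reg.lin_closed[OF b cxD(2)[OF c2, of j]]
    have "?l (mm R (cone_diff R D f E (j - 1)) (cone_diff R D f E j)) v = ?l (cone_diff R D f E (j - 1)) (?l (cone_diff R D f E j) v)"
      by (rule reg.lin_mm[OF vecs_UNIV[OF v] CM CM])
    also have "\<dots> = (?l (D (j - 1)) (?l (D j) a \<oplus>\<^bsub>vspace (regular_module R)\<^esub> ?l (f j) b)
        \<oplus>\<^bsub>vspace (regular_module R)\<^esub> ?l (f (j - 1)) (?l (E j) b))
        \<oplus>\<^bsub>vspace (regular_module R)\<^esub> ?l (E (j - 1)) (?l (E j) b)"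
      unfolding vab reg.cone_diff_apply(1)[OF C a b] reg.cone_diff_apply(1)[OF C reg.vecs_ops(2)[OF Da fb] Eb] ..
    also have "\<dots> = \<zero>\<^bsub>vspace (regular_module R)\<^esub>"
      using reg.lin_add[OF vecs_UNIV[OF Da] vecs_UNIV[OF fb] cxD(2)[OF c1, of "j - 1"]]
        reg.cone_anticomm[OF C vecs_UNIV[OF b], of "j - 1"]
        reg.lin_DD[OF c1 vecs_UNIV[OF a], of "j - 1"] reg.lin_DD[OF c2 vecs_UNIV[OF b], of "j - 1"]
        vecs_UNIV[OF reg.lin_closed[OF fb cxD(2)[OF c1, of "j - 1"]]]
      by (simp add: W.M.r_neg)
    finally show "?l (mm R (cone_diff R D f E (j - 1)) (cone_diff R D f E j)) v = ?l (mzero R) v"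
      by (simp add: reg.lin_mzero[OF vecs_UNIV[OF v]])
  qed
qed

lemma cone_exact:
  assumes C: "cone R I D f J E" and ex: "kills R \<one> I D j" "kills R \<one> J E j"
  shows "kills R \<one> (\<lambda>j. I j \<union> J j) (cone_diff R D f E) j"
  unfolding kills_def
proof (intro ballI impI)
  interpret W: module R "vspace (regular_module R)" by (rule reg.vec_module_module)
  let ?W = "vspace (regular_module R)"
  let ?l = "rlin R"
  note c1 = coneD(1)[OF C] and c2 = coneD(2)[OF C]
  fix v assume v: "v \<in> rvecs (I j \<union> J j)" and z: "?l (cone_diff R D f E j) v = \<zero>\<^bsub>?W\<^esub>"
  obtain a b where a: "a \<in> rvecs (I j)" and b: "b \<in> rvecs (J j)" and vab: "v = a \<oplus>\<^bsub>?W\<^esub> b"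
    using reg.vecs_split[OF v coneD(3)[OF C]] .
  note Da = reg.lin_closed[OF a cxD(2)[OF c1, of j]] and fb = reg.lin_closed[OF b coneD(4)[OF C, of j]]
      and Eb = reg.lin_closed[OF b cxD(2)[OF c2, of j]]
  have "(?l (D j) a \<oplus>\<^bsub>?W\<^esub> ?l (f j) b) \<oplus>\<^bsub>?W\<^esub> ?l (E j) b = \<zero>\<^bsub>?W\<^esub> \<oplus>\<^bsub>?W\<^esub> \<zero>\<^bsub>?W\<^esub>"
    using z by (simp add: vab reg.cone_diff_apply(1)[OF C a b] )
  then have z1: "?l (D j) a \<oplus>\<^bsub>?W\<^esub> ?l (f j) b = \<zero>\<^bsub>?W\<^esub>" and z2: "?l (E j) b = \<zero>\<^bsub>?W\<^esub>"
    using reg.vecs_disjoint_eq[OF reg.vecs_ops(2)[OF Da fb] reg.vecs_ops(1) Eb reg.vecs_ops(1) coneD(3)[OF C]]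
    by simp_all
  obtain w where w: "w \<in> rvecs (J (j + 1))" "?l (E (j + 1)) w = b"
    using ex(2) b z2 by (auto simp: kills_def vecs_UNIV)
  note fw = reg.lin_closed[OF w(1) coneD(5)[OF C]]
  define u where "u = a \<ominus>\<^bsub>?W\<^esub> ?l (f (j + 1)) w"
  have u: "u \<in> rvecs (I j)" unfolding u_def by (rule reg.vecs_ops(3)[OF a fw])
  note Dfw = reg.lin_closed[OF fw cxD(2)[OF c1, of j]]
  have "?l (D j) u = ?l (D j) a \<ominus>\<^bsub>?W\<^esub> ?l (D j) (?l (f (j + 1)) w)"
    unfolding u_def by (rule reg.lin_minus[OF vecs_UNIV[OF a] vecs_UNIV[OF fw] cxD(2)[OF c1]])
  also have "\<dots> = \<zero>\<^bsub>?W\<^esub>"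
    using reg.cone_anticomm[OF C vecs_UNIV[OF w(1)], of j] z1 by (simp add: w(2) a_minus_def)
  finally obtain x where x: "x \<in> rvecs (I (j + 1))" "?l (D (j + 1)) x = u"
    using ex(1) u by (auto simp: kills_def vecs_UNIV)
  have "?l (cone_diff R D f E (j + 1)) (x \<oplus>\<^bsub>?W\<^esub> w) = (u \<oplus>\<^bsub>?W\<^esub> ?l (f (j + 1)) w) \<oplus>\<^bsub>?W\<^esub> b"
    by (simp add: reg.cone_diff_apply(1)[OF C x(1) w(1)] x w)
  also have "\<dots> = v" using vecs_UNIV[OF a] vecs_UNIV[OF fw]
    by (simp add: u_def vab a_minus_def W.M.a_assoc W.M.l_neg)
  finally show "\<exists>w\<in>rvecs (I (j + 1) \<union> J (j + 1)). ?l (cone_diff R D f E (j + 1)) w = \<one> \<odot>\<^bsub>?W\<^esub> v"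
    using vecs_UNIV[OF v] vecs_mono[OF x(1), of "I (j + 1) \<union> J (j + 1)"] vecs_mono[OF w(1), of "I (j + 1) \<union> J (j + 1)"]
    by (intro bexI[of _ "x \<oplus>\<^bsub>?W\<^esub> w"]) (auto intro: reg.vecs_ops(2))
qed

text \<open>
  The dual of an extension is an extension with the roles of subcomplex and quotient exchanged. Statements on quotients
  thus yield statements on subcomplexes.
\<close>

lemma cone_dual:
  assumes C: "cone R I D f J E"
  shows "cone R (dual_index J) (dual_diff E) (dual_diff f) (dual_index I) (dual_diff D)"
    and "cone_diff R (dual_diff E) (dual_diff f) (dual_diff D) = dual_diff (cone_diff R D f E)"
proof -
  note c1 = coneD(1)[OF C] and c2 = coneD(2)[OF C]
  show "cone R (dual_index J) (dual_diff E) (dual_diff f) (dual_index I) (dual_diff D)"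
    unfolding cone_def
  proof (intro conjI allI cx_dual[OF c1] cx_dual[OF c2])
    fix j
    show "dual_index J j \<inter> dual_index I j = {}"
      using coneD(3)[OF C] by (auto simp: dual_index_def)
    show "dual_diff f j \<in> Mat R (dual_index J (j - 1)) (dual_index I j)"
      using coneD(5)[OF C, of "- j"] by (simp add: dual_index_def dual_diff_def)
    have f: "f (2 - j) \<in> Mat R (I (1 - j)) (J (2 - j))" using coneD(4)[OF C, of "2 - j"] by simp
    have f1: "f (1 - j) \<in> Mat R (I (- j)) (J (1 - j))" using coneD(4)[OF C, of "1 - j"] by simp
    have D: "D (1 - j) \<in> Mat R (I (- j)) (I (1 - j))" using cxD(2)[OF c1, of "1 - j"] by simp
    have E: "E (2 - j) \<in> Mat R (J (1 - j)) (J (2 - j))" using cxD(2)[OF c2, of "2 - j"] by simp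
    have "mm R (tr (f (2 - j))) (tr (D (1 - j))) = mneg R (tr (mneg R (mm R (D (1 - j)) (f (2 - j)))))"
      by (simp add: mm_tr[OF D f] tr_mneg mneg_mneg[OF Mat_mm[OF tr_Mat[OF f] tr_Mat[OF D]]])
    also have "mneg R (mm R (D (1 - j)) (f (2 - j))) = mm R (f (1 - j)) (E (2 - j))"
      using coneD(7)[OF C, of "1 - j"] by simp
    finally show "mm R (dual_diff f (j - 1)) (dual_diff D j) = mneg R (mm R (dual_diff E (j - 1)) (dual_diff f j))"
      by (simp add: mm_tr[OF f1 E] dual_diff_def algebra_simps)
  qed
  show "cone_diff R (dual_diff E) (dual_diff f) (dual_diff D) = dual_diff (cone_diff R D f E)"
  proof (intro ext)
    fix j a b
    have "E (1 - j) b a \<in> carrier R" "f (1 - j) b a \<in> carrier R" "D (1 - j) b a \<in> carrier R"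
      using MatD(1)[OF cxD(2)[OF c1]] MatD(1)[OF cxD(2)[OF c2]] MatD(1)[OF coneD(4)[OF C]] by auto
    then show "cone_diff R (dual_diff E) (dual_diff f) (dual_diff D) j a b = dual_diff (cone_diff R D f E) j a b"
      by (simp add: cone_diff_def dual_diff_def madd_def tr_def a_ac)
  qed
qed

end

section \<open>Null-homotopies of scalars\<close>

text \<open>
  The equation \<open>D h + h D = c\<close> in the single degree \<open>j\<close>. It is kept separate for each degree
  because the homotopies that occur exist only on half-lines of degrees.
\<close>

definition htpy where
  "htpy R c I D h j \<longleftrightarrow> h j \<in> Mat R (I (j + 1)) (I j) \<and> h (j - 1) \<in> Mat R (I j) (I (j - 1)) \<and>
     madd R (mm R (D (j + 1)) (h j)) (mm R (h (j - 1)) (D j)) = msmult R c (mid R (I j))"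

lemma (in rmodule) htpy_apply:
  assumes C: "cx R I D" and h: "htpy R c I D h j" and c: "c \<in> carrier R" and v: "v \<in> vecs M (I j)"
  shows "lin M (D (j + 1)) (lin M (h j) v) \<oplus>\<^bsub>vspace M\<^esub> lin M (h (j - 1)) (lin M (D j) v)
       = c \<odot>\<^bsub>vspace M\<^esub> v"
proof -
  have h1: "h j \<in> Mat R (I (j + 1)) (I j)" and h2: "h (j - 1) \<in> Mat R (I j) (I (j - 1))"
    using h by (auto simp: htpy_def)
  note D1 = cxD'(1)[OF C, of j] and D2 = cxD(2)[OF C, of j]
  have v': "v \<in> vecs M UNIV" using v by simp
  have "lin M (D (j + 1)) (lin M (h j) v) \<oplus>\<^bsub>vspace M\<^esub> lin M (h (j - 1)) (lin M (D j) v)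
      = lin M (madd R (mm R (D (j + 1)) (h j)) (mm R (h (j - 1)) (D j))) v"
    by (simp add: lin_madd[OF v' R.Mat_mm[OF D1 h1] R.Mat_mm[OF h2 D2]] lin_mm[OF v' D1 h1] lin_mm[OF v' h2 D2])
  also have "\<dots> = lin M (msmult R c (mid R (I j))) v" using h by (simp add: htpy_def)
  also have "\<dots> = c \<odot>\<^bsub>vspace M\<^esub> v"
    using lin_msmult[OF v' R.Mat_mid[OF cxD(1)[OF C]] c] lin_mid[OF v] by simp
  finally show ?thesis .
qed

context cring
begin

lemma htpyI:
  assumes C: "cx R I D" and c: "c \<in> carrier R"
    and h1: "h j \<in> Mat R (I (j + 1)) (I j)" and h2: "h (j - 1) \<in> Mat R (I j) (I (j - 1))"
    and eq: "\<And>v. v \<in> rvecs (I j) \<Longrightarrow> rlin R (D (j + 1)) (rlin R (h j) v)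
         \<oplus>\<^bsub>vspace (regular_module R)\<^esub> rlin R (h (j - 1)) (rlin R (D j) v)
       = c \<odot>\<^bsub>vspace (regular_module R)\<^esub> v"
  shows "htpy R c I D h j"
proof -
  note D1 = cxD'(1)[OF C, of j] and D2 = cxD(2)[OF C, of j] and I = Mat_mid[OF cxD(1)[OF C]]
  have "madd R (mm R (D (j + 1)) (h j)) (mm R (h (j - 1)) (D j)) = msmult R c (mid R (I j))"
  proof (rule mat_vec_eqI)
    show "madd R (mm R (D (j + 1)) (h j)) (mm R (h (j - 1)) (D j)) \<in> Mat R (I j) (I j)"
      by (rule Mat_madd[OF Mat_mm[OF D1 h1] Mat_mm[OF h2 D2]])
    show "msmult R c (mid R (I j)) \<in> Mat R (I j) (I j)" by (rule Mat_msmult[OF c I])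
    show "finite (I j)" by (rule cxD(1)[OF C])
    fix v assume v: "v \<in> rvecs (I j)"
    have v': "v \<in> rvecs UNIV" using v by simp
    show "rlin R (madd R (mm R (D (j + 1)) (h j)) (mm R (h (j - 1)) (D j))) v
        = rlin R (msmult R c (mid R (I j))) v"
      using eq[OF v] reg.lin_msmult[OF v' I c] reg.lin_mid[OF v]
      by (simp add: reg.lin_madd[OF v' Mat_mm[OF D1 h1] Mat_mm[OF h2 D2]] reg.lin_mm[OF v' D1 h1] reg.lin_mm[OF v' h2 D2])
  qed
  then show ?thesis using h1 h2 by (simp add: htpy_def)
qed

lemma htpy_scale:
  assumes C: "cx R I D" and c: "c \<in> carrier R" "d \<in> carrier R" and h: "htpy R c I D h j"
  shows "htpy R (d \<otimes> c) I D (\<lambda>j. msmult R d (h j)) j"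
proof -
  interpret W: module R "vspace (regular_module R)" by (rule reg.vec_module_module)
  have h1: "h j \<in> Mat R (I (j + 1)) (I j)" and h2: "h (j - 1) \<in> Mat R (I j) (I (j - 1))"
    using h by (auto simp: htpy_def)
  note D1 = cxD'(1)[OF C, of j] and D2 = cxD(2)[OF C, of j]
  show ?thesis
  proof (rule htpyI[OF C _ Mat_msmult[OF c(2) h1] Mat_msmult[OF c(2) h2]])
    show "d \<otimes> c \<in> carrier R" using c by simp
    fix v assume v: "v \<in> rvecs (I j)"
    have v': "v \<in> rvecs UNIV" using v by simp
    note hv = vecs_UNIV[OF reg.lin_closed[OF v' h1]] and Dv = vecs_UNIV[OF reg.lin_closed[OF v' D2]]
    show "rlin R (D (j + 1)) (rlin R (msmult R d (h j)) v) \<oplus>\<^bsub>vspace (regular_module R)\<^esub>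
         rlin R (msmult R d (h (j - 1))) (rlin R (D j) v) =
         (d \<otimes> c) \<odot>\<^bsub>vspace (regular_module R)\<^esub> v"
      unfolding reg.lin_msmult[OF v' h1 c(2)] reg.lin_msmult[OF Dv h2 c(2)] reg.lin_smult[OF c(2) hv D1]
        W.smult_assoc1[OF c(2,1) v'] reg.htpy_apply[OF C h c(1) v, symmetric]
      using W.smult_r_distr[OF c(2) vecs_UNIV[OF reg.lin_closed[OF hv D1]] vecs_UNIV[OF reg.lin_closed[OF Dv h2]]]
      by simp
  qed
qed

lemma htpy_dual:
  assumes C: "cx R I D" and h: "htpy R c I D h j"
  shows "htpy R c (dual_index I) (dual_diff D) (\<lambda>k. tr (h (- k - 1))) (- j)"
proof -
  have h1: "h j \<in> Mat R (I (j + 1)) (I j)" and h2: "h (j - 1) \<in> Mat R (I j) (I (j - 1))"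
    using h by (auto simp: htpy_def)
  note D1 = cxD'(1)[OF C, of j] and D2 = cxD(2)[OF C, of j]
  have "tr (madd R (mm R (D (j + 1)) (h j)) (mm R (h (j - 1)) (D j))) = tr (msmult R c (mid R (I j)))"
    using h by (simp add: htpy_def)
  then have "madd R (mm R (tr (h j)) (tr (D (j + 1)))) (mm R (tr (D j)) (tr (h (j - 1)))) = msmult R c (mid R (I j))"
    by (simp add: tr_madd tr_msmult mm_tr[OF D1 h1] mm_tr[OF h2 D2]) (auto simp: tr_def mid_def msmult_def fun_eq_iff)
  moreover have "madd R (mm R (tr (h j)) (tr (D (j + 1)))) (mm R (tr (D j)) (tr (h (j - 1)))) =
      madd R (mm R (tr (D j)) (tr (h (j - 1)))) (mm R (tr (h j)) (tr (D (j + 1))))"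
    unfolding madd_def
    using MatD(1)[OF Mat_mm[OF tr_Mat[OF h1] tr_Mat[OF D1]]] MatD(1)[OF Mat_mm[OF tr_Mat[OF D2] tr_Mat[OF h2]]]
    by (intro ext) (simp add: a_comm)
  ultimately show ?thesis using h1 h2
    by (simp add: htpy_def dual_index_def dual_diff_def algebra_simps)
qed

lemma htpy_kills:
  assumes C: "cx R I D" and c: "c \<in> carrier R" and h: "htpy R c I D h j"
  shows "kills R c I D j"
  unfolding kills_def
proof (intro ballI impI)
  fix v assume v: "v \<in> rvecs (I j)" and z: "rlin R (D j) v = \<zero>\<^bsub>vspace (regular_module R)\<^esub>"
  have h1: "h j \<in> Mat R (I (j + 1)) (I j)" using h by (auto simp: htpy_def)
  note hv = reg.lin_closed[OF v h1]
  show "\<exists>w\<in>rvecs (I (j + 1)). rlin R (D (j + 1)) w = c \<odot>\<^bsub>vspace (regular_module R)\<^esub> v"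
    using reg.htpy_apply[OF C h c v] vecs_UNIV[OF reg.lin_closed[OF hv cxD'(1)[OF C]]]
    by (intro bexI[OF _ hv]) (simp add: z reg.lin_zero reg.lin_zero_sum)
qed

text \<open>
  A homotopy is built upwards from the lowest degree \<open>b\<close>. Every further degree costs one more factor
  \<open>c\<close>, whence the exponent and the bound \<open>q\<close>.
\<close>

lemma null_homotopy:
  assumes C: "cx R I D" and low: "\<And>j. j < b \<Longrightarrow> I j = {}" and c: "c \<in> carrier R"
    and k: "\<And>j. j \<le> q \<Longrightarrow> kills R c I D j"
  shows "\<exists>h (e::nat). \<forall>j\<le>q. htpy R (c [^] e) I D h j"
proof -
  have empty: "htpy R (c [^] (0::nat)) I D (\<lambda>j. mzero R) j" if "j \<le> b - 1" for j
  proof (rule htpyI[OF C])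
    fix v assume "v \<in> rvecs (I j)"
    then have v: "v \<in> rvecs {}" using low[of j] that by simp
    then have "v = \<zero>\<^bsub>vspace (regular_module R)\<^esub>" using vecsD(2)[OF v] by auto
    then show "rlin R (D (j + 1)) (rlin R (mzero R) v) \<oplus>\<^bsub>vspace (regular_module R)\<^esub>
       rlin R (mzero R) (rlin R (D j) v) =
       c [^] (0::nat) \<odot>\<^bsub>vspace (regular_module R)\<^esub> v"
      by (simp add: reg.lin_zero reg.lin_zero_sum reg.vecs_ops(1)) auto
  qed auto
  show ?thesis
  proof (cases "q \<ge> b - 1")
    case False
    then show ?thesis using empty by (meson linear order_trans)
  next
    case True
    then show ?thesis using k
    proof (induction q rule: int_ge_induct)
    case base
    show ?case using empty by blast
  next
    case (step i)
    then obtain h and e :: nat where h: "\<And>j. j \<le> i \<Longrightarrow> htpy R (c [^] e) I D h j"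
      by (metis zle_add1_eq_le order_less_imp_le)
    interpret W: module R "vspace (regular_module R)" by (rule reg.vec_module_module)
    let ?W = "vspace (regular_module R)"
    let ?l = "rlin R"
    define m where "m = i + 1"
    have hi: "h i \<in> Mat R (I m) (I i)" using h[of i] by (auto simp: htpy_def m_def)
    have Dm: "D m \<in> Mat R (I i) (I m)" using cxD'(1)[OF C, of i] by (simp add: m_def)
    have ce: "c [^] e \<in> carrier R" using c by simp
    note hD = Mat_mm[OF hi Dm] and idm = Mat_msmult[OF ce Mat_mid[OF cxD(1)[OF C]], of m]
    \<comment> \<open>The columns of \<open>c ^ e - h D\<close> are cycles in degree \<open>m\<close>, so \<open>c\<close> times this
      matrix is \<open>D g\<close> for some \<open>g\<close>, which is the homotopy in the new degree.\<close>
    define H where "H = madd R (msmult R (c [^] e) (mid R (I m))) (mneg R (mm R (h i) (D m)))"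
    have H: "H \<in> Mat R (I m) (I m)" unfolding H_def by (rule Mat_madd[OF idm Mat_mneg[OF hD]])
    have Hv: "?l H v = c [^] e \<odot>\<^bsub>?W\<^esub> v \<ominus>\<^bsub>?W\<^esub> ?l (h i) (?l (D m) v)" if v: "v \<in> rvecs (I m)" for v
    proof -
      have v': "v \<in> rvecs UNIV" using v by simp
      show ?thesis unfolding H_def a_minus_def
        by (simp only: reg.lin_madd[OF v' idm Mat_mneg[OF hD]] reg.lin_msmult[OF v' Mat_mid[OF cxD(1)[OF C]] ce]
            reg.lin_mid[OF v] reg.lin_mneg[OF v' hD] reg.lin_mm[OF v' hi Dm])
    qed
    have "mm R (D m) H = mzero R"
    proof (rule mat_vec_eqI[OF Mat_mm[OF Dm H] Mat_mzero cxD(1)[OF C]])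
      fix v assume v: "v \<in> rvecs (I m)"
      have v': "v \<in> rvecs UNIV" using v by simp
      note Dv = reg.lin_closed[OF v Dm]
      note hDv = reg.lin_closed[OF Dv hi]
      note DhDv = reg.lin_closed[OF hDv Dm]
      have "?l (D m) (?l (h i) (?l (D m) v)) \<oplus>\<^bsub>?W\<^esub> ?l (h (i - 1)) (?l (D i) (?l (D m) v)) = c [^] e \<odot>\<^bsub>?W\<^esub> ?l (D m) v"
        using reg.htpy_apply[OF C h[of i] ce Dv] by (simp add: m_def)
      then have "?l (D m) (?l (h i) (?l (D m) v)) = c [^] e \<odot>\<^bsub>?W\<^esub> ?l (D m) v"
        using reg.lin_DD[OF C v', of i] vecs_UNIV[OF DhDv] by (simp add: m_def reg.lin_zero reg.lin_zero_sum)
      then have "?l (D m) (?l H v) = \<zero>\<^bsub>?W\<^esub>"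
        unfolding Hv[OF v] reg.lin_minus[OF vecs_UNIV[OF reg.vecs_ops(5)[OF ce v]] vecs_UNIV[OF hDv] Dm]
          reg.lin_smult[OF ce v' Dm] using vecs_UNIV[OF DhDv]
        by (metis W.M.r_neg a_minus_def)
      then show "?l (mm R (D m) H) v = ?l (mzero R) v"
        by (simp only: reg.lin_mm[OF v' Dm H] reg.lin_mzero[OF v'])
    qed
    then obtain g where g: "g \<in> Mat R (I (m + 1)) (I m)" "mm R (D (m + 1)) g = msmult R c H"
      using mat_lift[OF step.prems[of m] c C H] by (auto simp: m_def)
    define h' where "h' j = (if j = m then g else msmult R c (h j))" for j
    have "htpy R (c [^] Suc e) I D h' j" if "j \<le> m" for j
    proof (cases "j = m")
      case False
      then have "htpy R (c \<otimes> c [^] e) I D (\<lambda>j. msmult R c (h j)) j"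
        using htpy_scale[OF C ce c h[of j]] that by (simp add: m_def)
      moreover have "c \<otimes> c [^] e = c [^] Suc e" using c by (simp add: m_comm)
      ultimately show ?thesis using False that by (simp add: htpy_def h'_def)
    next
      case True
      have "htpy R (c [^] Suc e) I D h' m"
      proof (rule htpyI[OF C])
        show "c [^] Suc e \<in> carrier R" using c by simp
        show "h' m \<in> Mat R (I (m + 1)) (I m)" using g by (simp add: h'_def)
        show "h' (m - 1) \<in> Mat R (I m) (I (m - 1))"
          using Mat_msmult[OF c hi] by (simp add: h'_def m_def)
        fix v assume v: "v \<in> rvecs (I m)"
        have v': "v \<in> rvecs UNIV" using v by simp
        note Dv = reg.lin_closed[OF v Dm]
        note hDv = vecs_UNIV[OF reg.lin_closed[OF Dv hi]]
        have 1: "?l (D (m + 1)) (?l (h' m) v) = c \<odot>\<^bsub>?W\<^esub> (c [^] e \<odot>\<^bsub>?W\<^esub> v \<ominus>\<^bsub>?W\<^esub> ?l (h i) (?l (D m) v))"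
          using reg.lin_mm[OF v' cxD'(1)[OF C, of m] g(1)] g(2) reg.lin_msmult[OF v' H c] Hv[OF v]
          by (simp add: h'_def)
        have 2: "?l (h' (m - 1)) (?l (D m) v) = c \<odot>\<^bsub>?W\<^esub> ?l (h i) (?l (D m) v)"
          using reg.lin_msmult[OF vecs_UNIV[OF Dv] hi c] by (simp add: h'_def m_def)
        have cev: "c [^] e \<odot>\<^bsub>?W\<^esub> v \<in> rvecs UNIV" using reg.vecs_ops(5)[OF ce v'] .
        have "(c [^] e \<odot>\<^bsub>?W\<^esub> v \<ominus>\<^bsub>?W\<^esub> ?l (h i) (?l (D m) v)) \<oplus>\<^bsub>?W\<^esub> ?l (h i) (?l (D m) v) = c [^] e \<odot>\<^bsub>?W\<^esub> v"
          using hDv cev by (simp add: a_minus_def W.M.a_assoc W.M.l_neg)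
        then have "?l (D (m + 1)) (?l (h' m) v) \<oplus>\<^bsub>?W\<^esub> ?l (h' (m - 1)) (?l (D m) v) = c \<odot>\<^bsub>?W\<^esub> (c [^] e \<odot>\<^bsub>?W\<^esub> v)"
          unfolding 1 2 using W.smult_r_distr[OF c reg.vecs_ops(3)[OF cev hDv] hDv] by simp
        also have "\<dots> = c [^] Suc e \<odot>\<^bsub>?W\<^esub> v"
          using c ce v' by (simp only: W.smult_assoc1[symmetric]) (simp add: m_comm)
        finally show "?l (D (m + 1)) (?l (h' m) v) \<oplus>\<^bsub>?W\<^esub> ?l (h' (m - 1)) (?l (D m) v) = c [^] Suc e \<odot>\<^bsub>?W\<^esub> v" .
      qed
      then show ?thesis using True by simp
    qed
    then show ?case unfolding m_def by blast
    qed
  qed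
qed

text \<open>
  The connecting homomorphism \<open>H\<^sub>j\<^sub>+\<^sub>1(J) \<rightarrow> H\<^sub>j(I)\<close> is injective because
  the total complex is exact in degree \<open>j + 1\<close>.
\<close>

lemma cone_kills_quotient:
  assumes C: "cone R I D f J E" and c: "c \<in> carrier R" and k: "kills R c I D j"
    and ex: "kills R \<one> (\<lambda>j. I j \<union> J j) (cone_diff R D f E) (j + 1)"
  shows "kills R c J E (j + 1)"
  unfolding kills_def
proof (intro ballI impI)
  interpret W: module R "vspace (regular_module R)" by (rule reg.vec_module_module)
  let ?W = "vspace (regular_module R)"
  let ?l = "rlin R"
  note c1 = coneD(1)[OF C] and c2 = coneD(2)[OF C]
  fix v assume v: "v \<in> rvecs (J (j + 1))" and z: "?l (E (j + 1)) v = \<zero>\<^bsub>?W\<^esub>"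
  note fv = reg.lin_closed[OF v coneD(5)[OF C]]
  note Dfv = reg.lin_closed[OF fv cxD(2)[OF c1]]
  have "\<ominus>\<^bsub>?W\<^esub> ?l (D j) (?l (f (j + 1)) v) = \<zero>\<^bsub>?W\<^esub>"
    using reg.cone_anticomm[OF C vecs_UNIV[OF v], of j] by (simp add: z reg.lin_zero)
  then have "?l (D j) (?l (f (j + 1)) v) = \<zero>\<^bsub>?W\<^esub>"
    using vecs_UNIV[OF Dfv] W.M.add.inv_eq_1_iff by blast
  then obtain l where l: "l \<in> rvecs (I (j + 1))" "?l (D (j + 1)) l = c \<odot>\<^bsub>?W\<^esub> ?l (f (j + 1)) v"
    using k fv by (auto simp: kills_def)
  note cv = reg.vecs_ops(5)[OF c v] and nl = reg.vecs_ops(4)[OF l(1)]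
  have cfv: "c \<odot>\<^bsub>?W\<^esub> ?l (f (j + 1)) v \<in> rvecs UNIV" using reg.vecs_ops(5)[OF c vecs_UNIV[OF fv]] .
  have "?l (cone_diff R D f E (j + 1)) (\<ominus>\<^bsub>?W\<^esub> l \<oplus>\<^bsub>?W\<^esub> c \<odot>\<^bsub>?W\<^esub> v)
      = (\<ominus>\<^bsub>?W\<^esub> (c \<odot>\<^bsub>?W\<^esub> ?l (f (j + 1)) v) \<oplus>\<^bsub>?W\<^esub> c \<odot>\<^bsub>?W\<^esub> ?l (f (j + 1)) v) \<oplus>\<^bsub>?W\<^esub> c \<odot>\<^bsub>?W\<^esub> \<zero>\<^bsub>?W\<^esub>"
    unfolding reg.cone_diff_apply(1)[OF C nl cv] reg.lin_neg[OF vecs_UNIV[OF l(1)] cxD(2)[OF c1]] l(2)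
      reg.lin_smult[OF c vecs_UNIV[OF v] coneD(4)[OF C]] reg.lin_smult[OF c vecs_UNIV[OF v] cxD(2)[OF c2]] z ..
  also have "\<dots> = \<zero>\<^bsub>?W\<^esub>" using cfv c by (simp add: W.M.l_neg)
  finally obtain w where w: "w \<in> rvecs (I (j + 1 + 1) \<union> J (j + 1 + 1))"
    "?l (cone_diff R D f E (j + 1 + 1)) w = \<ominus>\<^bsub>?W\<^esub> l \<oplus>\<^bsub>?W\<^esub> c \<odot>\<^bsub>?W\<^esub> v"
    using ex vecs_mono[OF nl, of "I (j + 1) \<union> J (j + 1)"] vecs_mono[OF cv, of "I (j + 1) \<union> J (j + 1)"]
      vecs_UNIV[OF reg.vecs_ops(2)[OF vecs_UNIV[OF nl] vecs_UNIV[OF cv]]]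
    by (auto simp: kills_def intro: reg.vecs_ops(2))
  obtain a b where a: "a \<in> rvecs (I (j + 1 + 1))" and b: "b \<in> rvecs (J (j + 1 + 1))" and wab: "w = a \<oplus>\<^bsub>?W\<^esub> b"
    using reg.vecs_split[OF w(1) coneD(3)[OF C]] .
  have "?l (E (j + 1 + 1)) b = c \<odot>\<^bsub>?W\<^esub> v"
    using w(2) unfolding wab reg.cone_diff_apply(1)[OF C a b]
    by (rule reg.vecs_disjoint_eq(2)[rotated -1, OF _ _ nl _ cv coneD(3)[OF C]])
       (rule reg.vecs_ops(2) reg.lin_closed[OF a cxD'(1)[OF c1]] reg.lin_closed[OF b coneD(5)[OF C]] reg.lin_closed[OF b cxD'(1)[OF c2]])+
  then show "\<exists>w\<in>rvecs (J (j + 1 + 1)). ?l (E (j + 1 + 1)) w = c \<odot>\<^bsub>?W\<^esub> v"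
    using b by blast
qed

lemma mm_mres:
  assumes A: "A \<in> Mat R U Y" and B: "B \<in> Mat R Y' Z" and Y: "Y \<subseteq> S \<union> T" "S \<inter> T = {}"
  shows "mres R U' Z' (mm R A B) = madd R (mm R (mres R U' S A) (mres R S Z' B)) (mm R (mres R U' T A) (mres R T Z' B))"
proof (intro ext)
  fix i k
  let ?J = "{j. \<exists>k. B j k \<noteq> \<zero>}"
  have J: "finite ?J" by (rule MatD(4)[OF B])
  note m = mm_eq[OF Mat_mres[OF A] Mat_mres[OF B] J]
  have 1: "mm R (mres R U' S A) (mres R S Z' B) i k = (\<Oplus>j\<in>?J. mres R U' S A i j \<otimes> mres R S Z' B j k)"
    by (rule m) (auto simp: mres_def)
  have 2: "mm R (mres R U' T A) (mres R T Z' B) i k = (\<Oplus>j\<in>?J. mres R U' T A i j \<otimes> mres R T Z' B j k)"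
    by (rule m) (auto simp: mres_def)
  note cl = MatD(1)[OF Mat_mres[OF A]] MatD(1)[OF Mat_mres[OF B]] MatD(1)[OF A] MatD(1)[OF B]
  have "mres R U' Z' (mm R A B) i k = (\<Oplus>j\<in>?J. mres R U' S A i j \<otimes> mres R S Z' B j k \<oplus> mres R U' T A i j \<otimes> mres R T Z' B j k)"
  proof (cases "i \<in> U' \<and> k \<in> Z'")
    case True
    have "mres R U' Z' (mm R A B) i k = (\<Oplus>j\<in>?J. A i j \<otimes> B j k)"
      using True mm_eq[OF A B J order_refl] by (simp add: mres_def)
    also have "\<dots> = (\<Oplus>j\<in>?J. mres R U' S A i j \<otimes> mres R S Z' B j k \<oplus> mres R U' T A i j \<otimes> mres R T Z' B j k)"
    proof (rule finsum_cong'[OF refl])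
      fix j assume "j \<in> ?J"
      have "A i j = \<zero>" if "j \<notin> S \<union> T" using that Y MatD(3)[OF A] by blast
      then show "A i j \<otimes> B j k = mres R U' S A i j \<otimes> mres R S Z' B j k \<oplus> mres R U' T A i j \<otimes> mres R T Z' B j k"
        using True cl Y(2) by (cases "j \<in> S"; cases "j \<in> T") (auto simp: mres_def)
    qed (use cl in auto)
    finally show ?thesis .
  next
    case False
    then have "mres R U' S A i j \<otimes> mres R S Z' B j k \<oplus> mres R U' T A i j \<otimes> mres R T Z' B j k = \<zero>" for j
      using cl by (auto simp: mres_def)
    then show ?thesis using False by (auto simp: mres_def add.finprod_one_eqI)
  qed
  also have "\<dots> = mm R (mres R U' S A) (mres R S Z' B) i k \<oplus> mm R (mres R U' T A) (mres R T Z' B) i k"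
    unfolding 1 2 by (rule finsum_addf) (use cl in auto)
  finally show "mres R U' Z' (mm R A B) i k = madd R (mm R (mres R U' S A) (mres R S Z' B)) (mm R (mres R U' T A) (mres R T Z' B)) i k"
    by (simp add: madd_def)
qed

lemma madd_mzero: "A \<in> Mat R U Y \<Longrightarrow> madd R A (mzero R) = A" "A \<in> Mat R U Y \<Longrightarrow> madd R (mzero R) A = A"
  by (simp_all add: madd_def mzero_def fun_eq_iff MatD(1))

lemma madd_eq_mzero: "A \<in> Mat R U Y \<Longrightarrow> B \<in> Mat R U Y \<Longrightarrow> madd R A B = mzero R \<Longrightarrow> B = mneg R A"
  by (simp add: madd_def mzero_def mneg_def fun_eq_iff MatD(1)) (metis MatD(1) minus_equality a_comm)

text \<open>
  When a part \<open>L\<close> of the bases spans a subcomplex, the differential is block triangular and the complex is an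
  extension of its quotient by that subcomplex.
\<close>

lemma subcomplex_cone:
  assumes C: "cx R I D" and sub: "\<And>j. L j \<subseteq> I j"
    and tri: "\<And>j a b. b \<in> L j \<Longrightarrow> a \<notin> L (j - 1) \<Longrightarrow> D j a b = \<zero>"
  defines "Q \<equiv> \<lambda>j. I j - L j"
  defines "DL \<equiv> \<lambda>j. mres R (L (j - 1)) (L j) (D j)" and "f \<equiv> \<lambda>j. mres R (L (j - 1)) (Q j) (D j)"
    and "DQ \<equiv> \<lambda>j. mres R (Q (j - 1)) (Q j) (D j)"
  shows "cone R L DL f Q DQ" "cone_diff R DL f DQ = D" "(\<lambda>j. L j \<union> Q j) = I"
proof -
  have int: "L j \<inter> I j = L j" "Q j \<inter> I j = Q j" for j using sub by (auto simp: Q_def)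
  note D = cxD(2)[OF C] and D' = cxD(2)[OF C, of "j - 1" for j]
  have DLM: "DL j \<in> Mat R (L (j - 1)) (L j)" for j
    unfolding DL_def using Mat_mres[OF D, of "L (j - 1)" "L j" j] by (simp add: int)
  have fM: "f j \<in> Mat R (L (j - 1)) (Q j)" for j
    unfolding f_def using Mat_mres[OF D, of "L (j - 1)" "Q j" j] by (simp add: int)
  have DQM: "DQ j \<in> Mat R (Q (j - 1)) (Q j)" for j
    unfolding DQ_def using Mat_mres[OF D, of "Q (j - 1)" "Q j" j] by (simp add: int)
  have QL: "mres R (Q (j - 1)) (L j) (D j) = mzero R" for j
    using tri by (auto simp: mres_def mzero_def Q_def fun_eq_iff)
  have z: "madd R (mm R (mres R A (L (j - 1)) (D (j - 1))) (mres R (L (j - 1)) Z (D j)))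
      (mm R (mres R A (Q (j - 1)) (D (j - 1))) (mres R (Q (j - 1)) Z (D j))) = mzero R" for j A Z
  proof -
    have "mzero R = mres R A Z (mm R (D (j - 1)) (D j))" using cxD(3)[OF C] by (simp add: mres_def mzero_def)
    also have "\<dots> = madd R (mm R (mres R A (L (j - 1)) (D (j - 1))) (mres R (L (j - 1)) Z (D j)))
      (mm R (mres R A (Q (j - 1)) (D (j - 1))) (mres R (Q (j - 1)) Z (D j)))"
      by (rule mm_mres[OF D D]) (auto simp: Q_def)
    finally show ?thesis by simp
  qed
  have cL: "cx R L DL" unfolding cx_def
  proof (intro allI conjI DLM)
    fix j
    show "finite (L j)" using cxD(1)[OF C] sub finite_subset by metis
    show "mm R (DL (j - 1)) (DL j) = mzero R"
      using z[of "L (j - 1 - 1)" j "L j"] madd_mzero(1)[OF Mat_mm[OF DLM DLM, of "j - 1" j]]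
      by (simp add: QL DL_def mm_mzero_right[OF fM[of "j - 1", unfolded f_def, simplified]])
  qed
  have cQ: "cx R Q DQ" unfolding cx_def
  proof (intro allI conjI DQM)
    fix j
    show "finite (Q j)" using cxD(1)[OF C] by (simp add: Q_def)
    show "mm R (DQ (j - 1)) (DQ j) = mzero R"
      using z[of "Q (j - 1 - 1)" j "Q j"] madd_mzero(2)[OF Mat_mm[OF DQM DQM, of "j - 1" j]]
      by (simp add: QL[of "j - 1", simplified] DQ_def mm_mzero_left[OF fM[of j, unfolded f_def, simplified]])
  qed
  show "cone R L DL f Q DQ"
    unfolding cone_def
  proof (intro conjI allI cL cQ fM)
    fix j
    show "L j \<inter> Q j = {}" by (auto simp: Q_def)
    show "mm R (f (j - 1)) (DQ j) = mneg R (mm R (DL (j - 1)) (f j))"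
      using z[of "L (j - 1 - 1)" j "Q j"]
        madd_eq_mzero[OF Mat_mm[OF DLM fM, of "j - 1" j] Mat_mm[OF fM DQM, of "j - 1" j]]
      by (simp add: f_def DQ_def DL_def)
  qed
  show "(\<lambda>j. L j \<union> Q j) = I" using sub by (auto simp: Q_def)
  show "cone_diff R DL f DQ = D"
  proof (intro ext)
    fix j a b
    have c: "D j a b \<in> carrier R" using MatD(1)[OF D] .
    show "cone_diff R DL f DQ j a b = D j a b"
      using c tri[of b j a] MatD(2)[OF D, of a j b] MatD(3)[OF D, of b j a] sub[of j] sub[of "j - 1"]
      by (cases "a \<in> L (j - 1)"; cases "b \<in> L j"; cases "a \<in> I (j - 1)"; cases "b \<in> I j")
         (auto simp: cone_diff_def madd_def DL_def f_def DQ_def mres_def Q_def)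
  qed
qed

text \<open>
  For \<open>Q\<close> the annihilation passes from \<open>L\<close> to \<open>Q\<close> along the connecting
  homomorphism, and \<open>Q\<close> is bounded below. For \<open>L\<close> the argument is run a second time in the dual
  complex, where \<open>L\<close> is the quotient and is bounded below: the transposed homotopy on \<open>Q\<close>
  annihilates the homology of the dual of \<open>Q\<close> in a range that covers all degrees in which the dual of
  \<open>L\<close> is nonzero.
\<close>

lemma cone_homotopies:
  assumes C: "cone R L DL f Q DQ"
    and ex: "\<And>j. kills R \<one> (\<lambda>j. L j \<union> Q j) (cone_diff R DL f DQ) j"
    and exd: "\<And>j. kills R \<one> (dual_index (\<lambda>j. L j \<union> Q j)) (dual_diff (cone_diff R DL f DQ)) j"
    and low: "\<And>j. j < b \<Longrightarrow> Q j = {}" and high: "\<And>j. j > s \<Longrightarrow> L j = {}"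
    and c: "c \<in> carrier R"
  shows "(\<And>j. j \<le> q \<Longrightarrow> kills R c L DL j) \<Longrightarrow> \<exists>h (e::nat). \<forall>j\<le>q + 1. htpy R (c [^] e) Q DQ h j"
    and "(\<And>j. kills R c L DL j) \<Longrightarrow> \<exists>h (e::nat). \<forall>j\<ge>q. htpy R (c [^] e) L DL h j"
proof -
  have Qh: "\<exists>h (e::nat). \<forall>j\<le>q + 1. htpy R (c [^] e) Q DQ h j" if "\<And>j. j \<le> q \<Longrightarrow> kills R c L DL j" for q
  proof (rule null_homotopy[OF coneD(2)[OF C] low c])
    fix j assume "j \<le> q + 1"
    then show "kills R c Q DQ j"
      using cone_kills_quotient[OF C c, of "j - 1"] that[of "j - 1"] ex[of j] by simp
  qed
  then show "(\<And>j. j \<le> q \<Longrightarrow> kills R c L DL j) \<Longrightarrow> \<exists>h (e::nat). \<forall>j\<le>q + 1. htpy R (c [^] e) Q DQ h j" .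
  assume "\<And>j. kills R c L DL j"
  then obtain h and e :: nat where h: "\<And>j. j \<le> s + 1 \<Longrightarrow> htpy R (c [^] e) Q DQ h j"
    using Qh[of s] by blast
  have ce: "c [^] e \<in> carrier R" using c by simp
  note cd = cone_dual[OF C]
  note cLd = coneD(2)[OF cd(1)]
  have uni: "(\<lambda>j. dual_index Q j \<union> dual_index L j) = dual_index (\<lambda>j. L j \<union> Q j)"
    by (auto simp: dual_index_def)
  have "kills R (c [^] e) (dual_index L) (dual_diff DL) k" for k
  proof (cases "k < - s")
    case True
    then have "dual_index L k = {}" using high[of "- k"] by (simp add: dual_index_def)
    then have z: "v = \<zero>\<^bsub>vspace (regular_module R)\<^esub>" if "v \<in> rvecs (dual_index L k)" for v
      using vecsD(2)[OF that] by auto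
    interpret W: module R "vspace (regular_module R)" by (rule reg.vec_module_module)
    show ?thesis unfolding kills_def
      using z W.smult_r_null[OF ce] reg.lin_zero reg.vecs_ops(1) by metis
  next
    case False
    have "htpy R (c [^] e) (dual_index Q) (dual_diff DQ) (\<lambda>k. tr (h (- k - 1))) (k - 1)"
      using htpy_dual[OF coneD(2)[OF C] h[of "1 - k"]] False by simp
    then have "kills R (c [^] e) (dual_index Q) (dual_diff DQ) (k - 1)"
      by (rule htpy_kills[OF coneD(1)[OF cd(1)] ce])
    then show ?thesis
      using cone_kills_quotient[OF cd(1) ce, of "k - 1"] exd[of k] by (simp add: cd(2) uni)
  qed
  then obtain h' and e' :: nat where h': "\<And>k. k \<le> - q \<Longrightarrow> htpy R ((c [^] e) [^] e') (dual_index L) (dual_diff DL) h' k"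
    using null_homotopy[OF cLd _ ce, of "- s" "- q"] high by (auto simp: dual_index_def)
  have "htpy R (c [^] (e * e')) L DL (\<lambda>k. tr (h' (- k - 1))) j" if "j \<ge> q" for j
    using htpy_dual[OF cLd h'[of "- j"]] that c by (simp add: nat_pow_pow)
  then show "\<exists>h (e::nat). \<forall>j\<ge>q. htpy R (c [^] e) L DL h j" by blast
qed

end

section \<open>Depth by Koszul cohomology\<close>

text \<open>
  The differential of the Koszul cochain complex. A subset of the sequence is encoded as a list of truth values of the
  same length, so that the recursion on the sequence exhibits the complex for \<open>x # xs\<close> as the cone of
  multiplication by \<open>x\<close> on the complex for \<open>xs\<close>. On lists of another length cochains vanish.
\<close>

fun koszul :: "('a, 'm) module \<Rightarrow> 'a list \<Rightarrow> (bool list \<Rightarrow> 'm) \<Rightarrow> bool list \<Rightarrow> 'm" where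
  "koszul N [] c l = \<zero>\<^bsub>N\<^esub>"
| "koszul N (x # xs) c [] = \<zero>\<^bsub>N\<^esub>"
| "koszul N (x # xs) c (False # l) = koszul N xs (\<lambda>m. c (False # m)) l"
| "koszul N (x # xs) c (True # l) = x \<odot>\<^bsub>N\<^esub> c (False # l) \<ominus>\<^bsub>N\<^esub> koszul N xs (\<lambda>m. c (True # m)) l"

definition cochain :: "('a, 'm) module \<Rightarrow> 'm set \<Rightarrow> nat \<Rightarrow> int \<Rightarrow> (bool list \<Rightarrow> 'm) set" where
  "cochain N V n q = {c. \<forall>l. c l \<in> V \<and> (length l \<noteq> n \<or> int (count_list l True) \<noteq> q \<longrightarrow> c l = \<zero>\<^bsub>N\<^esub>)}"

text \<open>
  For a submodule \<open>U\<close> of \<open>V\<close> this says that the Koszul cohomology of \<open>V / U\<close>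
  vanishes in degrees below \<open>k\<close>, which replaces the bound \<open>depth (V / U) \<ge> k\<close> for modules
  that need not be finitely generated. Reasoning modulo \<open>U\<close> keeps all cochains in one ambient module
  \<open>N\<close>.
\<close>

definition rdepth :: "('a, 'm) module \<Rightarrow> 'm set \<Rightarrow> 'm set \<Rightarrow> 'a list \<Rightarrow> int \<Rightarrow> bool" where
  "rdepth N V U xs k \<longleftrightarrow> (\<forall>q<k. \<forall>c\<in>cochain N V (length xs) q. (\<forall>l. koszul N xs c l \<in> U) \<longrightarrow>
     (\<exists>c'\<in>cochain N V (length xs) (q - 1). \<forall>l. c l \<ominus>\<^bsub>N\<^esub> koszul N xs c' l \<in> U))"

text \<open>
  Weak regularity on \<open>N / U\<close>, where the passage to the next element enlarges \<open>U\<close> instead of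
  forming a quotient.
\<close>

fun weakly_regular :: "('a, 'm) module \<Rightarrow> 'm set \<Rightarrow> 'a list \<Rightarrow> bool" where
  "weakly_regular N U [] = True"
| "weakly_regular N U (x # xs) = ((\<forall>b\<in>carrier N. x \<odot>\<^bsub>N\<^esub> b \<in> U \<longrightarrow> b \<in> U) \<and>
     weakly_regular N {u \<oplus>\<^bsub>N\<^esub> x \<odot>\<^bsub>N\<^esub> b |u b. u \<in> U \<and> b \<in> carrier N} xs)"

context rmodule
begin

lemma neg_zero [simp]: "\<ominus>\<^bsub>M\<^esub> \<zero>\<^bsub>M\<^esub> = \<zero>\<^bsub>M\<^esub>"
  using M.minus_equality[of "\<zero>\<^bsub>M\<^esub>" "\<zero>\<^bsub>M\<^esub>"] by simp

lemma submodD: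
  assumes "submodule U R M"
  shows "u \<in> U \<Longrightarrow> u \<in> carrier M" "\<zero>\<^bsub>M\<^esub> \<in> U" "u \<in> U \<Longrightarrow> v \<in> U \<Longrightarrow> u \<oplus>\<^bsub>M\<^esub> v \<in> U"
    "u \<in> U \<Longrightarrow> v \<in> U \<Longrightarrow> u \<ominus>\<^bsub>M\<^esub> v \<in> U" "u \<in> U \<Longrightarrow> \<ominus>\<^bsub>M\<^esub> u \<in> U" "a \<in> carrier R \<Longrightarrow> u \<in> U \<Longrightarrow> a \<odot>\<^bsub>M\<^esub> u \<in> U"
proof -
  note s = submoduleE[OF assms]
  show "u \<in> U \<Longrightarrow> u \<in> carrier M" "u \<in> U \<Longrightarrow> v \<in> U \<Longrightarrow> u \<oplus>\<^bsub>M\<^esub> v \<in> U"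
    "u \<in> U \<Longrightarrow> v \<in> U \<Longrightarrow> u \<ominus>\<^bsub>M\<^esub> v \<in> U" "u \<in> U \<Longrightarrow> \<ominus>\<^bsub>M\<^esub> u \<in> U" "a \<in> carrier R \<Longrightarrow> u \<in> U \<Longrightarrow> a \<odot>\<^bsub>M\<^esub> u \<in> U"
    using s unfolding a_minus_def by blast+
  obtain u where "u \<in> U" using s(2) by blast
  then show "\<zero>\<^bsub>M\<^esub> \<in> U" using s by (metis M.r_neg subsetD)
qed

lemma submodule_sum:
  assumes "submodule U R M" "submodule V R M"
  shows "submodule {u \<oplus>\<^bsub>M\<^esub> v |u v. u \<in> U \<and> v \<in> V} R M" (is "submodule ?S R M")
proof (rule submoduleI)
  note u = submodD[OF assms(1)] and v = submodD[OF assms(2)]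
  show "?S \<subseteq> carrier M" using u v by auto
  show "\<zero>\<^bsub>M\<^esub> \<in> ?S" using u(2) v(2) M.l_zero[OF M.zero_closed] by force
  show "a \<oplus>\<^bsub>M\<^esub> b \<in> ?S" if "a \<in> ?S" "b \<in> ?S" for a b
  proof -
    obtain p q p' q' where *: "p \<in> U" "q \<in> V" "a = p \<oplus>\<^bsub>M\<^esub> q" "p' \<in> U" "q' \<in> V" "b = p' \<oplus>\<^bsub>M\<^esub> q'" using \<open>a \<in> ?S\<close> \<open>b \<in> ?S\<close> by auto
    then have "a \<oplus>\<^bsub>M\<^esub> b = (p \<oplus>\<^bsub>M\<^esub> p') \<oplus>\<^bsub>M\<^esub> (q \<oplus>\<^bsub>M\<^esub> q')" using u(1) v(1) by (simp add: M.a_ac)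
    then show ?thesis using * u(3) v(3) by blast
  qed
  show "\<ominus>\<^bsub>M\<^esub> a \<in> ?S" if a: "a \<in> ?S" for a
  proof -
    obtain p q where *: "p \<in> U" "q \<in> V" "a = p \<oplus>\<^bsub>M\<^esub> q" using a by auto
    then have "\<ominus>\<^bsub>M\<^esub> a = \<ominus>\<^bsub>M\<^esub> p \<oplus>\<^bsub>M\<^esub> \<ominus>\<^bsub>M\<^esub> q" using u(1) v(1) by (simp add: M.minus_add)
    then show ?thesis using * u(5) v(5) by blast
  qed
  show "a \<odot>\<^bsub>M\<^esub> b \<in> ?S" if ab: "a \<in> carrier R" "b \<in> ?S" for a b
  proof -
    obtain p q where *: "p \<in> U" "q \<in> V" "b = p \<oplus>\<^bsub>M\<^esub> q" using ab(2) by auto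
    then have "a \<odot>\<^bsub>M\<^esub> b = a \<odot>\<^bsub>M\<^esub> p \<oplus>\<^bsub>M\<^esub> a \<odot>\<^bsub>M\<^esub> q" using u(1) v(1) ab(1) by (simp add: smult_r_distr)
    then show ?thesis using * u(6) v(6) ab(1) by blast
  qed
qed

lemma submodule_smult_image:
  assumes "x \<in> carrier R"
  shows "submodule {x \<odot>\<^bsub>M\<^esub> b |b. b \<in> carrier M} R M"
proof (rule submoduleI)
  show "\<zero>\<^bsub>M\<^esub> \<in> {x \<odot>\<^bsub>M\<^esub> b |b. b \<in> carrier M}" using assms M.zero_closed by force
  show "\<ominus>\<^bsub>M\<^esub> a \<in> {x \<odot>\<^bsub>M\<^esub> b |b. b \<in> carrier M}" if "a \<in> {x \<odot>\<^bsub>M\<^esub> b |b. b \<in> carrier M}" for a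
    using that assms by (auto simp: smult_r_minus[symmetric])
  show "a \<oplus>\<^bsub>M\<^esub> b \<in> {x \<odot>\<^bsub>M\<^esub> b |b. b \<in> carrier M}" if "a \<in> {x \<odot>\<^bsub>M\<^esub> b |b. b \<in> carrier M}" "b \<in> {x \<odot>\<^bsub>M\<^esub> b |b. b \<in> carrier M}" for a b
    using that assms by (auto simp: smult_r_distr[symmetric])
  show "a \<odot>\<^bsub>M\<^esub> b \<in> {x \<odot>\<^bsub>M\<^esub> b |b. b \<in> carrier M}" if a: "a \<in> carrier R" "b \<in> {x \<odot>\<^bsub>M\<^esub> b |b. b \<in> carrier M}" for a b
  proof -
    obtain z where z: "z \<in> carrier M" "b = x \<odot>\<^bsub>M\<^esub> z" using a by auto
    then have "a \<odot>\<^bsub>M\<^esub> b = x \<odot>\<^bsub>M\<^esub> (a \<odot>\<^bsub>M\<^esub> z)" using a assms by (simp add: smult_assoc1[symmetric] R.m_comm)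
    then show ?thesis using z a by auto
  qed
qed (use assms in auto)

lemma koszul_closed:
  assumes "submodule V R M" "set xs \<subseteq> carrier R" "\<And>l. c l \<in> V"
  shows "koszul M xs c l \<in> V"
  using assms(2,3)
proof (induction xs arbitrary: c l)
  case Nil
  then show ?case using submodD(2)[OF assms(1)] by simp
next
  case (Cons x xs)
  note s = submodD[OF assms(1)]
  have *: "koszul M xs (\<lambda>m. c (b # m)) m \<in> V" for b m
    by (rule Cons.IH) (use Cons.prems in auto)
  show ?case
  proof (cases l)
    case Nil then show ?thesis using s(2) by simp
  next
    case (Cons b m)
    then show ?thesis using * Cons.prems s by (cases b) auto
  qed
qed

lemma koszul_carrier:
  assumes "set xs \<subseteq> carrier R" "\<And>l. c l \<in> carrier M"
  shows "koszul M xs c l \<in> carrier M"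
  using koszul_closed[OF carrier_is_submodule assms] .

lemma koszul_zero:
  assumes "set xs \<subseteq> carrier R" "\<And>l. c l = \<zero>\<^bsub>M\<^esub>"
  shows "koszul M xs c l = \<zero>\<^bsub>M\<^esub>"
  using assms
proof (induction xs arbitrary: c l)
  case (Cons x xs)
  have *: "koszul M xs (\<lambda>m. c (b # m)) m = \<zero>\<^bsub>M\<^esub>" for b m
    by (rule Cons.IH) (use Cons.prems in auto)
  show ?case
  proof (cases l)
    case (Cons b m)
    then show ?thesis using * Cons.prems by (cases b) (auto simp: a_minus_def)
  qed simp
qed simp

lemma koszul_minus:
  assumes "set xs \<subseteq> carrier R" "\<And>l. c l \<in> carrier M" "\<And>l. c' l \<in> carrier M"
  shows "koszul M xs (\<lambda>l. c l \<ominus>\<^bsub>M\<^esub> c' l) l = koszul M xs c l \<ominus>\<^bsub>M\<^esub> koszul M xs c' l"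
  using assms
proof (induction xs arbitrary: c c' l)
  case Nil
  then show ?case by (simp add: a_minus_def)
next
  case (Cons x xs)
  have *: "koszul M xs (\<lambda>m. c (b # m) \<ominus>\<^bsub>M\<^esub> c' (b # m)) m
     = koszul M xs (\<lambda>m. c (b # m)) m \<ominus>\<^bsub>M\<^esub> koszul M xs (\<lambda>m. c' (b # m)) m" for b m
    by (rule Cons.IH) (use Cons.prems in auto)
  have cl: "koszul M xs (\<lambda>m. c (b # m)) m \<in> carrier M" "koszul M xs (\<lambda>m. c' (b # m)) m \<in> carrier M" for b m
    using Cons.prems by (auto intro!: koszul_carrier)
  show ?case
  proof (cases l)
    case Nil then show ?thesis by (simp add: a_minus_def)
  next
    case (Cons b m)
    then show ?thesis using * cl Cons.prems
      by (cases b) (auto simp: a_minus_def smult_r_distr smult_r_minus M.minus_add M.a_ac)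
  qed
qed

lemma koszul_smult:
  assumes "set xs \<subseteq> carrier R" "\<And>l. c l \<in> carrier M" "a \<in> carrier R"
  shows "koszul M xs (\<lambda>l. a \<odot>\<^bsub>M\<^esub> c l) l = a \<odot>\<^bsub>M\<^esub> koszul M xs c l"
  using assms
proof (induction xs arbitrary: c l)
  case (Cons x xs)
  have *: "koszul M xs (\<lambda>m. a \<odot>\<^bsub>M\<^esub> c (b # m)) m = a \<odot>\<^bsub>M\<^esub> koszul M xs (\<lambda>m. c (b # m)) m" for b m
    by (rule Cons.IH) (use Cons.prems in auto)
  have cl: "koszul M xs (\<lambda>m. c (b # m)) m \<in> carrier M" for b m
    using Cons.prems by (auto intro!: koszul_carrier)
  have sw: "x \<odot>\<^bsub>M\<^esub> (a \<odot>\<^bsub>M\<^esub> c k) = a \<odot>\<^bsub>M\<^esub> (x \<odot>\<^bsub>M\<^esub> c k)" for k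
    using Cons.prems by (simp add: smult_assoc1[symmetric] R.m_comm)
  show ?case
  proof (cases l)
    case (Cons b m)
    then show ?thesis using * cl Cons.prems
      by (cases b) (auto simp: a_minus_def smult_r_distr smult_r_minus sw)
  qed (use Cons.prems in simp)
qed simp

lemma koszul_koszul:
  assumes "set xs \<subseteq> carrier R" "\<And>l. c l \<in> carrier M"
  shows "koszul M xs (koszul M xs c) l = \<zero>\<^bsub>M\<^esub>"
  using assms
proof (induction xs arbitrary: c l)
  case (Cons x xs)
  have xs: "set xs \<subseteq> carrier R" and x: "x \<in> carrier R" using Cons.prems by auto
  have cl: "koszul M xs (\<lambda>m. c (b # m)) m \<in> carrier M" for b m
    using Cons.prems by (auto intro!: koszul_carrier)
  have *: "koszul M xs (koszul M xs (\<lambda>m. c (b # m))) m = \<zero>\<^bsub>M\<^esub>" for b m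
    by (rule Cons.IH) (use Cons.prems in auto)
  have eF: "(\<lambda>m. koszul M (x # xs) c (False # m)) = koszul M xs (\<lambda>m. c (False # m))" by auto
  show ?case
  proof (cases l)
    case (Cons b m)
    show ?thesis
    proof (cases b)
      case False
      then show ?thesis using * Cons by (simp add: eF)
    next
      case True
      have "koszul M xs (\<lambda>m. koszul M (x # xs) c (True # m)) m
          = koszul M xs (\<lambda>m. x \<odot>\<^bsub>M\<^esub> c (False # m)) m \<ominus>\<^bsub>M\<^esub> koszul M xs (koszul M xs (\<lambda>m. c (True # m))) m"
        unfolding koszul.simps by (rule koszul_minus[OF xs]) (use Cons.prems x cl in auto)
      also have "\<dots> = x \<odot>\<^bsub>M\<^esub> koszul M xs (\<lambda>m. c (False # m)) m"
        using koszul_smult[OF xs _ x, of "\<lambda>m. c (False # m)" m] Cons.prems(2) * x cl by (simp add: a_minus_def)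
      finally have "koszul M xs (\<lambda>m. koszul M (x # xs) c (True # m)) m = x \<odot>\<^bsub>M\<^esub> koszul M xs (\<lambda>m. c (False # m)) m" .
      then show ?thesis using Cons True x cl
        by (simp add: a_minus_def M.r_neg del: koszul.simps(4)) (simp add: a_minus_def M.r_neg)
    qed
  qed simp
qed simp

lemma koszul_hom:
  assumes V: "submodule V R M" and xs: "set xs \<subseteq> carrier R" and c: "\<And>l. c l \<in> V"
    and p: "\<And>v. v \<in> V \<Longrightarrow> \<phi> v \<in> carrier M" "\<And>v w. v \<in> V \<Longrightarrow> w \<in> V \<Longrightarrow> \<phi> (v \<oplus>\<^bsub>M\<^esub> w) = \<phi> v \<oplus>\<^bsub>M\<^esub> \<phi> w"
      "\<And>a v. a \<in> carrier R \<Longrightarrow> v \<in> V \<Longrightarrow> \<phi> (a \<odot>\<^bsub>M\<^esub> v) = a \<odot>\<^bsub>M\<^esub> \<phi> v"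
  shows "\<phi> (koszul M xs c l) = koszul M xs (\<lambda>l. \<phi> (c l)) l"
  using xs c
proof (induction xs arbitrary: c l)
  note s = submodD[OF V]
  have z: "\<phi> \<zero>\<^bsub>M\<^esub> = \<zero>\<^bsub>M\<^esub>" using p(3)[OF R.zero_closed s(2)] p(1)[OF s(2)] by simp
  {
    case Nil
    then show ?case using z by simp
  next
    case (Cons x xs)
    have n: "\<phi> (\<ominus>\<^bsub>M\<^esub> v) = \<ominus>\<^bsub>M\<^esub> \<phi> v" if "v \<in> V" for v
    proof -
      have "\<phi> v \<oplus>\<^bsub>M\<^esub> \<phi> (\<ominus>\<^bsub>M\<^esub> v) = \<zero>\<^bsub>M\<^esub>" using p(2)[OF that s(5)[OF that]] M.r_neg[OF s(1)[OF that]] z by simp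
      then show ?thesis using p(1)[OF that] p(1)[OF s(5)[OF that]] by (metis M.minus_equality M.a_comm)
    qed
    have cl: "koszul M xs (\<lambda>m. c (b # m)) m \<in> V" for b m
      using Cons.prems by (auto intro!: koszul_closed[OF V])
    have *: "\<phi> (koszul M xs (\<lambda>m. c (b # m)) m) = koszul M xs (\<lambda>m. \<phi> (c (b # m))) m" for b m
      by (rule Cons.IH) (use Cons.prems in auto)
    have x: "x \<in> carrier R" using Cons.prems by auto
    show ?case
    proof (cases l)
      case Nil then show ?thesis using z by simp
    next
      case (Cons b m)
      show ?thesis
      proof (cases b)
        case True
        have "\<phi> (x \<odot>\<^bsub>M\<^esub> c (False # m) \<oplus>\<^bsub>M\<^esub> \<ominus>\<^bsub>M\<^esub> koszul M xs (\<lambda>m. c (True # m)) m)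
            = x \<odot>\<^bsub>M\<^esub> \<phi> (c (False # m)) \<oplus>\<^bsub>M\<^esub> \<ominus>\<^bsub>M\<^esub> \<phi> (koszul M xs (\<lambda>m. c (True # m)) m)"
          using p(2)[OF s(6)[OF x] s(5)[OF cl]] p(3)[OF x] n[OF cl] Cons.prems(2) by simp
        then show ?thesis using Cons True * by (simp add: a_minus_def)
      qed (use Cons * in simp)
    qed
  }
qed

lemma koszul_degree:
  assumes "set xs \<subseteq> carrier R" "c \<in> cochain M V (length xs) q" "submodule V R M"
  shows "koszul M xs c \<in> cochain M V (length xs) (q + 1)"
proof -
  have "koszul M xs c l = \<zero>\<^bsub>M\<^esub>" if "length l \<noteq> length xs \<or> int (count_list l True) \<noteq> q + 1" for l
    using assms(1,2) that
  proof (induction xs arbitrary: c l q)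
    case (Cons x xs)
    have cz: "c l = \<zero>\<^bsub>M\<^esub>" if "length l \<noteq> Suc (length xs) \<or> int (count_list l True) \<noteq> q" for l
      using Cons.prems(2) that by (auto simp: cochain_def)
    have cV: "c l \<in> V" for l using Cons.prems(2) by (auto simp: cochain_def)
    show ?case
    proof (cases l)
      case (Cons b m)
      show ?thesis
      proof (cases b)
        case False
        have "(\<lambda>m. c (False # m)) \<in> cochain M V (length xs) q" using cz cV by (auto simp: cochain_def)
        then show ?thesis using Cons.IH[of "\<lambda>m. c (False # m)" q m] Cons.prems Cons False by auto
      next
        case True
        have 1: "(\<lambda>m. c (True # m)) \<in> cochain M V (length xs) (q - 1)" using cz cV by (auto simp: cochain_def)
        have 2: "c (False # m) = \<zero>\<^bsub>M\<^esub>" by (rule cz) (use Cons.prems(3) Cons True in auto)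
        have "koszul M xs (\<lambda>m. c (True # m)) m = \<zero>\<^bsub>M\<^esub>"
          by (rule Cons.IH[OF _ 1]) (use Cons.prems Cons True in auto)
        then show ?thesis using 2 Cons True Cons.prems(1) by (simp add: a_minus_def)
      qed
    qed simp
  qed simp
  then show ?thesis
    using koszul_closed[OF assms(3,1)] assms(2) by (auto simp: cochain_def)
qed

lemma koszul_low:
  assumes "set xs \<subseteq> carrier R" "c \<in> cochain M V (length xs) 0" "submodule V R M" "submodule U R M" 
  shows "(\<forall>l. koszul M xs c l \<in> U) \<longleftrightarrow> (\<forall>x\<in>set xs. x \<odot>\<^bsub>M\<^esub> c (replicate (length xs) False) \<in> U)"
  using assms(1,2)
proof (induction xs arbitrary: c)
  case Nil
  then show ?case using submodD(2)[OF assms(4)] by simp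
next
  case (Cons x xs)
  have cz: "c l = \<zero>\<^bsub>M\<^esub>" if "length l \<noteq> Suc (length xs) \<or> count_list l True \<noteq> 0" for l
    using Cons.prems(2) that by (auto simp: cochain_def)
  have cV: "c l \<in> carrier M" for l using Cons.prems(2) submodD(1)[OF assms(3)] by (auto simp: cochain_def)
  have 1: "(\<lambda>m. c (False # m)) \<in> cochain M V (length xs) 0"
    using Cons.prems(2) by (auto simp: cochain_def)
  have 2: "koszul M (x # xs) c (True # m) = x \<odot>\<^bsub>M\<^esub> c (False # m)" for m
    using koszul_zero[of xs "\<lambda>m. c (True # m)" m] Cons.prems(1) cz cV by (simp add: a_minus_def)
  have 3: "c (False # m) \<noteq> \<zero>\<^bsub>M\<^esub> \<Longrightarrow> m = replicate (length xs) False" for m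
    using cz[of "False # m"] by (auto simp: count_list_0_iff intro!: replicate_eqI)
  have "(\<forall>l. koszul M (x # xs) c l \<in> U) \<longleftrightarrow>
      (\<forall>m. x \<odot>\<^bsub>M\<^esub> c (False # m) \<in> U) \<and> (\<forall>m. koszul M xs (\<lambda>m. c (False # m)) m \<in> U)"
  proof (intro iffI conjI allI)
    fix l assume a: "(\<forall>m. x \<odot>\<^bsub>M\<^esub> c (False # m) \<in> U) \<and> (\<forall>m. koszul M xs (\<lambda>m. c (False # m)) m \<in> U)"
    show "koszul M (x # xs) c l \<in> U"
    proof (cases l)
      case (Cons b m)
      then show ?thesis using a 2 by (cases b) auto
    qed (use submodD(2)[OF assms(4)] in simp)
  next
    fix m assume a: "\<forall>l. koszul M (x # xs) c l \<in> U"
    show "x \<odot>\<^bsub>M\<^esub> c (False # m) \<in> U" using a 2 by metis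
    show "koszul M xs (\<lambda>m. c (False # m)) m \<in> U" using a koszul.simps(3) by metis
  qed
  also have "(\<forall>m. x \<odot>\<^bsub>M\<^esub> c (False # m) \<in> U) \<longleftrightarrow> x \<odot>\<^bsub>M\<^esub> c (False # replicate (length xs) False) \<in> U"
    using 3 submodD(2)[OF assms(4)] Cons.prems(1) by (metis list.set_intros(1) smult_r_null subsetD)
  also have "(\<forall>m. koszul M xs (\<lambda>m. c (False # m)) m \<in> U) \<longleftrightarrow>
     (\<forall>x\<in>set xs. x \<odot>\<^bsub>M\<^esub> c (False # replicate (length xs) False) \<in> U)"
    using Cons.IH[OF _ 1] Cons.prems(1) by simp
  finally show ?case by auto
qed

lemma cochain_neg: "c \<in> cochain M V n q \<Longrightarrow> q < 0 \<Longrightarrow> c l = \<zero>\<^bsub>M\<^esub>"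
  by (auto simp: cochain_def)

text \<open>
  Koszul cohomology in degree \<open>0\<close> consists of the elements annihilated by the sequence.
\<close>

lemma rdepth_1_iff:
  assumes xs: "set xs \<subseteq> carrier R" and V: "submodule V R M" and U: "submodule U R M"
  shows "rdepth M V U xs 1 \<longleftrightarrow> (\<forall>v\<in>V. (\<forall>x\<in>set xs. x \<odot>\<^bsub>M\<^esub> v \<in> U) \<longrightarrow> v \<in> U)"
proof
  assume d: "rdepth M V U xs 1"
  show "\<forall>v\<in>V. (\<forall>x\<in>set xs. x \<odot>\<^bsub>M\<^esub> v \<in> U) \<longrightarrow> v \<in> U"
  proof (intro ballI impI)
    fix v assume v: "v \<in> V" "\<forall>x\<in>set xs. x \<odot>\<^bsub>M\<^esub> v \<in> U"
    define c where "c = (\<lambda>l. if l = replicate (length xs) False then v else \<zero>\<^bsub>M\<^esub>)"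
    have "count_list (replicate n False) True = 0" for n by (induction n) auto
    then have c: "c \<in> cochain M V (length xs) 0" using v submodD(2)[OF V] by (auto simp: c_def cochain_def)
    have "\<forall>l. koszul M xs c l \<in> U" unfolding koszul_low[OF xs c V U] using v(2) by (simp add: c_def)
    then obtain c' where c': "c' \<in> cochain M V (length xs) (0 - 1)" "\<forall>l. c l \<ominus>\<^bsub>M\<^esub> koszul M xs c' l \<in> U"
      using d[unfolded rdepth_def, rule_format, OF zero_less_one c] by blast
    have "koszul M xs c' l = \<zero>\<^bsub>M\<^esub>" for l
      by (rule koszul_zero[OF xs cochain_neg[OF c'(1)]]) simp
    then show "v \<in> U" using c'(2)[rule_format, of "replicate (length xs) False"] submodD(1)[OF V v(1)]
      by (simp add: c_def a_minus_def)
  qed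
next
  assume a: "\<forall>v\<in>V. (\<forall>x\<in>set xs. x \<odot>\<^bsub>M\<^esub> v \<in> U) \<longrightarrow> v \<in> U"
  show "rdepth M V U xs 1"
    unfolding rdepth_def
  proof (intro allI impI ballI)
    fix q :: int and c assume q: "q < 1" and c: "c \<in> cochain M V (length xs) q" and k: "\<forall>l. koszul M xs c l \<in> U"
    have z: "(\<lambda>l. \<zero>\<^bsub>M\<^esub>) \<in> cochain M V (length xs) (q - 1)" using submodD(2)[OF V] by (simp add: cochain_def)
    have "c l \<in> U" for l
    proof (cases "q = 0")
      case True
      have "c (replicate (length xs) False) \<in> U"
        using a k koszul_low[OF xs _ V U, of c] c True by (auto simp: cochain_def)
      moreover have "c l = \<zero>\<^bsub>M\<^esub>" if "l \<noteq> replicate (length xs) False"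
      proof -
        have "length l \<noteq> length xs \<or> count_list l True \<noteq> 0"
          using that by (auto simp: count_list_0_iff intro!: replicate_eqI)
        then show ?thesis using c True by (auto simp: cochain_def)
      qed
      ultimately show ?thesis using submodD(2)[OF U] by metis
    next
      case False
      then show ?thesis using cochain_neg[OF c] q submodD(2)[OF U] by simp
    qed
    then show "\<exists>c'\<in>cochain M V (length xs) (q - 1). \<forall>l. c l \<ominus>\<^bsub>M\<^esub> koszul M xs c' l \<in> U"
      using koszul_zero[OF xs, of "\<lambda>l. \<zero>\<^bsub>M\<^esub>"] submodD(1)[OF U]
      by (intro bexI[OF _ z]) (simp add: a_minus_def)
  qed
qed

lemma rdepth_mono: "rdepth M V U xs k \<Longrightarrow> k' \<le> k \<Longrightarrow> rdepth M V U xs k'"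
  by (auto simp: rdepth_def)

text \<open>
  By induction on the sequence. A cocycle for \<open>x # xs\<close> is a pair of cochains for \<open>xs\<close>, according
  to the first truth value. The second component is a cocycle modulo \<open>U + x N\<close>, where the induction
  hypothesis applies, and regularity of \<open>x\<close> on \<open>N / U\<close> then handles the first component.
\<close>

lemma weakly_regular_rdepth:
  assumes "set xs \<subseteq> carrier R" "submodule U R M" "weakly_regular M U xs"
  shows "rdepth M (carrier M) U xs (int (length xs))"
  using assms
proof (induction xs arbitrary: U)
  case Nil
  show ?case unfolding rdepth_def
  proof (intro allI impI ballI)
    fix q :: int and c assume q: "q < int (length [])" and c: "c \<in> cochain M (carrier M) (length []) q"
    have "(\<lambda>l. \<zero>\<^bsub>M\<^esub>) \<in> cochain M (carrier M) (length []) (q - 1)" by (auto simp: cochain_def)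
    moreover have "c l = \<zero>\<^bsub>M\<^esub>" for l using cochain_neg[OF c] q by simp
    ultimately show "\<exists>c'\<in>cochain M (carrier M) (length []) (q - 1). \<forall>l. c l \<ominus>\<^bsub>M\<^esub> koszul M [] c' l \<in> U"
      using submodD(2)[OF Nil(2)] by (auto simp: a_minus_def)
  qed
next
  case (Cons x xs)
  have xs: "set xs \<subseteq> carrier R" and x: "x \<in> carrier R" using Cons.prems by auto
  note u = submodD[OF Cons.prems(2)]
  let ?U' = "{u \<oplus>\<^bsub>M\<^esub> x \<odot>\<^bsub>M\<^esub> b |u b. u \<in> U \<and> b \<in> carrier M}"
  have reg: "\<And>b. b \<in> carrier M \<Longrightarrow> x \<odot>\<^bsub>M\<^esub> b \<in> U \<Longrightarrow> b \<in> U" and wr: "weakly_regular M ?U' xs"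
    using Cons.prems(3) by auto
  have U': "submodule ?U' R M"
  proof -
    have "?U' = {u \<oplus>\<^bsub>M\<^esub> v |u v. u \<in> U \<and> v \<in> {x \<odot>\<^bsub>M\<^esub> b |b. b \<in> carrier M}}" by blast
    then show ?thesis using submodule_sum[OF Cons.prems(2) submodule_smult_image[OF x]] by simp
  qed
  note IH = Cons.IH[OF xs U' wr]
  show ?case unfolding rdepth_def
  proof (intro allI impI ballI)
    fix q :: int and c
    assume q: "q < int (length (x # xs))" and c: "c \<in> cochain M (carrier M) (length (x # xs)) q"
      and k: "\<forall>l. koszul M (x # xs) c l \<in> U"
    let ?cF = "\<lambda>m. c (False # m)" and ?cT = "\<lambda>m. c (True # m)"
    have cc: "c l \<in> carrier M" for l using c by (auto simp: cochain_def)
    have cF: "?cF \<in> cochain M (carrier M) (length xs) q" and cT: "?cT \<in> cochain M (carrier M) (length xs) (q - 1)"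
      using c by (auto simp: cochain_def)
    have kF: "koszul M xs ?cF m \<in> U" for m using k koszul.simps(3)[of M x xs c m] by metis
    have kT: "x \<odot>\<^bsub>M\<^esub> c (False # m) \<ominus>\<^bsub>M\<^esub> koszul M xs ?cT m \<in> U" for m
      using k koszul.simps(4)[of M x xs c m] by metis
    have kTc: "koszul M xs ?cT m \<in> carrier M" for m by (rule koszul_carrier[OF xs]) (rule cc)
    have "koszul M xs ?cT m \<in> ?U'" for m
    proof -
      have "koszul M xs ?cT m = \<ominus>\<^bsub>M\<^esub> (x \<odot>\<^bsub>M\<^esub> c (False # m) \<ominus>\<^bsub>M\<^esub> koszul M xs ?cT m) \<oplus>\<^bsub>M\<^esub> x \<odot>\<^bsub>M\<^esub> c (False # m)"
        using kTc x cc by (simp add: a_minus_def M.minus_add M.a_assoc M.r_neg1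
            M.a_comm[of "koszul M xs ?cT m" "x \<odot>\<^bsub>M\<^esub> c (False # m)"])
      then show ?thesis using u(5)[OF kT] cc by blast
    qed
    then obtain w where w: "w \<in> cochain M (carrier M) (length xs) (q - 1 - 1)"
      "\<And>m. c (True # m) \<ominus>\<^bsub>M\<^esub> koszul M xs w m \<in> ?U'"
      using IH[unfolded rdepth_def, rule_format, of "q - 1" ?cT] q cT by auto
    have wc: "w m \<in> carrier M" for m using w(1) by (auto simp: cochain_def)
    have kw: "koszul M xs w \<in> cochain M (carrier M) (length xs) (q - 1 - 1 + 1)"
      by (rule koszul_degree[OF xs w(1) carrier_is_submodule])
    have kwc: "koszul M xs w m \<in> carrier M" for m by (rule koszul_carrier[OF xs]) (rule wc)
    have "\<exists>b. b \<in> carrier M \<and> (c (True # m) \<ominus>\<^bsub>M\<^esub> koszul M xs w m) \<ominus>\<^bsub>M\<^esub> x \<odot>\<^bsub>M\<^esub> b \<in> U \<and>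
        (length m \<noteq> length xs \<or> int (count_list m True) \<noteq> q - 1 \<longrightarrow> b = \<zero>\<^bsub>M\<^esub>)" for m
    proof (cases "length m \<noteq> length xs \<or> int (count_list m True) \<noteq> q - 1")
      case True
      then have "c (True # m) = \<zero>\<^bsub>M\<^esub>" "koszul M xs w m = \<zero>\<^bsub>M\<^esub>" using cT kw by (auto simp: cochain_def)
      then show ?thesis using x u(2) by (intro exI[of _ "\<zero>\<^bsub>M\<^esub>"]) (simp add: a_minus_def)
    next
      case False
      obtain v b where vb: "v \<in> U" "b \<in> carrier M" "c (True # m) \<ominus>\<^bsub>M\<^esub> koszul M xs w m = v \<oplus>\<^bsub>M\<^esub> x \<odot>\<^bsub>M\<^esub> b"
        using w(2)[of m] by auto
      have "(v \<oplus>\<^bsub>M\<^esub> x \<odot>\<^bsub>M\<^esub> b) \<ominus>\<^bsub>M\<^esub> x \<odot>\<^bsub>M\<^esub> b = v"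
        using vb u(1) x by (simp add: a_minus_def M.a_assoc M.r_neg)
      then show ?thesis using vb False by auto
    qed
    then obtain w' where w': "\<And>m. w' m \<in> carrier M"
      "\<And>m. (c (True # m) \<ominus>\<^bsub>M\<^esub> koszul M xs w m) \<ominus>\<^bsub>M\<^esub> x \<odot>\<^bsub>M\<^esub> w' m \<in> U"
      "\<And>m. length m \<noteq> length xs \<or> int (count_list m True) \<noteq> q - 1 \<Longrightarrow> w' m = \<zero>\<^bsub>M\<^esub>"
      by metis
    have kw'c: "koszul M xs w' m \<in> carrier M" for m by (rule koszul_carrier[OF xs]) (rule w')
    have nF: "c (False # m) \<ominus>\<^bsub>M\<^esub> koszul M xs w' m \<in> U" for m
    proof (rule reg)
      have "koszul M xs (\<lambda>m. (c (True # m) \<ominus>\<^bsub>M\<^esub> koszul M xs w m) \<ominus>\<^bsub>M\<^esub> x \<odot>\<^bsub>M\<^esub> w' m) m \<in> U"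
        by (rule koszul_closed[OF Cons.prems(2) xs]) (rule w'(2))
      also have "koszul M xs (\<lambda>m. (c (True # m) \<ominus>\<^bsub>M\<^esub> koszul M xs w m) \<ominus>\<^bsub>M\<^esub> x \<odot>\<^bsub>M\<^esub> w' m) m
          = (koszul M xs ?cT m \<ominus>\<^bsub>M\<^esub> koszul M xs (koszul M xs w) m) \<ominus>\<^bsub>M\<^esub> x \<odot>\<^bsub>M\<^esub> koszul M xs w' m"
        using cc kwc w' x by (simp add: koszul_minus[OF xs] koszul_smult[OF xs])
      also have "\<dots> = koszul M xs ?cT m \<ominus>\<^bsub>M\<^esub> x \<odot>\<^bsub>M\<^esub> koszul M xs w' m"
        using koszul_koszul[OF xs wc] kTc by (simp add: a_minus_def)
      finally have 1: "koszul M xs ?cT m \<ominus>\<^bsub>M\<^esub> x \<odot>\<^bsub>M\<^esub> koszul M xs w' m \<in> U" .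
      have "x \<odot>\<^bsub>M\<^esub> (c (False # m) \<ominus>\<^bsub>M\<^esub> koszul M xs w' m)
          = (x \<odot>\<^bsub>M\<^esub> c (False # m) \<ominus>\<^bsub>M\<^esub> koszul M xs ?cT m) \<oplus>\<^bsub>M\<^esub> (koszul M xs ?cT m \<ominus>\<^bsub>M\<^esub> x \<odot>\<^bsub>M\<^esub> koszul M xs w' m)"
        using x cc kTc kw'c by (simp add: a_minus_def smult_r_distr smult_r_minus M.a_assoc M.r_neg2 M.r_neg1)
      then show "x \<odot>\<^bsub>M\<^esub> (c (False # m) \<ominus>\<^bsub>M\<^esub> koszul M xs w' m) \<in> U" using u(3)[OF kT 1] by simp
    qed (use cc kw'c in simp)
    define c' where "c' l = (case l of [] \<Rightarrow> \<zero>\<^bsub>M\<^esub> | b # m \<Rightarrow> if b then \<ominus>\<^bsub>M\<^esub> w m else w' m)" for l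
    have c': "c' \<in> cochain M (carrier M) (length (x # xs)) (q - 1)"
    proof -
      have "w m = \<zero>\<^bsub>M\<^esub>" if "length m \<noteq> length xs \<or> int (count_list m True) \<noteq> q - 1 - 1" for m
        using w(1) that by (auto simp: cochain_def)
      then show ?thesis using w'(1,3) wc by (auto simp: cochain_def c'_def split: list.splits)
    qed
    have "c l \<ominus>\<^bsub>M\<^esub> koszul M (x # xs) c' l \<in> U" for l
    proof (cases l)
      case Nil
      then show ?thesis using c u(2) by (simp add: cochain_def a_minus_def)
    next
      case (Cons b m)
      show ?thesis
      proof (cases b)
        case False
        then show ?thesis using nF Cons by (simp add: c'_def)
      next
        case True
        have "koszul M xs (\<lambda>m. \<ominus>\<^bsub>M\<^esub> w m) m = \<ominus>\<^bsub>M\<^esub> koszul M xs w m"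
          using koszul_minus[OF xs, of "\<lambda>m. \<zero>\<^bsub>M\<^esub>" w m] koszul_zero[OF xs, of "\<lambda>m. \<zero>\<^bsub>M\<^esub>" m] wc kwc by (simp add: a_minus_def)
        then have "c l \<ominus>\<^bsub>M\<^esub> koszul M (x # xs) c' l = (c (True # m) \<ominus>\<^bsub>M\<^esub> koszul M xs w m) \<ominus>\<^bsub>M\<^esub> x \<odot>\<^bsub>M\<^esub> w' m"
          using Cons True cc kwc w'(1) x by (simp add: c'_def a_minus_def M.minus_add M.a_ac)
        then show ?thesis using w'(2) by simp
      qed
    qed
    then show "\<exists>c'\<in>cochain M (carrier M) (length (x # xs)) (q - 1). \<forall>l. c l \<ominus>\<^bsub>M\<^esub> koszul M (x # xs) c' l \<in> U"
      using c' by blast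
  qed
qed

text \<open>
  The depth estimate for the cokernel in the short exact sequence
  \<open>0 \<rightarrow> V / \<phi>\<^sup>-\<^sup>1(U') \<rightarrow> V' / U' \<rightarrow> V' / (U' + \<phi>(V)) \<rightarrow> 0\<close>:
  the cohomology of the cokernel in degree \<open>q\<close> lies between that of the middle term in degree
  \<open>q\<close> and that of the first term in degree \<open>q + 1\<close>.
\<close>

lemma rdepth_step:
  assumes xs: "set xs \<subseteq> carrier R" and V: "submodule V R M" and V': "submodule V' R M" and U': "submodule U' R M"
    and p: "\<And>v. v \<in> V \<Longrightarrow> \<phi> v \<in> V'" "\<And>v w. v \<in> V \<Longrightarrow> w \<in> V \<Longrightarrow> \<phi> (v \<oplus>\<^bsub>M\<^esub> w) = \<phi> v \<oplus>\<^bsub>M\<^esub> \<phi> w"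
      "\<And>a v. a \<in> carrier R \<Longrightarrow> v \<in> V \<Longrightarrow> \<phi> (a \<odot>\<^bsub>M\<^esub> v) = a \<odot>\<^bsub>M\<^esub> \<phi> v"
    and d: "rdepth M V {v \<in> V. \<phi> v \<in> U'} xs k" and d': "rdepth M V' U' xs (k - 1)"
  shows "rdepth M V' {u \<oplus>\<^bsub>M\<^esub> \<phi> v |u v. u \<in> U' \<and> v \<in> V} xs (k - 1)"
  unfolding rdepth_def
proof (intro allI impI ballI)
  let ?S = "{u \<oplus>\<^bsub>M\<^esub> \<phi> v |u v. u \<in> U' \<and> v \<in> V}"
  let ?n = "length xs"
  note u = submodD[OF U'] and v = submodD[OF V] and v' = submodD[OF V']
  have z: "\<phi> \<zero>\<^bsub>M\<^esub> = \<zero>\<^bsub>M\<^esub>" using p(3)[OF R.zero_closed v(2)] v'(1)[OF p(1)[OF v(2)]] v(2) by simp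
  have pc: "\<phi> a \<in> carrier M" if "a \<in> V" for a using v'(1)[OF p(1)[OF that]] .
  have neg: "\<phi> (\<ominus>\<^bsub>M\<^esub> a) = \<ominus>\<^bsub>M\<^esub> \<phi> a" if "a \<in> V" for a
  proof -
    have "\<phi> (\<ominus>\<^bsub>M\<^esub> a) \<oplus>\<^bsub>M\<^esub> \<phi> a = \<zero>\<^bsub>M\<^esub>"
      using p(2)[OF v(5)[OF that] that] M.l_neg[OF v(1)[OF that]] z by simp
    then show ?thesis using M.minus_equality[OF _ pc[OF that] pc[OF v(5)[OF that]]] by simp
  qed
  have minus: "\<phi> (a \<ominus>\<^bsub>M\<^esub> b) = \<phi> a \<ominus>\<^bsub>M\<^esub> \<phi> b" if "a \<in> V" "b \<in> V" for a b
    using that v(5) by (simp add: a_minus_def p(2) neg)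
  fix q :: int and c
  assume q: "q < k - 1" and c: "c \<in> cochain M V' ?n q" and kc: "\<forall>l. koszul M xs c l \<in> ?S"
  have cV: "c l \<in> V'" for l using c by (auto simp: cochain_def)
  have cc: "c l \<in> carrier M" for l using v'(1)[OF cV] .
  have kcc: "koszul M xs c l \<in> carrier M" for l by (rule koszul_carrier[OF xs cc])
  have kdeg: "koszul M xs c \<in> cochain M V' ?n (q + 1)" by (rule koszul_degree[OF xs c V'])
  have "\<exists>a. a \<in> V \<and> koszul M xs c l \<ominus>\<^bsub>M\<^esub> \<phi> a \<in> U' \<and>
      (length l \<noteq> ?n \<or> int (count_list l True) \<noteq> q + 1 \<longrightarrow> a = \<zero>\<^bsub>M\<^esub>)" for l
  proof (cases "length l \<noteq> ?n \<or> int (count_list l True) \<noteq> q + 1")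
    case True
    then have "koszul M xs c l = \<zero>\<^bsub>M\<^esub>" using kdeg by (auto simp: cochain_def)
    then show ?thesis using z v(2) u(2) by (intro exI[of _ "\<zero>\<^bsub>M\<^esub>"]) (simp add: a_minus_def)
  next
    case False
    obtain r a where ra: "r \<in> U'" "a \<in> V" "koszul M xs c l = r \<oplus>\<^bsub>M\<^esub> \<phi> a" using kc by blast
    then have "koszul M xs c l \<ominus>\<^bsub>M\<^esub> \<phi> a = r" using pc u(1) by (simp add: a_minus_def M.a_assoc M.r_neg)
    then show ?thesis using ra False by auto
  qed
  \<comment> \<open>The chase of the connecting homomorphism: \<open>c1\<close> represents the image of the class of \<open>c\<close>.
    Modulo \<open>\<phi>\<^sup>-\<^sup>1(U')\<close> it is the coboundary of \<open>c2\<close>, and subtracting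
    \<open>\<phi>(c2)\<close> from \<open>c\<close> leaves a cocycle modulo \<open>U'\<close>.\<close>
  then obtain c1 where c1: "\<And>l. c1 l \<in> V" "\<And>l. koszul M xs c l \<ominus>\<^bsub>M\<^esub> \<phi> (c1 l) \<in> U'"
    "\<And>l. length l \<noteq> ?n \<or> int (count_list l True) \<noteq> q + 1 \<Longrightarrow> c1 l = \<zero>\<^bsub>M\<^esub>" by metis
  have c1d: "c1 \<in> cochain M V ?n (q + 1)" using c1(1,3) by (auto simp: cochain_def)
  have "koszul M xs c1 l \<in> {v \<in> V. \<phi> v \<in> U'}" for l
  proof -
    have kV: "koszul M xs c1 l \<in> V" by (rule koszul_closed[OF V xs c1(1)])
    have "koszul M xs (\<lambda>l. koszul M xs c l \<ominus>\<^bsub>M\<^esub> \<phi> (c1 l)) l \<in> U'" by (rule koszul_closed[OF U' xs c1(2)])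
    also have "koszul M xs (\<lambda>l. koszul M xs c l \<ominus>\<^bsub>M\<^esub> \<phi> (c1 l)) l = koszul M xs (koszul M xs c) l \<ominus>\<^bsub>M\<^esub> koszul M xs (\<lambda>l. \<phi> (c1 l)) l"
      by (rule koszul_minus[OF xs kcc pc[OF c1(1)]])
    also have "\<dots> = \<ominus>\<^bsub>M\<^esub> \<phi> (koszul M xs c1 l)"
      using koszul_koszul[OF xs cc] koszul_hom[OF V xs, of c1 \<phi> l, OF c1(1) pc p(2,3)] pc[OF kV] by (simp add: a_minus_def)
    finally have "\<phi> (koszul M xs c1 l) \<in> U'" using u(5) pc[OF kV] by fastforce
    then show ?thesis using kV by simp
  qed
  then obtain c2 where c2: "c2 \<in> cochain M V ?n (q + 1 - 1)" "\<And>l. c1 l \<ominus>\<^bsub>M\<^esub> koszul M xs c2 l \<in> {v \<in> V. \<phi> v \<in> U'}"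
    using d[unfolded rdepth_def, rule_format, of "q + 1" c1] c1d q by auto
  have c2V: "c2 l \<in> V" for l using c2(1) by (auto simp: cochain_def)
  have kc2V: "koszul M xs c2 l \<in> V" for l by (rule koszul_closed[OF V xs c2V])
  define c3 where "c3 l = c l \<ominus>\<^bsub>M\<^esub> \<phi> (c2 l)" for l
  have c3: "c3 \<in> cochain M V' ?n q"
    using c c2(1) v'(4)[OF cV p(1)[OF c2V]] z by (auto simp: cochain_def c3_def a_minus_def)
  have "koszul M xs c3 l \<in> U'" for l
  proof -
    have "koszul M xs c3 l = koszul M xs c l \<ominus>\<^bsub>M\<^esub> \<phi> (koszul M xs c2 l)"
      unfolding c3_def using koszul_minus[OF xs cc pc[OF c2V]] koszul_hom[OF V xs, of c2 \<phi> l, OF c2V pc p(2,3)] by simp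
    also have "\<dots> = (koszul M xs c l \<ominus>\<^bsub>M\<^esub> \<phi> (c1 l)) \<oplus>\<^bsub>M\<^esub> \<phi> (c1 l \<ominus>\<^bsub>M\<^esub> koszul M xs c2 l)"
      unfolding minus[OF c1(1) kc2V]
      using kcc pc[OF c1(1)] pc[OF kc2V] by (simp add: a_minus_def M.a_assoc M.r_neg1)
    finally show ?thesis using u(3) c1(2) c2(2) by simp
  qed
  then obtain c4 where c4: "c4 \<in> cochain M V' ?n (q - 1)" "\<And>l. c3 l \<ominus>\<^bsub>M\<^esub> koszul M xs c4 l \<in> U'"
    using d'[unfolded rdepth_def, rule_format, OF q c3] by auto
  have "c l \<ominus>\<^bsub>M\<^esub> koszul M xs c4 l \<in> ?S" for l
  proof -
    have k4: "koszul M xs c4 l \<in> carrier M"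
      by (rule koszul_carrier[OF xs]) (use c4(1) v'(1) in \<open>auto simp: cochain_def\<close>)
    have "c l \<ominus>\<^bsub>M\<^esub> koszul M xs c4 l = (c3 l \<ominus>\<^bsub>M\<^esub> koszul M xs c4 l) \<oplus>\<^bsub>M\<^esub> \<phi> (c2 l)"
      using cc pc[OF c2V] k4 by (simp add: c3_def a_minus_def M.a_ac M.r_neg2 M.r_neg1 M.l_neg)
    then show ?thesis using c4(2) c2V by blast
  qed
  then show "\<exists>c'\<in>cochain M V' ?n (q - 1). \<forall>l. c l \<ominus>\<^bsub>M\<^esub> koszul M xs c' l \<in> ?S" using c4(1) by blast
qed

lemma koszul_coord:
  assumes "set xs \<subseteq> carrier R" "\<And>l. c l \<in> vecs M UNIV"
  shows "koszul (vspace M) xs c l i = koszul M xs (\<lambda>l. c l i) l"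
  using assms
proof (induction xs arbitrary: c l)
  case (Cons x xs)
  interpret W: module R "vspace M" by (rule vec_module_module)
  interpret W: rmodule R "vspace M" by unfold_locales
  have *: "koszul (vspace M) xs (\<lambda>m. c (b # m)) m i = koszul M xs (\<lambda>m. c (b # m) i) m" for b m
    by (rule Cons.IH) (use Cons.prems in auto)
  have cl: "koszul (vspace M) xs (\<lambda>m. c (b # m)) m \<in> vecs M UNIV" for b m
    using Cons.prems by (auto intro!: W.koszul_carrier)
  show ?case
  proof (cases l)
    case (Cons b m)
    show ?thesis
    proof (cases b)
      case True
      have "x \<odot>\<^bsub>vspace M\<^esub> c (False # m) \<in> vecs M UNIV" using Cons.prems by auto
      then show ?thesis using Cons True * vec_minus[OF _ cl] by simp
    qed (use Cons * in simp)
  qed simp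
qed simp

text \<open>
  Koszul cohomology of a direct sum is computed coordinate by coordinate.
\<close>

lemma rdepth_vecs:
  assumes xs: "set xs \<subseteq> carrier R" and S: "finite S" and d: "rdepth M (carrier M) {\<zero>\<^bsub>M\<^esub>} xs k"
  shows "rdepth (vspace M) (vecs M S) {\<zero>\<^bsub>vspace M\<^esub>} xs k"
  unfolding rdepth_def
proof (intro allI impI ballI)
  interpret W: module R "vspace M" by (rule vec_module_module)
  interpret W: rmodule R "vspace M" by unfold_locales
  let ?W = "vspace M" and ?n = "length xs"
  fix q :: int and c assume q: "q < k" and c: "c \<in> cochain ?W (vecs M S) ?n q"
    and kc: "\<forall>l. koszul ?W xs c l \<in> {\<zero>\<^bsub>?W\<^esub>}"
  have cV: "c l \<in> vecs M S" for l using c by (auto simp: cochain_def)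
  have cU: "c l \<in> vecs M UNIV" for l using vecs_UNIV[OF cV] .
  have "\<exists>b\<in>cochain M (carrier M) ?n (q - 1). \<forall>l. c l i \<ominus>\<^bsub>M\<^esub> koszul M xs b l \<in> {\<zero>\<^bsub>M\<^esub>}" for i
  proof (rule d[unfolded rdepth_def, rule_format, OF q])
    show "(\<lambda>l. c l i) \<in> cochain M (carrier M) ?n q"
      using c vecsD(1)[OF cV] by (auto simp: cochain_def)
    show "koszul M xs (\<lambda>l. c l i) l \<in> {\<zero>\<^bsub>M\<^esub>}" for l
      using kc koszul_coord[OF xs, of c l i, OF cU] by simp
  qed
  then obtain b where b: "\<And>i. b i \<in> cochain M (carrier M) ?n (q - 1)"
    "\<And>i l. c l i \<ominus>\<^bsub>M\<^esub> koszul M xs (b i) l = \<zero>\<^bsub>M\<^esub>" by (metis singletonD)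
  define c' where "c' l = (\<lambda>i. if i \<in> S then b i l else \<zero>\<^bsub>M\<^esub>)" for l
  have bc: "b i l \<in> carrier M" for i l using b(1) by (auto simp: cochain_def)
  have c'V: "c' l \<in> vecs M S" for l by (rule vecsI_fin) (use bc S in \<open>auto simp: c'_def\<close>)
  have c': "c' \<in> cochain ?W (vecs M S) ?n (q - 1)"
  proof -
    have "c' l = \<zero>\<^bsub>?W\<^esub>" if "length l \<noteq> ?n \<or> int (count_list l True) \<noteq> q - 1" for l
      by (rule ext) (use that b(1) in \<open>auto simp: c'_def cochain_def\<close>)
    then show ?thesis using c'V by (auto simp: cochain_def)
  qed
  have "c l \<ominus>\<^bsub>?W\<^esub> koszul ?W xs c' l = \<zero>\<^bsub>?W\<^esub>" for l
  proof (rule ext)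
    fix i
    have kU: "koszul ?W xs c' l \<in> vecs M UNIV" by (rule W.koszul_carrier[OF xs vecs_UNIV[OF c'V]])
    have "(c l \<ominus>\<^bsub>?W\<^esub> koszul ?W xs c' l) i = c l i \<ominus>\<^bsub>M\<^esub> koszul M xs (\<lambda>l. c' l i) l"
      unfolding vec_minus[OF cU kU] koszul_coord[OF xs vecs_UNIV[OF c'V]] ..
    also have "\<dots> = \<zero>\<^bsub>M\<^esub>"
    proof (cases "i \<in> S")
      case True
      then have "(\<lambda>l. c' l i) = b i" by (auto simp: c'_def)
      then show ?thesis using b(2) by simp
    next
      case False
      then have "koszul M xs (\<lambda>l. c' l i) l = \<zero>\<^bsub>M\<^esub>" by (intro koszul_zero[OF xs]) (simp add: c'_def)
      then show ?thesis using vecsD(2)[OF cV False] by (simp add: a_minus_def)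
    qed
    finally show "(c l \<ominus>\<^bsub>?W\<^esub> koszul ?W xs c' l) i = \<zero>\<^bsub>?W\<^esub> i" by simp
  qed
  then show "\<exists>c'\<in>cochain ?W (vecs M S) ?n (q - 1). \<forall>l. c l \<ominus>\<^bsub>?W\<^esub> koszul ?W xs c' l \<in> {\<zero>\<^bsub>?W\<^esub>}"
    using c' by blast
qed

text \<open>
  The element \<open>z\<close> is multiplied, for one member of \<open>ys\<close> after the other, by the largest power
  that keeps it outside \<open>U\<close>.
\<close>

lemma torsion_descent:
  assumes U: "submodule U R M" and "set ys \<subseteq> carrier R" "z \<in> carrier M" "z \<notin> U"
    and "\<And>y. y \<in> set ys \<Longrightarrow> \<exists>n::nat. (y [^] n) \<odot>\<^bsub>M\<^esub> z \<in> U"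
  shows "\<exists>r\<in>carrier R. r \<odot>\<^bsub>M\<^esub> z \<notin> U \<and> (\<forall>y\<in>set ys. y \<odot>\<^bsub>M\<^esub> (r \<odot>\<^bsub>M\<^esub> z) \<in> U)"
  using assms(2-5)
proof (induction ys arbitrary: z)
  case Nil
  then show ?case by (intro bexI[of _ \<one>]) auto
next
  case (Cons y ys)
  have y: "y \<in> carrier R" using Cons.prems by auto
  note u = submodD[OF U]
  define n where "n = (LEAST n::nat. (y [^] n) \<odot>\<^bsub>M\<^esub> z \<in> U)"
  have n: "(y [^] n) \<odot>\<^bsub>M\<^esub> z \<in> U" unfolding n_def by (rule LeastI_ex) (use Cons.prems(4) in auto)
  have "n \<noteq> 0" using n Cons.prems(2,3) by (metis R.nat_pow_0 smult_one)
  then obtain k where k: "n = Suc k" by (cases n) auto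
  have yk: "y [^] k \<in> carrier R" using y by simp
  define z1 where "z1 = (y [^] k) \<odot>\<^bsub>M\<^esub> z"
  have z1: "z1 \<in> carrier M" using yk Cons.prems by (simp add: z1_def)
  have z1U: "z1 \<notin> U" using not_less_Least[of k "\<lambda>n. (y [^] n) \<odot>\<^bsub>M\<^esub> z \<in> U"] k n_def by (simp add: z1_def)
  have yz1: "y \<odot>\<^bsub>M\<^esub> z1 \<in> U"
    using n yk y Cons.prems(2) by (simp add: z1_def smult_assoc1[symmetric] k R.m_comm)
  have "\<exists>n::nat. (y' [^] n) \<odot>\<^bsub>M\<^esub> z1 \<in> U" if y': "y' \<in> set ys" for y'
  proof -
    obtain n' :: nat where n': "(y' [^] n') \<odot>\<^bsub>M\<^esub> z \<in> U" using Cons.prems(4)[of y'] y' by auto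
    have y'c: "y' \<in> carrier R" using y' Cons.prems(1) by auto
    have "(y' [^] n') \<odot>\<^bsub>M\<^esub> z1 = (y [^] k) \<odot>\<^bsub>M\<^esub> ((y' [^] n') \<odot>\<^bsub>M\<^esub> z)"
      using y'c yk Cons.prems(2) by (simp add: z1_def smult_assoc1[symmetric] R.m_comm)
    then show ?thesis using u(6)[OF yk n'] by (intro exI[of _ n']) simp
  qed
  then obtain r where r: "r \<in> carrier R" "r \<odot>\<^bsub>M\<^esub> z1 \<notin> U" "\<forall>y\<in>set ys. y \<odot>\<^bsub>M\<^esub> (r \<odot>\<^bsub>M\<^esub> z1) \<in> U"
    using Cons.IH[OF _ z1 z1U] Cons.prems(1) by auto
  have e: "(r \<otimes> y [^] k) \<odot>\<^bsub>M\<^esub> z = r \<odot>\<^bsub>M\<^esub> z1" using r yk Cons.prems(2) by (simp add: z1_def smult_assoc1)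
  have "y \<odot>\<^bsub>M\<^esub> (r \<odot>\<^bsub>M\<^esub> z1) = r \<odot>\<^bsub>M\<^esub> (y \<odot>\<^bsub>M\<^esub> z1)"
    using r y z1 by (simp add: smult_assoc1[symmetric] R.m_comm)
  then have "y \<odot>\<^bsub>M\<^esub> (r \<odot>\<^bsub>M\<^esub> z1) \<in> U" using u(6)[OF r(1) yz1] by simp
  then show ?case using r yk e by (intro bexI[of _ "r \<otimes> y [^] k"]) auto
qed

text \<open>
  A torsion element outside \<open>U\<close> has a multiple outside \<open>U\<close> that the sequence annihilates modulo
  \<open>U\<close>.
\<close>

lemma rdepth_torsion_free:
  assumes xs: "set xs \<subseteq> carrier R" and V: "submodule V R M" and U: "submodule U R M"
    and d: "rdepth M V U xs k" "k \<ge> 1" and z: "z \<in> V"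
    and t: "\<And>x. x \<in> set xs \<Longrightarrow> \<exists>n::nat. (x [^] n) \<odot>\<^bsub>M\<^esub> z \<in> U"
  shows "z \<in> U"
proof (rule ccontr)
  assume "z \<notin> U"
  then obtain r where r: "r \<in> carrier R" "r \<odot>\<^bsub>M\<^esub> z \<notin> U" "\<forall>x\<in>set xs. x \<odot>\<^bsub>M\<^esub> (r \<odot>\<^bsub>M\<^esub> z) \<in> U"
    using torsion_descent[OF U xs, of z] t submodD(1)[OF V z] by auto
  then show False
    using rdepth_1_iff[OF xs V U] rdepth_mono[OF d] submodD(6)[OF V r(1) z] by blast
qed

lemma lin_image_submodule:
  assumes A: "A \<in> Mat R U Y"
  shows "submodule (lin M A ` vecs M S) R (vspace M)"
proof -
  interpret W: module R "vspace M" by (rule vec_module_module)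
  show ?thesis
  proof (rule W.submoduleI)
    show "lin M A ` vecs M S \<subseteq> vecs M UNIV" using vecs_UNIV[OF lin_closed[OF _ A]] by auto
    show "\<zero>\<^bsub>vspace M\<^esub> \<in> lin M A ` vecs M S" using lin_zero vecs_ops(1) by (metis image_eqI)
    show "\<ominus>\<^bsub>vspace M\<^esub> a \<in> lin M A ` vecs M S" if a: "a \<in> lin M A ` vecs M S" for a
    proof -
      obtain v where v: "v \<in> vecs M S" "a = lin M A v" using a by auto
      then show ?thesis using lin_neg[OF vecs_UNIV[OF v(1)] A] vecs_ops(4)[OF v(1)] by (metis image_eqI)
    qed
    show "a \<oplus>\<^bsub>vspace M\<^esub> b \<in> lin M A ` vecs M S" if a: "a \<in> lin M A ` vecs M S" "b \<in> lin M A ` vecs M S" for a b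
    proof -
      obtain v w where v: "v \<in> vecs M S" "a = lin M A v" "w \<in> vecs M S" "b = lin M A w" using a by auto
      then show ?thesis using lin_add[OF vecs_UNIV[OF v(1)] vecs_UNIV[OF v(3)] A] vecs_ops(2)[OF v(1,3)] by (metis image_eqI)
    qed
    show "c \<odot>\<^bsub>vspace M\<^esub> a \<in> lin M A ` vecs M S" if a: "c \<in> carrier R" "a \<in> lin M A ` vecs M S" for c a
    proof -
      obtain v where v: "v \<in> vecs M S" "a = lin M A v" using a by auto
      then show ?thesis using lin_smult[OF a(1) vecs_UNIV[OF v(1)] A] vecs_ops(5)[OF a(1) v(1)] by (metis image_eqI)
    qed
  qed
qed

section \<open>An acyclicity lemma\<close>

text \<open>
  Descending induction on \<open>i\<close>, from the degree \<open>s + 1\<close> in which the complex is zero. The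
  cokernel in degree \<open>i\<close> has positive depth, so its torsion submodule is zero; as the homotopies make the
  homology torsion, the complex \<open>M \<otimes> L\<close> is exact in degree \<open>i\<close> and the cokernel embeds
  in \<open>M \<otimes> L\<^sub>i\<^sub>-\<^sub>1\<close>, which has depth at least \<open>n\<close>. The cokernel of this
  embedding loses at most one from the depth.
\<close>

lemma acyclicity_tail:
  assumes C: "cx R L DL" and xs: "set xs \<subseteq> carrier R"
    and d: "rdepth M (carrier M) {\<zero>\<^bsub>M\<^esub>} xs n" and high: "\<And>j. j > s \<Longrightarrow> L j = {}"
    and h: "\<And>x. x \<in> set xs \<Longrightarrow> \<exists>h (e::nat). \<forall>j>i. htpy R (x [^] e) L DL h j"
    and i: "i \<le> s + 1" "n > s - i"
  shows "rdepth (vspace M) (vecs M (L i)) (lin M (DL (i + 1)) ` vecs M (L (i + 1))) xs (n - (s - i))"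
  using i(1) h i(2)
proof (induction i rule: int_le_induct)
  interpret W: module R "vspace M" by (rule vec_module_module)
  interpret W: rmodule R "vspace M" by unfold_locales
  let ?W = "vspace M"
  note im = lin_image_submodule[OF cxD(2)[OF C]]
  {
    case base
    have "L (s + 1) = {}" using high by simp
    then have z: "v = \<zero>\<^bsub>?W\<^esub>" if "v \<in> vecs M (L (s + 1))" for v using vecsD(2)[OF that] by auto
    show ?case unfolding rdepth_def
    proof (intro allI impI ballI)
      fix q :: int and c assume c: "c \<in> cochain ?W (vecs M (L (s + 1))) (length xs) q"
      have c0: "c l = \<zero>\<^bsub>?W\<^esub>" for l by (rule z) (use c in \<open>auto simp: cochain_def\<close>)
      have "(\<lambda>l. \<zero>\<^bsub>?W\<^esub>) \<in> cochain ?W (vecs M (L (s + 1))) (length xs) (q - 1)"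
        using vecs_ops(1) by (auto simp: cochain_def)
      moreover have "c l \<ominus>\<^bsub>?W\<^esub> koszul ?W xs (\<lambda>l. \<zero>\<^bsub>?W\<^esub>) l \<in> lin M (DL (s + 1 + 1)) ` vecs M (L (s + 1 + 1))" for l
      proof -
        have "koszul ?W xs (\<lambda>l. \<zero>\<^bsub>?W\<^esub>) l = \<zero>\<^bsub>?W\<^esub>" by (rule W.koszul_zero[OF xs]) (rule refl)
        then have "c l \<ominus>\<^bsub>?W\<^esub> koszul ?W xs (\<lambda>l. \<zero>\<^bsub>?W\<^esub>) l = \<zero>\<^bsub>?W\<^esub>"
          unfolding a_minus_def c0 using W.neg_zero lin_zero_sum vecs_ops(1) by metis
        then show ?thesis using W.submodD(2)[OF im] by metis
      qed
      ultimately show "\<exists>c'\<in>cochain ?W (vecs M (L (s + 1))) (length xs) (q - 1).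
            \<forall>l. c l \<ominus>\<^bsub>?W\<^esub> koszul ?W xs c' l \<in> lin M (DL (s + 1 + 1)) ` vecs M (L (s + 1 + 1))"
        by blast
    qed
  next
    case (step i)
    \<comment> \<open>Here \<open>i - 1\<close> is the degree to be treated.\<close>
    let ?V = "vecs M (L i)" and ?U = "lin M (DL (i + 1)) ` vecs M (L (i + 1))" and ?V' = "vecs M (L (i - 1))"
    have n: "n - (s - i) \<ge> 1" "n > s - i" using step by auto
    have dV: "rdepth ?W ?V ?U xs (n - (s - i))"
    proof (rule step.IH)
      fix x assume "x \<in> set xs"
      then obtain h and e :: nat where h: "\<forall>j>i - 1. htpy R (x [^] e) L DL h j" using step.prems(1) by blast
      then show "\<exists>h (e::nat). \<forall>j>i. htpy R (x [^] e) L DL h j" by (intro exI[of _ h] exI[of _ e]) auto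
    qed (rule n(2))
    have Z: "{v \<in> ?V. lin M (DL i) v \<in> {\<zero>\<^bsub>?W\<^esub>}} = ?U"
    proof (intro equalityI subsetI)
      fix v assume "v \<in> ?U"
      then obtain w where w: "w \<in> vecs M (L (i + 1))" "v = lin M (DL (i + 1)) w" by auto
      then show "v \<in> {v \<in> ?V. lin M (DL i) v \<in> {\<zero>\<^bsub>?W\<^esub>}}"
        using lin_closed[OF w(1) cxD'(1)[OF C]] lin_DD[OF C vecs_UNIV[OF w(1)]] by auto
    next
      fix v assume "v \<in> {v \<in> ?V. lin M (DL i) v \<in> {\<zero>\<^bsub>?W\<^esub>}}"
      then have v: "v \<in> ?V" "lin M (DL i) v = \<zero>\<^bsub>?W\<^esub>" by auto
      show "v \<in> ?U"
      proof (rule W.rdepth_torsion_free[OF xs vecs_submodule im dV n(1) v(1)])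
        fix x assume x: "x \<in> set xs"
        then obtain h and e :: nat where "\<forall>j>i - 1. htpy R (x [^] e) L DL h j" using step.prems(1)[OF x] by blast
        then have h: "htpy R (x [^] e) L DL h i" by simp
        have xe: "x [^] e \<in> carrier R" using x xs by auto
        have h1: "h i \<in> Mat R (L (i + 1)) (L i)" using h by (simp add: htpy_def)
        note hv = lin_closed[OF v(1) h1]
        have "lin M (DL (i + 1)) (lin M (h i) v) = x [^] e \<odot>\<^bsub>?W\<^esub> v"
          using htpy_apply[OF C h xe v(1)] vecs_UNIV[OF lin_closed[OF hv cxD'(1)[OF C]]]
          by (simp add: v(2) lin_zero lin_zero_sum)
        then show "\<exists>n::nat. x [^] n \<odot>\<^bsub>?W\<^esub> v \<in> ?U" using hv by (metis image_eqI)
      qed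
    qed
    have zs: "submodule {\<zero>\<^bsub>?W\<^esub>} R ?W" by (rule W.submoduleI) auto
    have "rdepth ?W ?V' {u \<oplus>\<^bsub>?W\<^esub> lin M (DL i) v |u v. u \<in> {\<zero>\<^bsub>?W\<^esub>} \<and> v \<in> ?V} xs (n - (s - i) - 1)"
    proof (rule W.rdepth_step[OF xs vecs_submodule vecs_submodule zs])
      show "lin M (DL i) v \<in> ?V'" if "v \<in> ?V" for v using lin_closed[OF that cxD(2)[OF C]] .
      show "lin M (DL i) (v \<oplus>\<^bsub>?W\<^esub> w) = lin M (DL i) v \<oplus>\<^bsub>?W\<^esub> lin M (DL i) w" if "v \<in> ?V" "w \<in> ?V" for v w
        using lin_add[OF vecs_UNIV[OF that(1)] vecs_UNIV[OF that(2)] cxD(2)[OF C]] .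
      show "lin M (DL i) (a \<odot>\<^bsub>?W\<^esub> v) = a \<odot>\<^bsub>?W\<^esub> lin M (DL i) v" if "a \<in> carrier R" "v \<in> ?V" for a v
        using lin_smult[OF that(1) vecs_UNIV[OF that(2)] cxD(2)[OF C]] .
      show "rdepth ?W ?V {v \<in> ?V. lin M (DL i) v \<in> {\<zero>\<^bsub>?W\<^esub>}} xs (n - (s - i))" unfolding Z by (rule dV)
      show "rdepth ?W ?V' {\<zero>\<^bsub>?W\<^esub>} xs (n - (s - i) - 1)"
        by (rule W.rdepth_mono[OF rdepth_vecs[OF xs cxD(1)[OF C] d]]) (use step.hyps in simp)
    qed
    also have "{u \<oplus>\<^bsub>?W\<^esub> lin M (DL i) v |u v. u \<in> {\<zero>\<^bsub>?W\<^esub>} \<and> v \<in> ?V} = lin M (DL i) ` ?V"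
      using vecs_UNIV[OF lin_closed[OF _ cxD(2)[OF C]]] by (auto simp: lin_zero_sum) (metis imageI lin_zero_sum(2))
    finally show ?case by (simp add: algebra_simps)
  }
qed

text \<open>
  The cokernels of \<open>L\<close>, of the cone and of \<open>Q\<close> in degree \<open>t + 1\<close> form a short exact
  sequence; injectivity at the left is the torsion argument again. Their depths are at least \<open>2\<close>,
  \<open>1\<close> and therefore \<open>1\<close>, so that the torsion class \<open>u\<close> of the last cokernel is
  zero.
\<close>

lemma acyclicity:
  assumes C: "cone R L DL f Q DQ" and xs: "set xs \<subseteq> carrier R"
    and d: "rdepth M (carrier M) {\<zero>\<^bsub>M\<^esub>} xs n" and high: "\<And>j. j > s \<Longrightarrow> L j = {}"
    and hL: "\<And>x. x \<in> set xs \<Longrightarrow> \<exists>h (e::nat). \<forall>j>t + 1. htpy R (x [^] e) L DL h j"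
    and hQ: "\<And>x. x \<in> set xs \<Longrightarrow> \<exists>h (e::nat). htpy R (x [^] e) Q DQ h (t + 2)"
    and ts: "0 \<le> t" "t \<le> s" "s < n"
    and d1: "rdepth (vspace M) (vecs M (L (t + 1) \<union> Q (t + 1)))
       (lin M (cone_diff R DL f DQ (t + 2)) ` vecs M (L (t + 2) \<union> Q (t + 2))) xs 1"
    and u: "u \<in> vecs M (Q (t + 1))"
    and tor: "\<And>x. x \<in> set xs \<Longrightarrow> \<exists>e::nat. x [^] e \<odot>\<^bsub>vspace M\<^esub> u \<in> lin M (DQ (t + 2)) ` vecs M (Q (t + 2))"
  shows "u \<in> lin M (DQ (t + 2)) ` vecs M (Q (t + 2))"
proof -
  interpret W: module R "vspace M" by (rule vec_module_module)
  interpret W: rmodule R "vspace M" by unfold_locales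
  let ?W = "vspace M"
  note cL = coneD(1)[OF C] and cQ = coneD(2)[OF C]
  let ?V = "vecs M (L (t + 1))" and ?U = "lin M (DL (t + 2)) ` vecs M (L (t + 2))"
  let ?V' = "vecs M (L (t + 1) \<union> Q (t + 1))"
  let ?C = "cone_diff R DL f DQ (t + 2)"
  let ?U' = "lin M ?C ` vecs M (L (t + 2) \<union> Q (t + 2))"
  have t2: "t + 1 + 1 = t + 2" "t + 2 - 1 = t + 1" by auto
  have DL: "DL (t + 2) \<in> Mat R (L (t + 1)) (L (t + 2))" using cxD(2)[OF cL, of "t + 2"] by (simp add: t2)
  have DQ: "DQ (t + 2) \<in> Mat R (Q (t + 1)) (Q (t + 2))" using cxD(2)[OF cQ, of "t + 2"] by (simp add: t2)
  have f: "f (t + 2) \<in> Mat R (L (t + 1)) (Q (t + 2))" using coneD(4)[OF C, of "t + 2"] by (simp add: t2)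
  have CM: "?C \<in> Mat R (L (t + 1) \<union> Q (t + 1)) (L (t + 2) \<union> Q (t + 2))"
    using cxD(2)[OF R.cone_cx[OF C], of "t + 2"] by (simp add: t2)
  note app = cone_diff_apply[OF C, of _ "t + 2"]
  have dV: "rdepth ?W ?V ?U xs (n - (s - (t + 1)))"
    using acyclicity_tail[OF cL xs d, of s "t + 1"] high hL ts by (simp add: t2)
  have imU: "submodule ?U R ?W" and imU': "submodule ?U' R ?W" by (rule lin_image_submodule DL CM)+
  have split: "\<exists>a b. a \<in> vecs M (L (t + 2)) \<and> b \<in> vecs M (Q (t + 2)) \<and>
      w = (lin M (DL (t + 2)) a \<oplus>\<^bsub>?W\<^esub> lin M (f (t + 2)) b) \<oplus>\<^bsub>?W\<^esub> lin M (DQ (t + 2)) b" if w: "w \<in> ?U'" for w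
  proof -
    obtain v where v: "v \<in> vecs M (L (t + 2) \<union> Q (t + 2))" "w = lin M ?C v" using w by blast
    obtain a b where ab: "a \<in> vecs M (L (t + 2))" "b \<in> vecs M (Q (t + 2))" "v = a \<oplus>\<^bsub>?W\<^esub> b"
      using vecs_split[OF v(1) coneD(3)[OF C]] .
    then show ?thesis using v(2) app(1)[OF ab(1,2)] by blast
  qed
  \<comment> \<open>Injectivity of the map of cokernels: if \<open>z\<close> in \<open>L\<close> is a boundary \<open>D a + f b\<close>
    of the cone, then \<open>b\<close> is a cycle of \<open>Q\<close>, so a multiple of \<open>f b\<close> is a boundary
    of \<open>L\<close>, and \<open>z\<close> is torsion modulo boundaries.\<close>
  have Z: "{v \<in> ?V. v \<in> ?U'} = ?U"
  proof (intro equalityI subsetI)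
    fix v assume "v \<in> ?U"
    then obtain w where w: "w \<in> vecs M (L (t + 2))" "v = lin M (DL (t + 2)) w" by auto
    then have "v = lin M ?C w" using app(2)[OF w(1) vecs_ops(1)] by simp
    moreover have "w \<in> vecs M (L (t + 2) \<union> Q (t + 2))" by (rule vecs_mono[OF w(1)]) simp
    ultimately show "v \<in> {v \<in> ?V. v \<in> ?U'}" using w lin_closed[OF w(1) DL] by auto
  next
    fix z assume "z \<in> {v \<in> ?V. v \<in> ?U'}"
    then have z: "z \<in> ?V" and zU: "z \<in> ?U'" by auto
    obtain a b where a: "a \<in> vecs M (L (t + 2))" and b: "b \<in> vecs M (Q (t + 2))"
      and zab: "z = (lin M (DL (t + 2)) a \<oplus>\<^bsub>?W\<^esub> lin M (f (t + 2)) b) \<oplus>\<^bsub>?W\<^esub> lin M (DQ (t + 2)) b" using split[OF zU] by blast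
    note Da = lin_closed[OF a DL] and fb = lin_closed[OF b f] and Db = lin_closed[OF b DQ]
    have "z \<oplus>\<^bsub>?W\<^esub> \<zero>\<^bsub>?W\<^esub> = (lin M (DL (t + 2)) a \<oplus>\<^bsub>?W\<^esub> lin M (f (t + 2)) b) \<oplus>\<^bsub>?W\<^esub> lin M (DQ (t + 2)) b"
      using zab lin_zero_sum[OF vecs_UNIV[OF z]] by simp
    note e = vecs_disjoint_eq[OF z vecs_ops(2)[OF Da fb] vecs_ops(1) Db coneD(3)[OF C] this]
    show "z \<in> ?U"
    proof (rule W.rdepth_torsion_free[OF xs vecs_submodule imU dV _ z])
      show "1 \<le> n - (s - (t + 1))" using ts by simp
      fix x assume x: "x \<in> set xs"
      obtain h and N :: nat where h: "htpy R (x [^] N) Q DQ h (t + 2)" using hQ[OF x] by blast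
      have xe: "x [^] N \<in> carrier R" using x xs by auto
      let ?c = "x [^] N"
      have h1: "h (t + 2) \<in> Mat R (Q (t + 3)) (Q (t + 2))" using h by (simp add: htpy_def add.commute)
      have f3: "f (t + 3) \<in> Mat R (L (t + 2)) (Q (t + 3))" using coneD(4)[OF C, of "t + 3"] by (simp add: add.commute)
      note hb = lin_closed[OF b h1]
      have D3: "DQ (t + 3) \<in> Mat R (Q (t + 2)) (Q (t + 3))" using cxD(2)[OF cQ, of "t + 3"] by (simp add: add.commute)
      have "lin M (DQ (t + 3)) (lin M (h (t + 2)) b) = ?c \<odot>\<^bsub>?W\<^esub> b"
        using htpy_apply[OF cQ h xe b] vecs_UNIV[OF lin_closed[OF hb D3]] e(2)[symmetric]
        by (simp add: lin_zero lin_zero_sum add.commute)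
      then have "lin M (f (t + 2)) (?c \<odot>\<^bsub>?W\<^esub> b) = \<ominus>\<^bsub>?W\<^esub> lin M (DL (t + 2)) (lin M (f (t + 3)) (lin M (h (t + 2)) b))"
        using cone_anticomm[OF C vecs_UNIV[OF hb], of "t + 2"] by (simp add: add.commute)
      then have 1: "?c \<odot>\<^bsub>?W\<^esub> lin M (f (t + 2)) b = \<ominus>\<^bsub>?W\<^esub> lin M (DL (t + 2)) (lin M (f (t + 3)) (lin M (h (t + 2)) b))"
        by (simp only: lin_smult[OF xe vecs_UNIV[OF b] f])
      have "?c \<odot>\<^bsub>?W\<^esub> z = ?c \<odot>\<^bsub>?W\<^esub> lin M (DL (t + 2)) a \<oplus>\<^bsub>?W\<^esub> ?c \<odot>\<^bsub>?W\<^esub> lin M (f (t + 2)) b"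
        unfolding e(1) by (rule W.smult_r_distr[OF xe vecs_UNIV[OF Da] vecs_UNIV[OF fb]])
      moreover have "?c \<odot>\<^bsub>?W\<^esub> lin M (DL (t + 2)) a \<in> ?U"
        by (rule W.submodD(6)[OF imU xe]) (use a in blast)
      moreover have "?c \<odot>\<^bsub>?W\<^esub> lin M (f (t + 2)) b \<in> ?U"
        unfolding 1 by (rule W.submodD(5)[OF imU]) (use lin_closed[OF hb f3] in blast)
      ultimately have "?c \<odot>\<^bsub>?W\<^esub> z \<in> ?U" using W.submodD(3)[OF imU] by simp
      then show "\<exists>n::nat. x [^] n \<odot>\<^bsub>?W\<^esub> z \<in> ?U" by blast
    qed
  qed
  let ?S = "{u \<oplus>\<^bsub>?W\<^esub> v |u v. u \<in> ?U' \<and> v \<in> ?V}"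
  have V'V: "v \<in> ?V'" if "v \<in> ?V" for v by (rule vecs_mono[OF that]) simp
  have "rdepth ?W ?V' ?S xs (2 - 1)"
  proof (rule W.rdepth_step[OF xs vecs_submodule vecs_submodule imU', where \<phi> = "\<lambda>v. v"])
    show "rdepth ?W ?V {v \<in> ?V. v \<in> ?U'} xs 2"
      unfolding Z by (rule W.rdepth_mono[OF dV]) (use ts in simp)
    show "rdepth ?W ?V' ?U' xs (2 - 1)" using d1 by simp
  qed (use V'V in auto)
  then have dS: "rdepth ?W ?V' ?S xs 1" by simp
  have S: "submodule ?S R ?W" by (rule W.submodule_sum[OF imU' vecs_submodule])
  have uV': "u \<in> ?V'" by (rule vecs_mono[OF u]) simp
  have "u \<in> ?S"
  proof (rule W.rdepth_torsion_free[OF xs vecs_submodule S dS order_refl uV'])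
    fix x assume "x \<in> set xs"
    then obtain e :: nat and w where w: "w \<in> vecs M (Q (t + 2))" "x [^] e \<odot>\<^bsub>?W\<^esub> u = lin M (DQ (t + 2)) w"
      using tor by blast
    note fw = lin_closed[OF w(1) f] and Dw = lin_closed[OF w(1) DQ]
    have "lin M (DQ (t + 2)) w = lin M ?C w \<oplus>\<^bsub>?W\<^esub> \<ominus>\<^bsub>?W\<^esub> lin M (f (t + 2)) w"
      using vecs_UNIV[OF fw] vecs_UNIV[OF Dw] app(3)[OF vecs_ops(1) w(1)] by (simp add: W.M.a_ac W.M.r_neg W.M.r_neg1 W.M.r_neg2)
    moreover have "lin M ?C w \<in> ?U'" using vecs_mono[OF w(1), of "L (t + 2) \<union> Q (t + 2)"] by blast
    ultimately have "x [^] e \<odot>\<^bsub>?W\<^esub> u \<in> ?S" using w(2) vecs_ops(4)[OF fw] by auto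
    then show "\<exists>n::nat. x [^] n \<odot>\<^bsub>?W\<^esub> u \<in> ?S" by blast
  qed
  then obtain w v where wv: "w \<in> ?U'" "v \<in> ?V" "u = w \<oplus>\<^bsub>?W\<^esub> v" by auto
  obtain a b where a: "a \<in> vecs M (L (t + 2))" and b: "b \<in> vecs M (Q (t + 2))"
    and wab: "w = (lin M (DL (t + 2)) a \<oplus>\<^bsub>?W\<^esub> lin M (f (t + 2)) b) \<oplus>\<^bsub>?W\<^esub> lin M (DQ (t + 2)) b" using split[OF wv(1)] by blast
  note Da = lin_closed[OF a DL] and fb = lin_closed[OF b f] and Db = lin_closed[OF b DQ]
  note c = vecs_UNIV[OF Da] vecs_UNIV[OF fb] vecs_UNIV[OF Db] vecs_UNIV[OF wv(2)]
  have "\<zero>\<^bsub>?W\<^esub> \<oplus>\<^bsub>?W\<^esub> u = ((lin M (DL (t + 2)) a \<oplus>\<^bsub>?W\<^esub> lin M (f (t + 2)) b) \<oplus>\<^bsub>?W\<^esub> v) \<oplus>\<^bsub>?W\<^esub> lin M (DQ (t + 2)) b"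
    using c lin_zero_sum[OF vecs_UNIV[OF u]] wv(3) wab by (simp add: W.M.a_ac)
  then have "u = lin M (DQ (t + 2)) b"
    by (rule vecs_disjoint_eq(2)[OF vecs_ops(1) vecs_ops(2)[OF vecs_ops(2)[OF Da fb] wv(2)] u Db coneD(3)[OF C]])
  then show ?thesis using b by blast
qed

end

section \<open>Quotient modules and regular sequences\<close>

text \<open>
  The submodule \<open>U + (xs) N\<close>.
\<close>

fun smult_sum :: "('a, 'm) module \<Rightarrow> 'm set \<Rightarrow> 'a list \<Rightarrow> 'm set" where
  "smult_sum N U [] = U"
| "smult_sum N U (x # xs) = smult_sum N {u \<oplus>\<^bsub>N\<^esub> x \<odot>\<^bsub>N\<^esub> b |u b. u \<in> U \<and> b \<in> carrier N} xs"

context rmodule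
begin

lemma submodule_additive:
  assumes "submodule U R M"
  shows "subgroup U (add_monoid M)" "U \<subseteq> carrier M" "abelian_subgroup U M"
proof -
  show s: "subgroup U (add_monoid M)" using assms by (simp add: submodule_def)
  show "U \<subseteq> carrier M" using submodD(1)[OF assms] by auto
  show "abelian_subgroup U M"
    by (rule abelian_subgroupI3) (auto intro: additive_subgroup.intro s M.abelian_group_axioms)
qed

lemma coset_eq_iff:
  assumes U: "submodule U R M" and xy: "x \<in> carrier M" "y \<in> carrier M"
  shows "U +>\<^bsub>M\<^esub> x = U +>\<^bsub>M\<^esub> y \<longleftrightarrow> x \<ominus>\<^bsub>M\<^esub> y \<in> U"
proof -
  interpret abelian_subgroup U M by (rule submodule_additive(3)[OF U])
  note u = submodD[OF U]
  have mem: "z \<in> U +>\<^bsub>M\<^esub> y \<longleftrightarrow> z \<ominus>\<^bsub>M\<^esub> y \<in> U" if z: "z \<in> carrier M" "y \<in> carrier M" for z y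
  proof
    assume "z \<in> U +>\<^bsub>M\<^esub> y"
    then obtain h where "h \<in> U" "z = h \<oplus>\<^bsub>M\<^esub> y" by (auto simp: a_r_coset_def')
    then show "z \<ominus>\<^bsub>M\<^esub> y \<in> U" using u(1) z by (simp add: a_minus_def M.a_assoc M.r_neg)
  next
    assume "z \<ominus>\<^bsub>M\<^esub> y \<in> U"
    moreover have "z = (z \<ominus>\<^bsub>M\<^esub> y) \<oplus>\<^bsub>M\<^esub> y" using z by (simp add: a_minus_def M.a_assoc M.l_neg)
    ultimately show "z \<in> U +>\<^bsub>M\<^esub> y" by (auto simp: a_r_coset_def')
  qed
  show ?thesis
  proof
    assume "U +>\<^bsub>M\<^esub> x = U +>\<^bsub>M\<^esub> y"
    moreover have "x \<in> U +>\<^bsub>M\<^esub> x" using mem[of x x] xy u(2) by (simp add: a_minus_def M.r_neg)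
    ultimately show "x \<ominus>\<^bsub>M\<^esub> y \<in> U" using mem xy by blast
  next
    assume "x \<ominus>\<^bsub>M\<^esub> y \<in> U"
    then have "x \<in> U +>\<^bsub>M\<^esub> y" using mem xy by blast
    then show "U +>\<^bsub>M\<^esub> x = U +>\<^bsub>M\<^esub> y"
      using M.a_repr_independence[OF _ xy(2) submodule_additive(1)[OF U]] by blast
  qed
qed

lemma quot_carrier: "carrier (quot_module M U) = {U +>\<^bsub>M\<^esub> x |x. x \<in> carrier M}"
  by (auto simp: quot_module_def A_RCOSETS_def')

lemma quot_zero: "\<zero>\<^bsub>quot_module M U\<^esub> = U"
  by (simp add: quot_module_def)

lemma quot_zero_coset:
  assumes U: "submodule U R M"
  shows "\<zero>\<^bsub>quot_module M U\<^esub> = U +>\<^bsub>M\<^esub> \<zero>\<^bsub>M\<^esub>"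
  unfolding quot_zero using M.a_coset_add_zero[OF submodule_additive(2)[OF U]] by simp

lemma quot_add:
  assumes U: "submodule U R M" and xy: "x \<in> carrier M" "y \<in> carrier M"
  shows "(U +>\<^bsub>M\<^esub> x) \<oplus>\<^bsub>quot_module M U\<^esub> (U +>\<^bsub>M\<^esub> y) = U +>\<^bsub>M\<^esub> (x \<oplus>\<^bsub>M\<^esub> y)"
proof -
  interpret abelian_subgroup U M by (rule submodule_additive(3)[OF U])
  show ?thesis using a_rcos_sum[OF xy] by (simp add: quot_module_def)
qed

lemma quot_smult:
  assumes U: "submodule U R M" and a: "a \<in> carrier R" and x: "x \<in> carrier M"
  shows "a \<odot>\<^bsub>quot_module M U\<^esub> (U +>\<^bsub>M\<^esub> x) = U +>\<^bsub>M\<^esub> (a \<odot>\<^bsub>M\<^esub> x)"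
proof -
  note u = submodD[OF U]
  have "U +>\<^bsub>M\<^esub> (a \<odot>\<^bsub>M\<^esub> z) = U +>\<^bsub>M\<^esub> (a \<odot>\<^bsub>M\<^esub> x)" if z: "z \<in> U +>\<^bsub>M\<^esub> x" for z
  proof -
    obtain h where h: "h \<in> U" "z = h \<oplus>\<^bsub>M\<^esub> x" using z by (auto simp: a_r_coset_def')
    have "a \<odot>\<^bsub>M\<^esub> z \<ominus>\<^bsub>M\<^esub> a \<odot>\<^bsub>M\<^esub> x = a \<odot>\<^bsub>M\<^esub> h"
      using h u(1) a x by (simp add: smult_r_distr a_minus_def M.a_assoc M.r_neg)
    then have "a \<odot>\<^bsub>M\<^esub> z \<ominus>\<^bsub>M\<^esub> a \<odot>\<^bsub>M\<^esub> x \<in> U" using u(6) h a by simp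
    then show ?thesis using coset_eq_iff[OF U] h u(1) a x by simp
  qed
  moreover have "x \<in> U +>\<^bsub>M\<^esub> x" using u(2) x by (force simp: a_r_coset_def')
  ultimately have "(\<Union>z\<in>U +>\<^bsub>M\<^esub> x. U +>\<^bsub>M\<^esub> (a \<odot>\<^bsub>M\<^esub> z)) = U +>\<^bsub>M\<^esub> (a \<odot>\<^bsub>M\<^esub> x)" by blast
  then show ?thesis by (simp add: quot_module_def)
qed

lemma quot_eq_zero_iff:
  assumes U: "submodule U R M" and x: "x \<in> carrier M"
  shows "U +>\<^bsub>M\<^esub> x = \<zero>\<^bsub>quot_module M U\<^esub> \<longleftrightarrow> x \<in> U"
  unfolding quot_zero_coset[OF U] using coset_eq_iff[OF U x] x by (simp add: a_minus_def)

lemma quot_module_module: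
  assumes U: "submodule U R M"
  shows "module R (quot_module M U)"
proof -
  note q = quot_add[OF U] quot_smult[OF U] quot_zero_coset[OF U]
  have el: "\<exists>z. z \<in> carrier M \<and> x = U +>\<^bsub>M\<^esub> z" if "x \<in> carrier (quot_module M U)" for x
    using that by (auto simp: quot_carrier)
  have co: "U +>\<^bsub>M\<^esub> z \<in> carrier (quot_module M U)" if "z \<in> carrier M" for z
    using that by (auto simp: quot_carrier)
  let ?Q = "quot_module M U"
  show ?thesis
  proof (rule moduleI)
    show "cring R" by (rule R.is_cring)
    show "abelian_group ?Q"
    proof (rule abelian_groupI)
      show "\<zero>\<^bsub>?Q\<^esub> \<in> carrier ?Q" using co by (simp add: q)
      fix x assume x: "x \<in> carrier ?Q"
      then obtain x' where x': "x' \<in> carrier M" "x = U +>\<^bsub>M\<^esub> x'" using el by blast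
      show "\<zero>\<^bsub>?Q\<^esub> \<oplus>\<^bsub>?Q\<^esub> x = x" using x' by (simp add: q)
      show "\<exists>y\<in>carrier ?Q. y \<oplus>\<^bsub>?Q\<^esub> x = \<zero>\<^bsub>?Q\<^esub>"
        using x' by (intro bexI[OF _ co[of "\<ominus>\<^bsub>M\<^esub> x'"]]) (auto simp: q M.l_neg)
      fix y assume "y \<in> carrier ?Q"
      then obtain y' where y': "y' \<in> carrier M" "y = U +>\<^bsub>M\<^esub> y'" using el by blast
      show "x \<oplus>\<^bsub>?Q\<^esub> y \<in> carrier ?Q" using x' y' co by (simp add: q)
      show "x \<oplus>\<^bsub>?Q\<^esub> y = y \<oplus>\<^bsub>?Q\<^esub> x" using x' y' by (simp add: q M.a_comm)
      fix z assume "z \<in> carrier ?Q"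
      then obtain z' where z': "z' \<in> carrier M" "z = U +>\<^bsub>M\<^esub> z'" using el by blast
      show "x \<oplus>\<^bsub>?Q\<^esub> y \<oplus>\<^bsub>?Q\<^esub> z = x \<oplus>\<^bsub>?Q\<^esub> (y \<oplus>\<^bsub>?Q\<^esub> z)" using x' y' z' by (simp add: q M.a_assoc)
    qed
    fix x assume x: "x \<in> carrier ?Q"
    then obtain x' where x': "x' \<in> carrier M" "x = U +>\<^bsub>M\<^esub> x'" using el by blast
    show "\<one> \<odot>\<^bsub>?Q\<^esub> x = x" using x' by (simp add: q)
    fix a assume a: "a \<in> carrier R"
    show "a \<odot>\<^bsub>?Q\<^esub> x \<in> carrier ?Q" using x' a co by (simp add: q)
    show "(a \<oplus> b) \<odot>\<^bsub>?Q\<^esub> x = a \<odot>\<^bsub>?Q\<^esub> x \<oplus>\<^bsub>?Q\<^esub> b \<odot>\<^bsub>?Q\<^esub> x"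
      "(a \<otimes> b) \<odot>\<^bsub>?Q\<^esub> x = a \<odot>\<^bsub>?Q\<^esub> (b \<odot>\<^bsub>?Q\<^esub> x)" if "b \<in> carrier R" for b
      using x' a that by (simp_all add: q smult_l_distr smult_assoc1)
    fix y assume "y \<in> carrier ?Q"
    then obtain y' where y': "y' \<in> carrier M" "y = U +>\<^bsub>M\<^esub> y'" using el by blast
    show "a \<odot>\<^bsub>?Q\<^esub> (x \<oplus>\<^bsub>?Q\<^esub> y) = a \<odot>\<^bsub>?Q\<^esub> x \<oplus>\<^bsub>?Q\<^esub> a \<odot>\<^bsub>?Q\<^esub> y"
      using x' y' a by (simp add: q smult_r_distr)
  qed
qed

lemma smult_step_submodule:
  assumes U: "submodule U R M" and x: "x \<in> carrier R"
  shows "submodule {u \<oplus>\<^bsub>M\<^esub> x \<odot>\<^bsub>M\<^esub> b |u b. u \<in> U \<and> b \<in> carrier M} R M"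
proof -
  have "{u \<oplus>\<^bsub>M\<^esub> x \<odot>\<^bsub>M\<^esub> b |u b. u \<in> U \<and> b \<in> carrier M} = {u \<oplus>\<^bsub>M\<^esub> v |u v. u \<in> U \<and> v \<in> {x \<odot>\<^bsub>M\<^esub> b |b. b \<in> carrier M}}" by blast
  then show ?thesis using submodule_sum[OF U submodule_smult_image[OF x]] by simp
qed

lemma smult_step_contains:
  assumes U: "submodule U R M" and x: "x \<in> carrier R"
  shows "U \<subseteq> {u \<oplus>\<^bsub>M\<^esub> x \<odot>\<^bsub>M\<^esub> b |u b. u \<in> U \<and> b \<in> carrier M}"
    "b \<in> carrier M \<Longrightarrow> x \<odot>\<^bsub>M\<^esub> b \<in> {u \<oplus>\<^bsub>M\<^esub> x \<odot>\<^bsub>M\<^esub> b |u b. u \<in> U \<and> b \<in> carrier M}"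
proof
  note u = submodD[OF U]
  fix v assume v: "v \<in> U"
  have "v = v \<oplus>\<^bsub>M\<^esub> x \<odot>\<^bsub>M\<^esub> \<zero>\<^bsub>M\<^esub>" using u(1)[OF v] x by simp
  then show "v \<in> {u \<oplus>\<^bsub>M\<^esub> x \<odot>\<^bsub>M\<^esub> b |u b. u \<in> U \<and> b \<in> carrier M}" using v by blast
next
  note u = submodD[OF U]
  assume b: "b \<in> carrier M"
  have "x \<odot>\<^bsub>M\<^esub> b = \<zero>\<^bsub>M\<^esub> \<oplus>\<^bsub>M\<^esub> x \<odot>\<^bsub>M\<^esub> b" using b x by simp
  then show "x \<odot>\<^bsub>M\<^esub> b \<in> {u \<oplus>\<^bsub>M\<^esub> x \<odot>\<^bsub>M\<^esub> b |u b. u \<in> U \<and> b \<in> carrier M}" using b u(2) by blast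
qed

lemma smult_sum_props:
  assumes "submodule U R M" "set xs \<subseteq> carrier R"
  shows "submodule (smult_sum M U xs) R M" "U \<subseteq> smult_sum M U xs"
    "\<forall>x\<in>set xs. \<forall>b\<in>carrier M. x \<odot>\<^bsub>M\<^esub> b \<in> smult_sum M U xs"
proof -
  have "submodule (smult_sum M U xs) R M \<and> U \<subseteq> smult_sum M U xs \<and>
    (\<forall>x\<in>set xs. \<forall>b\<in>carrier M. x \<odot>\<^bsub>M\<^esub> b \<in> smult_sum M U xs)"
    using assms
  proof (induction xs arbitrary: U)
    case (Cons x xs)
    have x: "x \<in> carrier R" and xs: "set xs \<subseteq> carrier R" using Cons.prems by auto
    note IH = Cons.IH[OF smult_step_submodule[OF Cons.prems(1) x] xs]
    note c = smult_step_contains[OF Cons.prems(1) x]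
    have "x \<odot>\<^bsub>M\<^esub> b \<in> smult_sum M U (x # xs)" if "b \<in> carrier M" for b
      using IH c(2)[OF that] unfolding smult_sum.simps by blast
    moreover have "U \<subseteq> smult_sum M U (x # xs)"
      using IH c(1) unfolding smult_sum.simps by blast
    ultimately show ?case using IH by simp
  qed simp
  then show "submodule (smult_sum M U xs) R M" "U \<subseteq> smult_sum M U xs"
    "\<forall>x\<in>set xs. \<forall>b\<in>carrier M. x \<odot>\<^bsub>M\<^esub> b \<in> smult_sum M U xs" by auto
qed

lemma smult_sum_least:
  assumes "submodule K R M" "U \<subseteq> K" "\<And>x b. x \<in> set xs \<Longrightarrow> b \<in> carrier M \<Longrightarrow> x \<odot>\<^bsub>M\<^esub> b \<in> K"
  shows "smult_sum M U xs \<subseteq> K"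
  using assms(2,3)
proof (induction xs arbitrary: U)
  case (Cons x xs)
  have "{u \<oplus>\<^bsub>M\<^esub> x \<odot>\<^bsub>M\<^esub> b |u b. u \<in> U \<and> b \<in> carrier M} \<subseteq> K"
    using Cons.prems submodD(3)[OF assms(1)] by auto
  then show ?case using Cons.IH Cons.prems(2) by simp
qed simp

lemma zero_submodule: "submodule {\<zero>\<^bsub>M\<^esub>} R M"
  by (rule submoduleI) auto

lemma submodule_span_props:
  assumes "S \<subseteq> carrier M"
  shows "submodule (submodule_span R M S) R M" "S \<subseteq> submodule_span R M S"
    "submodule K R M \<Longrightarrow> S \<subseteq> K \<Longrightarrow> submodule_span R M S \<subseteq> K"
proof -
  show "S \<subseteq> submodule_span R M S" by (auto simp: submodule_span_def)
  show "submodule K R M \<Longrightarrow> S \<subseteq> K \<Longrightarrow> submodule_span R M S \<subseteq> K" for K by (auto simp: submodule_span_def)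
  show "submodule (submodule_span R M S) R M"
  proof (rule submoduleI)
    show "submodule_span R M S \<subseteq> carrier M"
      using carrier_is_submodule assms by (auto simp: submodule_span_def)
  qed (auto simp: submodule_span_def submodD)
qed

lemma idl_smult_mem:
  assumes K: "submodule K R M" and b: "b \<in> carrier M" and Y: "Y \<subseteq> carrier R"
    and y: "\<And>y. y \<in> Y \<Longrightarrow> y \<odot>\<^bsub>M\<^esub> b \<in> K" and a: "a \<in> Idl Y"
  shows "a \<odot>\<^bsub>M\<^esub> b \<in> K"
proof -
  note k = submodD[OF K]
  let ?I = "{a \<in> carrier R. a \<odot>\<^bsub>M\<^esub> b \<in> K}"
  have "ideal ?I R"
  proof (rule idealI)
    show "ring R" by (rule R.ring_axioms)
    show "subgroup ?I (add_monoid R)"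
    proof (rule R.add.subgroupI)
      show "?I \<noteq> {}" using k(2) b by (auto intro!: exI[of _ \<zero>])
    qed (use b in \<open>auto simp: k smult_l_distr smult_l_minus\<close>)
    fix a x assume a: "a \<in> ?I" and x: "x \<in> carrier R"
    then show "x \<otimes> a \<in> ?I" using b by (auto simp: smult_assoc1 k)
    then show "a \<otimes> x \<in> ?I" using a x by (simp add: R.m_comm)
  qed
  then have "Idl Y \<subseteq> ?I" by (rule R.genideal_minimal) (use y Y in auto)
  then show ?thesis using a by auto
qed

lemma ideal_smult_eq:
  assumes xs: "set xs \<subseteq> carrier R"
  shows "ideal_smult R (Idl (set xs)) M = smult_sum M {\<zero>\<^bsub>M\<^esub>} xs"
proof
  note p = smult_sum_props[OF zero_submodule xs]
  note k = submodD[OF p(1)]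
  let ?K = "smult_sum M {\<zero>\<^bsub>M\<^esub>} xs"
  have id: "ideal (Idl (set xs)) R" by (rule R.genideal_ideal[OF xs])
  have Ic: "Idl (set xs) \<subseteq> carrier R" using ideal.Icarr[OF id] by auto
  show "ideal_smult R (Idl (set xs)) M \<subseteq> ?K"
    unfolding ideal_smult_def using Ic p(3) idl_smult_mem[OF p(1) _ xs] by (intro submodule_span_props(3)[OF _ p(1)]) auto
  have s: "{a \<odot>\<^bsub>M\<^esub> x |a x. a \<in> Idl (set xs) \<and> x \<in> carrier M} \<subseteq> carrier M" using Ic by auto
  note sp = submodule_span_props[OF s]
  show "?K \<subseteq> ideal_smult R (Idl (set xs)) M"
    unfolding ideal_smult_def
  proof (rule smult_sum_least[OF sp(1)])
    show "{\<zero>\<^bsub>M\<^esub>} \<subseteq> submodule_span R M {a \<odot>\<^bsub>M\<^esub> x |a x. a \<in> Idl (set xs) \<and> x \<in> carrier M}"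
      using submodD(2)[OF sp(1)] by blast
    fix x b assume "x \<in> set xs" "b \<in> carrier M"
    then show "x \<odot>\<^bsub>M\<^esub> b \<in> submodule_span R M {a \<odot>\<^bsub>M\<^esub> x |a x. a \<in> Idl (set xs) \<and> x \<in> carrier M}"
      using sp(2) R.genideal_self[OF xs] by blast
  qed
qed

text \<open>
  Nakayama's lemma for an ideal with finitely many generators that are nilpotent on \<open>M / U\<close>, the form in
  which it holds for a big module.
\<close>

lemma smult_sum_nilpotent:
  assumes "submodule U R M" "set ys \<subseteq> carrier R" "smult_sum M U ys = carrier M"
    and "\<And>y. y \<in> set ys \<Longrightarrow> \<exists>k::nat. \<forall>b\<in>carrier M. y [^] k \<odot>\<^bsub>M\<^esub> b \<in> U"
  shows "U = carrier M"
  using assms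
proof (induction ys arbitrary: U)
  case (Cons y ys)
  have y: "y \<in> carrier R" and ys: "set ys \<subseteq> carrier R" using Cons.prems by auto
  let ?U' = "{u \<oplus>\<^bsub>M\<^esub> y \<odot>\<^bsub>M\<^esub> b |u b. u \<in> U \<and> b \<in> carrier M}"
  note u = submodD[OF Cons.prems(1)]
  note c = smult_step_contains[OF Cons.prems(1) y]
  have U': "?U' = carrier M"
  proof (rule Cons.IH[OF smult_step_submodule[OF Cons.prems(1) y] ys])
    show "smult_sum M ?U' ys = carrier M" using Cons.prems(3) by simp
    fix z assume "z \<in> set ys"
    then have "\<exists>k::nat. \<forall>b\<in>carrier M. z [^] k \<odot>\<^bsub>M\<^esub> b \<in> U" using Cons.prems(4) by simp
    then show "\<exists>k::nat. \<forall>b\<in>carrier M. z [^] k \<odot>\<^bsub>M\<^esub> b \<in> ?U'" using c(1) by blast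
  qed
  obtain k :: nat where k: "\<forall>b\<in>carrier M. y [^] k \<odot>\<^bsub>M\<^esub> b \<in> U" using Cons.prems(4)[of y] by auto
  have "\<forall>b\<in>carrier M. \<exists>v\<in>U. \<exists>b'\<in>carrier M. b = v \<oplus>\<^bsub>M\<^esub> y [^] n \<odot>\<^bsub>M\<^esub> b'" for n :: nat
  proof (induction n)
    case 0
    show ?case
    proof
      fix b assume "b \<in> carrier M"
      then have "b = \<zero>\<^bsub>M\<^esub> \<oplus>\<^bsub>M\<^esub> y [^] (0::nat) \<odot>\<^bsub>M\<^esub> b" by simp
      then show "\<exists>v\<in>U. \<exists>b'\<in>carrier M. b = v \<oplus>\<^bsub>M\<^esub> y [^] (0::nat) \<odot>\<^bsub>M\<^esub> b'" using u(2) \<open>b \<in> carrier M\<close> by blast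
    qed
  next
    case (Suc n)
    show ?case
    proof
      fix b assume b: "b \<in> carrier M"
      obtain v b' where v: "v \<in> U" "b' \<in> carrier M" "b = v \<oplus>\<^bsub>M\<^esub> y [^] n \<odot>\<^bsub>M\<^esub> b'" using Suc b by blast
      obtain v' b'' where v': "v' \<in> U" "b'' \<in> carrier M" "b' = v' \<oplus>\<^bsub>M\<^esub> y \<odot>\<^bsub>M\<^esub> b''" using U' v(2) by blast
      have "b = (v \<oplus>\<^bsub>M\<^esub> y [^] n \<odot>\<^bsub>M\<^esub> v') \<oplus>\<^bsub>M\<^esub> y [^] Suc n \<odot>\<^bsub>M\<^esub> b''"
        using v v' u(1) y by (simp add: smult_r_distr smult_assoc1 M.a_assoc)
      moreover have "v \<oplus>\<^bsub>M\<^esub> y [^] n \<odot>\<^bsub>M\<^esub> v' \<in> U" using v v' u y by simp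
      ultimately show "\<exists>v\<in>U. \<exists>b'\<in>carrier M. b = v \<oplus>\<^bsub>M\<^esub> y [^] Suc n \<odot>\<^bsub>M\<^esub> b'" using v'(2) by blast
    qed
  qed
  note dec = this[of k, rule_format]
  have "b \<in> U" if b: "b \<in> carrier M" for b
  proof -
    obtain v b' where v: "v \<in> U" "b' \<in> carrier M" "b = v \<oplus>\<^bsub>M\<^esub> y [^] k \<odot>\<^bsub>M\<^esub> b'" using dec[OF b] by blast
    show ?thesis using u(3)[OF v(1) k[rule_format, OF v(2)]] v(3) by simp
  qed
  then show "U = carrier M" using u(1) by (intro equalityI subsetI) simp_all
qed simp

lemma weakly_regularI:
  assumes "\<And>i b. i < length xs \<Longrightarrow> b \<in> carrier M \<Longrightarrow> xs ! i \<odot>\<^bsub>M\<^esub> b \<in> smult_sum M U (take i xs) \<Longrightarrow>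
      b \<in> smult_sum M U (take i xs)"
  shows "weakly_regular M U xs"
  using assms
proof (induction xs arbitrary: U)
  case (Cons x xs)
  have "\<forall>b\<in>carrier M. x \<odot>\<^bsub>M\<^esub> b \<in> U \<longrightarrow> b \<in> U" using Cons.prems[of 0] by simp
  moreover have "weakly_regular M {u \<oplus>\<^bsub>M\<^esub> x \<odot>\<^bsub>M\<^esub> b |u b. u \<in> U \<and> b \<in> carrier M} xs"
  proof (rule Cons.IH)
    fix i b assume "i < length xs" "b \<in> carrier M"
      "xs ! i \<odot>\<^bsub>M\<^esub> b \<in> smult_sum M {u \<oplus>\<^bsub>M\<^esub> x \<odot>\<^bsub>M\<^esub> b |u b. u \<in> U \<and> b \<in> carrier M} (take i xs)"
    then show "b \<in> smult_sum M {u \<oplus>\<^bsub>M\<^esub> x \<odot>\<^bsub>M\<^esub> b |u b. u \<in> U \<and> b \<in> carrier M} (take i xs)"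
      using Cons.prems[of "Suc i" b] by simp
  qed
  ultimately show ?case by simp
qed simp

text \<open>
  The first conclusion restates regularity without quotient modules; the last one is what distinguishes regular sequences
  from weakly regular ones.
\<close>

lemma regular_sequence_weakly_regular:
  assumes r: "regular_sequence R M xs"
  shows "weakly_regular M {\<zero>\<^bsub>M\<^esub>} xs" "set xs \<subseteq> carrier R" "smult_sum M {\<zero>\<^bsub>M\<^esub>} xs \<noteq> carrier M"
proof -
  show xs: "set xs \<subseteq> carrier R" using r by (simp add: regular_sequence_def)
  show "smult_sum M {\<zero>\<^bsub>M\<^esub>} xs \<noteq> carrier M" using r ideal_smult_eq[OF xs] by (auto simp: regular_sequence_def)
  show "weakly_regular M {\<zero>\<^bsub>M\<^esub>} xs"
  proof (rule weakly_regularI)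
    fix i b assume i: "i < length xs" and b: "b \<in> carrier M"
      and xb: "xs ! i \<odot>\<^bsub>M\<^esub> b \<in> smult_sum M {\<zero>\<^bsub>M\<^esub>} (take i xs)"
    have t: "set (take i xs) \<subseteq> carrier R" using xs set_take_subset[of i xs] by blast
    let ?U = "smult_sum M {\<zero>\<^bsub>M\<^esub>} (take i xs)"
    note U = smult_sum_props(1)[OF zero_submodule t]
    have xi: "xs ! i \<in> carrier R" using xs i by auto
    have nz: "nonzerodivisor_on (xs ! i) (quot_module M ?U)"
      using r i unfolding regular_sequence_def ideal_smult_eq[OF t, symmetric] by blast
    have "xs ! i \<odot>\<^bsub>quot_module M ?U\<^esub> (?U +>\<^bsub>M\<^esub> b) = \<zero>\<^bsub>quot_module M ?U\<^esub>"
      using quot_smult[OF U xi b] quot_eq_zero_iff[OF U, of "xs ! i \<odot>\<^bsub>M\<^esub> b"] xb xi b by simp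
    then have "?U +>\<^bsub>M\<^esub> b = \<zero>\<^bsub>quot_module M ?U\<^esub>"
      using nz b unfolding nonzerodivisor_on_def quot_carrier by blast
    then show "b \<in> ?U" using quot_eq_zero_iff[OF U b] by simp
  qed
qed

end

section \<open>Nakayama's lemma for base changes\<close>

lemma local_ring_unit:
  assumes L: "noetherian_local_ring R \<mm>" and a: "a \<in> carrier R" "a \<notin> \<mm>"
  shows "\<exists>b\<in>carrier R. b \<otimes>\<^bsub>R\<^esub> a = \<one>\<^bsub>R\<^esub>"
proof (rule ccontr)
  interpret noetherian_local_ring R \<mm> by (rule L)
  assume no: "\<not> ?thesis"
  let ?P = "{I. ideal I R \<and> a \<in> I \<and> \<one>\<^bsub>R\<^esub> \<notin> I}"
  have P0: "PIdl\<^bsub>R\<^esub> a \<in> ?P"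
    using cgenideal_ideal[OF a(1)] cgenideal_self[OF a(1)] no by (auto simp: cgenideal_def)
  have "\<exists>M\<in>?P. \<forall>J\<in>?P. M \<subseteq> J \<longrightarrow> J = M"
  proof (rule subset_Zorn_nonempty)
    show "?P \<noteq> {}" using P0 by blast
    fix C assume C: "C \<noteq> {}" "subset.chain ?P C"
    then have "subset.chain {I. ideal I R} C" by (auto simp: pred_on.chain_def)
    then have "\<Union>C \<in> C" by (rule ideal_chain_is_trivial[OF C(1)])
    then show "\<Union>C \<in> ?P" using C(2) by (auto simp: pred_on.chain_def)
  qed
  then obtain M where M: "M \<in> ?P" "\<And>J. J \<in> ?P \<Longrightarrow> M \<subseteq> J \<Longrightarrow> J = M" by blast
  have "maximalideal M R"
  proof (rule maximalidealI)
    show "ideal M R" using M(1) by simp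
    show "carrier R \<noteq> M" using M(1) by blast
    fix J assume J: "ideal J R" "M \<subseteq> J" "J \<subseteq> carrier R"
    show "J = M \<or> J = carrier R"
    proof (cases "\<one>\<^bsub>R\<^esub> \<in> J")
      case True
      then show ?thesis using ideal.one_imp_carrier[OF J(1)] by simp
    next
      case False
      then show ?thesis using M J by auto
    qed
  qed
  then have "M = \<mm>" by (rule maximal_unique)
  then show False using M(1) a(2) by simp
qed

text \<open>
  By induction on \<open>S\<close>. If the \<open>i\<close>-th coordinates of the elements of \<open>U\<close> all lie in
  \<open>\<mm>\<close>, the \<open>i\<close>-th coordinate is the required linear form. Otherwise some element of
  \<open>U\<close> has a unit there and eliminates this coordinate.
\<close>

lemma (in cring) proper_submodule_functional:
  assumes L: "noetherian_local_ring R \<mm>" and "finite S"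
    and "submodule U R (vspace (regular_module R))" "U \<subseteq> rvecs S" "U \<noteq> rvecs S"
  shows "\<exists>w. (\<forall>i. w i \<in> carrier R) \<and> (\<exists>i\<in>S. w i = \<one>) \<and> (\<forall>u\<in>U. (\<Oplus>i\<in>S. w i \<otimes> u i) \<in> \<mm>)"
  using assms(2-5)
proof (induction S arbitrary: U)
  interpret L: noetherian_local_ring R \<mm> by (rule L)
  interpret mi: maximalideal \<mm> R by (rule L.maximal)
  interpret W: module R "vspace (regular_module R)" by (rule reg.vec_module_module)
  interpret W: rmodule R "vspace (regular_module R)" by unfold_locales
  let ?W = "vspace (regular_module R)"
  {
    case empty
    have "v = \<zero>\<^bsub>?W\<^esub>" if "v \<in> rvecs {}" for v using vecsD(2)[OF that] by auto
    then have "rvecs {} \<subseteq> U" using W.submodD(2)[OF empty(1)] by auto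
    then show ?case using empty by blast
  next
    case (insert i S)
    note us = W.submodD[OF insert.prems(1)]
    have uc: "u j \<in> carrier R" if "u \<in> U" for u j using vecsD(1)[of u "regular_module R" UNIV j] us(1)[OF that] by simp
    show ?case
    proof (cases "\<forall>u\<in>U. u i \<in> \<mm>")
      case True
      define w where "w j = (if j = i then \<one> else \<zero>)" for j
      have "(\<Oplus>j\<in>insert i S. w j \<otimes> u j) = u i" if u: "u \<in> U" for u
      proof -
        have "(\<Oplus>j\<in>insert i S. w j \<otimes> u j) = w i \<otimes> u i \<oplus> (\<Oplus>j\<in>S. w j \<otimes> u j)"
          by (rule finsum_insert) (use insert uc[OF u] in \<open>auto simp: w_def\<close>)
        also have "(\<Oplus>j\<in>S. w j \<otimes> u j) = \<zero>"
          by (rule add.finprod_one_eqI) (use insert uc[OF u] in \<open>auto simp: w_def\<close>)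
        finally show ?thesis using uc[OF u] by (simp add: w_def)
      qed
      then show ?thesis using True by (intro exI[of _ w]) (auto simp: w_def)
    next
      case False
      then obtain u0 where u0: "u0 \<in> U" "u0 i \<notin> \<mm>" by blast
      obtain b where b: "b \<in> carrier R" "b \<otimes> u0 i = \<one>" using local_ring_unit[OF L uc[OF u0(1)] u0(2)] by blast
      define u where "u = b \<odot>\<^bsub>?W\<^esub> u0"
      have u: "u \<in> U" "u i = \<one>" using us(6)[OF b(1) u0(1)] b(2) by (auto simp: u_def)
      have red: "z \<ominus>\<^bsub>?W\<^esub> z i \<odot>\<^bsub>?W\<^esub> u \<in> rvecs S" if z: "z \<in> rvecs (insert i S)" for z
      proof (rule vecsI_fin)
        have zi: "z i \<in> carrier R" using vecsD(1)[OF z] by simp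
        have uI: "u \<in> rvecs (insert i S)" using u(1) insert.prems(2) by blast
        have zu: "z i \<odot>\<^bsub>?W\<^esub> u \<in> rvecs UNIV" using reg.vecs_ops(5)[OF zi vecs_UNIV[OF uI]] .
        note zz = reg.vecs_ops(3)[OF z reg.vecs_ops(5)[OF zi uI]]
        show "(z \<ominus>\<^bsub>?W\<^esub> z i \<odot>\<^bsub>?W\<^esub> u) s \<in> carrier (regular_module R)" for s using vecsD(1)[OF zz] .
        show "(z \<ominus>\<^bsub>?W\<^esub> z i \<odot>\<^bsub>?W\<^esub> u) s = \<zero>\<^bsub>regular_module R\<^esub>" if "s \<notin> S" for s
        proof (cases "s = i")
          case True
          have "(z \<ominus>\<^bsub>?W\<^esub> z i \<odot>\<^bsub>?W\<^esub> u) i = z i \<ominus>\<^bsub>regular_module R\<^esub> (z i \<otimes> u i)"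
            using reg.vec_minus[OF vecs_UNIV[OF z] zu] by simp
          also have "\<dots> = \<zero>" using zi u(2) by (simp add: a_minus_def regular_neg r_neg)
          finally show ?thesis using True by simp
        next
          case False
          then show ?thesis using vecsD(2)[OF zz, of s] that by simp
        qed
      qed (rule insert.hyps(1))
      let ?U' = "U \<inter> rvecs S"
      have U': "submodule ?U' R ?W"
      proof (rule W.submoduleI)
        note rs = W.submodD[OF reg.vecs_submodule[of S]]
        show "?U' \<subseteq> carrier ?W" using us(1) by auto
      qed (use us reg.vecs_ops in auto)
      have "?U' \<noteq> rvecs S"
      proof
        assume e: "?U' = rvecs S"
        have "z \<in> U" if z: "z \<in> rvecs (insert i S)" for z
        proof -
          have zi: "z i \<in> carrier R" using vecsD(1)[OF z] by simp
          have 1: "z \<ominus>\<^bsub>?W\<^esub> z i \<odot>\<^bsub>?W\<^esub> u \<in> U" using red[OF z] e by blast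
          have 2: "z i \<odot>\<^bsub>?W\<^esub> u \<in> U" by (rule us(6)[OF zi u(1)])
          have "(z \<ominus>\<^bsub>?W\<^esub> z i \<odot>\<^bsub>?W\<^esub> u) \<oplus>\<^bsub>?W\<^esub> z i \<odot>\<^bsub>?W\<^esub> u = z"
            using vecs_UNIV[OF z] us(1)[OF 2] by (simp add: a_minus_def W.M.a_assoc W.M.l_neg)
          then show ?thesis using us(3)[OF 1 2] by simp
        qed
        then show False using insert.prems by blast
      qed
      then obtain w' i0 where w': "\<And>i. w' i \<in> carrier R" "i0 \<in> S" "w' i0 = \<one>"
        "\<And>u. u \<in> ?U' \<Longrightarrow> (\<Oplus>i\<in>S. w' i \<otimes> u i) \<in> \<mm>"
        using insert.IH[OF U'] by auto
      let ?p = "\<lambda>v. \<Oplus>j\<in>S. w' j \<otimes> v j"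
      have pc: "?p v \<in> carrier R" if "v \<in> rvecs UNIV" for v
        using vecsD(1)[OF that] w'(1) by (intro finsum_closed) auto
      define w where "w = w'(i := \<ominus> ?p u)"
      have uU: "u \<in> rvecs UNIV" using us(1)[OF u(1)] .
      have wc: "w j \<in> carrier R" for j using w'(1) pc[OF uU] by (simp add: w_def)
      have "(\<Oplus>j\<in>insert i S. w j \<otimes> z j) \<in> \<mm>" if z: "z \<in> U" for z
      proof -
        have zI: "z \<in> rvecs (insert i S)" using z insert.prems(2) by blast
        have zi: "z i \<in> carrier R" using uc[OF z] .
        have zU: "z \<in> rvecs UNIV" using us(1)[OF z] .
        have zuU: "z i \<odot>\<^bsub>?W\<^esub> u \<in> U" by (rule us(6)[OF zi u(1)])
        have mem: "?p (z \<ominus>\<^bsub>?W\<^esub> z i \<odot>\<^bsub>?W\<^esub> u) \<in> \<mm>"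
          by (rule w'(4)) (use red[OF zI] us(4)[OF z zuU] in blast)
        have uu: "u j \<in> carrier R" for j by (rule uc[OF u(1)])
        have zz: "z j \<in> carrier R" for j by (rule uc[OF z])
        have "?p (z \<ominus>\<^bsub>?W\<^esub> z i \<odot>\<^bsub>?W\<^esub> u) = (\<Oplus>j\<in>S. w' j \<otimes> z j \<oplus> (\<ominus> z i) \<otimes> (w' j \<otimes> u j))"
        proof (rule finsum_cong'[OF refl])
          fix j
          have "(z \<ominus>\<^bsub>?W\<^esub> z i \<odot>\<^bsub>?W\<^esub> u) j = z j \<ominus> z i \<otimes> u j"
            using reg.vec_minus[OF zU us(1)[OF zuU], of j] uu zz by (simp add: a_minus_def regular_neg)
          then show "w' j \<otimes> (z \<ominus>\<^bsub>?W\<^esub> z i \<odot>\<^bsub>?W\<^esub> u) j = w' j \<otimes> z j \<oplus> (\<ominus> z i) \<otimes> (w' j \<otimes> u j)"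
            using uu zz w'(1) by (simp add: a_minus_def r_distr l_minus r_minus m_lcomm)
        qed (use uu zz w'(1) in auto)
        also have "\<dots> = ?p z \<oplus> (\<Oplus>j\<in>S. (\<ominus> z i) \<otimes> (w' j \<otimes> u j))"
          by (rule finsum_addf) (use uu zz w'(1) in auto)
        also have "(\<Oplus>j\<in>S. (\<ominus> z i) \<otimes> (w' j \<otimes> u j)) = (\<ominus> z i) \<otimes> ?p u"
          by (rule finsum_rdistr[symmetric]) (use uu zz w'(1) insert.hyps(1) in auto)
        finally have e: "?p (z \<ominus>\<^bsub>?W\<^esub> z i \<odot>\<^bsub>?W\<^esub> u) = ?p z \<oplus> (\<ominus> z i) \<otimes> ?p u" .
        have "(\<Oplus>j\<in>insert i S. w j \<otimes> z j) = w i \<otimes> z i \<oplus> (\<Oplus>j\<in>S. w j \<otimes> z j)"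
          by (rule finsum_insert) (use insert.hyps wc zz in auto)
        also have "(\<Oplus>j\<in>S. w j \<otimes> z j) = ?p z"
          by (rule finsum_cong') (use insert.hyps w'(1) zz in \<open>auto simp: w_def\<close>)
        also have "w i \<otimes> z i \<oplus> ?p z = ?p z \<oplus> (\<ominus> z i) \<otimes> ?p u"
          using zi pc[OF uU] pc[OF zU] by (simp add: w_def l_minus r_minus m_comm a_comm)
        finally show ?thesis using mem e by simp
      qed
      moreover have "w i0 = \<one>" using w'(2,3) insert.hyps(2) by (auto simp: w_def)
      ultimately show ?thesis using wc w'(2) by blast
    qed
  }
qed

text \<open>
  A linear form with a coefficient \<open>\<one>\<close> maps the proper image of \<open>(A, B)\<close> over
  \<open>R\<close> into \<open>\<mm>\<close>. On families in \<open>M\<close> it maps the image of \<open>(A, B)\<close>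
  into \<open>\<mm>M\<close> but is onto \<open>M\<close>, and \<open>\<mm>M \<noteq> M\<close>.
\<close>

lemma (in rmodule) base_change_not_surjective:
  assumes L: "noetherian_local_ring R \<mm>" and ys: "set ys \<subseteq> carrier R" "\<mm> = Idl (set ys)"
    and nm: "smult_sum M {\<zero>\<^bsub>M\<^esub>} ys \<noteq> carrier M"
    and S: "finite S" and A: "A \<in> Mat R S T" and B: "B \<in> Mat R S T'" and T: "finite T" "finite T'"
    and v0: "v0 \<in> vecs (regular_module R) S"
      "\<And>a b. a \<in> vecs (regular_module R) T \<Longrightarrow> b \<in> vecs (regular_module R) T' \<Longrightarrow>
        v0 \<noteq> rlin R A a \<oplus>\<^bsub>vspace (regular_module R)\<^esub> rlin R B b"
  shows "\<exists>v\<in>vecs M S. \<forall>a\<in>vecs M T. \<forall>b\<in>vecs M T'. v \<noteq> lin M A a \<oplus>\<^bsub>vspace M\<^esub> lin M B b"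
proof -
  interpret RW: module R "vspace (regular_module R)" by (rule R.reg.vec_module_module)
  interpret RW: rmodule R "vspace (regular_module R)" by unfold_locales
  interpret W: module R "vspace M" by (rule vec_module_module)
  let ?rl = "rlin R" and ?rW = "vspace (regular_module R)" and ?W = "vspace M"
  let ?U = "{u \<oplus>\<^bsub>?rW\<^esub> v |u v. u \<in> ?rl A ` R.rvecs T \<and> v \<in> ?rl B ` R.rvecs T'}"
  have U: "submodule ?U R ?rW"
    by (rule RW.submodule_sum[OF R.reg.lin_image_submodule[OF A] R.reg.lin_image_submodule[OF B]])
  have US: "?U \<subseteq> R.rvecs S"
    using R.reg.vecs_ops(2) R.reg.lin_closed[OF _ A] R.reg.lin_closed[OF _ B] by blast
  have "v0 \<notin> ?U" using v0(2) by blast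
  then have "?U \<noteq> R.rvecs S" using v0(1) by blast
  then obtain w i0 where w: "\<And>i. w i \<in> carrier R" "i0 \<in> S" "w i0 = \<one>"
    "\<And>u. u \<in> ?U \<Longrightarrow> (\<Oplus>i\<in>S. w i \<otimes> u i) \<in> \<mm>"
    using R.proper_submodule_functional[OF L S U US] by blast
  define Wm where "Wm = (\<lambda>(_::unit) i. if i \<in> S then w i else \<zero>)"
  have Wm: "Wm \<in> Mat R UNIV S" by (rule MatI_fin) (use w S in \<open>auto simp: Wm_def\<close>)
  have Wmu: "?rl Wm u () \<in> \<mm>" if u: "u \<in> ?U" for u
  proof -
    have uS: "u \<in> R.rvecs S" using u US by blast
    have "?rl Wm u () = (\<Oplus>\<^bsub>regular_module R\<^esub>i\<in>S. Wm () i \<odot>\<^bsub>regular_module R\<^esub> u i)"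
      by (rule R.reg.lin_eq'[OF uS Wm S]) (use vecsD(4)[OF uS] in auto)
    also have "\<dots> = (\<Oplus>i\<in>S. w i \<otimes> u i)" unfolding R.reg.finsum_regular
      by (rule R.finsum_cong') (use vecsD(1)[OF uS] w(1) in \<open>auto simp: Wm_def\<close>)
    finally show ?thesis using w(4)[OF u] by simp
  qed
  let ?N = "smult_sum M {\<zero>\<^bsub>M\<^esub>} ys"
  note p = smult_sum_props[OF zero_submodule ys(1)]
  note n = submodD[OF p(1)]
  have mN: "a \<odot>\<^bsub>M\<^esub> b \<in> ?N" if "a \<in> \<mm>" "b \<in> carrier M" for a b
  proof -
    have Ic: "Idl (set ys) \<subseteq> carrier R" using ideal.Icarr[OF R.genideal_ideal[OF ys(1)]] by auto
    have "{a \<odot>\<^bsub>M\<^esub> x |a x. a \<in> Idl (set ys) \<and> x \<in> carrier M} \<subseteq> carrier M" using Ic by auto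
    from submodule_span_props(2)[OF this]
    have "{a \<odot>\<^bsub>M\<^esub> x |a x. a \<in> Idl (set ys) \<and> x \<in> carrier M} \<subseteq> ?N"
      unfolding ideal_smult_eq[OF ys(1), symmetric] ideal_smult_def .
    then show ?thesis using that ys(2) by blast
  qed
  have ent: "lin M Wm (lin M C a) () \<in> ?N" if C: "C \<in> Mat R S Z" and Z: "finite Z" and a: "a \<in> vecs M Z"
    and im: "\<And>b. b \<in> R.rvecs Z \<Longrightarrow> ?rl C b \<in> ?U" for C Z a
  proof -
    have "mm R Wm C () k \<in> \<mm>" for k
    proof -
      have "mm R Wm C () k = ?rl Wm (\<lambda>i. C i k) ()" by (simp add: mm_def)
      moreover have "(\<lambda>i. C i k) \<in> ?U"
        using im[OF col_vecs[OF R.Mat_mid[OF Z]]] R.lin_basis[OF C Z] by simp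
      ultimately show ?thesis using Wmu by simp
    qed
    then have t: "mm R Wm C () k \<odot>\<^bsub>M\<^esub> a k \<in> ?N" for k using mN vecsD(1)[OF a] by blast
    have fin: "(\<Oplus>\<^bsub>M\<^esub>k\<in>K. f k) \<in> ?N" if "finite K" "\<And>k. f k \<in> ?N" for K f
      using that(1)
    proof (induction K)
      case (insert k K)
      then show ?case using that(2) n(1,3) by (subst M.finsum_insert) auto
    qed (simp add: n(2))
    have "lin M (mm R Wm C) a () \<in> ?N" unfolding lin_def by (rule fin[OF vecsD(3)[OF a] t])
    then show ?thesis by (simp add: lin_mm[OF vecs_UNIV[OF a] Wm C])
  qed
  obtain b0 where b0: "b0 \<in> carrier M" "b0 \<notin> ?N" using nm n(1) by blast
  define v where "v = (\<lambda>i. if i = i0 then b0 else \<zero>\<^bsub>M\<^esub>)"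
  have v: "v \<in> vecs M S" by (rule vecsI_fin) (use b0 w(2) S in \<open>auto simp: v_def\<close>)
  have "lin M Wm v () = (\<Oplus>\<^bsub>M\<^esub>i\<in>{i0}. Wm () i \<odot>\<^bsub>M\<^esub> v i)"
    by (rule lin_eq'[OF v Wm]) (auto simp: v_def)
  also have "\<dots> = b0" using b0 w by (simp add: v_def Wm_def)
  finally have Wv: "lin M Wm v () = b0" .
  show ?thesis
  proof (rule bexI[OF _ v], intro ballI notI)
    fix a b assume a: "a \<in> vecs M T" and b: "b \<in> vecs M T'" and e: "v = lin M A a \<oplus>\<^bsub>?W\<^esub> lin M B b"
    have "?rl A x \<in> ?U" if x: "x \<in> R.rvecs T" for x
    proof -
      have "?rl A x = ?rl A x \<oplus>\<^bsub>?rW\<^esub> \<zero>\<^bsub>?rW\<^esub>"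
        using R.reg.lin_zero_sum vecs_UNIV[OF R.reg.lin_closed[OF x A]] by simp
      moreover have "\<zero>\<^bsub>?rW\<^esub> \<in> ?rl B ` R.rvecs T'" using RW.submodD(2)[OF R.reg.lin_image_submodule[OF B]] .
      ultimately show ?thesis using x by blast
    qed
    moreover have "?rl B x \<in> ?U" if x: "x \<in> R.rvecs T'" for x
    proof -
      have "?rl B x = \<zero>\<^bsub>?rW\<^esub> \<oplus>\<^bsub>?rW\<^esub> ?rl B x"
        using R.reg.lin_zero_sum vecs_UNIV[OF R.reg.lin_closed[OF x B]] by simp
      moreover have "\<zero>\<^bsub>?rW\<^esub> \<in> ?rl A ` R.rvecs T" using RW.submodD(2)[OF R.reg.lin_image_submodule[OF A]] .
      ultimately show ?thesis using x by blast
    qed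
    ultimately have "lin M Wm (lin M A a) () \<in> ?N" "lin M Wm (lin M B b) () \<in> ?N"
      using ent[OF A T(1) a] ent[OF B T(2) b] by blast+
    moreover have "b0 = lin M Wm (lin M A a) () \<oplus>\<^bsub>M\<^esub> lin M Wm (lin M B b) ()"
      using Wv lin_add[OF vecs_UNIV[OF lin_closed[OF a A]] vecs_UNIV[OF lin_closed[OF b B]] Wm] by (simp add: e)
    ultimately show False using n(3) b0(2) by simp
  qed
qed

section \<open>Tensor products with cokernels of matrices\<close>

lemma (in rmodule) submoduleI_smult:
  assumes "H \<subseteq> carrier M" "\<zero>\<^bsub>M\<^esub> \<in> H" "\<And>a b. a \<in> H \<Longrightarrow> b \<in> H \<Longrightarrow> a \<oplus>\<^bsub>M\<^esub> b \<in> H"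
    "\<And>a x. a \<in> carrier R \<Longrightarrow> x \<in> H \<Longrightarrow> a \<odot>\<^bsub>M\<^esub> x \<in> H"
  shows "submodule H R M"
proof (rule submoduleI)
  fix a assume a: "a \<in> H"
  then have "\<ominus>\<^bsub>M\<^esub> a = (\<ominus> \<one>) \<odot>\<^bsub>M\<^esub> a" using assms(1) smult_l_minus[of \<one> a] by auto
  then show "\<ominus>\<^bsub>M\<^esub> a \<in> H" using assms(4)[of "\<ominus> \<one>" a] a by simp
qed (use assms in auto)

lemma (in rmodule) vec_submodule_restrict:
  assumes U: "submodule U R (vspace M)" "U \<subseteq> vecs M S"
  shows "submodule U R (vec_module M S)"
proof -
  interpret W: module R "vspace M" by (rule vec_module_module)
  interpret W: rmodule R "vspace M" by unfold_locales
  interpret V: module R "vec_module M S" by (rule vec_module_module)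
  interpret V: rmodule R "vec_module M S" by unfold_locales
  note u = W.submodD[OF U(1)]
  have ops: "\<zero>\<^bsub>vec_module M S\<^esub> = \<zero>\<^bsub>vspace M\<^esub>" "x \<oplus>\<^bsub>vec_module M S\<^esub> y = x \<oplus>\<^bsub>vspace M\<^esub> y"
    "a \<odot>\<^bsub>vec_module M S\<^esub> x = a \<odot>\<^bsub>vspace M\<^esub> x" for a x y
    by (simp_all add: vec_module_def)
  show ?thesis by (rule V.submoduleI_smult) (use u U(2) in \<open>auto simp: ops\<close>)
qed

lemma finsum_hom:
  assumes "rmodule R M" "rmodule R N"
    and h: "\<And>x. x \<in> carrier M \<Longrightarrow> h x \<in> carrier N" "\<And>x y. x \<in> carrier M \<Longrightarrow> y \<in> carrier M \<Longrightarrow> h (x \<oplus>\<^bsub>M\<^esub> y) = h x \<oplus>\<^bsub>N\<^esub> h y"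
      "h \<zero>\<^bsub>M\<^esub> = \<zero>\<^bsub>N\<^esub>"
    and A: "finite A" "\<And>i. i \<in> A \<Longrightarrow> f i \<in> carrier M"
  shows "h (finsum M f A) = (\<Oplus>\<^bsub>N\<^esub>i\<in>A. h (f i))"
  using A
proof (induction A)
  interpret m: rmodule R M by fact
  interpret n: rmodule R N by fact
  {
    case empty
    then show ?case by (simp add: h(3))
  next
    case (insert i A)
    then have "f \<in> A \<rightarrow> carrier M" "f i \<in> carrier M" by auto
    moreover have "(\<lambda>i. h (f i)) \<in> A \<rightarrow> carrier N" using insert h(1) by auto
    ultimately show ?case using insert h by (simp add: m.M.finsum_insert n.M.finsum_insert m.M.finsum_closed)
  }
qed

lemma mod_homD:
  assumes "h \<in> mod_hom R M N"
  shows "x \<in> carrier M \<Longrightarrow> h x \<in> carrier N"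
    "x \<in> carrier M \<Longrightarrow> y \<in> carrier M \<Longrightarrow> h (x \<oplus>\<^bsub>M\<^esub> y) = h x \<oplus>\<^bsub>N\<^esub> h y"
    "a \<in> carrier R \<Longrightarrow> x \<in> carrier M \<Longrightarrow> h (a \<odot>\<^bsub>M\<^esub> x) = a \<odot>\<^bsub>N\<^esub> h x"
  using assms by (auto simp: mod_hom_def)

lemma mod_hom_zero:
  assumes "rmodule R M" "rmodule R N" "h \<in> mod_hom R M N"
  shows "h \<zero>\<^bsub>M\<^esub> = \<zero>\<^bsub>N\<^esub>"
proof -
  interpret m: rmodule R M by fact
  interpret n: rmodule R N by fact
  show ?thesis
    using mod_homD(3)[OF assms(3), of "\<zero>\<^bsub>R\<^esub>" "\<zero>\<^bsub>M\<^esub>"] mod_homD(1)[OF assms(3), of "\<zero>\<^bsub>M\<^esub>"] by simp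
qed

context cring
begin

lemma basis_elt_vec: "s \<in> S \<Longrightarrow> basis_elt R s \<in> rvecs S"
  by (rule vecsI) (auto simp: basis_elt_def)

lemma free_module_rmodule: "rmodule R (free_module R S)"
  unfolding vec_module_regular[symmetric] rmodule_def by (rule reg.vec_module_module)

lemma free_module_ops:
  "carrier (free_module R S) = rvecs S"
  "(f \<oplus>\<^bsub>free_module R S\<^esub> g) = (\<lambda>s. f s \<oplus> g s)" "\<zero>\<^bsub>free_module R S\<^esub> = (\<lambda>s. \<zero>)"
  "(a \<odot>\<^bsub>free_module R S\<^esub> f) = (\<lambda>s. a \<otimes> f s)"
  by (simp_all add: vec_module_regular[symmetric]) (simp_all add: vec_module_def)

lemma free_hom_expand:
  assumes P: "rmodule R P" and h: "h \<in> mod_hom R (free_module R S) P" and S: "finite S" and u: "u \<in> rvecs S"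
  shows "h u = (\<Oplus>\<^bsub>P\<^esub>i\<in>S. u i \<odot>\<^bsub>P\<^esub> h (basis_elt R i))"
proof -
  interpret P: rmodule R P by (rule P)
  note hD = mod_homD[OF h, unfolded free_module_ops]
  have uc: "u i \<in> carrier R" for i using vecsD(1)[OF u] by simp
  have hb: "h (basis_elt R i) \<in> carrier P" if "i \<in> S" for i using hD(1) basis_elt_vec[OF that] .
  have part: "h (\<lambda>i. if i \<in> A then u i else \<zero>) = (\<Oplus>\<^bsub>P\<^esub>i\<in>A. u i \<odot>\<^bsub>P\<^esub> h (basis_elt R i))" if "A \<subseteq> S" for A
  proof -
    have "finite A" using that S finite_subset by blast
    then show ?thesis using that
    proof (induction A)
      case empty
      then show ?case using mod_hom_zero[OF free_module_rmodule P h] by (simp add: free_module_ops)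
    next
      case (insert i A)
      have c1: "(\<lambda>j. if j \<in> A then u j else \<zero>) \<in> rvecs S"
        by (rule vecsI_fin) (use uc insert S in auto)
      have c2: "(\<lambda>s. u i \<otimes> basis_elt R i s) \<in> rvecs S"
        by (rule vecsI_fin) (use uc insert S in \<open>auto simp: basis_elt_def\<close>)
      have "(\<lambda>j. if j \<in> insert i A then u j else \<zero>) = (\<lambda>s. (u i \<otimes> basis_elt R i s) \<oplus> (if s \<in> A then u s else \<zero>))"
        using insert(2) uc by (auto simp: basis_elt_def fun_eq_iff)
      then have "h (\<lambda>j. if j \<in> insert i A then u j else \<zero>) = u i \<odot>\<^bsub>P\<^esub> h (basis_elt R i) \<oplus>\<^bsub>P\<^esub> h (\<lambda>s. if s \<in> A then u s else \<zero>)"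
        using hD(2)[OF c2 c1] hD(3)[OF uc[of i] basis_elt_vec[of i S]] insert.prems by simp
      also have "\<dots> = (\<Oplus>\<^bsub>P\<^esub>i\<in>insert i A. u i \<odot>\<^bsub>P\<^esub> h (basis_elt R i))"
        using insert uc hb by (subst P.M.finsum_insert) (auto simp: subset_iff)
      finally show ?case .
    qed
  qed
  have "(\<lambda>i. if i \<in> S then u i else \<zero>) = u" using vecsD(2)[OF u] by auto
  then show ?thesis using part[OF order_refl] by simp
qed

lemma free_module_universal:
  assumes P: "rmodule R P" and g: "\<And>s. s \<in> S \<Longrightarrow> g s \<in> carrier P"
  shows "\<exists>h\<in>mod_hom R (free_module R S) P. \<forall>s\<in>S. h (basis_elt R s) = g s"
proof -
  interpret P: rmodule R P by (rule P)
  define h where "h f = (\<Oplus>\<^bsub>P\<^esub>s\<in>{s. f s \<noteq> \<zero>}. f s \<odot>\<^bsub>P\<^esub> g s)" for f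
  have sup: "h f = (\<Oplus>\<^bsub>P\<^esub>s\<in>A. f s \<odot>\<^bsub>P\<^esub> g s)" if f: "f \<in> rvecs S" and A: "finite A" "{s. f s \<noteq> \<zero>} \<subseteq> A" "A \<subseteq> S" for f A
    unfolding h_def
  proof (rule P.M.add.finprod_mono_neutral_cong_left)
    show "f i \<odot>\<^bsub>P\<^esub> g i = \<zero>\<^bsub>P\<^esub>" if "i \<in> A - {s. f s \<noteq> \<zero>}" for i using that g A(3) by auto
    show "(\<lambda>s. f s \<odot>\<^bsub>P\<^esub> g s) \<in> A \<rightarrow> carrier P" using g vecsD(1)[OF f] A(3) by auto
  qed (use A in auto)
  have supp: "finite {s. f s \<noteq> \<zero>}" "{s. f s \<noteq> \<zero>} \<subseteq> S" if "f \<in> rvecs S" for f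
    using vecsD(3,4)[OF that] by auto
  have "h \<in> mod_hom R (free_module R S) P"
    unfolding mod_hom_def free_module_ops
  proof (intro CollectI conjI ballI funcsetI)
    fix x assume x: "x \<in> rvecs S"
    note xc = vecsD(1)[OF x, unfolded regular_simps]
    show "h x \<in> carrier P" unfolding h_def by (rule P.M.finsum_closed) (use xc g supp(2)[OF x] in auto)
    show "h (\<lambda>s. a \<otimes> x s) = a \<odot>\<^bsub>P\<^esub> h x" if a: "a \<in> carrier R" for a
    proof -
      have ax: "(\<lambda>s. a \<otimes> x s) \<in> rvecs S"
      proof -
        interpret F: rmodule R "free_module R S" by (rule free_module_rmodule)
        show ?thesis using F.smult_closed[of a x] a x by (simp add: free_module_ops)
      qed
      have "h (\<lambda>s. a \<otimes> x s) = (\<Oplus>\<^bsub>P\<^esub>s\<in>{s. x s \<noteq> \<zero>}. (a \<otimes> x s) \<odot>\<^bsub>P\<^esub> g s)"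
        by (rule sup[OF ax supp(1)[OF x] _ supp(2)[OF x]]) (use a in auto)
      also have "\<dots> = (\<Oplus>\<^bsub>P\<^esub>s\<in>{s. x s \<noteq> \<zero>}. a \<odot>\<^bsub>P\<^esub> (x s \<odot>\<^bsub>P\<^esub> g s))"
        by (rule P.M.finsum_cong') (use a xc g supp(2)[OF x] in \<open>auto simp: P.smult_assoc1 subset_iff\<close>)
      also have "\<dots> = a \<odot>\<^bsub>P\<^esub> h x" unfolding h_def
        by (rule P.finsum_smult_ldistr[symmetric]) (use a xc g supp[OF x] in auto)
      finally show ?thesis .
    qed
    fix y assume y: "y \<in> rvecs S"
    note yc = vecsD(1)[OF y, unfolded regular_simps]
    have xy: "(\<lambda>s. x s \<oplus> y s) \<in> rvecs S"
    proof -
      interpret F: rmodule R "free_module R S" by (rule free_module_rmodule)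
      show ?thesis using F.M.a_closed[of x y] x y by (simp add: free_module_ops)
    qed
    let ?A = "{s. x s \<noteq> \<zero>} \<union> {s. y s \<noteq> \<zero>}"
    have A: "finite ?A" "?A \<subseteq> S" using supp[OF x] supp[OF y] by auto
    have gA: "g s \<in> carrier P" if "s \<in> ?A" for s using g A(2) that by blast
    have "h (\<lambda>s. x s \<oplus> y s) = (\<Oplus>\<^bsub>P\<^esub>s\<in>?A. (x s \<oplus> y s) \<odot>\<^bsub>P\<^esub> g s)"
      by (rule sup[OF xy A(1) _ A(2)]) auto
    also have "\<dots> = (\<Oplus>\<^bsub>P\<^esub>s\<in>?A. x s \<odot>\<^bsub>P\<^esub> g s \<oplus>\<^bsub>P\<^esub> y s \<odot>\<^bsub>P\<^esub> g s)"
      by (rule P.M.finsum_cong'[OF refl]) (use xc yc gA in \<open>auto simp: P.smult_l_distr\<close>)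
    also have "\<dots> = (\<Oplus>\<^bsub>P\<^esub>s\<in>?A. x s \<odot>\<^bsub>P\<^esub> g s) \<oplus>\<^bsub>P\<^esub> (\<Oplus>\<^bsub>P\<^esub>s\<in>?A. y s \<odot>\<^bsub>P\<^esub> g s)"
      by (rule P.M.finsum_addf) (use xc yc gA in auto)
    also have "\<dots> = h x \<oplus>\<^bsub>P\<^esub> h y" using sup[OF x A(1) _ A(2)] sup[OF y A(1) _ A(2)] by simp
    finally show "h (\<lambda>s. x s \<oplus> y s) = h x \<oplus>\<^bsub>P\<^esub> h y" .
  qed
  moreover have "h (basis_elt R s) = g s" if s: "s \<in> S" for s
  proof -
    have "h (basis_elt R s) = (\<Oplus>\<^bsub>P\<^esub>t\<in>{s}. basis_elt R s t \<odot>\<^bsub>P\<^esub> g t)"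
      by (rule sup[OF basis_elt_vec[OF s]]) (use s in \<open>auto simp: basis_elt_def\<close>)
    then show ?thesis using g[OF s] by (simp add: basis_elt_def)
  qed
  ultimately show ?thesis by blast
qed

end

locale tensor = M: rmodule R M + N: rmodule R N
  for R :: "('a, 'c) ring_scheme" (structure) and M :: "('a, 'm) module" and N :: "('a, 'n) module"
begin

abbreviation "F \<equiv> free_module R (carrier M \<times> carrier N)"
definition "J = submodule_span R F (bilinear_relations R M N)"
definition "pure x y = J +>\<^bsub>F\<^esub> basis_elt R (x, y)"

lemma F: "rmodule R F"
  by (rule M.R.free_module_rmodule)

lemma e_closed: "x \<in> carrier M \<Longrightarrow> y \<in> carrier N \<Longrightarrow> basis_elt R (x, y) \<in> carrier F"
  unfolding M.R.free_module_ops by (rule M.R.basis_elt_vec) simp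

lemma relations_closed: "bilinear_relations R M N \<subseteq> carrier F"
proof -
  interpret F: rmodule R F by (rule F)
  show ?thesis
    unfolding bilinear_relations_def Let_def
    by (auto intro!: F.M.minus_closed F.M.a_closed F.smult_closed e_closed)
qed

lemma J: "submodule J R F" "bilinear_relations R M N \<subseteq> J"
proof -
  interpret F: rmodule R F by (rule F)
  show "submodule J R F" "bilinear_relations R M N \<subseteq> J"
    using F.submodule_span_props[OF relations_closed] by (auto simp: J_def)
qed

lemma tensor_eq: "tensor_module R M N = quot_module F J"
  by (simp add: tensor_module_def J_def Let_def)

lemma tensor_rmodule: "rmodule R (tensor_module R M N)"
proof -
  interpret F: rmodule R F by (rule F)
  show ?thesis unfolding tensor_eq rmodule_def by (rule F.quot_module_module[OF J(1)])
qed

lemma pure_closed: "x \<in> carrier M \<Longrightarrow> y \<in> carrier N \<Longrightarrow> pure x y \<in> carrier (tensor_module R M N)"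
proof -
  interpret F: rmodule R F by (rule F)
  show "x \<in> carrier M \<Longrightarrow> y \<in> carrier N \<Longrightarrow> pure x y \<in> carrier (tensor_module R M N)"
    unfolding tensor_eq F.quot_carrier pure_def using e_closed by blast
qed

lemma pure_bilinear:
  assumes x: "x \<in> carrier M" and y: "y \<in> carrier N"
  shows "x' \<in> carrier M \<Longrightarrow> pure (x \<oplus>\<^bsub>M\<^esub> x') y = pure x y \<oplus>\<^bsub>tensor_module R M N\<^esub> pure x' y"
    "y' \<in> carrier N \<Longrightarrow> pure x (y \<oplus>\<^bsub>N\<^esub> y') = pure x y \<oplus>\<^bsub>tensor_module R M N\<^esub> pure x y'"
    "a \<in> carrier R \<Longrightarrow> pure (a \<odot>\<^bsub>M\<^esub> x) y = a \<odot>\<^bsub>tensor_module R M N\<^esub> pure x y"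
    "a \<in> carrier R \<Longrightarrow> pure x (a \<odot>\<^bsub>N\<^esub> y) = a \<odot>\<^bsub>tensor_module R M N\<^esub> pure x y"
proof -
  interpret F: rmodule R F by (rule F)
  note ec = e_closed and ce = F.coset_eq_iff[OF J(1)]
  have rel: "r \<in> bilinear_relations R M N \<Longrightarrow> r \<in> J" for r using J(2) by blast
  note b = bilinear_relations_def[of R M N, unfolded Let_def]
  show "pure (x \<oplus>\<^bsub>M\<^esub> x') y = pure x y \<oplus>\<^bsub>tensor_module R M N\<^esub> pure x' y" if x': "x' \<in> carrier M"
  proof -
    have "basis_elt R (x \<oplus>\<^bsub>M\<^esub> x', y) \<ominus>\<^bsub>F\<^esub> (basis_elt R (x, y) \<oplus>\<^bsub>F\<^esub> basis_elt R (x', y)) \<in> J"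
      by (rule rel, unfold b) (use x x' y in blast)
    then show ?thesis using ec x x' y
      by (simp add: pure_def tensor_eq F.quot_add[OF J(1)] ce)
  qed
  show "pure x (y \<oplus>\<^bsub>N\<^esub> y') = pure x y \<oplus>\<^bsub>tensor_module R M N\<^esub> pure x y'" if y': "y' \<in> carrier N"
  proof -
    have "basis_elt R (x, y \<oplus>\<^bsub>N\<^esub> y') \<ominus>\<^bsub>F\<^esub> (basis_elt R (x, y) \<oplus>\<^bsub>F\<^esub> basis_elt R (x, y')) \<in> J"
      by (rule rel, unfold b) (use x y' y in blast)
    then show ?thesis using ec x y' y
      by (simp add: pure_def tensor_eq F.quot_add[OF J(1)] ce)
  qed
  show "pure (a \<odot>\<^bsub>M\<^esub> x) y = a \<odot>\<^bsub>tensor_module R M N\<^esub> pure x y" if a: "a \<in> carrier R"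
  proof -
    have "basis_elt R (a \<odot>\<^bsub>M\<^esub> x, y) \<ominus>\<^bsub>F\<^esub> a \<odot>\<^bsub>F\<^esub> basis_elt R (x, y) \<in> J"
      by (rule rel, unfold b) (use x a y in blast)
    then show ?thesis using ec x a y
      by (simp add: pure_def tensor_eq F.quot_smult[OF J(1)] ce)
  qed
  show "pure x (a \<odot>\<^bsub>N\<^esub> y) = a \<odot>\<^bsub>tensor_module R M N\<^esub> pure x y" if a: "a \<in> carrier R"
  proof -
    have "basis_elt R (x, a \<odot>\<^bsub>N\<^esub> y) \<ominus>\<^bsub>F\<^esub> a \<odot>\<^bsub>F\<^esub> basis_elt R (x, y) \<in> J"
      by (rule rel, unfold b) (use x a y in blast)
    then show ?thesis using ec x a y
      by (simp add: pure_def tensor_eq F.quot_smult[OF J(1)] ce)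
  qed
qed

lemma pure_zero_right: "x \<in> carrier M \<Longrightarrow> pure x \<zero>\<^bsub>N\<^esub> = \<zero>\<^bsub>tensor_module R M N\<^esub>"
proof -
  assume x: "x \<in> carrier M"
  interpret T: rmodule R "tensor_module R M N" by (rule tensor_rmodule)
  show ?thesis using pure_bilinear(4)[OF x N.M.zero_closed M.R.zero_closed] pure_closed[OF x N.M.zero_closed] by simp
qed

end

lemma (in cring) free_image_submodule:
  assumes D: "D \<in> Mat R S T"
  shows "submodule (rlin R D ` rvecs T) R (free_module R S)"
  unfolding vec_module_regular[symmetric]
  by (rule reg.vec_submodule_restrict[OF reg.lin_image_submodule[OF D]]) (use reg.lin_closed[OF _ D] in auto)

lemma (in rmodule) lin_outer:
  assumes D: "D \<in> Mat R S T" and t: "t \<in> vecs (regular_module R) T" and b: "b \<in> carrier M"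
  shows "(\<lambda>k. t k \<odot>\<^bsub>M\<^esub> b) \<in> vecs M T"
    "lin M D (\<lambda>k. t k \<odot>\<^bsub>M\<^esub> b) = (\<lambda>i. rlin R D t i \<odot>\<^bsub>M\<^esub> b)"
proof -
  have tc: "t k \<in> carrier R" for k using vecsD(1)[OF t] by simp
  let ?K = "{k. t k \<noteq> \<zero>}"
  have K: "finite ?K" using vecsD(3)[OF t] by simp
  show tb: "(\<lambda>k. t k \<odot>\<^bsub>M\<^esub> b) \<in> vecs M T"
  proof (rule vecsI)
    show "finite {s. t s \<odot>\<^bsub>M\<^esub> b \<noteq> \<zero>\<^bsub>M\<^esub>}" by (rule finite_subset[OF _ K]) (use b in auto)
    show "t s \<odot>\<^bsub>M\<^esub> b = \<zero>\<^bsub>M\<^esub>" if "s \<notin> T" for s using vecsD(2)[OF t that] b by simp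
  qed (use tc b in auto)
  show "lin M D (\<lambda>k. t k \<odot>\<^bsub>M\<^esub> b) = (\<lambda>i. rlin R D t i \<odot>\<^bsub>M\<^esub> b)"
  proof (rule ext)
    fix i
    have "lin M D (\<lambda>k. t k \<odot>\<^bsub>M\<^esub> b) i = (\<Oplus>\<^bsub>M\<^esub>k\<in>?K. D i k \<odot>\<^bsub>M\<^esub> (t k \<odot>\<^bsub>M\<^esub> b))"
      by (rule lin_eq'[OF tb D K]) (use b in auto)
    also have "\<dots> = (\<Oplus>\<^bsub>M\<^esub>k\<in>?K. (D i k \<otimes> t k) \<odot>\<^bsub>M\<^esub> b)"
      by (rule M.finsum_cong') (use MatD(1)[OF D] tc b in \<open>auto simp: smult_assoc1\<close>)
    also have "\<dots> = (\<Oplus>k\<in>?K. D i k \<otimes> t k) \<odot>\<^bsub>M\<^esub> b"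
      by (rule finsum_smult_rdistr[symmetric]) (use MatD(1)[OF D] tc b K in auto)
    finally show "lin M D (\<lambda>k. t k \<odot>\<^bsub>M\<^esub> b) i = rlin R D t i \<odot>\<^bsub>M\<^esub> b"
      by (simp add: lin_def R.reg.finsum_regular)
  qed
qed

text \<open>
  The module \<open>M \<otimes> coker D\<close> is the cokernel of \<open>D\<close> on families in \<open>M\<close>. The
  proof uses two halves of this isomorphism. The family \<open>v\<close> has the image
  \<open>f = \<Sum>\<^sub>i v\<^sub>i \<otimes> e\<^sub>i\<close>, which lies in the socle and thus is zero. A map
  \<open>\<Psi>\<close> in the opposite direction, defined on the free module underlying the tensor product, sends the
  relations to the image of \<open>D\<close> and \<open>f\<close> to \<open>v\<close> modulo that image.
\<close>

lemma (in rmodule) tensor_cokernel_socle: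
  fixes S :: "'s set" and T :: "'t set"
  assumes D: "D \<in> Mat R S T" and S: "finite S"
  defines "U \<equiv> rlin R D ` vecs (regular_module R) T"
  defines "N \<equiv> quot_module (free_module R S) U"
  assumes soc: "socle \<mm> (tensor_module R M N) = {\<zero>\<^bsub>tensor_module R M N\<^esub>}" and mR: "\<mm> \<subseteq> carrier R"
    and v: "v \<in> vecs M S" and mv: "\<And>a. a \<in> \<mm> \<Longrightarrow> a \<odot>\<^bsub>vspace M\<^esub> v \<in> lin M D ` vecs M T"
  shows "v \<in> lin M D ` vecs M T"
proof -
  interpret P: rmodule R "free_module R S" by (rule R.free_module_rmodule)
  note Us = R.free_image_submodule[OF D, folded U_def]
  interpret N: rmodule R N unfolding rmodule_def N_def by (rule P.quot_module_module[OF Us])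
  interpret tensor R M N ..
  interpret T: rmodule R "tensor_module R M N" by (rule tensor_rmodule)
  interpret F: rmodule R F by (rule F)
  interpret W: module R "vspace M" by (rule vec_module_module)
  interpret W: rmodule R "vspace M" by unfold_locales
  let ?T = "tensor_module R M N" and ?W = "vspace M" and ?P = "free_module R S"
  define c where "c u = U +>\<^bsub>?P\<^esub> u" for u
  have cN: "c u \<in> carrier N" if "u \<in> R.rvecs S" for u
    unfolding N_def P.quot_carrier c_def using that by (auto simp: R.free_module_ops)
  have ec: "c (basis_elt R i) \<in> carrier N" if "i \<in> S" for i using cN R.basis_elt_vec[OF that] by blast
  have gam: "(\<lambda>u. pure b (c u)) \<in> mod_hom R ?P ?T" if b: "b \<in> carrier M" for b
    unfolding mod_hom_def
  proof (intro CollectI conjI ballI funcsetI)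
    fix x assume x: "x \<in> carrier ?P"
    then have xN: "c x \<in> carrier N" using cN by (simp add: R.free_module_ops(1))
    show "pure b (c x) \<in> carrier ?T" by (rule pure_closed[OF b xN])
    show "pure b (c (a \<odot>\<^bsub>?P\<^esub> x)) = a \<odot>\<^bsub>?T\<^esub> pure b (c x)" if a: "a \<in> carrier R" for a
      using pure_bilinear(4)[OF b xN a] P.quot_smult[OF Us a x] by (simp add: c_def N_def)
    fix y assume y: "y \<in> carrier ?P"
    then have yN: "c y \<in> carrier N" using cN by (simp add: R.free_module_ops(1))
    show "pure b (c (x \<oplus>\<^bsub>?P\<^esub> y)) = pure b (c x) \<oplus>\<^bsub>?T\<^esub> pure b (c y)"
      using pure_bilinear(2)[OF b xN yN] P.quot_add[OF Us x y] by (simp add: c_def N_def)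
  qed
  define \<Phi> where "\<Phi> w = (\<Oplus>\<^bsub>?T\<^esub>i\<in>S. pure (w i) (c (basis_elt R i)))" for w
  have vc: "w i \<in> carrier M" if "w \<in> vecs M S" for w i using vecsD(1)[OF that] .
  have Phi_im: "\<Phi> (lin M D b) = \<zero>\<^bsub>?T\<^esub>" if b: "b \<in> vecs M T" for b
  proof -
    let ?K = "{k. b k \<noteq> \<zero>\<^bsub>M\<^esub>}"
    have K: "finite ?K" using vecsD(3)[OF b] .
    have bc: "b k \<in> carrier M" for k using vecsD(1)[OF b] .
    note Dc = MatD(1)[OF D]
    have pc: "pure (b k) (c (basis_elt R i)) \<in> carrier ?T" if "i \<in> S" for i k
      by (rule pure_closed[OF bc ec[OF that]])
    have "pure (lin M D b i) (c (basis_elt R i)) = (\<Oplus>\<^bsub>?T\<^esub>k\<in>?K. D i k \<odot>\<^bsub>?T\<^esub> pure (b k) (c (basis_elt R i)))" if i: "i \<in> S" for i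
    proof -
      have "pure (lin M D b i) (c (basis_elt R i)) = (\<Oplus>\<^bsub>?T\<^esub>k\<in>?K. pure (D i k \<odot>\<^bsub>M\<^esub> b k) (c (basis_elt R i)))"
        unfolding lin_def
      proof (rule finsum_hom[OF rmodule_axioms T.rmodule_axioms, where h = "\<lambda>x. pure x (c (basis_elt R i))"])
        show "pure \<zero>\<^bsub>M\<^esub> (c (basis_elt R i)) = \<zero>\<^bsub>?T\<^esub>"
          using pure_bilinear(3)[OF M.zero_closed ec[OF i] R.zero_closed] pure_closed[OF M.zero_closed ec[OF i]] by simp
      qed (use pure_closed pure_bilinear(1) ec[OF i] K Dc bc in auto)
      also have "\<dots> = (\<Oplus>\<^bsub>?T\<^esub>k\<in>?K. D i k \<odot>\<^bsub>?T\<^esub> pure (b k) (c (basis_elt R i)))"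
        by (rule T.M.finsum_cong'[OF refl]) (use pure_bilinear(3)[OF bc ec[OF i] Dc] pc[OF i] Dc in auto)
      finally show ?thesis .
    qed
    then have "\<Phi> (lin M D b) = (\<Oplus>\<^bsub>?T\<^esub>i\<in>S. \<Oplus>\<^bsub>?T\<^esub>k\<in>?K. D i k \<odot>\<^bsub>?T\<^esub> pure (b k) (c (basis_elt R i)))"
      unfolding \<Phi>_def by (intro T.M.finsum_cong'[OF refl]) (use pc Dc in \<open>auto intro!: T.M.finsum_closed\<close>)
    also have "\<dots> = (\<Oplus>\<^bsub>?T\<^esub>k\<in>?K. \<Oplus>\<^bsub>?T\<^esub>i\<in>S. D i k \<odot>\<^bsub>?T\<^esub> pure (b k) (c (basis_elt R i)))"
      by (rule T.finsum_swap[OF S K]) (use pc Dc in auto)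
    also have "\<dots> = (\<Oplus>\<^bsub>?T\<^esub>k\<in>?K. \<zero>\<^bsub>?T\<^esub>)"
    proof (rule T.M.finsum_cong'[OF refl])
      fix k assume "k \<in> ?K"
      then have kT: "k \<in> T" using vecsD(4)[OF b] by blast
      have colS: "(\<lambda>i. D i k) \<in> R.rvecs S" by (rule col_vecs[OF D])
      have "(\<Oplus>\<^bsub>?T\<^esub>i\<in>S. D i k \<odot>\<^bsub>?T\<^esub> pure (b k) (c (basis_elt R i))) = pure (b k) (c (\<lambda>i. D i k))"
        by (rule R.free_hom_expand[OF T.rmodule_axioms gam[OF bc] S colS, symmetric])
      also have "c (\<lambda>i. D i k) = \<zero>\<^bsub>N\<^esub>"
      proof -
        have "basis_elt R k \<in> R.rvecs T" by (rule R.basis_elt_vec[OF kT])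
        moreover have "rlin R D (basis_elt R k) i = D i k" for i
        proof -
          have "{j. basis_elt R k j \<noteq> \<zero>\<^bsub>regular_module R\<^esub>} \<subseteq> {k}" by (auto simp: basis_elt_def)
          from R.reg.lin_eq'[OF R.basis_elt_vec[OF kT] D _ this, of i]
          show ?thesis using Dc by (simp add: basis_elt_def R.reg.finsum_regular)
        qed
        ultimately have "(\<lambda>i. D i k) \<in> U" unfolding U_def by (metis image_eqI ext)
        then show ?thesis
          using P.quot_eq_zero_iff[OF Us, of "\<lambda>i. D i k"] colS by (simp add: c_def N_def R.free_module_ops(1))
      qed
      finally show "(\<Oplus>\<^bsub>?T\<^esub>i\<in>S. D i k \<odot>\<^bsub>?T\<^esub> pure (b k) (c (basis_elt R i))) = \<zero>\<^bsub>?T\<^esub>"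
        using pure_zero_right[OF bc] by simp
    qed auto
    also have "\<dots> = \<zero>\<^bsub>?T\<^esub>" by (rule T.M.add.finprod_one_eqI) simp
    finally show ?thesis .
  qed
  have pv: "pure (v i) (c (basis_elt R i)) \<in> carrier ?T" if "i \<in> S" for i by (rule pure_closed[OF vc[OF v] ec[OF that]])
  have "a \<odot>\<^bsub>?T\<^esub> \<Phi> v = \<zero>\<^bsub>?T\<^esub>" if a: "a \<in> \<mm>" for a
  proof -
    have aR: "a \<in> carrier R" using a mR by blast
    have "a \<odot>\<^bsub>?T\<^esub> \<Phi> v = (\<Oplus>\<^bsub>?T\<^esub>i\<in>S. a \<odot>\<^bsub>?T\<^esub> pure (v i) (c (basis_elt R i)))"
      unfolding \<Phi>_def by (rule T.finsum_smult_ldistr) (use S aR pv in auto)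
    also have "\<dots> = \<Phi> (a \<odot>\<^bsub>?W\<^esub> v)" unfolding \<Phi>_def
      by (rule T.M.finsum_cong'[OF refl])
         (use pure_bilinear(3)[OF vc[OF v] ec aR] pure_closed[OF _ ec] vc[OF v] aR in auto)
    also have "\<dots> = \<zero>\<^bsub>?T\<^esub>" using mv[OF a] Phi_im by auto
    finally show ?thesis .
  qed
  moreover have "\<Phi> v \<in> carrier ?T" unfolding \<Phi>_def by (rule T.M.finsum_closed) (use pv in auto)
  ultimately have Pv: "\<Phi> v = \<zero>\<^bsub>?T\<^esub>" using soc by (auto simp: socle_def)
  define f where "f = (\<Oplus>\<^bsub>F\<^esub>i\<in>S. basis_elt R (v i, c (basis_elt R i)))"
  have fe: "basis_elt R (v i, c (basis_elt R i)) \<in> carrier F" if "i \<in> S" for i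
    by (rule e_closed[OF vc[OF v] ec[OF that]])
  have fF: "f \<in> carrier F" unfolding f_def by (rule F.M.finsum_closed) (use fe in auto)
  have "J +>\<^bsub>F\<^esub> f = \<Phi> v"
    unfolding f_def \<Phi>_def pure_def
  proof (rule finsum_hom[OF F T.rmodule_axioms, where h = "\<lambda>x. J +>\<^bsub>F\<^esub> x"])
    show "J +>\<^bsub>F\<^esub> x \<in> carrier ?T" if "x \<in> carrier F" for x unfolding tensor_eq F.quot_carrier using that by blast
    show "J +>\<^bsub>F\<^esub> (x \<oplus>\<^bsub>F\<^esub> y) = (J +>\<^bsub>F\<^esub> x) \<oplus>\<^bsub>?T\<^esub> (J +>\<^bsub>F\<^esub> y)" if "x \<in> carrier F" "y \<in> carrier F" for x y
      unfolding tensor_eq using F.quot_add[OF J(1) that] by simp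
    show "J +>\<^bsub>F\<^esub> \<zero>\<^bsub>F\<^esub> = \<zero>\<^bsub>?T\<^esub>" unfolding tensor_eq using F.quot_zero_coset[OF J(1)] by simp
  qed (use S fe in auto)
  then have fJ: "f \<in> J" using F.quot_eq_zero_iff[OF J(1) fF] Pv by (simp add: tensor_eq)
  \<comment> \<open>The choice of representatives \<open>rep\<close> is not linear. It is so modulo \<open>U\<close>, and this suffices
    since \<open>\<Psi>\<close> is only considered modulo the image of \<open>D\<close>.\<close>
  define rep where "rep y = (SOME u. u \<in> R.rvecs S \<and> c u = y)" for y
  have rep: "rep y \<in> R.rvecs S" "c (rep y) = y" if "y \<in> carrier N" for y
  proof -
    have "\<exists>u. u \<in> R.rvecs S \<and> c u = y"
      using that unfolding N_def P.quot_carrier c_def by (auto simp: R.free_module_ops(1))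
    from someI_ex[OF this] show "rep y \<in> R.rvecs S" "c (rep y) = y" by (auto simp: rep_def)
  qed
  let ?g = "\<lambda>p. \<lambda>i. rep (snd p) i \<odot>\<^bsub>M\<^esub> fst p"
  have g: "?g p \<in> vecs M S" if p: "p \<in> carrier M \<times> carrier N" for p
  proof -
    have p1: "rep (snd p) \<in> R.rvecs S" and p2: "fst p \<in> carrier M" using rep p by auto
    show ?thesis by (rule lin_outer(1)[OF R.Mat_mid[OF S] p1 p2])
  qed
  then obtain \<Psi> where Psi: "\<Psi> \<in> mod_hom R F ?W" "\<And>p. p \<in> carrier M \<times> carrier N \<Longrightarrow> \<Psi> (basis_elt R p) = ?g p"
    using R.free_module_universal[OF W.rmodule_axioms, of "carrier M \<times> carrier N" ?g] vecs_UNIV by blast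
  note PsiD = mod_homD[OF Psi(1)]
  let ?Y = "lin M D ` vecs M T"
  have Y: "submodule ?Y R ?W" by (rule lin_image_submodule[OF D])
  note y = W.submodD[OF Y]
  have outer: "(\<lambda>i. u i \<odot>\<^bsub>M\<^esub> b) \<in> ?Y" if "u \<in> U" "b \<in> carrier M" for u b
    using that lin_outer[OF D] unfolding U_def by (auto intro!: image_eqI)
  have congU: "(\<lambda>i. u i \<odot>\<^bsub>M\<^esub> b) \<ominus>\<^bsub>?W\<^esub> (\<lambda>i. u' i \<odot>\<^bsub>M\<^esub> b) \<in> ?Y"
    if u: "u \<in> R.rvecs S" and u': "u' \<in> R.rvecs S" and cc: "c u = c u'" and b: "b \<in> carrier M" for u u' b
  proof -
    note uP = u[folded R.free_module_ops(1)] and uP' = u'[folded R.free_module_ops(1)]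
    have "u \<ominus>\<^bsub>?P\<^esub> u' \<in> U" using P.coset_eq_iff[OF Us uP uP'] cc by (simp add: c_def)
    then obtain r where r: "r \<in> U" "u = r \<oplus>\<^bsub>?P\<^esub> u'"
      using uP uP' by (metis P.M.add.inv_closed P.M.add.m_assoc P.M.l_neg P.M.r_zero a_minus_def)
    have rc: "r i \<in> carrier R" "u i \<in> carrier R" "u' i \<in> carrier R" for i
      using vecsD(1)[OF u] vecsD(1)[OF u'] r(1) vecsD(1)[OF R.reg.lin_closed[OF _ D]] by (auto simp: U_def)
    note v1 = vecs_UNIV[OF lin_outer(1)[OF R.Mat_mid[OF S] u b]] and v2 = vecs_UNIV[OF lin_outer(1)[OF R.Mat_mid[OF S] u' b]]
    have "(\<lambda>i. u i \<odot>\<^bsub>M\<^esub> b) \<ominus>\<^bsub>?W\<^esub> (\<lambda>i. u' i \<odot>\<^bsub>M\<^esub> b) = (\<lambda>i. r i \<odot>\<^bsub>M\<^esub> b)"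
    proof (rule ext)
      fix i
      have "u i = r i \<oplus> u' i" using r(2) by (simp add: R.free_module_ops)
      then show "((\<lambda>i. u i \<odot>\<^bsub>M\<^esub> b) \<ominus>\<^bsub>?W\<^esub> (\<lambda>i. u' i \<odot>\<^bsub>M\<^esub> b)) i = r i \<odot>\<^bsub>M\<^esub> b"
        using vec_minus[OF v1 v2, of i] rc b by (simp add: smult_l_distr a_minus_def M.a_assoc M.r_neg)
    qed
    then show ?thesis using outer[OF r(1) b] by simp
  qed
  let ?K = "{f \<in> carrier F. \<Psi> f \<in> ?Y}"
  have K: "submodule ?K R F"
  proof (rule F.submoduleI_smult)
    show "\<zero>\<^bsub>F\<^esub> \<in> ?K" using mod_hom_zero[OF F W.rmodule_axioms Psi(1)] y(2) by simp
  qed (use PsiD(2,3) y(3,6) in auto)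
  have Pm: "\<Psi> (p \<ominus>\<^bsub>F\<^esub> q) = \<Psi> p \<ominus>\<^bsub>?W\<^esub> \<Psi> q" if "p \<in> carrier F" "q \<in> carrier F" for p q
  proof -
    have "(\<ominus> \<one>) \<odot>\<^bsub>F\<^esub> q = \<ominus>\<^bsub>F\<^esub> q" "(\<ominus> \<one>) \<odot>\<^bsub>?W\<^esub> \<Psi> q = \<ominus>\<^bsub>?W\<^esub> \<Psi> q"
      using F.smult_l_minus[of \<one> q] W.smult_l_minus[of \<one> "\<Psi> q"] that PsiD(1) by auto
    then show ?thesis using PsiD(3)[of "\<ominus> \<one>" q] PsiD(2)[of p "\<ominus>\<^bsub>F\<^esub> q"] that by (simp add: a_minus_def)
  qed
  have Pe: "\<Psi> (basis_elt R (x, z)) = (\<lambda>i. rep z i \<odot>\<^bsub>M\<^esub> x)" if "x \<in> carrier M" "z \<in> carrier N" for x z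
    using Psi(2)[of "(x, z)"] that by simp
  have repc: "rep z i \<in> carrier R" if "z \<in> carrier N" for z i using vecsD(1)[OF rep(1)[OF that]] by simp
  have gW: "(\<lambda>i. rep z i \<odot>\<^bsub>M\<^esub> x) \<in> vecs M UNIV" if "x \<in> carrier M" "z \<in> carrier N" for x z
    using vecs_UNIV[OF g[of "(x, z)"]] that by simp
  have self: "p \<ominus>\<^bsub>?W\<^esub> p \<in> ?Y" if "p \<in> vecs M UNIV" for p using that y(2) by (simp add: a_minus_def W.M.r_neg)
  have relK: "bilinear_relations R M N \<subseteq> ?K"
  proof
    fix r assume r: "r \<in> bilinear_relations R M N"
    have rF: "r \<in> carrier F" using relations_closed r by blast
    have 1: "\<Psi> (basis_elt R (x \<oplus>\<^bsub>M\<^esub> x', z) \<ominus>\<^bsub>F\<^esub> (basis_elt R (x, z) \<oplus>\<^bsub>F\<^esub> basis_elt R (x', z))) \<in> ?Y" (is "\<Psi> ?r \<in> _")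
      if 1: "x \<in> carrier M" "x' \<in> carrier M" "z \<in> carrier N" for x x' z
    proof -
      have "\<Psi> ?r = (\<lambda>i. rep z i \<odot>\<^bsub>M\<^esub> (x \<oplus>\<^bsub>M\<^esub> x')) \<ominus>\<^bsub>?W\<^esub> ((\<lambda>i. rep z i \<odot>\<^bsub>M\<^esub> x) \<oplus>\<^bsub>?W\<^esub> (\<lambda>i. rep z i \<odot>\<^bsub>M\<^esub> x'))"
        using 1 e_closed by (simp add: Pm PsiD(2) Pe)
      also have "(\<lambda>i. rep z i \<odot>\<^bsub>M\<^esub> x) \<oplus>\<^bsub>?W\<^esub> (\<lambda>i. rep z i \<odot>\<^bsub>M\<^esub> x') = (\<lambda>i. rep z i \<odot>\<^bsub>M\<^esub> (x \<oplus>\<^bsub>M\<^esub> x'))"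
        by (rule ext) (use 1 repc in \<open>simp add: smult_r_distr\<close>)
      finally show ?thesis using self[OF gW] 1 by simp
    qed
    have 2: "\<Psi> (basis_elt R (x, z \<oplus>\<^bsub>N\<^esub> z') \<ominus>\<^bsub>F\<^esub> (basis_elt R (x, z) \<oplus>\<^bsub>F\<^esub> basis_elt R (x, z'))) \<in> ?Y" (is "\<Psi> ?r \<in> _")
      if 2: "x \<in> carrier M" "z \<in> carrier N" "z' \<in> carrier N" for x z z'
    proof -
      have "\<Psi> ?r = (\<lambda>i. rep (z \<oplus>\<^bsub>N\<^esub> z') i \<odot>\<^bsub>M\<^esub> x) \<ominus>\<^bsub>?W\<^esub> ((\<lambda>i. rep z i \<odot>\<^bsub>M\<^esub> x) \<oplus>\<^bsub>?W\<^esub> (\<lambda>i. rep z' i \<odot>\<^bsub>M\<^esub> x))"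
        using 2 e_closed by (simp add: Pm PsiD(2) Pe)
      also have "(\<lambda>i. rep z i \<odot>\<^bsub>M\<^esub> x) \<oplus>\<^bsub>?W\<^esub> (\<lambda>i. rep z' i \<odot>\<^bsub>M\<^esub> x) = (\<lambda>i. (rep z \<oplus>\<^bsub>?P\<^esub> rep z') i \<odot>\<^bsub>M\<^esub> x)"
        by (rule ext) (use 2 repc in \<open>simp add: smult_l_distr R.free_module_ops\<close>)
      also have "(\<lambda>i. rep (z \<oplus>\<^bsub>N\<^esub> z') i \<odot>\<^bsub>M\<^esub> x) \<ominus>\<^bsub>?W\<^esub> \<dots> \<in> ?Y"
      proof (rule congU)
        have rz: "rep z \<in> carrier ?P" "rep z' \<in> carrier ?P" using rep(1) 2 by (auto simp: R.free_module_ops(1))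
        show "rep z \<oplus>\<^bsub>?P\<^esub> rep z' \<in> R.rvecs S" using P.M.a_closed[OF rz] by (simp add: R.free_module_ops(1))
        have "c (rep z \<oplus>\<^bsub>?P\<^esub> rep z') = c (rep z) \<oplus>\<^bsub>N\<^esub> c (rep z')"
          unfolding c_def N_def by (rule P.quot_add[OF Us rz, symmetric])
        then show "c (rep (z \<oplus>\<^bsub>N\<^esub> z')) = c (rep z \<oplus>\<^bsub>?P\<^esub> rep z')" using 2 rep(2) by simp
      qed (use 2 rep(1) in auto)
      finally show ?thesis .
    qed
    have 3: "\<Psi> (basis_elt R (a \<odot>\<^bsub>M\<^esub> x, z) \<ominus>\<^bsub>F\<^esub> a \<odot>\<^bsub>F\<^esub> basis_elt R (x, z)) \<in> ?Y" (is "\<Psi> ?r \<in> _")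
      if 3: "a \<in> carrier R" "x \<in> carrier M" "z \<in> carrier N" for a x z
    proof -
      have "\<Psi> ?r = (\<lambda>i. rep z i \<odot>\<^bsub>M\<^esub> (a \<odot>\<^bsub>M\<^esub> x)) \<ominus>\<^bsub>?W\<^esub> a \<odot>\<^bsub>?W\<^esub> (\<lambda>i. rep z i \<odot>\<^bsub>M\<^esub> x)"
        using 3 e_closed by (simp add: Pm PsiD(3) Pe)
      also have "a \<odot>\<^bsub>?W\<^esub> (\<lambda>i. rep z i \<odot>\<^bsub>M\<^esub> x) = (\<lambda>i. rep z i \<odot>\<^bsub>M\<^esub> (a \<odot>\<^bsub>M\<^esub> x))"
        by (rule ext) (use 3 repc in \<open>simp add: smult_assoc1[symmetric] R.m_comm\<close>)
      finally show ?thesis using self[OF gW] 3 by simp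
    qed
    have 4: "\<Psi> (basis_elt R (x, a \<odot>\<^bsub>N\<^esub> z) \<ominus>\<^bsub>F\<^esub> a \<odot>\<^bsub>F\<^esub> basis_elt R (x, z)) \<in> ?Y" (is "\<Psi> ?r \<in> _")
      if 4: "a \<in> carrier R" "x \<in> carrier M" "z \<in> carrier N" for a x z
    proof -
      have "\<Psi> ?r = (\<lambda>i. rep (a \<odot>\<^bsub>N\<^esub> z) i \<odot>\<^bsub>M\<^esub> x) \<ominus>\<^bsub>?W\<^esub> a \<odot>\<^bsub>?W\<^esub> (\<lambda>i. rep z i \<odot>\<^bsub>M\<^esub> x)"
        using 4 e_closed by (simp add: Pm PsiD(3) Pe)
      also have "a \<odot>\<^bsub>?W\<^esub> (\<lambda>i. rep z i \<odot>\<^bsub>M\<^esub> x) = (\<lambda>i. (a \<odot>\<^bsub>?P\<^esub> rep z) i \<odot>\<^bsub>M\<^esub> x)"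
        by (rule ext) (use 4 repc in \<open>simp add: smult_assoc1 R.free_module_ops\<close>)
      also have "(\<lambda>i. rep (a \<odot>\<^bsub>N\<^esub> z) i \<odot>\<^bsub>M\<^esub> x) \<ominus>\<^bsub>?W\<^esub> \<dots> \<in> ?Y"
      proof (rule congU)
        have rz: "rep z \<in> carrier ?P" using rep(1) 4 by (auto simp: R.free_module_ops(1))
        show "a \<odot>\<^bsub>?P\<^esub> rep z \<in> R.rvecs S" using P.smult_closed[OF 4(1) rz] by (simp add: R.free_module_ops(1))
        have "c (a \<odot>\<^bsub>?P\<^esub> rep z) = a \<odot>\<^bsub>N\<^esub> c (rep z)"
          unfolding c_def N_def by (rule P.quot_smult[OF Us 4(1) rz, symmetric])
        then show "c (rep (a \<odot>\<^bsub>N\<^esub> z)) = c (a \<odot>\<^bsub>?P\<^esub> rep z)" using 4 rep(2) by simp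
      qed (use 4 rep(1) in auto)
      finally show ?thesis .
    qed
    have "\<Psi> r \<in> ?Y"
      using r unfolding bilinear_relations_def Let_def
      by (elim UnE CollectE exE conjE) (simp_all only: 1 2 3 4)
    then show "r \<in> ?K" using rF by simp
  qed
  have "J \<subseteq> ?K" unfolding J_def by (rule F.submodule_span_props(3)[OF relations_closed K relK])
  then have PfY: "\<Psi> f \<in> ?Y" using fJ by blast
  have Pf: "\<Psi> f = (\<Oplus>\<^bsub>?W\<^esub>i\<in>S. (\<lambda>j. rep (c (basis_elt R i)) j \<odot>\<^bsub>M\<^esub> v i))"
  proof -
    have "\<Psi> f = (\<Oplus>\<^bsub>?W\<^esub>i\<in>S. \<Psi> (basis_elt R (v i, c (basis_elt R i))))"
      unfolding f_def
      by (rule finsum_hom[OF F W.rmodule_axioms PsiD(1) PsiD(2) mod_hom_zero[OF F W.rmodule_axioms Psi(1)] S fe])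
    also have "\<dots> = (\<Oplus>\<^bsub>?W\<^esub>i\<in>S. (\<lambda>j. rep (c (basis_elt R i)) j \<odot>\<^bsub>M\<^esub> v i))"
      by (rule W.M.finsum_cong'[OF refl]) (use Pe[OF vc[OF v] ec] gW[OF vc[OF v] ec] in auto)
    finally show ?thesis .
  qed
  have "v = (\<Oplus>\<^bsub>?W\<^esub>i\<in>S. (\<lambda>j. basis_elt R i j \<odot>\<^bsub>M\<^esub> v i))"
  proof (rule ext)
    fix j
    have bo: "(\<lambda>j. basis_elt R i j \<odot>\<^bsub>M\<^esub> v i) \<in> carrier ?W" if "i \<in> S" for i
      using vecs_UNIV[OF lin_outer(1)[OF R.Mat_mid[OF S] R.basis_elt_vec[OF that] vc[OF v]]] .
    have "(\<Oplus>\<^bsub>?W\<^esub>i\<in>S. (\<lambda>j. basis_elt R i j \<odot>\<^bsub>M\<^esub> v i)) j = (\<Oplus>\<^bsub>M\<^esub>i\<in>S. basis_elt R i j \<odot>\<^bsub>M\<^esub> v i)"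
      by (rule finsum_hom[OF W.rmodule_axioms rmodule_axioms, where h = "\<lambda>w. w j"])
         (use S bo vecsD(1) in auto)
    also have "\<dots> = (\<Oplus>\<^bsub>M\<^esub>i\<in>S. if j = i then v i else \<zero>\<^bsub>M\<^esub>)"
      by (rule M.finsum_cong'[OF refl]) (use vc[OF v] in \<open>auto simp: basis_elt_def\<close>)
    also have "\<dots> = v j"
    proof (cases "j \<in> S")
      case True then show ?thesis by (subst M.finsum_singleton) (use S vc[OF v] in auto)
    next
      case False then show ?thesis using vecsD(2)[OF v False] by (auto intro!: M.add.finprod_one_eqI)
    qed
    finally show "v j = (\<Oplus>\<^bsub>?W\<^esub>i\<in>S. (\<lambda>j. basis_elt R i j \<odot>\<^bsub>M\<^esub> v i)) j" by simp
  qed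
  note vexp = this
  have bo: "(\<lambda>j. basis_elt R i j \<odot>\<^bsub>M\<^esub> v i) \<in> carrier ?W" if "i \<in> S" for i
    using vecs_UNIV[OF lin_outer(1)[OF R.Mat_mid[OF S] R.basis_elt_vec[OF that] vc[OF v]]] .
  have ro: "(\<lambda>j. rep (c (basis_elt R i)) j \<odot>\<^bsub>M\<^esub> v i) \<in> carrier ?W" if "i \<in> S" for i
    using gW[OF vc[OF v] ec[OF that]] .
  have "(\<Oplus>\<^bsub>?W\<^esub>i\<in>A. (\<lambda>j. basis_elt R i j \<odot>\<^bsub>M\<^esub> v i)) \<ominus>\<^bsub>?W\<^esub> (\<Oplus>\<^bsub>?W\<^esub>i\<in>A. (\<lambda>j. rep (c (basis_elt R i)) j \<odot>\<^bsub>M\<^esub> v i)) \<in> ?Y"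
    if "finite A" "A \<subseteq> S" for A
    using that
  proof (induction A)
    case empty
    show ?case using self[OF vecs_ops(1)] by (simp only: W.M.finsum_empty)
  next
    case (insert i A)
    let ?b = "\<lambda>i. (\<lambda>j. basis_elt R i j \<odot>\<^bsub>M\<^esub> v i)" and ?r = "\<lambda>i. (\<lambda>j. rep (c (basis_elt R i)) j \<odot>\<^bsub>M\<^esub> v i)"
    have i: "i \<in> S" and A: "A \<subseteq> S" using insert by auto
    have bA: "?b \<in> A \<rightarrow> carrier ?W" and rA: "?r \<in> A \<rightarrow> carrier ?W" using bo ro A by auto
    have 1: "finsum ?W ?b (insert i A) = ?b i \<oplus>\<^bsub>?W\<^esub> finsum ?W ?b A" "finsum ?W ?r (insert i A) = ?r i \<oplus>\<^bsub>?W\<^esub> finsum ?W ?r A"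
      using W.M.finsum_insert[OF insert(1,2) bA bo[OF i]] W.M.finsum_insert[OF insert(1,2) rA ro[OF i]] by auto
    have 2: "?b i \<ominus>\<^bsub>?W\<^esub> ?r i \<in> ?Y"
      by (rule congU) (use R.basis_elt_vec[OF i] rep[OF ec[OF i]] vc[OF v] in auto)
    have "finsum ?W ?b (insert i A) \<ominus>\<^bsub>?W\<^esub> finsum ?W ?r (insert i A)
        = (?b i \<ominus>\<^bsub>?W\<^esub> ?r i) \<oplus>\<^bsub>?W\<^esub> (finsum ?W ?b A \<ominus>\<^bsub>?W\<^esub> finsum ?W ?r A)"
      unfolding 1 using bo[OF i] ro[OF i] W.M.finsum_closed[OF bA] W.M.finsum_closed[OF rA]
      by (simp add: a_minus_def W.M.minus_add W.M.a_ac)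
    then show ?case using y(3)[OF 2 insert.IH[OF A]] by (simp only:)
  qed
  from this[OF S order_refl] have dY: "v \<ominus>\<^bsub>?W\<^esub> \<Psi> f \<in> ?Y"
    unfolding Pf vexp[symmetric] .
  have "v = (v \<ominus>\<^bsub>?W\<^esub> \<Psi> f) \<oplus>\<^bsub>?W\<^esub> \<Psi> f"
    using vecs_UNIV[OF v] PsiD(1)[OF fF] by (simp add: a_minus_def W.M.a_assoc W.M.l_neg)
  then show ?thesis using y(3)[OF dY PfY] by (simp only:)
qed

section \<open>Totally reflexive modules as syzygies\<close>

lemma chain_complexD:
  assumes "chain_complex R C d"
  shows "module R (C i)" "d i \<in> mod_hom R (C i) (C (i - 1))" "d (i + 1) \<in> mod_hom R (C (i + 1)) (C i)"
    "x \<in> carrier (C i) \<Longrightarrow> d (i - 1) (d i x) = \<zero>\<^bsub>C (i - 2)\<^esub>"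
    "x \<in> carrier (C (i + 1)) \<Longrightarrow> d i (d (i + 1) x) = \<zero>\<^bsub>C (i - 1)\<^esub>"
proof -
  have a: "\<forall>i. d i \<in> mod_hom R (C i) (C (i - 1))"
    "\<forall>i. \<forall>x\<in>carrier (C i). d (i - 1) (d i x) = \<zero>\<^bsub>C (i - 2)\<^esub>"
    using assms by (auto simp: chain_complex_def)
  show "d (i + 1) \<in> mod_hom R (C (i + 1)) (C i)" using a(1)[rule_format, of "i + 1"] by simp
  show "x \<in> carrier (C (i + 1)) \<Longrightarrow> d i (d (i + 1) x) = \<zero>\<^bsub>C (i - 1)\<^esub>"
    using a(2)[rule_format, of x "i + 1"] by (simp add: algebra_simps)
qed (use assms in \<open>auto simp: chain_complex_def\<close>)

lemma cycles_boundaries_submodule: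
  assumes C: "chain_complex R C d"
  shows "submodule (cycles C d i) R (C i)"
    "submodule (boundaries C d i) R ((C i)\<lparr>carrier := cycles C d i\<rparr>)"
    "module R ((C i)\<lparr>carrier := cycles C d i\<rparr>)"
    "boundaries C d i \<subseteq> cycles C d i"
proof -
  interpret M: module R "C i" by (rule chain_complexD(1)[OF C])
  interpret M: rmodule R "C i" by unfold_locales
  interpret M': module R "C (i - 1)" by (rule chain_complexD(1)[OF C])
  interpret M': rmodule R "C (i - 1)" by unfold_locales
  interpret M1: module R "C (i + 1)" by (rule chain_complexD(1)[OF C])
  interpret M1: rmodule R "C (i + 1)" by unfold_locales
  note h = chain_complexD(2)[OF C, of i] and h1 = chain_complexD(3)[OF C, of i]
  note hz = mod_hom_zero[OF M.rmodule_axioms M'.rmodule_axioms h] and hz1 = mod_hom_zero[OF M1.rmodule_axioms M.rmodule_axioms h1]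
  note hD = mod_homD[OF h] and hD1 = mod_homD[OF h1]
  show cy: "submodule (cycles C d i) R (C i)"
    by (rule M.submoduleI_smult) (auto simp: cycles_def hz hD)
  show m: "module R ((C i)\<lparr>carrier := cycles C d i\<rparr>)"
    by (rule submodule.submodule_is_module[OF cy M.module_axioms])
  show bc: "boundaries C d i \<subseteq> cycles C d i"
    using hD1(1) chain_complexD(5)[OF C] by (auto simp: cycles_def boundaries_def)
  interpret Z: module R "(C i)\<lparr>carrier := cycles C d i\<rparr>" by (rule m)
  interpret Z: rmodule R "(C i)\<lparr>carrier := cycles C d i\<rparr>" by unfold_locales
  show "submodule (boundaries C d i) R ((C i)\<lparr>carrier := cycles C d i\<rparr>)"
  proof (rule Z.submoduleI_smult)
    show "boundaries C d i \<subseteq> carrier ((C i)\<lparr>carrier := cycles C d i\<rparr>)" using bc by simp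
    show "\<zero>\<^bsub>(C i)\<lparr>carrier := cycles C d i\<rparr>\<^esub> \<in> boundaries C d i"
      using imageI[OF M1.M.zero_closed, of "d (i + 1)"] hz1 by (simp add: boundaries_def)
    show "a \<oplus>\<^bsub>(C i)\<lparr>carrier := cycles C d i\<rparr>\<^esub> b \<in> boundaries C d i"
      if ab: "a \<in> boundaries C d i" "b \<in> boundaries C d i" for a b
    proof -
      obtain x y where "x \<in> carrier (C (i + 1))" "y \<in> carrier (C (i + 1))" "a = d (i + 1) x" "b = d (i + 1) y"
        using ab by (auto simp: boundaries_def)
      then show ?thesis using hD1(2)[of x y] imageI[OF M1.M.a_closed[of x y], of "d (i + 1)"] by (simp add: boundaries_def)
    qed
    show "a \<odot>\<^bsub>(C i)\<lparr>carrier := cycles C d i\<rparr>\<^esub> b \<in> boundaries C d i"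
      if ab: "a \<in> carrier R" "b \<in> boundaries C d i" for a b
    proof -
      obtain x where "x \<in> carrier (C (i + 1))" "b = d (i + 1) x"
        using ab by (auto simp: boundaries_def)
      then show ?thesis using hD1(3)[of a x] imageI[OF M1.smult_closed[of a x], of "d (i + 1)"] ab(1) by (simp add: boundaries_def)
    qed
  qed
qed

lemma homology_zero_iff:
  assumes C: "chain_complex R C d"
  shows "zero_module (homology C d i) \<longleftrightarrow> cycles C d i \<subseteq> boundaries C d i"
proof -
  note s = cycles_boundaries_submodule[OF C, of i]
  interpret Z: module R "(C i)\<lparr>carrier := cycles C d i\<rparr>" by (rule s(3))
  interpret Z: rmodule R "(C i)\<lparr>carrier := cycles C d i\<rparr>" by unfold_locales
  have "zero_module (homology C d i) \<longleftrightarrow> (\<forall>x\<in>cycles C d i. x \<in> boundaries C d i)"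
  proof -
    have "zero_module (homology C d i) \<longleftrightarrow> (\<forall>y\<in>carrier (homology C d i). y = \<zero>\<^bsub>homology C d i\<^esub>)"
    proof -
      interpret H: module R "homology C d i" unfolding homology_def by (rule Z.quot_module_module[OF s(2)])
      show ?thesis using H.M.zero_closed by (auto simp: zero_module_def)
    qed
    also have "\<dots> \<longleftrightarrow> (\<forall>x\<in>cycles C d i. x \<in> boundaries C d i)"
      unfolding homology_def Z.quot_carrier using Z.quot_eq_zero_iff[OF s(2)] by auto
    finally show ?thesis .
  qed
  then show ?thesis by auto
qed

lemma Hom_module_module:
  assumes M: "rmodule R M" and N: "rmodule R N"
  shows "module R (Hom_module R M N)"
proof -
  interpret M: rmodule R M by (rule M)
  interpret N: rmodule R N by (rule N)
  let ?H = "Hom_module R M N"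
  have op: "f \<oplus>\<^bsub>?H\<^esub> g = (\<lambda>x\<in>carrier M. f x \<oplus>\<^bsub>N\<^esub> g x)" "\<zero>\<^bsub>?H\<^esub> = (\<lambda>x\<in>carrier M. \<zero>\<^bsub>N\<^esub>)"
    "a \<odot>\<^bsub>?H\<^esub> f = (\<lambda>x\<in>carrier M. a \<odot>\<^bsub>N\<^esub> f x)" for f g a
    by (simp_all add: Hom_module_def)
  have car: "f \<in> carrier ?H \<longleftrightarrow> f \<in> mod_hom R M N \<and> f \<in> extensional (carrier M)" for f by (simp add: Hom_module_def)
  have eqI: "f = g" if "f \<in> carrier ?H" "g \<in> carrier ?H" "\<And>x. x \<in> carrier M \<Longrightarrow> f x = g x" for f g
    using that by (auto simp: car intro: extensionalityI)
  have zc: "\<zero>\<^bsub>?H\<^esub> \<in> carrier ?H" by (auto simp: car op mod_hom_def)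
  have ac: "f \<oplus>\<^bsub>?H\<^esub> g \<in> carrier ?H" if fg: "f \<in> carrier ?H" "g \<in> carrier ?H" for f g
  proof -
    have f: "f \<in> mod_hom R M N" and g: "g \<in> mod_hom R M N" using fg car by auto
    have "(\<lambda>x\<in>carrier M. f x \<oplus>\<^bsub>N\<^esub> g x) \<in> mod_hom R M N"
      using mod_homD[OF f] mod_homD[OF g] by (auto simp: mod_hom_def N.M.a_ac N.smult_r_distr)
    then show ?thesis by (simp add: car op)
  qed
  have sc: "a \<odot>\<^bsub>?H\<^esub> f \<in> carrier ?H" if a: "a \<in> carrier R" and fg: "f \<in> carrier ?H" for f a
  proof -
    have f: "f \<in> mod_hom R M N" using fg car by auto
    have "(\<lambda>x\<in>carrier M. a \<odot>\<^bsub>N\<^esub> f x) \<in> mod_hom R M N"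
      using mod_homD[OF f] a by (auto simp: mod_hom_def N.smult_r_distr N.smult_assoc1[symmetric] M.R.m_comm)
    then show ?thesis by (simp add: car op)
  qed
  have val: "f x \<in> carrier N" if "f \<in> carrier ?H" "x \<in> carrier M" for f x using that mod_homD(1) by (auto simp: car)
  show ?thesis
  proof (rule moduleI)
    show "cring R" by (rule M.R.is_cring)
    show "abelian_group ?H"
    proof (rule abelian_groupI)
      fix x assume x: "x \<in> carrier ?H"
      show "\<zero>\<^bsub>?H\<^esub> \<oplus>\<^bsub>?H\<^esub> x = x" by (rule eqI[OF ac[OF zc x] x]) (use val[OF x] in \<open>auto simp: op\<close>)
      have "(\<ominus>\<^bsub>R\<^esub> \<one>\<^bsub>R\<^esub>) \<odot>\<^bsub>?H\<^esub> x \<oplus>\<^bsub>?H\<^esub> x = \<zero>\<^bsub>?H\<^esub>"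
        by (rule eqI[OF ac[OF sc x] zc]) (use x val[OF x] in \<open>auto simp: op N.smult_l_minus N.M.l_neg\<close>)
      then show "\<exists>y\<in>carrier ?H. y \<oplus>\<^bsub>?H\<^esub> x = \<zero>\<^bsub>?H\<^esub>" using sc[OF _ x, of "\<ominus>\<^bsub>R\<^esub> \<one>\<^bsub>R\<^esub>"] by auto
      fix y assume y: "y \<in> carrier ?H"
      show "x \<oplus>\<^bsub>?H\<^esub> y \<in> carrier ?H" by (rule ac[OF x y])
      show "x \<oplus>\<^bsub>?H\<^esub> y = y \<oplus>\<^bsub>?H\<^esub> x" by (rule eqI[OF ac[OF x y] ac[OF y x]]) (use val[OF x] val[OF y] in \<open>auto simp: op N.M.a_comm\<close>)
      fix z assume z: "z \<in> carrier ?H"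
      show "x \<oplus>\<^bsub>?H\<^esub> y \<oplus>\<^bsub>?H\<^esub> z = x \<oplus>\<^bsub>?H\<^esub> (y \<oplus>\<^bsub>?H\<^esub> z)"
        by (rule eqI[OF ac[OF ac[OF x y] z] ac[OF x ac[OF y z]]]) (use val[OF x] val[OF y] val[OF z] in \<open>auto simp: op N.M.a_assoc\<close>)
    qed (rule zc)
    fix x assume x: "x \<in> carrier ?H"
    show "\<one>\<^bsub>R\<^esub> \<odot>\<^bsub>?H\<^esub> x = x" by (rule eqI[OF sc[OF M.R.one_closed x] x]) (use val[OF x] in \<open>auto simp: op\<close>)
    fix a assume a: "a \<in> carrier R"
    show "a \<odot>\<^bsub>?H\<^esub> x \<in> carrier ?H" by (rule sc[OF a x])
    show "(a \<oplus>\<^bsub>R\<^esub> b) \<odot>\<^bsub>?H\<^esub> x = a \<odot>\<^bsub>?H\<^esub> x \<oplus>\<^bsub>?H\<^esub> b \<odot>\<^bsub>?H\<^esub> x" if b: "b \<in> carrier R" for b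
      by (rule eqI[OF sc[OF _ x] ac[OF sc[OF a x] sc[OF b x]]]) (use a b val[OF x] in \<open>auto simp: op N.smult_l_distr\<close>)
    show "(a \<otimes>\<^bsub>R\<^esub> b) \<odot>\<^bsub>?H\<^esub> x = a \<odot>\<^bsub>?H\<^esub> (b \<odot>\<^bsub>?H\<^esub> x)" if b: "b \<in> carrier R" for b
      by (rule eqI[OF sc[OF _ x] sc[OF a sc[OF b x]]]) (use a b val[OF x] in \<open>auto simp: op N.smult_assoc1\<close>)
    fix y assume y: "y \<in> carrier ?H"
    show "a \<odot>\<^bsub>?H\<^esub> (x \<oplus>\<^bsub>?H\<^esub> y) = a \<odot>\<^bsub>?H\<^esub> x \<oplus>\<^bsub>?H\<^esub> a \<odot>\<^bsub>?H\<^esub> y"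
      by (rule eqI[OF sc[OF a ac[OF x y]] ac[OF sc[OF a x] sc[OF a y]]]) (use a val[OF x] val[OF y] in \<open>auto simp: op N.smult_r_distr\<close>)
  qed
qed

context cring
begin

lemma free_module_eq: "free_module R S = vec_module (regular_module R) S"
  by (simp add: vec_module_regular)

lemma lin_mod_hom:
  assumes A: "A \<in> Mat R S' S"
  shows "rlin R A \<in> mod_hom R (free_module R S) (free_module R S')"
proof -
  have o: "f \<oplus>\<^bsub>free_module R Z\<^esub> g = f \<oplus>\<^bsub>vspace (regular_module R)\<^esub> g"
    "a \<odot>\<^bsub>free_module R Z\<^esub> f = a \<odot>\<^bsub>vspace (regular_module R)\<^esub> f" for f g a and Z :: "'z set"
    by (simp_all add: free_module_eq vec_module_def)
  show ?thesis
    unfolding mod_hom_def free_module_ops(1) o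
    using reg.lin_closed[OF _ A] reg.lin_add[OF _ _ A] reg.lin_smult[OF _ _ A] vecs_UNIV by blast
qed

lemma hom_matrix:
  assumes h: "h \<in> mod_hom R (free_module R S) (free_module R S')" and S: "finite S" "finite S'"
  shows "\<exists>A\<in>Mat R S' S. \<forall>v\<in>rvecs S. h v = rlin R A v"
proof -
  note hD = mod_homD[OF h, unfolded free_module_ops(1)]
  define A where "A = (\<lambda>a b. if b \<in> S then h (basis_elt R b) a else \<zero>)"
  have hb: "h (basis_elt R b) \<in> rvecs S'" if "b \<in> S" for b using hD(1) basis_elt_vec[OF that] .
  have A: "A \<in> Mat R S' S"
  proof (rule MatI_fin[OF _ _ S(2,1)])
    show "A i j \<in> carrier R" for i j using vecsD(1)[OF hb, of j i] by (auto simp: A_def)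
    show "A i j = \<zero>" if "i \<notin> S' \<or> j \<notin> S" for i j using that vecsD(2)[OF hb, of j i] by (auto simp: A_def)
  qed
  moreover have "h v = rlin R A v" if v: "v \<in> rvecs S" for v
  proof (rule ext)
    fix a
    have vc: "v b \<in> carrier R" for b using vecsD(1)[OF v] by simp
    interpret F': rmodule R "free_module R S'" by (rule free_module_rmodule)
    have "h v a = (\<Oplus>\<^bsub>free_module R S'\<^esub>b\<in>S. v b \<odot>\<^bsub>free_module R S'\<^esub> h (basis_elt R b)) a"
      using free_hom_expand[OF free_module_rmodule h S(1) v] by simp
    also have "\<dots> = (\<Oplus>\<^bsub>regular_module R\<^esub>b\<in>S. (v b \<odot>\<^bsub>free_module R S'\<^esub> h (basis_elt R b)) a)"
    proof (rule finsum_hom[OF free_module_rmodule regular_rmodule, where h = "\<lambda>w. w a"])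
      show "v b \<odot>\<^bsub>free_module R S'\<^esub> h (basis_elt R b) \<in> carrier (free_module R S')" if "b \<in> S" for b
        using F'.smult_closed[OF vc] hb[OF that] by (simp add: free_module_ops(1))
    qed (use S vecsD(1)[of _ "regular_module R" S'] in \<open>auto simp: free_module_ops\<close>)
    also have "\<dots> = (\<Oplus>b\<in>S. A a b \<otimes> v b)"
      unfolding reg.finsum_regular
      by (rule finsum_cong'[OF refl]) (use vc MatD(1)[OF A] vecsD(1)[OF hb] in \<open>auto simp: free_module_ops A_def m_comm\<close>)
    also have "\<dots> = rlin R A v a"
      using reg.lin_eq'[OF v A S(1)] vecsD(4)[OF v] by (simp add: reg.finsum_regular)
    finally show "h v a = rlin R A v a" .
  qed
  ultimately show ?thesis by blast
qed

definition "rowm v = (\<lambda>(_::unit) b. v b)"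

lemma rowm: "finite S \<Longrightarrow> v \<in> rvecs S \<Longrightarrow> rowm v \<in> Mat R UNIV S"
  by (rule MatI_fin) (use vecsD(1,2)[of v "regular_module R" S] in \<open>auto simp: rowm_def\<close>)

text \<open>
  Linear forms on a finite free module are row vectors, and precomposition with \<open>A\<close> is multiplication by the
  transpose. This identifies the complex of linear forms with the dual complex of matrices.
\<close>

lemma row_adjoint:
  assumes A: "A \<in> Mat R S S'" and S: "finite S" and v: "v \<in> rvecs S" and x: "x \<in> rvecs UNIV"
  shows "rlin R (rowm v) (rlin R A x) = rlin R (rowm (rlin R (tr A) v)) x"
proof -
  note r = rowm[OF S v]
  have "tr (mm R (rowm v) A) = mm R (tr A) (tr (rowm v))" by (rule mm_tr[OF r A])
  also have "\<dots> = tr (rowm (rlin R (tr A) v))"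
    by (intro ext) (simp add: mm_def tr_def rowm_def)
  finally have "mm R (rowm v) A = rowm (rlin R (tr A) v)" by (simp only: tr_eq_iff)
  then show ?thesis using reg.lin_mm[OF x r A] by simp
qed

lemma row_basis:
  assumes v: "v \<in> rvecs S" and S: "finite S" and b: "b \<in> S"
  shows "rlin R (rowm v) (basis_elt R b) () = v b"
proof -
  have "{j. basis_elt R b j \<noteq> \<zero>\<^bsub>regular_module R\<^esub>} \<subseteq> {b}" by (auto simp: basis_elt_def)
  from reg.lin_eq'[OF basis_elt_vec[OF b] rowm[OF S v] _ this, of "()"]
  show ?thesis using vecsD(1)[OF v] by (simp add: basis_elt_def rowm_def reg.finsum_regular)
qed

lemma functional_row:
  assumes h: "h \<in> mod_hom R (free_module R S) (regular_module R)" and S: "finite S"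
  shows "\<exists>w\<in>rvecs S. \<forall>x\<in>rvecs S. h x = rlin R (rowm w) x ()"
proof -
  define w where "w b = (if b \<in> S then h (basis_elt R b) else \<zero>)" for b
  have hb: "h (basis_elt R b) \<in> carrier R" if "b \<in> S" for b
    using mod_homD(1)[OF h] basis_elt_vec[OF that] by (simp add: free_module_ops(1))
  have w: "w \<in> rvecs S" by (rule vecsI_fin) (use hb S in \<open>auto simp: w_def\<close>)
  have "h x = rlin R (rowm w) x ()" if x: "x \<in> rvecs S" for x
  proof -
    have xc: "x b \<in> carrier R" for b using vecsD(1)[OF x] by simp
    have "h x = (\<Oplus>b\<in>S. x b \<otimes> h (basis_elt R b))"
      using free_hom_expand[OF regular_rmodule h S x] by (simp add: reg.finsum_regular)
    also have "\<dots> = (\<Oplus>b\<in>S. rowm w () b \<otimes> x b)"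
      by (rule finsum_cong'[OF refl]) (use xc hb in \<open>auto simp: rowm_def w_def m_comm\<close>)
    also have "\<dots> = rlin R (rowm w) x ()"
      using reg.lin_eq'[OF x rowm[OF S w] S] vecsD(4)[OF x] by (simp add: reg.finsum_regular)
    finally show ?thesis .
  qed
  then show ?thesis using w by blast
qed

lemma row_hom:
  assumes S: "finite S" and v: "v \<in> rvecs S"
  shows "(\<lambda>x\<in>rvecs S. rlin R (rowm v) x ()) \<in> carrier (Hom_module R (free_module R S) (regular_module R))"
proof -
  have F: "rmodule R (free_module R S)" by (rule free_module_rmodule)
  interpret F: rmodule R "free_module R S" by (rule F)
  note l = mod_homD[OF lin_mod_hom[OF rowm[OF S v]], unfolded free_module_ops(1)]
  have "(\<lambda>x\<in>rvecs S. rlin R (rowm v) x ()) \<in> mod_hom R (free_module R S) (regular_module R)"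
    unfolding mod_hom_def free_module_ops(1)
  proof (intro CollectI conjI ballI funcsetI)
    fix x assume x: "x \<in> rvecs S"
    show "(\<lambda>x\<in>rvecs S. rlin R (rowm v) x ()) x \<in> carrier (regular_module R)"
      using x vecsD(1)[OF l(1)[OF x]] by simp
    fix y assume y: "y \<in> rvecs S"
    have "x \<oplus>\<^bsub>free_module R S\<^esub> y \<in> rvecs S" using F.M.a_closed[of x y] x y by (simp add: free_module_ops(1))
    then show "(\<lambda>x\<in>rvecs S. rlin R (rowm v) x ()) (x \<oplus>\<^bsub>free_module R S\<^esub> y) =
       (\<lambda>x\<in>rvecs S. rlin R (rowm v) x ()) x \<oplus>\<^bsub>regular_module R\<^esub> (\<lambda>x\<in>rvecs S. rlin R (rowm v) x ()) y"
      using x y l(2)[OF x y] by (simp add: free_module_ops(2))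
  next
    fix a x assume a: "a \<in> carrier R" and x: "x \<in> rvecs S"
    have "a \<odot>\<^bsub>free_module R S\<^esub> x \<in> rvecs S" using F.smult_closed[of a x] x a by (simp add: free_module_ops(1))
    then show "(\<lambda>x\<in>rvecs S. rlin R (rowm v) x ()) (a \<odot>\<^bsub>free_module R S\<^esub> x) =
       a \<odot>\<^bsub>regular_module R\<^esub> (\<lambda>x\<in>rvecs S. rlin R (rowm v) x ()) x"
      using x l(3)[OF a x] by (simp add: free_module_ops(4))
  qed
  then show ?thesis by (simp add: Hom_module_def free_module_ops(1))
qed

end

definition pull :: "('a, 'm) module \<Rightarrow> 'k set \<Rightarrow> ('k \<Rightarrow> 'i) \<Rightarrow> ('i \<Rightarrow> 'm) \<Rightarrow> 'k \<Rightarrow> 'm" where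
  "pull N K \<rho> v = (\<lambda>a. if a \<in> K then v (\<rho> a) else \<zero>\<^bsub>N\<^esub>)"

text \<open>
  Transport along bijections of the bases.
\<close>

definition mrelabel where
  "mrelabel R K' K \<rho>' \<rho> A = (\<lambda>a b. if a \<in> K' \<and> b \<in> K then A (\<rho>' a) (\<rho> b) else \<zero>\<^bsub>R\<^esub>)"

definition relabel where
  "relabel R K \<rho> D = (\<lambda>j. mrelabel R (K (j - 1)) (K j) (\<rho> (j - 1)) (\<rho> j) (D (j::int)))"

lemma (in cring) Mat_mrelabel:
  assumes A: "A \<in> Mat R I' I" and K: "finite K" "finite K'"
  shows "mrelabel R K' K \<rho>' \<rho> A \<in> Mat R K' K"
  by (rule MatI_fin) (use K MatD(1)[OF A] in \<open>auto simp: mrelabel_def\<close>)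

context rmodule
begin

lemma pull_vecs: "v \<in> vecs M I \<Longrightarrow> finite K \<Longrightarrow> pull M K \<rho> v \<in> vecs M K"
  by (rule vecsI_fin) (use vecsD(1)[of v M I] in \<open>auto simp: pull_def\<close>)

lemma pull_surj:
  assumes b: "bij_betw \<rho> K I" and K: "finite K" and u: "u \<in> vecs M K"
  shows "\<exists>v\<in>vecs M I. u = pull M K \<rho> v"
proof (rule bexI[of _ "pull M I (inv_into K \<rho>) u"])
  have I: "finite I" using b K bij_betw_finite by blast
  show "pull M I (inv_into K \<rho>) u \<in> vecs M I" by (rule pull_vecs[OF u I])
  show "u = pull M K \<rho> (pull M I (inv_into K \<rho>) u)"
    using b vecsD(2)[OF u] by (auto simp: pull_def bij_betw_def fun_eq_iff)
qed

lemma pull_inj: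
  assumes b: "bij_betw \<rho> K I" and v: "v \<in> vecs M I" "w \<in> vecs M I" and e: "pull M K \<rho> v = pull M K \<rho> w"
  shows "v = w"
proof (rule ext)
  fix i
  show "v i = w i"
  proof (cases "i \<in> I")
    case True
    then obtain k where "k \<in> K" "i = \<rho> k" using b by (auto simp: bij_betw_def)
    then show ?thesis using fun_cong[OF e, of k] by (simp add: pull_def)
  qed (use vecsD(2)[OF v(1)] vecsD(2)[OF v(2)] in simp)
qed

lemma lin_mrelabel:
  assumes A: "A \<in> Mat R I' I" and b: "bij_betw \<rho> K I" and K: "finite K" "finite K'" and v: "v \<in> vecs M I"
  shows "lin M (mrelabel R K' K \<rho>' \<rho> A) (pull M K \<rho> v) = pull M K' \<rho>' (lin M A v)"
proof (rule ext)
  fix a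
  note A' = R.Mat_mrelabel[OF A K, of \<rho>' \<rho>]
  have I: "finite I" using b K bij_betw_finite by blast
  have "lin M (mrelabel R K' K \<rho>' \<rho> A) (pull M K \<rho> v) a = (\<Oplus>\<^bsub>M\<^esub>k\<in>K. mrelabel R K' K \<rho>' \<rho> A a k \<odot>\<^bsub>M\<^esub> pull M K \<rho> v k)"
    by (rule lin_eq'[OF pull_vecs[OF v K(1)] A' K(1)]) (auto simp: pull_def split: if_splits)
  also have "\<dots> = pull M K' \<rho>' (lin M A v) a"
  proof (cases "a \<in> K'")
    case True
    have "(\<Oplus>\<^bsub>M\<^esub>k\<in>K. mrelabel R K' K \<rho>' \<rho> A a k \<odot>\<^bsub>M\<^esub> pull M K \<rho> v k) = (\<Oplus>\<^bsub>M\<^esub>k\<in>K. A (\<rho>' a) (\<rho> k) \<odot>\<^bsub>M\<^esub> v (\<rho> k))"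
      by (rule M.finsum_cong'[OF refl]) (use True MatD(1)[OF A] vecsD(1)[OF v] in \<open>auto simp: mrelabel_def pull_def\<close>)
    also have "\<dots> = (\<Oplus>\<^bsub>M\<^esub>i\<in>\<rho> ` K. A (\<rho>' a) i \<odot>\<^bsub>M\<^esub> v i)"
      by (rule M.finsum_reindex[symmetric]) (use b MatD(1)[OF A] vecsD(1)[OF v] in \<open>auto simp: bij_betw_def\<close>)
    also have "\<dots> = lin M A v (\<rho>' a)"
      using lin_eq'[OF v A I] vecsD(4)[OF v] b by (simp add: bij_betw_def)
    finally show ?thesis using True by (simp add: pull_def)
  next
    case False
    then show ?thesis using vecsD(1)[OF pull_vecs[OF v K(1)]]
      by (auto simp: mrelabel_def pull_def intro!: M.add.finprod_one_eqI)
  qed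
  finally show "lin M (mrelabel R K' K \<rho>' \<rho> A) (pull M K \<rho> v) a = pull M K' \<rho>' (lin M A v) a" .
qed

lemma pull_zero: "pull M K \<rho> \<zero>\<^bsub>vspace M\<^esub> = \<zero>\<^bsub>vspace M\<^esub>"
  by (rule ext) (simp add: pull_def)

lemma pull_smult:
  "a \<in> carrier R \<Longrightarrow> pull M K \<rho> (a \<odot>\<^bsub>vspace M\<^esub> v) = a \<odot>\<^bsub>vspace M\<^esub> pull M K \<rho> v"
  by (rule ext) (simp add: pull_def)

end

context cring
begin

lemma relabel_cx:
  assumes C: "cx R I D" and b: "\<And>j. bij_betw (\<rho> j) (K j) (I j)"
  shows "cx R K (relabel R K \<rho> D)"
  unfolding cx_def
proof (intro allI conjI)
  have K: "finite (K j)" for j using b cxD(1)[OF C] bij_betw_finite by blast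
  fix j
  show "finite (K j)" by (rule K)
  show M: "relabel R K \<rho> D j \<in> Mat R (K (j - 1)) (K j)" for j
    unfolding relabel_def by (rule Mat_mrelabel[OF cxD(2)[OF C] K K])
  have D1: "D (j - 1) \<in> Mat R (I (j - 1 - 1)) (I (j - 1))" by (rule cxD(2)[OF C])
  show "mm R (relabel R K \<rho> D (j - 1)) (relabel R K \<rho> D j) = mzero R"
  proof (rule mat_vec_eqI[OF Mat_mm[OF M M] Mat_mzero K])
    fix u assume u: "u \<in> rvecs (K j)"
    obtain v where v: "v \<in> rvecs (I j)" "u = pull (regular_module R) (K j) (\<rho> j) v" using reg.pull_surj[OF b K u] by blast
    note Dv = reg.lin_closed[OF v(1) cxD(2)[OF C]]
    have "rlin R (mm R (relabel R K \<rho> D (j - 1)) (relabel R K \<rho> D j)) u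
      = rlin R (relabel R K \<rho> D (j - 1)) (rlin R (relabel R K \<rho> D j) u)"
      by (rule reg.lin_mm[OF vecs_UNIV[OF u] M M])
    also have "\<dots> = pull (regular_module R) (K (j - 1 - 1)) (\<rho> (j - 1 - 1)) (rlin R (D (j - 1)) (rlin R (D j) v))"
      unfolding relabel_def v(2) reg.lin_mrelabel[OF cxD(2)[OF C] b K K v(1)] reg.lin_mrelabel[OF D1 b K K Dv] ..
    also have "\<dots> = \<zero>\<^bsub>vspace (regular_module R)\<^esub>"
      using reg.lin_DD[OF C vecs_UNIV[OF v(1)], of "j - 1"] by (simp add: reg.pull_zero)
    finally show "rlin R (mm R (relabel R K \<rho> D (j - 1)) (relabel R K \<rho> D j)) u = rlin R (mzero R) u"
      by (simp add: reg.lin_mzero[OF vecs_UNIV[OF u]])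
  qed
qed

lemma relabel_kills:
  assumes C: "cx R I D" and b: "\<And>j. bij_betw (\<rho> j) (K j) (I j)" and k: "kills R c I D j" and c: "c \<in> carrier R"
  shows "kills R c K (relabel R K \<rho> D) j"
  unfolding kills_def
proof (intro ballI impI)
  have K: "finite (K j)" for j using b cxD(1)[OF C] bij_betw_finite by blast
  fix u assume u: "u \<in> rvecs (K j)" and z: "rlin R (relabel R K \<rho> D j) u = \<zero>\<^bsub>vspace (regular_module R)\<^esub>"
  obtain v where v: "v \<in> rvecs (I j)" "u = pull (regular_module R) (K j) (\<rho> j) v" using reg.pull_surj[OF b K u] by blast
  note Dv = reg.lin_closed[OF v(1) cxD(2)[OF C]]
  have "pull (regular_module R) (K (j - 1)) (\<rho> (j - 1)) (rlin R (D j) v) = pull (regular_module R) (K (j - 1)) (\<rho> (j - 1)) \<zero>\<^bsub>vspace (regular_module R)\<^esub>"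
    using z unfolding relabel_def v(2) reg.lin_mrelabel[OF cxD(2)[OF C] b K K v(1)] by (simp only: reg.pull_zero)
  then have "rlin R (D j) v = \<zero>\<^bsub>vspace (regular_module R)\<^esub>"
    by (rule reg.pull_inj[OF b Dv reg.vecs_ops(1)])
  then obtain w where w: "w \<in> rvecs (I (j + 1))" "rlin R (D (j + 1)) w = c \<odot>\<^bsub>vspace (regular_module R)\<^esub> v"
    using k v(1) by (auto simp: kills_def)
  have "rlin R (relabel R K \<rho> D (j + 1)) (pull (regular_module R) (K (j + 1)) (\<rho> (j + 1)) w)
      = pull (regular_module R) (K (j + 1 - 1)) (\<rho> (j + 1 - 1)) (c \<odot>\<^bsub>vspace (regular_module R)\<^esub> v)"
    unfolding relabel_def reg.lin_mrelabel[OF cxD(2)[OF C] b K K w(1)] w(2) ..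
  then have "rlin R (relabel R K \<rho> D (j + 1)) (pull (regular_module R) (K (j + 1)) (\<rho> (j + 1)) w)
      = c \<odot>\<^bsub>vspace (regular_module R)\<^esub> u"
    unfolding reg.pull_smult[OF c] by (simp only: v(2) add_diff_cancel_right')
  then show "\<exists>w\<in>rvecs (K (j + 1)). rlin R (relabel R K \<rho> D (j + 1)) w = c \<odot>\<^bsub>vspace (regular_module R)\<^esub> u"
    using reg.pull_vecs[OF w(1) K] by blast
qed

lemma relabel_dual: "dual_diff (relabel R K \<rho> D) = relabel R (dual_index K) (\<lambda>j. \<rho> (- j)) (dual_diff D)"
  by (intro ext) (auto simp: dual_diff_def relabel_def mrelabel_def dual_index_def tr_def)

text \<open>
  The totally acyclic complexes of finite free modules.
\<close>

definition tacyclic where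
  "tacyclic I D \<longleftrightarrow> cx R I D \<and> (\<forall>j. kills R \<one> I D j) \<and> (\<forall>j. kills R \<one> (dual_index I) (dual_diff D) j)"

lemma relabel_tacyclic:
  assumes T: "tacyclic I D" and b: "\<And>j. bij_betw (\<rho> j) (K j) (I j)"
  shows "tacyclic K (relabel R K \<rho> D)"
proof -
  have C: "cx R I D" using T by (simp add: tacyclic_def)
  have "kills R \<one> (dual_index K) (relabel R (dual_index K) (\<lambda>j. \<rho> (- j)) (dual_diff D)) j" for j
    by (rule relabel_kills[OF cx_dual[OF C]]) (use b T in \<open>auto simp: dual_index_def tacyclic_def\<close>)
  then show ?thesis
    using relabel_cx[OF C b] relabel_kills[OF C b _ one_closed] T by (auto simp: tacyclic_def relabel_dual)
qed

lemma shift_tacyclic: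
  assumes T: "tacyclic I D"
  shows "tacyclic (\<lambda>j. I (j + k)) (\<lambda>j. D (j + k))"
proof -
  have C: "cx R I D" using T by (simp add: tacyclic_def)
  have "cx R (\<lambda>j. I (j + k)) (\<lambda>j. D (j + k))"
    unfolding cx_def
  proof (intro allI conjI)
    fix j
    show "finite (I (j + k))" by (rule cxD(1)[OF C])
    show "D (j + k) \<in> Mat R (I (j - 1 + k)) (I (j + k))" using cxD(2)[OF C, of "j + k"] by (simp add: algebra_simps)
    show "mm R (D (j - 1 + k)) (D (j + k)) = mzero R" using cxD(3)[OF C, of "j + k"] by (simp add: algebra_simps)
  qed
  moreover have "kills R \<one> (\<lambda>j. I (j + k)) (\<lambda>j. D (j + k)) j" for j
  proof -
    have "kills R \<one> I D (j + k)" using T by (simp add: tacyclic_def)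
    then show ?thesis by (simp add: kills_def algebra_simps)
  qed
  moreover have "kills R \<one> (dual_index (\<lambda>j. I (j + k))) (dual_diff (\<lambda>j. D (j + k))) j" for j
  proof -
    have "kills R \<one> (dual_index I) (dual_diff D) (j - k)" using T by (simp add: tacyclic_def)
    then show ?thesis by (simp add: kills_def dual_index_def dual_diff_def algebra_simps)
  qed
  ultimately show ?thesis by (simp add: tacyclic_def)
qed

lemma kills_oneD:
  assumes "kills R \<one> I D j" "v \<in> rvecs (I j)" "rlin R (D j) v = \<zero>\<^bsub>vspace (regular_module R)\<^esub>"
  shows "\<exists>w\<in>rvecs (I (j + 1)). rlin R (D (j + 1)) w = v"
proof -
  interpret W: module R "vspace (regular_module R)" by (rule reg.vec_module_module)
  show ?thesis using assms vecs_UNIV[OF assms(2)] by (auto simp: kills_def)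
qed

lemma kills_oneI:
  assumes "\<And>v. v \<in> rvecs (I j) \<Longrightarrow> rlin R (D j) v = \<zero>\<^bsub>vspace (regular_module R)\<^esub> \<Longrightarrow>
    \<exists>w\<in>rvecs (I (j + 1)). rlin R (D (j + 1)) w = v"
  shows "kills R \<one> I D j"
proof -
  interpret W: module R "vspace (regular_module R)" by (rule reg.vec_module_module)
  show ?thesis using assms vecs_UNIV by (auto simp: kills_def)
qed

lemma free_zero: "\<zero>\<^bsub>free_module R S\<^esub> = \<zero>\<^bsub>vspace (regular_module R)\<^esub>"
  by (simp add: free_module_eq vec_module_def)

lemma totally_reflexive_matrix:
  assumes T: "totally_reflexive R M"
  shows "\<exists>(n :: int \<Rightarrow> nat) E \<iota>. tacyclic (\<lambda>j. {..<n j}) E \<and> \<iota> \<in> mod_hom R M (free_module R {..<n (- 1)}) \<and>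
    inj_on \<iota> (carrier M) \<and> \<iota> ` carrier M = rlin R (E 0) ` rvecs {..<n 0}"
proof -
  obtain n :: "int \<Rightarrow> nat" and d where ex: "exact_complex R (\<lambda>i. free_module R {..<n i}) d"
    and exd: "exact_complex R (Hom_complex R (\<lambda>i. free_module R {..<n i}) (regular_module R)) (Hom_diff (\<lambda>i. free_module R {..<n i}) d)"
    and iso: "mod_iso R M ((free_module R {..<n (- 1)})\<lparr>carrier := d 0 ` carrier (free_module R {..<n 0})\<rparr>)"
    using T unfolding totally_reflexive_def Let_def by blast
  let ?F = "\<lambda>i. free_module R {..<n i}" and ?I = "\<lambda>i. {..<n i}" and ?l = "rlin R"
  have C: "chain_complex R ?F d" and Cd: "chain_complex R (Hom_complex R ?F (regular_module R)) (Hom_diff ?F d)"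
    using ex exd by (auto simp: exact_complex_def)
  have "\<exists>A\<in>Mat R (?I (j - 1)) (?I j). \<forall>v\<in>rvecs (?I j). d j v = ?l A v" for j
    by (rule hom_matrix[OF chain_complexD(2)[OF C]]) auto
  then obtain E where E: "\<And>j. E j \<in> Mat R (?I (j - 1)) (?I j)" "\<And>j v. v \<in> rvecs (?I j) \<Longrightarrow> d j v = ?l (E j) v" by metis
  have cx: "cx R ?I E"
    unfolding cx_def
  proof (intro allI conjI E(1))
    fix j
    show "mm R (E (j - 1)) (E j) = mzero R"
    proof (rule mat_vec_eqI[OF Mat_mm[OF E(1) E(1)] Mat_mzero])
      fix v assume v: "v \<in> rvecs (?I j)"
      have "?l (E (j - 1)) (?l (E j) v) = d (j - 1) (d j v)" using E(2)[OF v] E(2)[OF reg.lin_closed[OF v E(1)]] by simp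
      also have "\<dots> = \<zero>\<^bsub>vspace (regular_module R)\<^esub>"
        using chain_complexD(4)[OF C, of v j] v by (simp only: free_module_ops(1) free_zero)
      finally show "?l (mm R (E (j - 1)) (E j)) v = ?l (mzero R) v"
        by (simp only: reg.lin_mm[OF vecs_UNIV[OF v] E(1) E(1)] reg.lin_mzero[OF vecs_UNIV[OF v]])
    qed simp
  qed simp
  have k: "kills R \<one> ?I E j" for j
  proof (rule kills_oneI)
    fix v assume v: "v \<in> rvecs (?I j)" and z: "?l (E j) v = \<zero>\<^bsub>vspace (regular_module R)\<^esub>"
    have "v \<in> cycles ?F d j" using v z E(2)[OF v] by (simp only: cycles_def free_module_ops(1) free_zero mem_Collect_eq)
    then have "v \<in> boundaries ?F d j" using ex homology_zero_iff[OF C] by (auto simp: exact_complex_def)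
    then obtain w where "w \<in> rvecs (?I (j + 1))" "v = d (j + 1) w" by (auto simp: boundaries_def free_module_ops(1))
    then show "\<exists>w\<in>rvecs (?I (j + 1)). ?l (E (j + 1)) w = v" using E(2) by metis
  qed
  have kd: "kills R \<one> (dual_index ?I) (dual_diff E) j" for j
  proof (rule kills_oneI)
    fix v assume v0: "v \<in> rvecs (dual_index ?I j)" and z: "?l (dual_diff E j) v = \<zero>\<^bsub>vspace (regular_module R)\<^esub>"
    have v: "v \<in> rvecs (?I (- j))" using v0 by (simp add: dual_index_def)
    have E1: "E (1 - j) \<in> Mat R (?I (- j)) (?I (1 - j))" using E(1)[of "1 - j"] by simp
    define \<phi> where "\<phi> = (\<lambda>x\<in>rvecs (?I (- j)). ?l (rowm v) x ())"
    have \<phi>: "\<phi> \<in> carrier (Hom_complex R ?F (regular_module R) j)"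
      unfolding \<phi>_def Hom_complex_def by (rule row_hom[OF _ v]) simp
    have "Hom_diff ?F d j \<phi> = \<zero>\<^bsub>Hom_complex R ?F (regular_module R) (j - 1)\<^esub>"
    proof -
      have "\<phi> (d (1 - j) x) = \<zero>" if x: "x \<in> rvecs (?I (1 - j))" for x
      proof -
        have "\<phi> (d (1 - j) x) = ?l (rowm v) (?l (E (1 - j)) x) ()"
          using E(2)[OF x] reg.lin_closed[OF x E1] by (simp add: \<phi>_def)
        also have "\<dots> = ?l (rowm (?l (dual_diff E j) v)) x ()"
          using row_adjoint[OF E1 _ v vecs_UNIV[OF x]] by (simp add: dual_diff_def)
        also have "\<dots> = \<zero>"
          unfolding z unfolding lin_def reg.finsum_regular
          by (rule add.finprod_one_eqI) (use vecsD(1)[OF x] in \<open>auto simp: rowm_def\<close>)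
        finally show ?thesis .
      qed
      then show ?thesis by (auto simp: Hom_diff_def Hom_complex_def Hom_module_def free_module_ops(1) intro!: restrict_ext)
    qed
    then have "\<phi> \<in> cycles (Hom_complex R ?F (regular_module R)) (Hom_diff ?F d) j" using \<phi> by (simp add: cycles_def)
    then have "\<phi> \<in> boundaries (Hom_complex R ?F (regular_module R)) (Hom_diff ?F d) j"
      using exd homology_zero_iff[OF Cd] by (auto simp: exact_complex_def)
    then obtain \<psi> where \<psi>: "\<psi> \<in> carrier (Hom_module R (?F (- (j + 1))) (regular_module R))" "\<phi> = Hom_diff ?F d (j + 1) \<psi>"
      by (auto simp: boundaries_def Hom_complex_def)
    have "\<psi> \<in> mod_hom R (?F (- (j + 1))) (regular_module R)" using \<psi>(1) by (simp add: Hom_module_def)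
    then obtain w where w: "w \<in> rvecs (?I (- (j + 1)))" "\<And>x. x \<in> rvecs (?I (- (j + 1))) \<Longrightarrow> \<psi> x = ?l (rowm w) x ()"
      using functional_row by blast
    have E2: "E (- j) \<in> Mat R (?I (- (j + 1))) (?I (- j))" using E(1)[of "- j"] by simp
    have wl: "?l (tr (E (- j))) w \<in> rvecs (?I (- j))" by (rule reg.lin_closed[OF w(1) tr_Mat[OF E2]])
    have eq: "?l (rowm v) x () = ?l (rowm (?l (tr (E (- j))) w)) x ()" if x: "x \<in> rvecs (?I (- j))" for x
    proof -
      have "?l (rowm v) x () = \<phi> x" using x by (simp add: \<phi>_def)
      also have "\<dots> = \<psi> (d (- j) x)" using x by (simp add: \<psi>(2) Hom_diff_def free_module_ops(1))
      also have "\<dots> = ?l (rowm w) (?l (E (- j)) x) ()" using E(2)[OF x] w(2)[OF reg.lin_closed[OF x E2]] by simp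
      also have "\<dots> = ?l (rowm (?l (tr (E (- j))) w)) x ()" using row_adjoint[OF E2 _ w(1) vecs_UNIV[OF x]] by simp
      finally show ?thesis .
    qed
    have "v = ?l (tr (E (- j))) w"
    proof (rule ext)
      fix b
      show "v b = ?l (tr (E (- j))) w b"
      proof (cases "b \<in> ?I (- j)")
        case True
        show ?thesis using eq[OF basis_elt_vec[OF True]] row_basis[OF v _ True] row_basis[OF wl _ True] by simp
      next
        case False
        then show ?thesis using vecsD(2)[OF v False] vecsD(2)[OF wl False] by simp
      qed
    qed
    then show "\<exists>w\<in>rvecs (dual_index ?I (j + 1)). ?l (dual_diff E (j + 1)) w = v"
      using w(1) by (intro bexI[of _ w]) (simp_all add: dual_diff_def dual_index_def)
  qed
  obtain \<iota> where \<iota>: "\<iota> \<in> mod_hom R M ((?F (- 1))\<lparr>carrier := d 0 ` carrier (?F 0)\<rparr>)" "bij_betw \<iota> (carrier M) (d 0 ` carrier (?F 0))"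
    using iso by (auto simp: mod_iso_def)
  have im: "d 0 ` carrier (?F 0) = ?l (E 0) ` rvecs (?I 0)" using E(2) by (auto simp: free_module_ops(1))
  have "d 0 ` rvecs (?I 0) \<subseteq> rvecs (?I (- 1))"
    using reg.lin_closed[OF _ E(1)[of 0]] im unfolding free_module_ops(1) by auto
  then have "\<iota> \<in> mod_hom R M (?F (- 1))"
    using \<iota>(1) unfolding mod_hom_def free_module_ops(1) by (simp add: Pi_iff subset_iff)
  then show ?thesis using cx k kd \<iota>(2) im
    by (intro exI[of _ n] exI[of _ E] exI[of _ \<iota>]) (auto simp: tacyclic_def bij_betw_def)
qed

end

lemma (in rmodule) minus_eq_zero_iff:
  assumes "a \<in> carrier M" "b \<in> carrier M"
  shows "a \<ominus>\<^bsub>M\<^esub> b = \<zero>\<^bsub>M\<^esub> \<longleftrightarrow> a = b"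
proof
  assume z: "a \<ominus>\<^bsub>M\<^esub> b = \<zero>\<^bsub>M\<^esub>"
  have "a = (a \<ominus>\<^bsub>M\<^esub> b) \<oplus>\<^bsub>M\<^esub> b" using assms by (simp add: a_minus_def M.a_assoc M.l_neg)
  then show "a = b" using z assms by simp
qed (use assms in \<open>simp add: a_minus_def M.r_neg\<close>)

context cring
begin

text \<open>
  The differential \<open>d 0\<close> identifies the cokernel of \<open>d 1\<close> with the image of \<open>d 0\<close>,
  and the matrices of a totally acyclic complex give exact complexes of modules and of linear forms.
\<close>

lemma cokernel_totally_reflexive_0:
  fixes n :: "int \<Rightarrow> nat"
  assumes T: "tacyclic (\<lambda>j. {..<n j}) E"
  shows "totally_reflexive R (quot_module (free_module R {..<n 0}) (rlin R (E 1) ` rvecs {..<n 1}))"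
proof -
  let ?F = "\<lambda>i. free_module R {..<n i}" and ?I = "\<lambda>i. {..<n i}" and ?l = "rlin R"
  let ?reg = "regular_module R"
  define d where "d j = ?l (E j)" for j
  have cx: "cx R ?I E" and k: "\<And>j. kills R \<one> ?I E j" and kd: "\<And>j. kills R \<one> (dual_index ?I) (dual_diff E) j"
    using T by (auto simp: tacyclic_def)
  note EM = cxD(2)[OF cx]
  have Frm: "rmodule R (?F i)" for i by (rule free_module_rmodule)
  have Fm: "module R (?F i)" for i using Frm by (simp add: rmodule_def)
  have dh: "d j \<in> mod_hom R (?F j) (?F (j - 1))" for j unfolding d_def by (rule lin_mod_hom[OF EM])
  note dD = mod_homD[OF dh, unfolded free_module_ops(1)]
  have dd: "d (j - 1) (d j x) = \<zero>\<^bsub>?F (j - 2)\<^esub>" if x: "x \<in> rvecs (?I j)" for j x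
    using reg.lin_DD[OF cx vecs_UNIV[OF x], of "j - 1"] by (simp add: d_def free_zero)
  have C: "chain_complex R ?F d"
    unfolding chain_complex_def using Fm dh dd by (simp add: free_module_ops(1))
  have ex: "exact_complex R ?F d"
    unfolding exact_complex_def
  proof (intro conjI C allI)
    fix i
    show "zero_module (homology ?F d i)"
      unfolding homology_zero_iff[OF C]
    proof
      fix v assume "v \<in> cycles ?F d i"
      then have v: "v \<in> rvecs (?I i)" "?l (E i) v = \<zero>\<^bsub>vec_module ?reg UNIV\<^esub>"
        by (simp_all only: cycles_def d_def free_module_ops(1) free_zero mem_Collect_eq)
      show "v \<in> boundaries ?F d i"
        using kills_oneD[OF k v] by (auto simp: boundaries_def d_def free_module_ops(1))
    qed
  qed
  let ?H = "Hom_complex R ?F ?reg" and ?\<delta> = "Hom_diff ?F d"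
  have Hcar: "carrier (?H j) = mod_hom R (?F (- j)) ?reg \<inter> extensional (rvecs (?I (- j)))" for j
    by (simp add: Hom_complex_def Hom_module_def free_module_ops(1))
  have Hop: "f \<oplus>\<^bsub>?H j\<^esub> g = (\<lambda>x\<in>rvecs (?I (- j)). f x \<oplus> g x)" "\<zero>\<^bsub>?H j\<^esub> = (\<lambda>x\<in>rvecs (?I (- j)). \<zero>)"
    "a \<odot>\<^bsub>?H j\<^esub> f = (\<lambda>x\<in>rvecs (?I (- j)). a \<otimes> f x)" for f g a j
    by (simp_all add: Hom_complex_def Hom_module_def free_module_ops(1))
  have ddual: "?\<delta> j f = (\<lambda>x\<in>rvecs (?I (1 - j)). f (d (1 - j) x))" for j f
    by (simp add: Hom_diff_def free_module_ops(1))
  have dcl: "d (1 - j) x \<in> rvecs (?I (- j))" if "x \<in> rvecs (?I (1 - j))" for x j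
    using dD(1)[OF that] by simp
  have Cd: "chain_complex R ?H ?\<delta>"
    unfolding chain_complex_def
  proof (intro conjI allI ballI)
    fix j
    show "module R (?H j)" unfolding Hom_complex_def by (rule Hom_module_module[OF Frm regular_rmodule])
    have comp: "(\<lambda>x\<in>rvecs (?I (1 - j)). f (d (1 - j) x)) \<in> mod_hom R (?F (1 - j)) ?reg"
      if f: "f \<in> mod_hom R (?F (- j)) ?reg" for f
    proof -
      note fD = mod_homD[OF f, unfolded free_module_ops(1)]
      have cl: "x \<oplus>\<^bsub>?F (1 - j)\<^esub> y \<in> rvecs (?I (1 - j))" if "x \<in> rvecs (?I (1 - j))" "y \<in> rvecs (?I (1 - j))" for x y
      proof -
        interpret F: rmodule R "?F (1 - j)" by (rule Frm)
        show ?thesis using F.M.a_closed[of x y] that by (simp add: free_module_ops(1))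
      qed
      have cs: "a \<odot>\<^bsub>?F (1 - j)\<^esub> x \<in> rvecs (?I (1 - j))" if "a \<in> carrier R" "x \<in> rvecs (?I (1 - j))" for a x
      proof -
        interpret F: rmodule R "?F (1 - j)" by (rule Frm)
        show ?thesis using F.smult_closed[of a x] that by (simp add: free_module_ops(1))
      qed
      show ?thesis
        unfolding mod_hom_def free_module_ops(1)
      proof (intro CollectI conjI ballI funcsetI)
        fix x assume x: "x \<in> rvecs (?I (1 - j))"
        show "(\<lambda>x\<in>rvecs (?I (1 - j)). f (d (1 - j) x)) x \<in> carrier ?reg" using fD(1)[OF dcl[OF x]] x by simp
        fix y assume y: "y \<in> rvecs (?I (1 - j))"
        show "(\<lambda>x\<in>rvecs (?I (1 - j)). f (d (1 - j) x)) (x \<oplus>\<^bsub>?F (1 - j)\<^esub> y) =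
           (\<lambda>x\<in>rvecs (?I (1 - j)). f (d (1 - j) x)) x \<oplus>\<^bsub>?reg\<^esub> (\<lambda>x\<in>rvecs (?I (1 - j)). f (d (1 - j) x)) y"
          using cl[OF x y] x y dD(2)[OF x y] fD(2)[OF dcl[OF x] dcl[OF y]] by simp
      next
        fix a x assume a: "a \<in> carrier R" and x: "x \<in> rvecs (?I (1 - j))"
        show "(\<lambda>x\<in>rvecs (?I (1 - j)). f (d (1 - j) x)) (a \<odot>\<^bsub>?F (1 - j)\<^esub> x) =
           a \<odot>\<^bsub>?reg\<^esub> (\<lambda>x\<in>rvecs (?I (1 - j)). f (d (1 - j) x)) x"
          using cs[OF a x] x dD(3)[OF a x] fD(3)[OF a dcl[OF x]] by simp
      qed
    qed
    show "?\<delta> j \<in> mod_hom R (?H j) (?H (j - 1))"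
      unfolding mod_hom_def
    proof (intro CollectI conjI ballI funcsetI)
      fix f assume f: "f \<in> carrier (?H j)"
      then have fh: "f \<in> mod_hom R (?F (- j)) ?reg" by (simp add: Hcar)
      show "?\<delta> j f \<in> carrier (?H (j - 1))" using comp[OF fh] by (simp add: Hcar ddual)
      fix g assume g: "g \<in> carrier (?H j)"
      show "?\<delta> j (f \<oplus>\<^bsub>?H j\<^esub> g) = ?\<delta> j f \<oplus>\<^bsub>?H (j - 1)\<^esub> ?\<delta> j g"
        unfolding Hop ddual using dcl by (auto intro!: restrict_ext)
    next
      fix a f assume a: "a \<in> carrier R" and f: "f \<in> carrier (?H j)"
      show "?\<delta> j (a \<odot>\<^bsub>?H j\<^esub> f) = a \<odot>\<^bsub>?H (j - 1)\<^esub> ?\<delta> j f"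
        unfolding Hop ddual using dcl by (auto intro!: restrict_ext)
    qed
    fix f assume f: "f \<in> carrier (?H j)"
    then have fh: "f \<in> mod_hom R (?F (- j)) ?reg" by (simp add: Hcar)
    have z: "f \<zero>\<^bsub>?F (- j)\<^esub> = \<zero>" using mod_hom_zero[OF Frm regular_rmodule fh] by simp
    have dd2: "d (1 - j) (d (2 - j) x) = \<zero>\<^bsub>?F (- j)\<^esub>" if "x \<in> rvecs (?I (2 - j))" for x
      using dd[OF that] by simp
    have d2: "d (2 - j) x \<in> rvecs (?I (1 - j))" if "x \<in> rvecs (?I (2 - j))" for x using dD(1)[OF that] by simp
    show "?\<delta> (j - 1) (?\<delta> j f) = \<zero>\<^bsub>?H (j - 2)\<^esub>"
      unfolding Hop ddual using dd2 d2 z by (auto intro!: restrict_ext)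
  qed
  have exd: "exact_complex R ?H ?\<delta>"
    unfolding exact_complex_def
  proof (intro conjI Cd allI)
    fix j
    show "zero_module (homology ?H ?\<delta> j)"
      unfolding homology_zero_iff[OF Cd]
    proof
      fix f assume f: "f \<in> cycles ?H ?\<delta> j"
      then have fh: "f \<in> mod_hom R (?F (- j)) ?reg" and fe: "f \<in> extensional (rvecs (?I (- j)))"
        and fz: "?\<delta> j f = \<zero>\<^bsub>?H (j - 1)\<^esub>" by (auto simp: cycles_def Hcar)
      obtain w where w: "w \<in> rvecs (?I (- j))" "\<And>x. x \<in> rvecs (?I (- j)) \<Longrightarrow> f x = ?l (rowm w) x ()"
        using functional_row[OF fh] by blast
      have E1: "E (1 - j) \<in> Mat R (?I (- j)) (?I (1 - j))" using EM[of "1 - j"] by simp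
      have wl: "?l (dual_diff E j) w \<in> rvecs (?I (1 - j))"
        unfolding dual_diff_def by (rule reg.lin_closed[OF w(1) tr_Mat[OF E1]])
      have "?l (dual_diff E j) w = \<zero>\<^bsub>vec_module ?reg UNIV\<^esub>"
      proof (rule ext)
        fix b
        show "?l (dual_diff E j) w b = \<zero>\<^bsub>vec_module ?reg UNIV\<^esub> b"
        proof (cases "b \<in> ?I (1 - j)")
          case True
          note eb = basis_elt_vec[OF True]
          have "?l (dual_diff E j) w b = ?l (rowm (?l (dual_diff E j) w)) (basis_elt R b) ()"
            using row_basis[OF wl _ True] by simp
          also have "\<dots> = ?l (rowm w) (?l (E (1 - j)) (basis_elt R b)) ()"
            using row_adjoint[OF E1 _ w(1) vecs_UNIV[OF eb]] by (simp add: dual_diff_def)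
          also have "\<dots> = f (d (1 - j) (basis_elt R b))" using w(2)[OF dcl[OF eb]] by (simp add: d_def)
          also have "\<dots> = \<zero>" using fun_cong[OF fz, of "basis_elt R b"] eb by (simp add: ddual Hop)
          finally show ?thesis by simp
        next
          case False
          then show ?thesis using vecsD(2)[OF wl False] by simp
        qed
      qed
      then obtain u where u: "u \<in> rvecs (dual_index ?I (j + 1))" "?l (dual_diff E (j + 1)) u = w"
        using kills_oneD[OF kd, of w j] w(1) by (auto simp: dual_index_def)
      have u1: "u \<in> rvecs (?I (- (j + 1)))" using u(1) by (simp add: dual_index_def)
      have E2: "E (- j) \<in> Mat R (?I (- (j + 1))) (?I (- j))" using EM[of "- j"] by simp
      define g where "g = (\<lambda>x\<in>rvecs (?I (- (j + 1))). ?l (rowm u) x ())"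
      have g: "g \<in> carrier (?H (j + 1))"
        unfolding g_def Hom_complex_def by (rule row_hom[OF _ u1]) simp
      have "f = ?\<delta> (j + 1) g"
      proof (rule extensionalityI[OF fe])
        show "?\<delta> (j + 1) g \<in> extensional (rvecs (?I (- j)))" by (simp add: ddual)
        fix x assume x: "x \<in> rvecs (?I (- j))"
        have "?\<delta> (j + 1) g x = ?l (rowm u) (?l (E (- j)) x) ()"
          using x reg.lin_closed[OF x E2] by (simp add: ddual d_def g_def)
        also have "\<dots> = ?l (rowm w) x ()"
          using row_adjoint[OF E2 _ u1 vecs_UNIV[OF x]] u(2) by (simp add: dual_diff_def)
        finally show "f x = ?\<delta> (j + 1) g x" using w(2)[OF x] by simp
      qed
      then show "f \<in> boundaries ?H ?\<delta> j" using g by (auto simp: boundaries_def)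
    qed
  qed
  interpret P: rmodule R "?F 0" by (rule Frm)
  have E1: "E 1 \<in> Mat R (?I 0) (?I 1)" using EM[of 1] by simp
  let ?U = "?l (E 1) ` rvecs (?I 1)" and ?M = "quot_module (?F 0) (?l (E 1) ` rvecs (?I 1))"
  note U = free_image_submodule[OF E1]
  interpret Q: module R ?M by (rule P.quot_module_module[OF U])
  interpret Q: rmodule R ?M by unfold_locales
  let ?c = "\<lambda>u. ?U +>\<^bsub>?F 0\<^esub> u"
  have ch: "?c \<in> mod_hom R (?F 0) ?M"
    unfolding mod_hom_def P.quot_carrier using P.quot_add[OF U] P.quot_smult[OF U] by auto
  have fg: "fin_gen R ?M"
    unfolding fin_gen_def
  proof (intro exI conjI)
    let ?S = "(\<lambda>b. ?c (basis_elt R b)) ` ?I 0"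
    show "finite ?S" by simp
    show S: "?S \<subseteq> carrier ?M" by (auto simp: free_module_ops(1) intro!: mod_homD(1)[OF ch] basis_elt_vec)
    note sp = Q.submodule_span_props[OF S]
    show "submodule_span R ?M ?S = carrier ?M"
    proof
      show "submodule_span R ?M ?S \<subseteq> carrier ?M" using Q.submodD(1)[OF sp(1)] by auto
      show "carrier ?M \<subseteq> submodule_span R ?M ?S"
      proof
        fix y assume "y \<in> carrier ?M"
        then obtain u where u: "u \<in> rvecs (?I 0)" "y = ?c u" by (auto simp: P.quot_carrier free_module_ops(1))
        have uc: "u i \<in> carrier R" for i using vecsD(1)[OF u(1)] by simp
        have "?c u = (\<Oplus>\<^bsub>?M\<^esub>i\<in>?I 0. u i \<odot>\<^bsub>?M\<^esub> ?c (basis_elt R i))"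
          by (rule free_hom_expand[OF Q.rmodule_axioms ch _ u(1)]) simp
        also have "\<dots> \<in> submodule_span R ?M ?S"
        proof -
          have "(\<Oplus>\<^bsub>?M\<^esub>i\<in>A. u i \<odot>\<^bsub>?M\<^esub> ?c (basis_elt R i)) \<in> submodule_span R ?M ?S" if "A \<subseteq> ?I 0" for A
          proof -
            have "finite A" using that finite_subset by blast
            then show ?thesis using that
            proof (induction A)
              case empty
              then show ?case using Q.submodD(2)[OF sp(1)] by simp
            next
              case (insert i A)
              have m: "u i \<odot>\<^bsub>?M\<^esub> ?c (basis_elt R i) \<in> submodule_span R ?M ?S" if "i \<in> ?I 0" for i
                by (rule Q.submodD(6)[OF sp(1) uc]) (use sp(2) that in blast)
              have "(\<Oplus>\<^bsub>?M\<^esub>i\<in>insert i A. u i \<odot>\<^bsub>?M\<^esub> ?c (basis_elt R i)) =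
                u i \<odot>\<^bsub>?M\<^esub> ?c (basis_elt R i) \<oplus>\<^bsub>?M\<^esub> (\<Oplus>\<^bsub>?M\<^esub>i\<in>A. u i \<odot>\<^bsub>?M\<^esub> ?c (basis_elt R i))"
                by (rule Q.M.finsum_insert) (use insert m Q.submodD(1)[OF sp(1)] in auto)
              then show ?case using Q.submodD(3)[OF sp(1) m insert.IH] insert.prems by simp
            qed
          qed
          then show ?thesis by simp
        qed
        finally show "y \<in> submodule_span R ?M ?S" using u(2) by simp
      qed
    qed
  qed
  have d0U: "?l (E 0) u = \<zero>\<^bsub>vec_module ?reg UNIV\<^esub>" if u: "u \<in> ?U" for u
  proof -
    obtain v where v: "v \<in> rvecs (?I 1)" "u = ?l (E 1) v" using u by blast
    then show ?thesis using reg.lin_DD[OF cx vecs_UNIV[OF v(1)], of 0] by simp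
  qed
  have d0iff: "d 0 u = d 0 v \<longleftrightarrow> ?c u = ?c v" if u: "u \<in> rvecs (?I 0)" and v: "v \<in> rvecs (?I 0)" for u v
  proof -
    interpret RW: module R "vec_module ?reg UNIV" by (rule reg.vec_module_module)
    interpret RW: rmodule R "vec_module ?reg UNIV" by unfold_locales
    have E0: "E 0 \<in> Mat R (?I (- 1)) (?I 0)" using EM[of 0] by simp
    have sub: "u \<ominus>\<^bsub>?F 0\<^esub> v = u \<ominus>\<^bsub>vec_module ?reg UNIV\<^esub> v"
    proof (rule ext)
      fix i
      have "(\<ominus> \<one>) \<odot>\<^bsub>?F 0\<^esub> v = \<ominus>\<^bsub>?F 0\<^esub> v" using P.smult_l_minus[of \<one> v] v by (simp add: free_module_ops(1))
      then have "(u \<ominus>\<^bsub>?F 0\<^esub> v) i = u i \<oplus> (\<ominus> \<one>) \<otimes> v i" by (metis a_minus_def free_module_ops(2,4))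
      then show "(u \<ominus>\<^bsub>?F 0\<^esub> v) i = (u \<ominus>\<^bsub>vec_module ?reg UNIV\<^esub> v) i"
        using reg.vec_minus[OF vecs_UNIV[OF u] vecs_UNIV[OF v]] vecsD(1)[OF v]
        by (simp add: a_minus_def l_minus regular_neg)
    qed
    note uv = reg.vecs_ops(3)[OF u v]
    have "?c u = ?c v \<longleftrightarrow> u \<ominus>\<^bsub>vec_module ?reg UNIV\<^esub> v \<in> ?U"
      using P.coset_eq_iff[OF U, of u v] u v sub by (simp add: free_module_ops(1))
    also have "\<dots> \<longleftrightarrow> ?l (E 0) (u \<ominus>\<^bsub>vec_module ?reg UNIV\<^esub> v) = \<zero>\<^bsub>vec_module ?reg UNIV\<^esub>"
    proof
      assume "?l (E 0) (u \<ominus>\<^bsub>vec_module ?reg UNIV\<^esub> v) = \<zero>\<^bsub>vec_module ?reg UNIV\<^esub>"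
      then obtain w where "w \<in> rvecs (?I 1)" "?l (E 1) w = u \<ominus>\<^bsub>vec_module ?reg UNIV\<^esub> v"
        using kills_oneD[OF k uv] by auto
      then show "u \<ominus>\<^bsub>vec_module ?reg UNIV\<^esub> v \<in> ?U" by (metis imageI)
    qed (rule d0U)
    also have "\<dots> \<longleftrightarrow> d 0 u = d 0 v"
      unfolding reg.lin_minus[OF vecs_UNIV[OF u] vecs_UNIV[OF v] E0] d_def
      using vecs_UNIV[OF reg.lin_closed[OF u E0]] vecs_UNIV[OF reg.lin_closed[OF v E0]]
      by (rule RW.minus_eq_zero_iff)
    finally show ?thesis by blast
  qed
  define f where "f y = d 0 (SOME u. u \<in> rvecs (?I 0) \<and> y = ?c u)" for y
  have fc: "f (?c u) = d 0 u" if u: "u \<in> rvecs (?I 0)" for u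
  proof -
    define w where "w = (SOME v. v \<in> rvecs (?I 0) \<and> ?c u = ?c v)"
    have "w \<in> rvecs (?I 0) \<and> ?c u = ?c w"
      unfolding w_def by (rule someI[of "\<lambda>v. v \<in> rvecs (?I 0) \<and> ?c u = ?c v" u]) (use u in blast)
    then have "d 0 u = d 0 w" using d0iff[OF u, of w] by blast
    then show ?thesis unfolding f_def w_def by (rule sym)
  qed
  have el: "\<exists>u\<in>rvecs (?I 0). y = ?c u" if "y \<in> carrier ?M" for y
    using that by (auto simp: P.quot_carrier free_module_ops(1))
  let ?D = "(?F (- 1))\<lparr>carrier := d 0 ` carrier (?F 0)\<rparr>"
  have d0: "d 0 \<in> mod_hom R (?F 0) (?F (- 1))" using dh[of 0] by simp
  have "f \<in> mod_hom R ?M ?D"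
    unfolding mod_hom_def
  proof (intro CollectI conjI ballI funcsetI)
    fix x assume x: "x \<in> carrier ?M"
    then obtain u where u: "u \<in> rvecs (?I 0)" "x = ?c u" using el by blast
    note uP = u(1)[folded free_module_ops(1)]
    show "f x \<in> carrier ?D" using fc u by (simp add: free_module_ops(1))
    fix y assume y: "y \<in> carrier ?M"
    then obtain v where v: "v \<in> rvecs (?I 0)" "y = ?c v" using el by blast
    note vP = v(1)[folded free_module_ops(1)]
    have "x \<oplus>\<^bsub>?M\<^esub> y = ?c (u \<oplus>\<^bsub>?F 0\<^esub> v)" using P.quot_add[OF U uP vP] u v by simp
    moreover have "u \<oplus>\<^bsub>?F 0\<^esub> v \<in> rvecs (?I 0)" using P.M.a_closed[OF uP vP] by (simp add: free_module_ops(1))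
    ultimately show "f (x \<oplus>\<^bsub>?M\<^esub> y) = f x \<oplus>\<^bsub>?D\<^esub> f y"
      using fc u v mod_homD(2)[OF d0 uP vP] by simp
  next
    fix a x assume a: "a \<in> carrier R" and x: "x \<in> carrier ?M"
    then obtain u where u: "u \<in> rvecs (?I 0)" "x = ?c u" using el by blast
    note uP = u(1)[folded free_module_ops(1)]
    have "a \<odot>\<^bsub>?M\<^esub> x = ?c (a \<odot>\<^bsub>?F 0\<^esub> u)" using P.quot_smult[OF U a uP] u by simp
    moreover have "a \<odot>\<^bsub>?F 0\<^esub> u \<in> rvecs (?I 0)" using P.smult_closed[OF a uP] by (simp add: free_module_ops(1))
    ultimately show "f (a \<odot>\<^bsub>?M\<^esub> x) = a \<odot>\<^bsub>?D\<^esub> f x"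
      using fc u mod_homD(3)[OF d0 a uP] by simp
  qed
  moreover have "bij_betw f (carrier ?M) (carrier ?D)"
  proof (rule bij_betwI')
    show "(f x = f y) = (x = y)" if "x \<in> carrier ?M" "y \<in> carrier ?M" for x y
      using el[OF that(1)] el[OF that(2)] fc d0iff by auto
    show "f x \<in> carrier ?D" if "x \<in> carrier ?M" for x using el[OF that] fc by (auto simp: free_module_ops(1))
    show "\<exists>x\<in>carrier ?M. y = f x" if y: "y \<in> carrier ?D" for y
    proof -
      obtain u where "u \<in> rvecs (?I 0)" "y = d 0 u" using y by (auto simp: free_module_ops(1))
      then show ?thesis using fc by (intro bexI[of _ "?c u"]) (auto simp: P.quot_carrier free_module_ops(1))
    qed
  qed
  ultimately have "mod_iso R ?M ?D" by (auto simp: mod_iso_def)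
  then show ?thesis
    unfolding totally_reflexive_def Let_def using Q.module_axioms fg ex exd by blast
qed

text \<open>
  A shift of the complex moves the degree \<open>k\<close> to \<open>0\<close>.
\<close>

lemma cokernel_totally_reflexive:
  fixes n :: "int \<Rightarrow> nat"
  assumes T: "tacyclic (\<lambda>j. {..<n j}) E"
  shows "totally_reflexive R (quot_module (free_module R {..<n k}) (rlin R (E (k + 1)) ` rvecs {..<n (k + 1)}))"
  using cokernel_totally_reflexive_0[OF shift_tacyclic[OF T, of k]] by (simp add: add.commute)

end

section \<open>Gluing totally acyclic complexes\<close>

text \<open>
  The first component of a basis element is the index of the module \<open>G\<^sub>i\<close> whose complex contributes it.
  The complex for \<open>G\<^sub>i\<close> is graded such that \<open>G\<^sub>i\<close> is the image of its differential
  into degree \<open>i\<close>. Its terms in degrees up to \<open>i\<close>, which are the ones selected here, form a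
  coresolution of \<open>G\<^sub>i\<close>, and the other ones form a resolution.
\<close>

definition copart :: "(int \<Rightarrow> (int \<times> nat) set) \<Rightarrow> int \<Rightarrow> (int \<times> nat) set" where
  "copart I i = {a \<in> I i. i \<le> fst a}"

text \<open>
  The state of the construction when the modules \<open>G\<^sub>i\<close> with \<open>i \<le> p\<close> have been treated.
  The triangularity of \<open>D\<close> makes \<open>copart I\<close> a subcomplex. The maps \<open>\<epsilon> i\<close>
  form a chain map into it from the truncation of \<open>G\<close> at degree \<open>p\<close>, and the last two clauses
  state that it is injective and surjective on homology. The homology of the truncation in degree \<open>p\<close>
  consists of all cycles, which is why the clause on injectivity admits a boundary only for \<open>i < p\<close>.
\<close>

definition coresolves where
  "coresolves R G d p I D \<epsilon> \<longleftrightarrow>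
     cring.tacyclic R I D \<and> (\<forall>j. \<forall>a\<in>I j. 0 \<le> fst a \<and> fst a \<le> p) \<and>
     (\<forall>j a b. j \<le> fst b \<longrightarrow> fst a < j - 1 \<longrightarrow> D j a b = \<zero>\<^bsub>R\<^esub>) \<and>
     (\<forall>i\<le>p. \<epsilon> i \<in> mod_hom R (G i) (free_module R (copart I i))) \<and>
     (\<forall>i\<le>p. \<forall>x\<in>carrier (G i). rlin R (D i) (\<epsilon> i x) = \<epsilon> (i - 1) (d i x)) \<and>
     (\<forall>i\<le>p. \<forall>x\<in>carrier (G i). d i x = \<zero>\<^bsub>G (i - 1)\<^esub> \<longrightarrow>
        (\<forall>l\<in>vecs (regular_module R) (copart I (i + 1)). \<epsilon> i x = rlin R (D (i + 1)) l \<longrightarrow>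
           x = \<zero>\<^bsub>G i\<^esub> \<or> i < p \<and> (\<exists>y\<in>carrier (G (i + 1)). d (i + 1) y = x))) \<and>
     (\<forall>i\<le>p. \<forall>v\<in>vecs (regular_module R) (copart I i).
        rlin R (D i) v = \<zero>\<^bsub>vspace (regular_module R)\<^esub> \<longrightarrow>
        (\<exists>x\<in>carrier (G i). d i x = \<zero>\<^bsub>G (i - 1)\<^esub> \<and> (\<exists>l\<in>vecs (regular_module R) (copart I (i + 1)).
           v = \<epsilon> i x \<oplus>\<^bsub>vspace (regular_module R)\<^esub> rlin R (D (i + 1)) l)))"

context cring
begin

text \<open>
  The basis elements are tagged with the number \<open>P\<close>, and the complex is shifted such that \<open>M\<close> is
  the image of the differential into degree \<open>P\<close>.
\<close>

lemma totally_reflexive_indexed: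
  assumes T: "totally_reflexive R M"
  shows "\<exists>J E \<iota>. tacyclic J E \<and> (\<forall>j. \<forall>a\<in>J j. fst a = (P::int)) \<and> \<iota> \<in> mod_hom R M (free_module R (J P :: (int \<times> nat) set)) \<and>
    inj_on \<iota> (carrier M) \<and> \<iota> ` carrier M = rlin R (E (P + 1)) ` rvecs (J (P + 1))"
proof -
  obtain n :: "int \<Rightarrow> nat" and E \<iota> where t: "tacyclic (\<lambda>j. {..<n j}) E" and \<iota>: "\<iota> \<in> mod_hom R M (free_module R {..<n (- 1)})"
    "inj_on \<iota> (carrier M)" "\<iota> ` carrier M = rlin R (E 0) ` rvecs {..<n 0}"
    using totally_reflexive_matrix[OF T] by blast
  define J where "J j = {P} \<times> {..<n (j - P - 1)}" for j
  define E' where "E' = relabel R J (\<lambda>_. snd) (\<lambda>j. E (j - P - 1))"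
  have t1: "tacyclic (\<lambda>j. {..<n (j - P - 1)}) (\<lambda>j. E (j - P - 1))"
    using shift_tacyclic[OF t, of "- P - 1"] by (simp add: algebra_simps)
  have bij: "bij_betw snd (J j) {..<n (j - P - 1)}" for j
    unfolding J_def by (auto simp: bij_betw_def inj_on_def image_iff)
  have t': "tacyclic J E'" unfolding E'_def by (rule relabel_tacyclic[OF t1 bij])
  let ?p = "pull (regular_module R) (J P) (snd :: int \<times> nat \<Rightarrow> nat)"
  have JP: "J P = {P} \<times> {..<n (- 1)}" and JP1: "J (P + 1) = {P} \<times> {..<n 0}" by (auto simp: J_def)
  have fin: "finite (J j)" for j by (simp add: J_def)
  have b0: "bij_betw snd (J P) {..<n (- 1)}" using bij[of P] by simp
  have b1: "bij_betw snd (J (P + 1)) {..<n 0}" using bij[of "P + 1"] by simp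
  have E0: "E 0 \<in> Mat R {..<n (- 1)} {..<n 0}" using cxD(2)[of R "\<lambda>j. {..<n j}" E 0] t by (simp add: tacyclic_def)
  have cl: "\<iota> x \<in> rvecs {..<n (- 1)}" if "x \<in> carrier M" for x using mod_homD(1)[OF \<iota>(1) that] by (simp add: free_module_ops(1))
  have hom: "(\<lambda>x. ?p (\<iota> x)) \<in> mod_hom R M (free_module R (J P))"
    unfolding mod_hom_def free_module_ops
    using cl reg.pull_vecs[OF cl fin] mod_homD(2,3)[OF \<iota>(1), unfolded free_module_ops]
    by (auto simp: pull_def)
  have inj: "inj_on (\<lambda>x. ?p (\<iota> x)) (carrier M)"
  proof (rule inj_onI)
    fix x y assume xy: "x \<in> carrier M" "y \<in> carrier M" "?p (\<iota> x) = ?p (\<iota> y)"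
    have "\<iota> x = \<iota> y" by (rule reg.pull_inj[OF b0 cl[OF xy(1)] cl[OF xy(2)] xy(3)])
    then show "x = y" using \<iota>(2) xy by (auto simp: inj_on_def)
  qed
  have rel: "rlin R (E' (P + 1)) (pull (regular_module R) (J (P + 1)) snd v) = ?p (rlin R (E 0) v)"
    if v: "v \<in> rvecs {..<n 0}" for v
    using reg.lin_mrelabel[OF E0 b1 fin fin[of P] v, where \<rho>' = snd] by (simp add: E'_def relabel_def)
  have "(\<lambda>x. ?p (\<iota> x)) ` carrier M = ?p ` (rlin R (E 0) ` rvecs {..<n 0})"
    unfolding \<iota>(3)[symmetric] by (simp add: image_image)
  also have "\<dots> = rlin R (E' (P + 1)) ` (pull (regular_module R) (J (P + 1)) snd ` rvecs {..<n 0})"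
    by (simp add: image_image rel cong: image_cong)
  also have "pull (regular_module R) (J (P + 1)) snd ` rvecs {..<n 0} = rvecs (J (P + 1))"
    using reg.pull_surj[OF b1 fin] reg.pull_vecs[OF _ fin] by blast
  finally have im: "(\<lambda>x. ?p (\<iota> x)) ` carrier M = rlin R (E' (P + 1)) ` rvecs (J (P + 1))" .
  show ?thesis
    by (rule exI[of _ J], rule exI[of _ E'], rule exI[of _ "\<lambda>x. ?p (\<iota> x)"])
       (use t' hom inj im in \<open>auto simp: J_def\<close>)
qed

lemma cone_tacyclic:
  assumes C: "cone R I D f J E" and T: "tacyclic I D" "tacyclic J E"
  shows "tacyclic (\<lambda>j. I j \<union> J j) (cone_diff R D f E)"
proof -
  have "kills R \<one> (\<lambda>j. dual_index J j \<union> dual_index I j) (cone_diff R (dual_diff E) (dual_diff f) (dual_diff D)) j" for j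
    by (rule cone_exact[OF cone_dual(1)[OF C]]) (use T in \<open>auto simp: tacyclic_def\<close>)
  moreover have "(\<lambda>j. dual_index J j \<union> dual_index I j) = dual_index (\<lambda>j. I j \<union> J j)" by (auto simp: dual_index_def)
  ultimately show ?thesis
    using cone_cx[OF C] cone_exact[OF C] T by (simp add: tacyclic_def cone_dual(2)[OF C])
qed

lemma coresolves_base:
  assumes G: "chain_complex R G d" and z: "\<And>i. i < 0 \<Longrightarrow> zero_module (G i)"
  shows "coresolves R G d (- 1) (\<lambda>_. {}) (\<lambda>_. mzero R) (\<lambda>_ _. \<zero>\<^bsub>vspace (regular_module R)\<^esub>)"
proof -
  let ?W = "vspace (regular_module R)"
  have v0: "v = \<zero>\<^bsub>?W\<^esub>" if "v \<in> rvecs {}" for v using vecsD(2)[OF that] by auto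
  have up: "copart (\<lambda>_. {}) i = {}" for i by (simp add: copart_def)
  have l0: "rlin R A \<zero>\<^bsub>?W\<^esub> = \<zero>\<^bsub>?W\<^esub>" for A by (rule reg.lin_zero)
  have di: "dual_index (\<lambda>_. {}) = (\<lambda>_. {})" by (simp add: dual_index_def)
  have ki: "kills R \<one> (\<lambda>_. {} :: (int \<times> nat) set) D j" for D j
    by (rule kills_oneI) (use v0 l0 reg.vecs_ops(1) in auto)
  have cx: "cx R (\<lambda>_. {} :: (int \<times> nat) set) (\<lambda>_. mzero R)"
    unfolding cx_def by (simp add: mm_mzero_right[OF Mat_mzero[of UNIV UNIV]])
  have t: "tacyclic (\<lambda>_. {} :: (int \<times> nat) set) (\<lambda>_. mzero R)" using ki cx by (simp add: tacyclic_def di)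
  have hom: "(\<lambda>_. \<zero>\<^bsub>?W\<^esub>) \<in> mod_hom R (G i) (free_module R {})" for i
    unfolding mod_hom_def free_module_ops by (auto simp: reg.vecs_ops(1) fun_eq_iff)
  have z1: "x = \<zero>\<^bsub>G i\<^esub>" if "i \<le> - 1" "x \<in> carrier (G i)" for i x
    using z[of i] that by (auto simp: zero_module_def)
  have zc: "\<zero>\<^bsub>G i\<^esub> \<in> carrier (G i)" "d i \<zero>\<^bsub>G i\<^esub> = \<zero>\<^bsub>G (i - 1)\<^esub>" for i
  proof -
    interpret m: rmodule R "G i" unfolding rmodule_def by (rule chain_complexD(1)[OF G])
    interpret m': rmodule R "G (i - 1)" unfolding rmodule_def by (rule chain_complexD(1)[OF G])
    show "\<zero>\<^bsub>G i\<^esub> \<in> carrier (G i)" by simp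
    show "d i \<zero>\<^bsub>G i\<^esub> = \<zero>\<^bsub>G (i - 1)\<^esub>" by (rule mod_hom_zero[OF m.rmodule_axioms m'.rmodule_axioms chain_complexD(2)[OF G]])
  qed
  have zz: "\<zero>\<^bsub>?W\<^esub> = \<zero>\<^bsub>?W\<^esub> \<oplus>\<^bsub>?W\<^esub> \<zero>\<^bsub>?W\<^esub>" by (simp only: reg.lin_zero_sum(1)[OF reg.vecs_ops(1)])
  show ?thesis
    unfolding coresolves_def up
  proof (intro conjI allI impI ballI t hom)
    fix i :: int and v assume i: "i \<le> - 1" and v: "v \<in> rvecs {}"
    show "\<exists>x\<in>carrier (G i). d i x = \<zero>\<^bsub>G (i - 1)\<^esub> \<and> (\<exists>l\<in>rvecs {}. v = \<zero>\<^bsub>?W\<^esub> \<oplus>\<^bsub>?W\<^esub> rlin R (mzero R) l)"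
    proof (rule bexI[OF _ zc(1)[of i]], rule conjI[OF zc(2)[of i]])
      show "\<exists>l\<in>rvecs {}. v = \<zero>\<^bsub>?W\<^esub> \<oplus>\<^bsub>?W\<^esub> rlin R (mzero R) l"
        by (rule bexI[OF _ reg.vecs_ops(1)]) (simp only: v0[OF v] l0 zz[symmetric])
    qed
  qed (use z1 l0 in \<open>auto simp: mzero_def\<close>)
qed

lemma coresolvesD:
  assumes "coresolves R G d p I D \<epsilon>"
  shows "tacyclic I D" "a \<in> I j \<Longrightarrow> 0 \<le> fst a" "a \<in> I j \<Longrightarrow> fst a \<le> p"
    "j \<le> fst b \<Longrightarrow> fst a < j - 1 \<Longrightarrow> D j a b = \<zero>"
    "i \<le> p \<Longrightarrow> \<epsilon> i \<in> mod_hom R (G i) (free_module R (copart I i))"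
    "i \<le> p \<Longrightarrow> x \<in> carrier (G i) \<Longrightarrow> rlin R (D i) (\<epsilon> i x) = \<epsilon> (i - 1) (d i x)"
    "i \<le> p \<Longrightarrow> x \<in> carrier (G i) \<Longrightarrow> d i x = \<zero>\<^bsub>G (i - 1)\<^esub> \<Longrightarrow> l \<in> rvecs (copart I (i + 1)) \<Longrightarrow>
       \<epsilon> i x = rlin R (D (i + 1)) l \<Longrightarrow> x = \<zero>\<^bsub>G i\<^esub> \<or> i < p \<and> (\<exists>y\<in>carrier (G (i + 1)). d (i + 1) y = x)"
    "i \<le> p \<Longrightarrow> v \<in> rvecs (copart I i) \<Longrightarrow> rlin R (D i) v = \<zero>\<^bsub>vspace (regular_module R)\<^esub> \<Longrightarrow>
       \<exists>x\<in>carrier (G i). d i x = \<zero>\<^bsub>G (i - 1)\<^esub> \<and> (\<exists>l\<in>rvecs (copart I (i + 1)).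
         v = \<epsilon> i x \<oplus>\<^bsub>vspace (regular_module R)\<^esub> rlin R (D (i + 1)) l)"
proof -
  note a = assms[unfolded coresolves_def]
  note c1 = a[THEN conjunct1] and a1 = a[THEN conjunct2]
  note c2 = a1[THEN conjunct1] and a2 = a1[THEN conjunct2]
  note c3 = a2[THEN conjunct1] and a3 = a2[THEN conjunct2]
  note c4 = a3[THEN conjunct1] and a4 = a3[THEN conjunct2]
  note c5 = a4[THEN conjunct1] and a5 = a4[THEN conjunct2]
  note c6 = a5[THEN conjunct1] and c7 = a5[THEN conjunct2]
  show "tacyclic I D" by (rule c1)
  show "a \<in> I j \<Longrightarrow> 0 \<le> fst a" "a \<in> I j \<Longrightarrow> fst a \<le> p" using c2 by blast+
  show "j \<le> fst b \<Longrightarrow> fst a < j - 1 \<Longrightarrow> D j a b = \<zero>" using c3 by blast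
  show "i \<le> p \<Longrightarrow> \<epsilon> i \<in> mod_hom R (G i) (free_module R (copart I i))" using c4 by blast
  show "i \<le> p \<Longrightarrow> x \<in> carrier (G i) \<Longrightarrow> rlin R (D i) (\<epsilon> i x) = \<epsilon> (i - 1) (d i x)" using c5 by blast
  show "i \<le> p \<Longrightarrow> x \<in> carrier (G i) \<Longrightarrow> d i x = \<zero>\<^bsub>G (i - 1)\<^esub> \<Longrightarrow> l \<in> rvecs (copart I (i + 1)) \<Longrightarrow>
       \<epsilon> i x = rlin R (D (i + 1)) l \<Longrightarrow> x = \<zero>\<^bsub>G i\<^esub> \<or> i < p \<and> (\<exists>y\<in>carrier (G (i + 1)). d (i + 1) y = x)"
    by (rule c6[rule_format])
  show "i \<le> p \<Longrightarrow> v \<in> rvecs (copart I i) \<Longrightarrow> rlin R (D i) v = \<zero>\<^bsub>vspace (regular_module R)\<^esub> \<Longrightarrow>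
       \<exists>x\<in>carrier (G i). d i x = \<zero>\<^bsub>G (i - 1)\<^esub> \<and> (\<exists>l\<in>rvecs (copart I (i + 1)).
         v = \<epsilon> i x \<oplus>\<^bsub>vspace (regular_module R)\<^esub> rlin R (D (i + 1)) l)"
    by (rule c7[rule_format])
qed

lemma copart_cone:
  assumes t: "tacyclic I D" and tri: "\<And>j a b. j \<le> fst b \<Longrightarrow> fst a < j - 1 \<Longrightarrow> D j a b = \<zero>"
  defines "DL \<equiv> \<lambda>j. mres R (copart I (j - 1)) (copart I j) (D j)"
    and "Q \<equiv> \<lambda>j. I j - copart I j"
  defines "f \<equiv> \<lambda>j. mres R (copart I (j - 1)) (Q j) (D j)" and "DQ \<equiv> \<lambda>j. mres R (Q (j - 1)) (Q j) (D j)"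
  shows "cone R (copart I) DL f Q DQ" "cone_diff R DL f DQ = D" "(\<lambda>j. copart I j \<union> Q j) = I"
proof -
  have cx: "cx R I D" using t by (simp add: tacyclic_def)
  have tri': "D j a b = \<zero>" if b: "b \<in> copart I j" and a: "a \<notin> copart I (j - 1)" for j a b
  proof (cases "a \<in> I (j - 1)")
    case True
    then show ?thesis using a b tri by (auto simp: copart_def)
  next
    case False
    then show ?thesis by (rule MatD(2)[OF cxD(2)[OF cx]])
  qed
  have sub: "copart I j \<subseteq> I j" for j by (auto simp: copart_def)
  show "cone R (copart I) DL f Q DQ" "cone_diff R DL f DQ = D" "(\<lambda>j. copart I j \<union> Q j) = I"
    unfolding DL_def f_def DQ_def Q_def using subcomplex_cone[OF cx sub tri'] by auto
qed

text \<open>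
  The new complex is the cone of a map \<open>f\<close> from the totally acyclic complex \<open>J\<close> of
  \<open>G (p + 1)\<close> to the old one. In the degree of \<open>G (p + 1)\<close> the map \<open>f\<close> is an
  extension of \<open>\<epsilon> p\<close> composed with the differential of \<open>G\<close>; such an extension from
  \<open>G (p + 1)\<close> to the free module around it exists because the dual of \<open>J\<close> is exact. In lower
  degrees \<open>f\<close> is obtained by exactness of the dual of \<open>J\<close> too, with values in the subcomplex,
  and in higher degrees by exactness of the old complex. The homological clauses hold again because the truncation of
  \<open>G\<close> at \<open>p + 1\<close> arises in the same way, as the cone of the differential from
  \<open>G (p + 1)\<close> to the truncation at \<open>p\<close>.
\<close>

lemma coresolves_step:
  assumes G: "chain_complex R G d" and T: "totally_reflexive R (G (p + 1))" and p: "- 1 \<le> p"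
    and C: "coresolves R G d p I D \<epsilon>"
  shows "\<exists>I' D' \<epsilon>'. coresolves R G d (p + 1) I' D' \<epsilon>'"
proof -
  define P where "P = p + 1"
  have P0: "0 \<le> P" and P1: "P - 1 = p" "P - 2 = p - 1" using p by (auto simp: P_def)
  have pP: "p \<noteq> P" by (simp add: P_def)
  let ?W = "vspace (regular_module R)" and ?l = "rlin R"
  interpret W: module R "vspace (regular_module R)" by (rule reg.vec_module_module)
  interpret W: rmodule R "vspace (regular_module R)" by unfold_locales
  note c = coresolvesD[OF C]
  have cI: "cx R I D" and exI: "\<And>j. kills R \<one> I D j" using c(1) by (auto simp: tacyclic_def)
  have "totally_reflexive R (G P)" using T by (simp add: P_def)
  from totally_reflexive_indexed[OF this, of P]
  obtain J :: "int \<Rightarrow> (int \<times> nat) set" and E \<iota> where t: "tacyclic J E" and J': "\<forall>j. \<forall>a\<in>J j. fst a = P"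
    and \<iota>: "\<iota> \<in> mod_hom R (G P) (free_module R (J P))" "inj_on \<iota> (carrier (G P))"
    "\<iota> ` carrier (G P) = ?l (E (P + 1)) ` rvecs (J (P + 1))"
    by (elim exE conjE)
  have J: "fst a = P" if "a \<in> J j" for a j using J' that by blast
  have cJ: "cx R J E" and exJ: "\<And>j. kills R \<one> J E j" and exJd: "\<And>j. kills R \<one> (dual_index J) (dual_diff E) j"
    using t by (auto simp: tacyclic_def)
  have Gm: "rmodule R (G i)" for i unfolding rmodule_def by (rule chain_complexD(1)[OF G])
  have z\<iota>: "\<iota> \<zero>\<^bsub>G P\<^esub> = \<zero>\<^bsub>?W\<^esub>" using mod_hom_zero[OF Gm free_module_rmodule \<iota>(1)] by (simp only: free_zero)
  have \<iota>c: "\<iota> x \<in> rvecs (J P)" if "x \<in> carrier (G P)" for x using mod_homD(1)[OF \<iota>(1) that] by (simp add: free_module_ops(1))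
  have dP: "d P \<in> mod_hom R (G P) (G p)" using chain_complexD(2)[OF G, of P] by (simp add: P1)
  have \<epsilon>p: "\<epsilon> p \<in> mod_hom R (G p) (free_module R (copart I p))" by (rule c(5)) simp
  have upI: "v \<in> rvecs (copart I j) \<Longrightarrow> v \<in> rvecs (I j)" for v j by (rule vecs_mono) (auto simp: copart_def)
  have \<epsilon>c: "\<epsilon> i x \<in> rvecs (copart I i)" if "i \<le> p" "x \<in> carrier (G i)" for i x
    using mod_homD(1)[OF c(5)[OF that(1)] that(2)] by (simp add: free_module_ops(1))
  have z\<epsilon>: "\<epsilon> i \<zero>\<^bsub>G i\<^esub> = \<zero>\<^bsub>?W\<^esub>" if "i \<le> p" for i using mod_hom_zero[OF Gm free_module_rmodule c(5)[OF that]] by (simp only: free_zero)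
  have dc: "d P x \<in> carrier (G p)" if "x \<in> carrier (G P)" for x using mod_homD(1)[OF dP that] .
  have ddP: "d p (d P x) = \<zero>\<^bsub>G (p - 1)\<^esub>" if "x \<in> carrier (G P)" for x
    using chain_complexD(4)[OF G that] by (simp add: P1)
  define g where "g y = inv_into (carrier (G P)) \<iota> (?l (E (P + 1)) y)" for y
  have gc: "g y \<in> carrier (G P)" and \<iota>g: "\<iota> (g y) = ?l (E (P + 1)) y" if y: "y \<in> rvecs (J (P + 1))" for y
  proof -
    have m: "?l (E (P + 1)) y \<in> \<iota> ` carrier (G P)" using \<iota>(3) y by blast
    show "g y \<in> carrier (G P)" unfolding g_def by (rule inv_into_into[OF m])
    show "\<iota> (g y) = ?l (E (P + 1)) y" unfolding g_def by (rule f_inv_into_f[OF m])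
  qed
  have geq: "g y = x" if "y \<in> rvecs (J (P + 1))" "x \<in> carrier (G P)" "\<iota> x = ?l (E (P + 1)) y" for x y
    using inv_into_f_eq[OF \<iota>(2) that(2,3)] by (simp add: g_def)
  have EP1: "E (P + 1) \<in> Mat R (J P) (J (P + 1))" by (rule cxD'(1)[OF cJ])
  have lh: "?l (E (P + 1)) \<in> mod_hom R (free_module R (J (P + 1))) (free_module R (J P))" by (rule lin_mod_hom[OF EP1])
  have gh: "g \<in> mod_hom R (free_module R (J (P + 1))) (G P)"
  proof -
    interpret GP: rmodule R "G P" by (rule Gm)
    interpret FP: rmodule R "free_module R (J (P + 1))" by (rule free_module_rmodule)
    note car = free_module_ops(1)[where S = "J (P + 1)"]
    show ?thesis
      unfolding mod_hom_def
    proof (intro CollectI conjI ballI funcsetI)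
      fix y assume y: "y \<in> carrier (free_module R (J (P + 1)))"
      note y' = y[unfolded car]
      show "g y \<in> carrier (G P)" by (rule gc[OF y'])
      fix z assume z: "z \<in> carrier (free_module R (J (P + 1)))"
      note z' = z[unfolded car]
      show "g (y \<oplus>\<^bsub>free_module R (J (P + 1))\<^esub> z) = g y \<oplus>\<^bsub>G P\<^esub> g z"
      proof (rule geq)
        show "y \<oplus>\<^bsub>free_module R (J (P + 1))\<^esub> z \<in> rvecs (J (P + 1))" using FP.M.a_closed[OF y z] by (simp only: car)
        show "\<iota> (g y \<oplus>\<^bsub>G P\<^esub> g z) = ?l (E (P + 1)) (y \<oplus>\<^bsub>free_module R (J (P + 1))\<^esub> z)"
          by (simp only: mod_homD(2)[OF \<iota>(1) gc[OF y'] gc[OF z']] mod_homD(2)[OF lh y z] \<iota>g[OF y'] \<iota>g[OF z'])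
      qed (use gc[OF y'] gc[OF z'] in auto)
    next
      fix a y assume a: "a \<in> carrier R" and y: "y \<in> carrier (free_module R (J (P + 1)))"
      note y' = y[unfolded car]
      show "g (a \<odot>\<^bsub>free_module R (J (P + 1))\<^esub> y) = a \<odot>\<^bsub>G P\<^esub> g y"
      proof (rule geq)
        show "a \<odot>\<^bsub>free_module R (J (P + 1))\<^esub> y \<in> rvecs (J (P + 1))" using FP.smult_closed[OF a y] by (simp only: car)
        show "\<iota> (a \<odot>\<^bsub>G P\<^esub> g y) = ?l (E (P + 1)) (a \<odot>\<^bsub>free_module R (J (P + 1))\<^esub> y)"
          by (simp only: mod_homD(3)[OF \<iota>(1) a gc[OF y']] mod_homD(3)[OF lh a y] \<iota>g[OF y'])
      qed (use gc[OF y'] a in auto)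
    qed
  qed
  \<comment> \<open>The map \<open>g\<close> is the projection of \<open>J (P + 1)\<close> onto \<open>G P\<close>. On this free module
    the map to be extended is a matrix \<open>H\<close>, which vanishes on boundaries and thus factors through the
    differential as \<open>f0\<close>.\<close>
  have "(\<lambda>y. \<epsilon> p (d P (g y))) \<in> mod_hom R (free_module R (J (P + 1))) (free_module R (copart I p))"
    using mod_homD[OF gh] mod_homD[OF dP] mod_homD[OF \<epsilon>p] by (simp add: mod_hom_def)
  moreover have "finite (copart I p)" using cxD(1)[OF cI, of p] by (simp add: copart_def)
  ultimately obtain H where H: "H \<in> Mat R (copart I p) (J (P + 1))"
    "\<And>y. y \<in> rvecs (J (P + 1)) \<Longrightarrow> \<epsilon> p (d P (g y)) = ?l H y"
    using hom_matrix[OF _ cxD(1)[OF cJ]] by blast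
  have "mm R H (E (P + 1 + 1)) = mzero R"
  proof (rule mat_vec_eqI[OF Mat_mm[OF H(1) cxD'(1)[OF cJ]] Mat_mzero cxD(1)[OF cJ]])
    fix y assume y: "y \<in> rvecs (J (P + 1 + 1))"
    note Ey = reg.lin_closed[OF y cxD'(1)[OF cJ, of "P + 1"]]
    have "?l (E (P + 1)) (?l (E (P + 1 + 1)) y) = \<zero>\<^bsub>?W\<^esub>" by (rule reg.lin_DD[OF cJ vecs_UNIV[OF y]])
    interpret GP: rmodule R "G P" by (rule Gm)
    have "g (?l (E (P + 1 + 1)) y) = \<zero>\<^bsub>G P\<^esub>"
      by (rule geq[OF Ey]) (use z\<iota> \<open>?l (E (P + 1)) (?l (E (P + 1 + 1)) y) = \<zero>\<^bsub>?W\<^esub>\<close> in auto)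
    then have "?l H (?l (E (P + 1 + 1)) y) = \<zero>\<^bsub>?W\<^esub>"
      using H(2)[OF Ey] mod_hom_zero[OF Gm Gm dP] z\<epsilon>[of p] by simp
    then show "?l (mm R H (E (P + 1 + 1))) y = ?l (mzero R) y"
      by (simp only: reg.lin_mm[OF vecs_UNIV[OF y] H(1) cxD'(1)[OF cJ]] reg.lin_mzero[OF vecs_UNIV[OF y]])
  qed
  then obtain f0 where f0: "f0 \<in> Mat R (copart I p) (J P)" "mm R f0 (E (P + 1)) = H"
    using mat_extend_exact[OF exJd cJ H(1)] by auto
  have f0\<iota>: "?l f0 (\<iota> x) = \<epsilon> p (d P x)" if x: "x \<in> carrier (G P)" for x
  proof -
    obtain y where y: "y \<in> rvecs (J (P + 1))" "\<iota> x = ?l (E (P + 1)) y" using \<iota>(3) x by blast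
    have "?l f0 (\<iota> x) = ?l H y" using reg.lin_mm[OF vecs_UNIV[OF y(1)] f0(1) EP1] f0(2) y(2) by simp
    then show ?thesis using H(2)[OF y(1)] geq[OF y(1) x y(2)] by simp
  qed
  have f0I: "f0 \<in> Mat R (I (P - 1)) (J P)" by (rule Mat_mono[OF f0(1)]) (auto simp: copart_def P1)
  have f0L: "f0 \<in> Mat R (copart I (P - 1)) (J P)" using f0(1) by (simp add: P1)
  have DH: "mm R (D p) H = mzero R"
  proof (rule mat_vec_eqI[OF Mat_mm[OF cxD(2)[OF cI] H(1)] Mat_mzero cxD(1)[OF cJ]])
    fix y assume y: "y \<in> rvecs (J (P + 1))"
    have "?l (D p) (?l H y) = \<epsilon> (p - 1) (d p (d P (g y)))" using c(6)[OF order_refl dc[OF gc[OF y]]] H(2)[OF y] by simp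
    also have "\<dots> = \<zero>\<^bsub>?W\<^esub>" using ddP[OF gc[OF y]] z\<epsilon>[of "p - 1"] by simp
    finally show "?l (mm R (D p) H) y = ?l (mzero R) y"
      by (simp only: reg.lin_mm[OF vecs_UNIV[OF y] cxD(2)[OF cI] H(1)] reg.lin_mzero[OF vecs_UNIV[OF y]])
  qed
  note uc = copart_cone[OF c(1) c(4)]
  define DL where "DL = (\<lambda>j. mres R (copart I (j - 1)) (copart I j) (D j))"
  have cL: "cx R (copart I) DL" using coneD(1)[OF uc(1)] by (simp add: DL_def)
  have DLD: "?l (DL j) v = ?l (D j) v" if "v \<in> rvecs (copart I j)" for j v
    using reg.cone_diff_apply(2)[OF uc(1) that reg.vecs_ops(1)] by (simp only: DL_def uc(2))
  have mmDL: "mm R (DL j) A = mm R (D j) A" if A: "A \<in> Mat R (copart I j) S" and S: "finite S" for j A S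
  proof (rule mat_vec_eqI[OF Mat_mm[OF cxD(2)[OF cL] A] Mat_mm[OF cxD(2)[OF cI] A] S])
    fix v assume v: "v \<in> rvecs S"
    show "?l (mm R (DL j) A) v = ?l (mm R (D j) A) v"
      using DLD[OF reg.lin_closed[OF v A]]
      by (simp only: reg.lin_mm[OF vecs_UNIV[OF v] cxD(2)[OF cL] A] reg.lin_mm[OF vecs_UNIV[OF v] cxD(2)[OF cI] A])
  qed
  have condI: "mm R (D (P - 1)) (mm R f0 (E (P + 1))) = mzero R" using DH f0(2) by (simp add: P1)
  have condL: "mm R (DL (P - 1)) (mm R f0 (E (P + 1))) = mzero R"
    using condI mmDL[of H "P - 1" "J (P + 1)"] H(1) cxD(1)[OF cJ] f0(2) by (simp add: P1)
  \<comment> \<open>Upwards the values lie in the whole complex, since only it is exact; downwards they stay in the subcomplex.\<close>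
  obtain f1 where f1: "f1 P = f0" "\<And>j. j \<ge> P \<Longrightarrow> f1 j \<in> Mat R (I (j - 1)) (J j)"
    "\<And>j. j \<ge> P \<Longrightarrow> mm R (D j) (f1 (j + 1)) = mneg R (mm R (f1 j) (E (j + 1)))"
    using extend_left[OF cI cJ exI f0I condI] by blast
  obtain f2 where f2: "f2 P = f0" "\<And>j. j \<le> P \<Longrightarrow> f2 j \<in> Mat R (copart I (j - 1)) (J j)"
    "\<And>j. j \<le> P \<Longrightarrow> mm R (f2 (j - 1)) (E j) = mneg R (mm R (DL (j - 1)) (f2 j))"
    using extend_right[OF cL cJ exJd f0L condL] by blast
  define f where "f j = (if j \<le> P then f2 j else f1 j)" for j
  have fP: "f P = f0" using f2(1) by (simp add: f_def)
  have fL: "f j \<in> Mat R (copart I (j - 1)) (J j)" if "j \<le> P" for j using f2(2)[OF that] that by (simp add: f_def)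
  have fM: "f j \<in> Mat R (I (j - 1)) (J j)" for j
  proof (cases "j \<le> P")
    case True
    show ?thesis by (rule Mat_mono[OF fL[OF True]]) (auto simp: copart_def)
  qed (use f1(2)[of j] in \<open>simp add: f_def\<close>)
  have fE: "mm R (f (j - 1)) (E j) = mneg R (mm R (D (j - 1)) (f j))" for j
  proof (cases "j \<le> P")
    case True
    then show ?thesis using f2(3)[OF True] mmDL[OF f2(2)[OF True] cxD(1)[OF cJ]] by (simp add: f_def)
  next
    case False
    have "f (j - 1) = f1 (j - 1)"
    proof (cases "j - 1 = P")
      case True
      then show ?thesis by (simp only: fP f1(1))
    qed (use False in \<open>simp add: f_def\<close>)
    moreover have "f j = f1 j" using False by (simp add: f_def)
    ultimately have e: "f (j - 1) = f1 (j - 1)" "f j = f1 j" .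
    have M: "mm R (f1 (j - 1)) (E j) \<in> Mat R (I (j - 1 - 1)) (J j)"
      by (rule Mat_mm[OF f1(2) cxD(2)[OF cJ]]) (use False in simp)
    show ?thesis unfolding e using f1(3)[of "j - 1"] False mneg_mneg[OF M] by simp
  qed
  have disj: "I j \<inter> J j = {}" for j using c(3) J by (fastforce simp: P_def)
  have cone: "cone R I D f J E" unfolding cone_def using cI cJ disj fM fE by blast
  let ?I' = "\<lambda>j. I j \<union> J j" and ?D' = "cone_diff R D f E"
  define \<epsilon>' where "\<epsilon>' i = (if i = P then \<iota> else \<epsilon> i)" for i
  have up: "copart ?I' i = copart I i \<union> (if i \<le> P then J i else {})" for i
    using J by (auto simp: copart_def)
  have upP: "copart I i = {}" if "P \<le> i" for i
  proof -
    have "fst a < i" if a: "a \<in> I i" for a using c(3)[OF a] \<open>P \<le> i\<close> by (simp add: P_def)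
    then show ?thesis by (force simp: copart_def)
  qed
  have up1: "copart ?I' P = J P" "copart ?I' (P + 1) = {}" using upP[of P] upP[of "P + 1"] by (auto simp: up)
  have up2: "copart ?I' i = copart I i \<union> J i" if "i \<le> P" for i using that by (simp add: up)
  have v0: "v = \<zero>\<^bsub>?W\<^esub>" if "v \<in> rvecs {}" for v using vecsD(2)[OF that] by auto
  have disjU: "copart I i \<inter> J j = {}" for i j using c(3) J by (fastforce simp: copart_def P_def)
  have app1: "?l (?D' j) a = ?l (D j) a" if "a \<in> rvecs (copart I j)" for a j
    by (rule reg.cone_diff_apply(2)[OF cone upI[OF that] reg.vecs_ops(1)])
  have app2: "?l (?D' j) b = ?l (f j) b \<oplus>\<^bsub>?W\<^esub> ?l (E j) b" if "b \<in> rvecs (J j)" for b j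
    by (rule reg.cone_diff_apply(3)[OF cone reg.vecs_ops(1) that])
  have app3: "?l (?D' j) (a \<oplus>\<^bsub>?W\<^esub> b) = (?l (D j) a \<oplus>\<^bsub>?W\<^esub> ?l (f j) b) \<oplus>\<^bsub>?W\<^esub> ?l (E j) b"
    if "a \<in> rvecs (copart I j)" "b \<in> rvecs (J j)" for a b j
    by (rule reg.cone_diff_apply(1)[OF cone upI[OF that(1)] that(2)])
  have anti: "?l (f j) (?l (E (j + 1)) w) = \<ominus>\<^bsub>?W\<^esub> ?l (D j) (?l (f (j + 1)) w)" if "w \<in> rvecs (J (j + 1))" for w j
    by (rule reg.cone_anticomm[OF cone vecs_UNIV[OF that]])
  have Dup: "?l (D j) a \<in> rvecs (copart I (j - 1))" if "a \<in> rvecs (copart I j)" for a j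
    unfolding DLD[OF that, symmetric] by (rule reg.lin_closed[OF that cxD(2)[OF cL]])
  have fup: "?l (f j) b \<in> rvecs (copart I (j - 1))" if "b \<in> rvecs (J j)" "j \<le> P" for b j
    by (rule reg.lin_closed[OF that(1) fL[OF that(2)]])
  have Ecl: "?l (E j) b \<in> rvecs (J (j - 1))" if "b \<in> rvecs (J j)" for b j
    by (rule reg.lin_closed[OF that cxD(2)[OF cJ]])
  note U = vecs_UNIV and ops = reg.vecs_ops
  have "coresolves R G d P ?I' ?D' \<epsilon>'"
    unfolding coresolves_def
  proof (intro conjI allI impI ballI)
    show "tacyclic ?I' ?D'" by (rule cone_tacyclic[OF cone c(1) t])
    show "0 \<le> fst a" if "a \<in> ?I' j" for j a using that c(2)[of a j] J[of a j] P0 by (elim UnE) simp_all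
    show "fst a \<le> P" if "a \<in> ?I' j" for j a using that c(3)[of a j] J[of a j] by (elim UnE) (simp_all add: P_def)
    fix j :: int and a b :: "int \<times> nat" assume ab: "j \<le> fst b" "fst a < j - 1"
    have "D j a b = \<zero>" by (rule c(4)[OF ab])
    moreover have "E j a b = \<zero>"
    proof (cases "a \<in> J (j - 1) \<and> b \<in> J j")
      case True
      then have "fst a = P" "fst b = P" using J[of a "j - 1"] J[of b j] by simp_all
      then show ?thesis using ab by simp
    next
      case False
      then show ?thesis using MatD(2,3)[OF cxD(2)[OF cJ]] by blast
    qed
    moreover have "f j a b = \<zero>"
    proof (cases "b \<in> J j")
      case True
      then have "j \<le> P" using J[of b j] ab by simp
      moreover have "a \<notin> copart I (j - 1)" using ab by (simp add: copart_def)
      ultimately show ?thesis using MatD(2)[OF fL] by blast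
    next
      case False
      then show ?thesis by (rule MatD(3)[OF fM])
    qed
    ultimately show "?D' j a b = \<zero>" by (simp add: cone_diff_def madd_def)
  next
    fix i assume i: "i \<le> P"
    show "\<epsilon>' i \<in> mod_hom R (G i) (free_module R (copart ?I' i))"
    proof (cases "i = P")
      case True
      then show ?thesis using \<iota>(1) up1(1) by (simp add: \<epsilon>'_def)
    next
      case False
      then have ip: "i \<le> p" using i by (simp add: P_def)
      have "v \<in> rvecs (copart ?I' i)" if "v \<in> rvecs (copart I i)" for v
        by (rule vecs_mono[OF that]) (simp add: up)
      then show ?thesis using c(5)[OF ip] False
        by (auto simp: mod_hom_def free_module_ops \<epsilon>'_def)
    qed
  next
    fix i x assume i: "i \<le> P" and x: "x \<in> carrier (G i)"
    show "?l (?D' i) (\<epsilon>' i x) = \<epsilon>' (i - 1) (d i x)"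
    proof (cases "i = P")
      case True
      then have xP: "x \<in> carrier (G P)" using x by simp
      obtain y where y: "y \<in> rvecs (J (P + 1))" "\<iota> x = ?l (E (P + 1)) y" using \<iota>(3) xP by blast
      have "?l (E P) (\<iota> x) = \<zero>\<^bsub>?W\<^esub>" using reg.lin_DD[OF cJ U[OF y(1)]] y(2) by simp
      then have "?l (?D' P) (\<iota> x) = ?l (f P) (\<iota> x)"
        using app2[OF \<iota>c[OF xP]] reg.lin_zero_sum(1)[OF U[OF fup[OF \<iota>c[OF xP] order_refl]]] by simp
      then show ?thesis using f0\<iota>[OF xP] True fP pP by (simp add: \<epsilon>'_def P1)
    next
      case False
      then have ip: "i \<le> p" using i by (simp add: P_def)
      then show ?thesis using app1[OF \<epsilon>c[OF ip x]] c(6)[OF ip x] False i by (simp add: \<epsilon>'_def)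
    qed
  next
    fix i x l assume i: "i \<le> P" and x: "x \<in> carrier (G i)" and dx: "d i x = \<zero>\<^bsub>G (i - 1)\<^esub>"
      and l: "l \<in> rvecs (copart ?I' (i + 1))" and e: "\<epsilon>' i x = ?l (?D' (i + 1)) l"
    show "x = \<zero>\<^bsub>G i\<^esub> \<or> i < P \<and> (\<exists>y\<in>carrier (G (i + 1)). d (i + 1) y = x)"
    proof (cases "i = P")
      case True
      have "l = \<zero>\<^bsub>?W\<^esub>" using v0 l up1(2) True by simp
      then have "\<iota> x = \<iota> \<zero>\<^bsub>G P\<^esub>" using e True z\<iota> reg.lin_zero by (simp add: \<epsilon>'_def)
      moreover have "\<zero>\<^bsub>G P\<^esub> \<in> carrier (G P)"
      proof -
        interpret GP: rmodule R "G P" by (rule Gm)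
        show ?thesis by simp
      qed
      ultimately show ?thesis using \<iota>(2) x True by (auto simp: inj_on_def)
    next
      case False
      then have ip: "i \<le> p" and i1: "i + 1 \<le> P" using i by (auto simp: P_def)
      have \<epsilon>e: "\<epsilon> i x = ?l (?D' (i + 1)) l" using e False by (simp add: \<epsilon>'_def)
      obtain a b where a: "a \<in> rvecs (copart I (i + 1))" and b: "b \<in> rvecs (J (i + 1))" and lab: "l = a \<oplus>\<^bsub>?W\<^esub> b"
        using reg.vecs_split[OF l[unfolded up2[OF i1]] disjU] .
      have Da: "?l (D (i + 1)) a \<in> rvecs (copart I i)" using Dup[OF a] by simp
      have fb: "?l (f (i + 1)) b \<in> rvecs (copart I i)" using fup[OF b i1] by simp
      have Eb: "?l (E (i + 1)) b \<in> rvecs (J i)" using Ecl[OF b] by simp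
      have "\<epsilon> i x \<oplus>\<^bsub>?W\<^esub> \<zero>\<^bsub>?W\<^esub> = (?l (D (i + 1)) a \<oplus>\<^bsub>?W\<^esub> ?l (f (i + 1)) b) \<oplus>\<^bsub>?W\<^esub> ?l (E (i + 1)) b"
        using \<epsilon>e app3[OF a b] reg.lin_zero_sum(1)[OF U[OF \<epsilon>c[OF ip x]]] by (simp add: lab)
      note eq = reg.vecs_disjoint_eq[OF \<epsilon>c[OF ip x] ops(2)[OF Da fb] ops(1) Eb disjU this]
      obtain y where y: "y \<in> rvecs (J (i + 1 + 1))" "?l (E (i + 1 + 1)) y = b"
        using kills_oneD[OF exJ b eq(2)[symmetric]] by blast
      show ?thesis
      proof (cases "i = p")
        case True
        then have iP: "i + 1 = P" "i = p" by (auto simp: P_def)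
        have a0: "a = \<zero>\<^bsub>?W\<^esub>" using v0 a upP[of P] iP by simp
        have y': "y \<in> rvecs (J (P + 1))" "?l (E (P + 1)) y = b" using y iP by auto
        let ?g = "g y"
        have gG: "?g \<in> carrier (G P)" by (rule gc[OF y'(1)])
        have fb': "?l (f (i + 1)) b = \<epsilon> p (d P ?g)" using f0\<iota>[OF gG] \<iota>g[OF y'(1)] y'(2) fP iP by simp
        have "\<epsilon> p x = \<epsilon> p (d P ?g)"
          using eq(1) a0 fb' reg.lin_zero_sum(2)[OF U[OF fb]] iP by (simp add: reg.lin_zero)
        interpret Gp: rmodule R "G p" by (rule Gm)
        have xp: "x \<in> carrier (G p)" using x iP by simp
        note dg = dc[OF gG]
        interpret Gp1: rmodule R "G (p - 1)" by (rule Gm)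
        have dmin: "d p (x \<ominus>\<^bsub>G p\<^esub> d P ?g) = \<zero>\<^bsub>G (p - 1)\<^esub>"
        proof -
          have dph: "d p \<in> mod_hom R (G p) (G (p - 1))" by (rule chain_complexD(2)[OF G])
          have "\<ominus>\<^bsub>G p\<^esub> d P ?g = (\<ominus> \<one>) \<odot>\<^bsub>G p\<^esub> d P ?g" using Gp.smult_l_minus[of \<one> "d P ?g"] dg by simp
          then have "d p (x \<ominus>\<^bsub>G p\<^esub> d P ?g) = d p x \<oplus>\<^bsub>G (p - 1)\<^esub> (\<ominus> \<one>) \<odot>\<^bsub>G (p - 1)\<^esub> d p (d P ?g)"
            using mod_homD(2)[OF dph xp] mod_homD(3)[OF dph _ dg] dg by (simp add: a_minus_def)
          then show ?thesis using dx iP ddP[OF gG] by simp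
        qed
        have emin: "\<epsilon> p (x \<ominus>\<^bsub>G p\<^esub> d P ?g) = \<zero>\<^bsub>?W\<^esub>"
        proof -
          interpret Fp: rmodule R "free_module R (copart I p)" by (rule free_module_rmodule)
          have "\<ominus>\<^bsub>G p\<^esub> d P ?g = (\<ominus> \<one>) \<odot>\<^bsub>G p\<^esub> d P ?g" using Gp.smult_l_minus[of \<one> "d P ?g"] dg by simp
          then have "\<epsilon> p (x \<ominus>\<^bsub>G p\<^esub> d P ?g) = \<epsilon> p x \<oplus>\<^bsub>free_module R (copart I p)\<^esub> (\<ominus> \<one>) \<odot>\<^bsub>free_module R (copart I p)\<^esub> \<epsilon> p (d P ?g)"
            using mod_homD(2)[OF \<epsilon>p xp] mod_homD(3)[OF \<epsilon>p _ dg] dg by (simp add: a_minus_def)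
          also have "\<dots> = \<epsilon> p x \<ominus>\<^bsub>free_module R (copart I p)\<^esub> \<epsilon> p (d P ?g)"
            using Fp.smult_l_minus[of \<one> "\<epsilon> p (d P ?g)"] mod_homD(1)[OF \<epsilon>p dg] by (simp add: a_minus_def)
          also have "\<dots> = \<zero>\<^bsub>free_module R (copart I p)\<^esub>"
            using Fp.minus_eq_zero_iff[OF mod_homD(1)[OF \<epsilon>p xp] mod_homD(1)[OF \<epsilon>p dg]] \<open>\<epsilon> p x = \<epsilon> p (d P ?g)\<close> by blast
          finally show ?thesis by (simp only: free_zero)
        qed
        have e0: "\<epsilon> p (x \<ominus>\<^bsub>G p\<^esub> d P ?g) = ?l (D (p + 1)) \<zero>\<^bsub>?W\<^esub>" by (simp only: emin reg.lin_zero)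
        have "x \<ominus>\<^bsub>G p\<^esub> d P ?g = \<zero>\<^bsub>G p\<^esub>"
          using c(7)[OF order_refl _ dmin ops(1) e0] xp dg by auto
        then have "x = d P ?g" using Gp.minus_eq_zero_iff[OF xp dg] by simp
        then show ?thesis using gG iP by (auto simp: P_def)
      next
        case False
        then have i2: "i + 1 + 1 \<le> P" and ilp: "i < p" using ip by (auto simp: P_def)
        have fy: "?l (f (i + 1 + 1)) y \<in> rvecs (copart I (i + 1))" using fup[OF y(1) i2] by (simp only: add_diff_cancel_right')
        have "?l (f (i + 1)) b = \<ominus>\<^bsub>?W\<^esub> ?l (D (i + 1)) (?l (f (i + 1 + 1)) y)" using anti[OF y(1)] y(2) by simp
        then have "\<epsilon> i x = ?l (D (i + 1)) (a \<ominus>\<^bsub>?W\<^esub> ?l (f (i + 1 + 1)) y)"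
          using eq(1) unfolding reg.lin_minus[OF U[OF a] U[OF fy] cxD(2)[OF cI]] by (simp only: a_minus_def)
        then show ?thesis using c(7)[OF ip x dx ops(3)[OF a fy]] ilp by (auto simp: P_def)
      qed
    qed
  next
    fix i v assume i: "i \<le> P" and v: "v \<in> rvecs (copart ?I' i)" and z: "?l (?D' i) v = \<zero>\<^bsub>?W\<^esub>"
    obtain a b where a: "a \<in> rvecs (copart I i)" and b: "b \<in> rvecs (J i)" and vab: "v = a \<oplus>\<^bsub>?W\<^esub> b"
      using reg.vecs_split[OF v[unfolded up2[OF i]] disjU] .
    note Da = Dup[OF a] and fb = fup[OF b i] and Eb = Ecl[OF b]
    have "(?l (D i) a \<oplus>\<^bsub>?W\<^esub> ?l (f i) b) \<oplus>\<^bsub>?W\<^esub> ?l (E i) b = \<zero>\<^bsub>?W\<^esub> \<oplus>\<^bsub>?W\<^esub> \<zero>\<^bsub>?W\<^esub>"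
      using z app3[OF a b] reg.lin_zero_sum(1)[OF ops(1)] by (simp add: vab)
    note eq = reg.vecs_disjoint_eq[OF ops(2)[OF Da fb] ops(1) Eb ops(1) disjU this]
    obtain y where y: "y \<in> rvecs (J (i + 1))" "?l (E (i + 1)) y = b" using kills_oneD[OF exJ b eq(2)] by blast
    show "\<exists>x\<in>carrier (G i). d i x = \<zero>\<^bsub>G (i - 1)\<^esub> \<and> (\<exists>l\<in>rvecs (copart ?I' (i + 1)).
       v = \<epsilon>' i x \<oplus>\<^bsub>?W\<^esub> ?l (?D' (i + 1)) l)"
    proof (cases "i = P")
      case True
      have a0: "a = \<zero>\<^bsub>?W\<^esub>" using v0 a upP[of P] True by simp
      have y': "y \<in> rvecs (J (P + 1))" "?l (E (P + 1)) y = b" using y True by auto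
      have gG: "g y \<in> carrier (G P)" by (rule gc[OF y'(1)])
      have "\<epsilon> p (d P (g y)) = ?l f0 b" using f0\<iota>[OF gG] \<iota>g[OF y'(1)] y'(2) by simp
      also have "\<dots> = \<zero>\<^bsub>?W\<^esub>" using eq(1) a0 True fP reg.lin_zero_sum(2)[OF U[OF fb]] by (simp add: reg.lin_zero)
      finally have "\<epsilon> p (d P (g y)) = ?l (D (p + 1)) \<zero>\<^bsub>?W\<^esub>" by (simp add: reg.lin_zero)
      then have "d P (g y) = \<zero>\<^bsub>G p\<^esub>"
        using c(7)[OF order_refl dc[OF gG] ddP[OF gG] ops(1)] by auto
      moreover have "v = \<iota> (g y) \<oplus>\<^bsub>?W\<^esub> ?l (?D' (P + 1)) \<zero>\<^bsub>?W\<^esub>"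
        using \<iota>g[OF y'(1)] y'(2) vab a0 reg.lin_zero_sum[OF U[OF b]] by (simp add: reg.lin_zero)
      ultimately show ?thesis using gG True ops(1) by (auto simp: \<epsilon>'_def P1)
    next
      case False
      then have ip: "i \<le> p" and i1: "i + 1 \<le> P" using i by (auto simp: P_def)
      have fy: "?l (f (i + 1)) y \<in> rvecs (copart I i)" using fup[OF y(1) i1] by simp
      have fbe: "?l (f i) b = \<ominus>\<^bsub>?W\<^esub> ?l (D i) (?l (f (i + 1)) y)" using anti[OF y(1)] y(2) by simp
      have "?l (D i) (a \<ominus>\<^bsub>?W\<^esub> ?l (f (i + 1)) y) = \<zero>\<^bsub>?W\<^esub>"
        using eq(1) fbe unfolding reg.lin_minus[OF U[OF a] U[OF fy] cxD(2)[OF cI]] by (simp only: a_minus_def)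
      then obtain x l where x: "x \<in> carrier (G i)" "d i x = \<zero>\<^bsub>G (i - 1)\<^esub>" and l: "l \<in> rvecs (copart I (i + 1))"
        and xl: "a \<ominus>\<^bsub>?W\<^esub> ?l (f (i + 1)) y = \<epsilon> i x \<oplus>\<^bsub>?W\<^esub> ?l (D (i + 1)) l"
        using c(8)[OF ip ops(3)[OF a fy]] by blast
      have Dl: "?l (D (i + 1)) l \<in> rvecs (copart I i)" using Dup[OF l] by simp
      note un = U[OF a] U[OF b] U[OF fy] U[OF Dl] U[OF \<epsilon>c[OF ip x(1)]]
      have ly: "?l (?D' (i + 1)) (l \<oplus>\<^bsub>?W\<^esub> y) = (?l (D (i + 1)) l \<oplus>\<^bsub>?W\<^esub> ?l (f (i + 1)) y) \<oplus>\<^bsub>?W\<^esub> b"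
        using app3[OF l y(1)] y(2) by (simp only:)
      have "a = (a \<ominus>\<^bsub>?W\<^esub> ?l (f (i + 1)) y) \<oplus>\<^bsub>?W\<^esub> ?l (f (i + 1)) y"
        using un by (simp add: a_minus_def W.M.a_assoc W.M.l_neg)
      then have "v = ((\<epsilon> i x \<oplus>\<^bsub>?W\<^esub> ?l (D (i + 1)) l) \<oplus>\<^bsub>?W\<^esub> ?l (f (i + 1)) y) \<oplus>\<^bsub>?W\<^esub> b"
        unfolding vab xl by (rule arg_cong)
      also have "\<dots> = \<epsilon>' i x \<oplus>\<^bsub>?W\<^esub> ?l (?D' (i + 1)) (l \<oplus>\<^bsub>?W\<^esub> y)"
        unfolding ly using un False by (simp add: \<epsilon>'_def W.M.a_assoc)
      finally have "v = \<epsilon>' i x \<oplus>\<^bsub>?W\<^esub> ?l (?D' (i + 1)) (l \<oplus>\<^bsub>?W\<^esub> y)" .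
      moreover have "l \<oplus>\<^bsub>?W\<^esub> y \<in> rvecs (copart ?I' (i + 1))"
        unfolding up2[OF i1] by (rule ops(2)[OF vecs_mono[OF l] vecs_mono[OF y(1)]]) auto
      ultimately show ?thesis using x by blast
    qed
  qed
  then show ?thesis unfolding P_def by blast
qed

lemma coresolves_exists:
  assumes G: "chain_complex R G d" and z: "\<And>i. i < 0 \<Longrightarrow> zero_module (G i)"
    and T: "\<And>i. 0 \<le> i \<Longrightarrow> i \<le> s \<Longrightarrow> totally_reflexive R (G i)" and s: "- 1 \<le> s"
  shows "\<exists>I D \<epsilon>. coresolves R G d s I D \<epsilon>"
  using s T
proof (induction s rule: int_ge_induct)
  case base
  then show ?case using coresolves_base[OF G z] by blast
next
  case (step p)
  then obtain I D \<epsilon> where "coresolves R G d p I D \<epsilon>" by (metis order_less_imp_le zless_add1_eq order.order_iff_strict)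
  then show ?case using coresolves_step[OF G _ step.hyps(1)] step.prems[of "p + 1"] step.hyps(1) by auto
qed

end

section \<open>Homology of finite length\<close>

text \<open>
  For each \<open>h\<close> the chain of the submodules \<open>R a\<^sup>k h\<close> has two equal successive members
  within the first \<open>l + 1\<close> steps, where \<open>l\<close> is the length. Then
  \<open>(1 - r a) a\<^sup>k h = 0\<close> for some \<open>r\<close> and \<open>k \<le> l\<close>, and
  \<open>1 - r a\<close> is a unit. The exponent \<open>l\<close> serves for all \<open>h\<close> at once.
\<close>

lemma finite_length_power_zero:
  assumes L: "noetherian_local_ring R \<mm>" and H: "rmodule R H" and fl: "finite_length R H" and a: "a \<in> \<mm>"
  shows "\<exists>l::nat. \<forall>h\<in>carrier H. (a [^]\<^bsub>R\<^esub> l) \<odot>\<^bsub>H\<^esub> h = \<zero>\<^bsub>H\<^esub>"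
proof -
  interpret L: noetherian_local_ring R \<mm> by (rule L)
  interpret mi: maximalideal \<mm> R by (rule L.maximal)
  interpret H: rmodule R H by (rule H)
  have ac: "a \<in> carrier R" using a mi.Icarr by blast
  have pc: "a [^]\<^bsub>R\<^esub> (k::nat) \<in> carrier R" for k using ac by simp
  obtain l where l: "chain_length {N. submodule N R H} = enat l"
    using fl by (auto simp: finite_length_def module_length_def)
  have "(a [^]\<^bsub>R\<^esub> l) \<odot>\<^bsub>H\<^esub> h = \<zero>\<^bsub>H\<^esub>" if h: "h \<in> carrier H" for h
  proof -
    \<comment> \<open>The chain is indexed such that it increases, as in the definition of the length.\<close>
    define N where "N k = {r \<odot>\<^bsub>H\<^esub> ((a [^]\<^bsub>R\<^esub> (Suc l - k)) \<odot>\<^bsub>H\<^esub> h) |r. r \<in> carrier R}" for k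
    have sub: "submodule (N k) R H" for k
    proof (rule H.submoduleI_smult)
      let ?h = "(a [^]\<^bsub>R\<^esub> (Suc l - k)) \<odot>\<^bsub>H\<^esub> h"
      have hc: "?h \<in> carrier H" using h pc by simp
      show "N k \<subseteq> carrier H" using hc by (auto simp: N_def)
      show "\<zero>\<^bsub>H\<^esub> \<in> N k" using hc by (auto simp: N_def intro!: exI[of _ "\<zero>\<^bsub>R\<^esub>"])
      show "x \<oplus>\<^bsub>H\<^esub> y \<in> N k" if xy: "x \<in> N k" "y \<in> N k" for x y
      proof -
        obtain r r' where "r \<in> carrier R" "r' \<in> carrier R" "x = r \<odot>\<^bsub>H\<^esub> ?h" "y = r' \<odot>\<^bsub>H\<^esub> ?h"
          using xy unfolding N_def by blast
        then show ?thesis using hc by (auto simp: N_def H.smult_l_distr intro!: exI[of _ "r \<oplus>\<^bsub>R\<^esub> r'"])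
      qed
      show "c \<odot>\<^bsub>H\<^esub> x \<in> N k" if cx: "c \<in> carrier R" "x \<in> N k" for c x
      proof -
        obtain r where "r \<in> carrier R" "x = r \<odot>\<^bsub>H\<^esub> ?h"
          using cx unfolding N_def by blast
        then show ?thesis using hc cx by (auto simp: N_def H.smult_assoc1 intro!: exI[of _ "c \<otimes>\<^bsub>R\<^esub> r"])
      qed
    qed
    have step: "(a [^]\<^bsub>R\<^esub> (Suc l - k)) \<odot>\<^bsub>H\<^esub> h = a \<odot>\<^bsub>H\<^esub> ((a [^]\<^bsub>R\<^esub> (l - k)) \<odot>\<^bsub>H\<^esub> h)" if "k \<le> l" for k
      using that ac h pc by (simp add: Suc_diff_le H.smult_assoc1[symmetric] L.m_comm del: H.smult_assoc1)
    have "\<exists>k\<le>l. \<not> N k \<subset> N (Suc k)"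
    proof (rule ccontr)
      assume "\<not> ?thesis"
      then have "\<forall>i<Suc l. N i \<subset> N (Suc i)" by auto
      then have "enat (Suc l) \<in> {enat n |n. \<exists>N. (\<forall>i\<le>n. N i \<in> {N. submodule N R H}) \<and> (\<forall>i<n. N i \<subset> N (Suc i))}"
        using sub by blast
      then have "enat (Suc l) \<le> chain_length {N. submodule N R H}"
        unfolding chain_length_def by (rule Sup_upper)
      then show False by (simp add: l)
    qed
    then obtain k where k: "k \<le> l" "\<not> N k \<subset> N (Suc k)" by blast
    let ?g = "(a [^]\<^bsub>R\<^esub> (l - k)) \<odot>\<^bsub>H\<^esub> h"
    have g: "?g \<in> carrier H" using h pc by simp
    have "N k \<subseteq> N (Suc k)"
    proof
      fix x assume "x \<in> N k"
      then obtain r where "r \<in> carrier R" "x = r \<odot>\<^bsub>H\<^esub> (a \<odot>\<^bsub>H\<^esub> ?g)" using step[OF k(1)] by (auto simp: N_def)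
      then show "x \<in> N (Suc k)" using ac g by (auto simp: N_def H.smult_assoc1 intro!: exI[of _ "r \<otimes>\<^bsub>R\<^esub> a"])
    qed
    then have eq: "N k = N (Suc k)" using k(2) by blast
    have "?g \<in> N (Suc k)" using g by (auto simp: N_def intro!: exI[of _ "\<one>\<^bsub>R\<^esub>"])
    then obtain r where r: "r \<in> carrier R" "?g = r \<odot>\<^bsub>H\<^esub> (a \<odot>\<^bsub>H\<^esub> ?g)" using eq step[OF k(1)] by (auto simp: N_def)
    have ra: "r \<otimes>\<^bsub>R\<^esub> a \<in> \<mm>" using mi.I_l_closed[OF a r(1)] .
    have "\<one>\<^bsub>R\<^esub> \<ominus>\<^bsub>R\<^esub> r \<otimes>\<^bsub>R\<^esub> a \<notin> \<mm>"
    proof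
      assume "\<one>\<^bsub>R\<^esub> \<ominus>\<^bsub>R\<^esub> r \<otimes>\<^bsub>R\<^esub> a \<in> \<mm>"
      then have "(\<one>\<^bsub>R\<^esub> \<ominus>\<^bsub>R\<^esub> r \<otimes>\<^bsub>R\<^esub> a) \<oplus>\<^bsub>R\<^esub> r \<otimes>\<^bsub>R\<^esub> a \<in> \<mm>" using ra mi.a_closed by blast
      then have "\<one>\<^bsub>R\<^esub> \<in> \<mm>" using ac r(1) by (simp add: a_minus_def L.a_assoc L.l_neg)
      then show False using mi.one_imp_carrier mi.I_notcarr by blast
    qed
    then obtain b where b: "b \<in> carrier R" "b \<otimes>\<^bsub>R\<^esub> (\<one>\<^bsub>R\<^esub> \<ominus>\<^bsub>R\<^esub> r \<otimes>\<^bsub>R\<^esub> a) = \<one>\<^bsub>R\<^esub>"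
      using local_ring_unit[OF L, of "\<one>\<^bsub>R\<^esub> \<ominus>\<^bsub>R\<^esub> r \<otimes>\<^bsub>R\<^esub> a"] ac r(1) by auto
    have "(\<one>\<^bsub>R\<^esub> \<ominus>\<^bsub>R\<^esub> r \<otimes>\<^bsub>R\<^esub> a) \<odot>\<^bsub>H\<^esub> ?g = ?g \<ominus>\<^bsub>H\<^esub> r \<odot>\<^bsub>H\<^esub> (a \<odot>\<^bsub>H\<^esub> ?g)"
      using g ac r(1) by (simp add: a_minus_def H.smult_l_distr H.smult_l_minus H.smult_assoc1)
    then have "(\<one>\<^bsub>R\<^esub> \<ominus>\<^bsub>R\<^esub> r \<otimes>\<^bsub>R\<^esub> a) \<odot>\<^bsub>H\<^esub> ?g = \<zero>\<^bsub>H\<^esub>"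
      using r(2) H.minus_eq_zero_iff[OF g, of "r \<odot>\<^bsub>H\<^esub> (a \<odot>\<^bsub>H\<^esub> ?g)"] g ac r(1) by auto
    then have "(b \<otimes>\<^bsub>R\<^esub> (\<one>\<^bsub>R\<^esub> \<ominus>\<^bsub>R\<^esub> r \<otimes>\<^bsub>R\<^esub> a)) \<odot>\<^bsub>H\<^esub> ?g = \<zero>\<^bsub>H\<^esub>"
      using H.smult_assoc1[of b "\<one>\<^bsub>R\<^esub> \<ominus>\<^bsub>R\<^esub> r \<otimes>\<^bsub>R\<^esub> a" ?g] b(1) g ac r(1) by simp
    then have "?g = \<zero>\<^bsub>H\<^esub>" unfolding b(2) using g by simp
    moreover have "a [^]\<^bsub>R\<^esub> l = a [^]\<^bsub>R\<^esub> k \<otimes>\<^bsub>R\<^esub> a [^]\<^bsub>R\<^esub> (l - k)" using ac k(1) by (simp add: L.nat_pow_mult)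
    ultimately show ?thesis using h pc by (simp add: H.smult_assoc1)
  qed
  then show ?thesis by blast
qed

text \<open>
  Only finitely many homology modules are nonzero, so the sum of their exponents serves for all degrees.
\<close>

lemma finite_length_homology_power:
  assumes L: "noetherian_local_ring R \<mm>" and G: "chain_complex R G d" and c: "c \<in> \<mm>"
    and z: "\<And>i. i < 0 \<or> int s < i \<Longrightarrow> zero_module (G i)" and fl: "\<And>i. finite_length R (homology G d i)"
  shows "\<exists>l::nat. \<forall>i. \<forall>x\<in>cycles G d i. (c [^]\<^bsub>R\<^esub> l) \<odot>\<^bsub>G i\<^esub> x \<in> boundaries G d i"
proof -
  interpret L: noetherian_local_ring R \<mm> by (rule L)
  interpret mi: maximalideal \<mm> R by (rule L.maximal)
  have cc: "c \<in> carrier R" using c mi.Icarr by blast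
  note s = cycles_boundaries_submodule[OF G]
  define kl where "kl l i \<longleftrightarrow> (\<forall>x\<in>cycles G d i. (c [^]\<^bsub>R\<^esub> l) \<odot>\<^bsub>G i\<^esub> x \<in> boundaries G d i)" for l :: nat and i
  have ex: "\<exists>l. kl l i" for i
  proof -
    let ?Z = "(G i)\<lparr>carrier := cycles G d i\<rparr>"
    interpret Z: rmodule R ?Z unfolding rmodule_def by (rule s(3))
    have H: "rmodule R (homology G d i)"
      unfolding rmodule_def homology_def by (rule Z.quot_module_module[OF s(2)])
    obtain l where l: "\<And>h. h \<in> carrier (homology G d i) \<Longrightarrow> (c [^]\<^bsub>R\<^esub> (l::nat)) \<odot>\<^bsub>homology G d i\<^esub> h = \<zero>\<^bsub>homology G d i\<^esub>"
      using finite_length_power_zero[OF L H fl c] by blast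
    have "kl l i" unfolding kl_def
    proof
      fix x assume x: "x \<in> cycles G d i"
      then have xZ: "x \<in> carrier ?Z" by simp
      have pc: "c [^]\<^bsub>R\<^esub> l \<in> carrier R" using cc by simp
      have "boundaries G d i +>\<^bsub>?Z\<^esub> x \<in> carrier (homology G d i)"
        unfolding homology_def Z.quot_carrier using xZ by blast
      from l[OF this] have "boundaries G d i +>\<^bsub>?Z\<^esub> ((c [^]\<^bsub>R\<^esub> l) \<odot>\<^bsub>?Z\<^esub> x) = \<zero>\<^bsub>quot_module ?Z (boundaries G d i)\<^esub>"
        unfolding homology_def Z.quot_smult[OF s(2) pc xZ] .
      then have "(c [^]\<^bsub>R\<^esub> l) \<odot>\<^bsub>?Z\<^esub> x \<in> boundaries G d i"
        using Z.quot_eq_zero_iff[OF s(2) Z.smult_closed[OF pc xZ]] by blast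
      then show "(c [^]\<^bsub>R\<^esub> l) \<odot>\<^bsub>G i\<^esub> x \<in> boundaries G d i" by simp
    qed
    then show ?thesis by blast
  qed
  have up: "kl l' i" if k: "kl l i" and l: "l \<le> l'" for l l' i
    unfolding kl_def
  proof
    fix x assume x: "x \<in> cycles G d i"
    interpret Gi: rmodule R "G i" unfolding rmodule_def by (rule chain_complexD(1)[OF G])
    interpret Z: rmodule R "(G i)\<lparr>carrier := cycles G d i\<rparr>" unfolding rmodule_def by (rule s(3))
    have xG: "x \<in> carrier (G i)" using x by (simp add: cycles_def)
    have "c [^]\<^bsub>R\<^esub> l' = c [^]\<^bsub>R\<^esub> (l' - l) \<otimes>\<^bsub>R\<^esub> c [^]\<^bsub>R\<^esub> l" using cc l by (simp add: L.nat_pow_mult)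
    then have "(c [^]\<^bsub>R\<^esub> l') \<odot>\<^bsub>G i\<^esub> x = (c [^]\<^bsub>R\<^esub> (l' - l)) \<odot>\<^bsub>G i\<^esub> ((c [^]\<^bsub>R\<^esub> l) \<odot>\<^bsub>G i\<^esub> x)"
      using xG cc by (simp add: Gi.smult_assoc1)
    moreover have "(c [^]\<^bsub>R\<^esub> l) \<odot>\<^bsub>G i\<^esub> x \<in> boundaries G d i" using k x by (simp add: kl_def)
    ultimately show "(c [^]\<^bsub>R\<^esub> l') \<odot>\<^bsub>G i\<^esub> x \<in> boundaries G d i"
      using Z.submodD(6)[OF s(2), of "c [^]\<^bsub>R\<^esub> (l' - l)"] cc by simp
  qed
  from ex obtain F where F: "\<And>i. kl (F i) i" by metis
  have "kl (\<Sum>i\<in>{0..int s}. F i) i" for i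
  proof (cases "0 \<le> i \<and> i \<le> int s")
    case True
    then show ?thesis by (intro up[OF F] member_le_sum) auto
  next
    case False
    then have 0: "zero_module (G i)" using z by auto
    interpret Z: rmodule R "(G i)\<lparr>carrier := cycles G d i\<rparr>" unfolding rmodule_def by (rule s(3))
    interpret Gi: rmodule R "G i" unfolding rmodule_def by (rule chain_complexD(1)[OF G])
    have "(c [^]\<^bsub>R\<^esub> (\<Sum>i\<in>{0..int s}. F i)) \<odot>\<^bsub>G i\<^esub> x = \<zero>\<^bsub>G i\<^esub>" if "x \<in> carrier (G i)" for x
      using Gi.smult_closed[OF _ that] 0 cc by (simp add: zero_module_def)
    then show ?thesis using Z.submodD(2)[OF s(2)] by (auto simp: kl_def cycles_def)
  qed
  then show ?thesis unfolding kl_def by blast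
qed

context cring
begin

lemma coresolves_augment:
  assumes G: "chain_complex R G d" and C: "coresolves R G d p I D \<epsilon>" and i: "i \<le> p" and x: "x \<in> cycles G d i"
  shows "\<epsilon> i x \<in> rvecs (copart I i)" "rlin R (D i) (\<epsilon> i x) = \<zero>\<^bsub>vspace (regular_module R)\<^esub>"
proof -
  note c = coresolvesD[OF C]
  have Gm: "rmodule R (G j)" for j unfolding rmodule_def by (rule chain_complexD(1)[OF G])
  have xG: "x \<in> carrier (G i)" and dx: "d i x = \<zero>\<^bsub>G (i - 1)\<^esub>" using x by (auto simp: cycles_def)
  show "\<epsilon> i x \<in> rvecs (copart I i)" using mod_homD(1)[OF c(5)[OF i] xG] by (simp add: free_module_ops(1))
  have i1: "i - 1 \<le> p" using i by simp
  show "rlin R (D i) (\<epsilon> i x) = \<zero>\<^bsub>vspace (regular_module R)\<^esub>"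
    using c(6)[OF i xG] mod_hom_zero[OF Gm free_module_rmodule c(5)[OF i1]] by (simp only: dx free_zero)
qed

text \<open>
  The homology of the subcomplex is that of \<open>G\<close>. The case \<open>i = p\<close> is separate since
  \<open>\<epsilon>\<close> is only defined up to degree \<open>p\<close>; there the hypothesis on
  \<open>G (p + 1)\<close> makes all boundaries zero.
\<close>

lemma copart_kills:
  assumes G: "chain_complex R G d" and C: "coresolves R G d p I D \<epsilon>" and z: "zero_module (G (p + 1))"
    and c: "c \<in> carrier R" and k: "\<And>x. x \<in> cycles G d i \<Longrightarrow> c \<odot>\<^bsub>G i\<^esub> x \<in> boundaries G d i"
  shows "kills R c (copart I) (\<lambda>j. mres R (copart I (j - 1)) (copart I j) (D j)) i"
proof -
  note co = coresolvesD[OF C]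
  note uc = copart_cone[OF co(1) co(4)]
  let ?W = "vspace (regular_module R)" and ?l = "rlin R"
  define DL where "DL = (\<lambda>j. mres R (copart I (j - 1)) (copart I j) (D j))"
  interpret W: module R ?W by (rule reg.vec_module_module)
  have DLD: "?l (DL j) v = ?l (D j) v" if "v \<in> rvecs (copart I j)" for j v
    using reg.cone_diff_apply(2)[OF uc(1) that reg.vecs_ops(1)] by (simp only: DL_def uc(2))
  have cI: "cx R I D" using co(1) by (simp add: tacyclic_def)
  have Gm: "rmodule R (G j)" for j unfolding rmodule_def by (rule chain_complexD(1)[OF G])
  have "\<exists>w\<in>rvecs (copart I (i + 1)). ?l (DL (i + 1)) w = c \<odot>\<^bsub>?W\<^esub> v"
    if v: "v \<in> rvecs (copart I i)" and Dv: "?l (DL i) v = \<zero>\<^bsub>?W\<^esub>" for v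
  proof (cases "i \<le> p")
    case False
    have "copart I i = {}"
    proof -
      have "fst a < i" if "a \<in> I i" for a using co(3)[OF that] False by simp
      then show ?thesis by (force simp: copart_def)
    qed
    then have "v = \<zero>\<^bsub>?W\<^esub>" using vecsD(2)[OF v] by auto
    then have "c \<odot>\<^bsub>?W\<^esub> v = \<zero>\<^bsub>?W\<^esub>" using c by (simp only: W.smult_r_null)
    then show ?thesis by (intro bexI[OF _ reg.vecs_ops(1)]) (simp only: reg.lin_zero)
  next
    case True
    obtain x l where x: "x \<in> carrier (G i)" "d i x = \<zero>\<^bsub>G (i - 1)\<^esub>" and l: "l \<in> rvecs (copart I (i + 1))"
      and vxl: "v = \<epsilon> i x \<oplus>\<^bsub>?W\<^esub> ?l (D (i + 1)) l"
      using co(8)[OF True v Dv[unfolded DLD[OF v]]] by blast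
    have xz: "x \<in> cycles G d i" using x by (simp add: cycles_def)
    have \<epsilon>x: "\<epsilon> i x \<in> rvecs (copart I i)" by (rule coresolves_augment(1)[OF G C True xz])
    obtain y where y: "y \<in> carrier (G (i + 1))" "d (i + 1) y = c \<odot>\<^bsub>G i\<^esub> x" using k[OF xz] by (auto simp: boundaries_def)
    have "\<exists>w\<in>rvecs (copart I (i + 1)). ?l (D (i + 1)) w = \<epsilon> i (c \<odot>\<^bsub>G i\<^esub> x)"
    proof (cases "i = p")
      case True
      have "y = \<zero>\<^bsub>G (i + 1)\<^esub>" using y z True by (simp add: zero_module_def)
      then have "c \<odot>\<^bsub>G i\<^esub> x = \<zero>\<^bsub>G i\<^esub>" using y(2) mod_hom_zero[OF Gm Gm chain_complexD(3)[OF G]] by simp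
      then have "\<epsilon> i (c \<odot>\<^bsub>G i\<^esub> x) = \<zero>\<^bsub>?W\<^esub>"
        using mod_hom_zero[OF Gm free_module_rmodule co(5)[OF \<open>i \<le> p\<close>]] by (simp only: free_zero)
      then show ?thesis by (intro bexI[OF _ reg.vecs_ops(1)]) (simp only: reg.lin_zero)
    next
      case False
      then have i1: "i + 1 \<le> p" using \<open>i \<le> p\<close> by simp
      have "?l (D (i + 1)) (\<epsilon> (i + 1) y) = \<epsilon> i (c \<odot>\<^bsub>G i\<^esub> x)" using co(6)[OF i1 y(1)] y(2) by simp
      moreover have "\<epsilon> (i + 1) y \<in> rvecs (copart I (i + 1))"
        using mod_homD(1)[OF co(5)[OF i1] y(1)] by (simp add: free_module_ops(1))
      ultimately show ?thesis by blast
    qed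
    then obtain w where w: "w \<in> rvecs (copart I (i + 1))" "?l (D (i + 1)) w = \<epsilon> i (c \<odot>\<^bsub>G i\<^esub> x)" by blast
    have \<epsilon>c: "\<epsilon> i (c \<odot>\<^bsub>G i\<^esub> x) = c \<odot>\<^bsub>?W\<^esub> \<epsilon> i x"
      using mod_homD(3)[OF co(5)[OF True] c x(1)] reg.pull_smult by (simp add: free_module_eq vec_module_def)
    note U = vecs_UNIV
    have cl: "c \<odot>\<^bsub>?W\<^esub> l \<in> rvecs (copart I (i + 1))" by (rule reg.vecs_ops(5)[OF c l])
    have "?l (DL (i + 1)) (w \<oplus>\<^bsub>?W\<^esub> c \<odot>\<^bsub>?W\<^esub> l) = ?l (D (i + 1)) (w \<oplus>\<^bsub>?W\<^esub> c \<odot>\<^bsub>?W\<^esub> l)"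
      by (rule DLD[OF reg.vecs_ops(2)[OF w(1) cl]])
    also have "\<dots> = c \<odot>\<^bsub>?W\<^esub> \<epsilon> i x \<oplus>\<^bsub>?W\<^esub> c \<odot>\<^bsub>?W\<^esub> ?l (D (i + 1)) l"
      by (simp only: reg.lin_add[OF U[OF w(1)] U[OF cl] cxD(2)[OF cI]] w(2) \<epsilon>c reg.lin_smult[OF c U[OF l] cxD(2)[OF cI]])
    also have "\<dots> = c \<odot>\<^bsub>?W\<^esub> v"
      using U[OF \<epsilon>x] U[OF reg.lin_closed[OF U[OF l] cxD(2)[OF cI, of "i + 1"]]] by (simp add: vxl W.smult_r_distr[OF c])
    finally show ?thesis using reg.vecs_ops(2)[OF w(1) cl] by blast
  qed
  then show ?thesis unfolding kills_def DL_def by blast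
qed

text \<open>
  The inverse of the connecting homomorphism: the image of \<open>x\<close> in the subcomplex is a boundary of the exact
  total complex, say of \<open>w\<close>, and \<open>z\<close> is the component of \<open>w\<close> in the quotient.
\<close>

lemma nonboundary_in_quotient:
  assumes G: "chain_complex R G d" and C: "coresolves R G d p I D \<epsilon>" and i: "i \<le> p"
    and x: "x \<in> cycles G d i" "x \<notin> boundaries G d i"
  defines "DQ \<equiv> \<lambda>j. mres R (I (j - 1) - copart I (j - 1)) (I j - copart I j) (D j)"
  shows "\<exists>z\<in>rvecs (I (i + 1) - copart I (i + 1)). rlin R (DQ (i + 1)) z = \<zero>\<^bsub>vspace (regular_module R)\<^esub> \<and>
    z \<notin> rlin R (DQ (i + 2)) ` rvecs (I (i + 2) - copart I (i + 2))"
proof -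
  note co = coresolvesD[OF C]
  note uc = copart_cone[OF co(1) co(4)]
  let ?W = "vspace (regular_module R)" and ?l = "rlin R"
  define DL f where "DL = (\<lambda>j. mres R (copart I (j - 1)) (copart I j) (D j))"
    and "f = (\<lambda>j. mres R (copart I (j - 1)) (I j - copart I j) (D j))"
  have cone: "cone R (copart I) DL f (\<lambda>j. I j - copart I j) DQ" using uc(1) unfolding DL_def f_def DQ_def .
  have cd: "cone_diff R DL f DQ = D" using uc(2) unfolding DL_def f_def DQ_def .
  interpret W: module R ?W by (rule reg.vec_module_module)
  interpret W: rmodule R ?W by unfold_locales
  note U = vecs_UNIV and ops = reg.vecs_ops
  note \<epsilon>x = coresolves_augment[OF G C i x(1)]
  have DLD: "?l (DL j) v = ?l (D j) v" if "v \<in> rvecs (copart I j)" for j v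
    using reg.cone_diff_apply(2)[OF cone that ops(1)] by (simp only: cd)
  have ex: "\<And>j. kills R \<one> I D j" using co(1) by (auto simp: tacyclic_def)
  have "\<epsilon> i x \<in> rvecs (I i)" by (rule vecs_mono[OF \<epsilon>x(1)]) (auto simp: copart_def)
  then obtain w where w: "w \<in> rvecs (I (i + 1))" "?l (D (i + 1)) w = \<epsilon> i x" using kills_oneD[OF ex _ \<epsilon>x(2)] by blast
  have sp: "copart I (i + 1) \<union> (I (i + 1) - copart I (i + 1)) = I (i + 1)" "copart I (i + 1) \<inter> (I (i + 1) - copart I (i + 1)) = {}"
    by (auto simp: copart_def)
  have w': "w \<in> rvecs (copart I (i + 1) \<union> (I (i + 1) - copart I (i + 1)))" unfolding sp(1) by (rule w(1))
  obtain l z where l: "l \<in> rvecs (copart I (i + 1))" and z: "z \<in> rvecs (I (i + 1) - copart I (i + 1))" and wlz: "w = l \<oplus>\<^bsub>?W\<^esub> z"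
    using reg.vecs_split[OF w' sp(2)] .
  have DLl: "?l (DL (i + 1)) l \<in> rvecs (copart I i)" using reg.lin_closed[OF U[OF l] coneD(1)[OF cone, THEN cxD(2), of "i + 1"]] by simp
  have fz: "?l (f (i + 1)) z \<in> rvecs (copart I i)" by (rule reg.lin_closed[OF U[OF z] coneD(5)[OF cone]])
  have DQz: "?l (DQ (i + 1)) z \<in> rvecs (I i - copart I i)" using reg.lin_closed[OF U[OF z] coneD(2)[OF cone, THEN cxD(2), of "i + 1"]] by simp
  have "\<epsilon> i x \<oplus>\<^bsub>?W\<^esub> \<zero>\<^bsub>?W\<^esub> = (?l (DL (i + 1)) l \<oplus>\<^bsub>?W\<^esub> ?l (f (i + 1)) z) \<oplus>\<^bsub>?W\<^esub> ?l (DQ (i + 1)) z"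
    using reg.cone_diff_apply(1)[OF cone l z] w(2) reg.lin_zero_sum(1)[OF U[OF \<epsilon>x(1)]] by (simp only: cd wlz)
  note eq = reg.vecs_disjoint_eq[OF \<epsilon>x(1) ops(2)[OF DLl fz] ops(1) DQz _ this]
  have eq1: "\<epsilon> i x = ?l (DL (i + 1)) l \<oplus>\<^bsub>?W\<^esub> ?l (f (i + 1)) z" by (rule eq(1)) blast
  have eq2: "?l (DQ (i + 1)) z = \<zero>\<^bsub>?W\<^esub>" by (rule eq(2)[symmetric]) blast
  have "z \<notin> ?l (DQ (i + 2)) ` rvecs (I (i + 2) - copart I (i + 2))"
  proof
    assume "z \<in> ?l (DQ (i + 2)) ` rvecs (I (i + 2) - copart I (i + 2))"
    then obtain y where y0: "y \<in> rvecs (I (i + 2) - copart I (i + 2))" "z = ?l (DQ (i + 2)) y" by blast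
    have i2: "i + 2 = i + 1 + 1" by simp
    note y = y0[unfolded i2]
    have "?l (f (i + 1)) z = \<ominus>\<^bsub>?W\<^esub> ?l (DL (i + 1)) (?l (f (i + 1 + 1)) y)"
      using reg.cone_anticomm[OF cone U[OF y(1)], of "i + 1"] by (simp only: y(2))
    moreover have fy: "?l (f (i + 1 + 1)) y \<in> rvecs (copart I (i + 1))"
      by (rule reg.lin_closed[OF U[OF y(1)] coneD(5)[OF cone]])
    ultimately have "\<epsilon> i x = ?l (DL (i + 1)) (l \<ominus>\<^bsub>?W\<^esub> ?l (f (i + 1 + 1)) y)"
      using eq1 unfolding reg.lin_minus[OF U[OF l] U[OF fy] coneD(1)[OF cone, THEN cxD(2)]] by (simp only: a_minus_def)
    then have e: "\<epsilon> i x = ?l (D (i + 1)) (l \<ominus>\<^bsub>?W\<^esub> ?l (f (i + 1 + 1)) y)"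
      by (simp only: DLD[OF ops(3)[OF l fy]])
    have xc: "x \<in> carrier (G i)" "d i x = \<zero>\<^bsub>G (i - 1)\<^esub>" using x(1) by (auto simp: cycles_def)
    interpret Z: rmodule R "(G i)\<lparr>carrier := cycles G d i\<rparr>"
      unfolding rmodule_def by (rule cycles_boundaries_submodule(3)[OF G])
    show False
      using co(7)[OF i xc ops(3)[OF l fy] e] x(2) Z.submodD(2)[OF cycles_boundaries_submodule(2)[OF G]]
      by (auto simp: boundaries_def)
  qed
  then show ?thesis using z eq2 by blast
qed

end

text \<open>
  Contractibility up to degree \<open>t\<close> gives the idempotent \<open>P = h D\<close> in degree
  \<open>t + 1\<close>, whose kernel consists of the cycles. Hence \<open>z\<close> lies outside the image of
  \<open>(D, P)\<close>; this property passes to \<open>M\<close>, and \<open>v - P v\<close> is the cycle sought.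
\<close>

lemma (in rmodule) base_change_cycle:
  assumes L: "noetherian_local_ring R \<mm>" and ys: "set ys \<subseteq> carrier R" "\<mm> = Idl (set ys)"
    and nm: "smult_sum M {\<zero>\<^bsub>M\<^esub>} ys \<noteq> carrier M"
    and C: "cx R Q DQ" and h: "htpy R \<one> Q DQ h t"
    and z: "z \<in> vecs (regular_module R) (Q (t + 1))"
      "rlin R (DQ (t + 1)) z = \<zero>\<^bsub>vspace (regular_module R)\<^esub>"
      "z \<notin> rlin R (DQ (t + 2)) ` vecs (regular_module R) (Q (t + 2))"
  shows "\<exists>u\<in>vecs M (Q (t + 1)). lin M (DQ (t + 1)) u = \<zero>\<^bsub>vspace M\<^esub> \<and>
    u \<notin> lin M (DQ (t + 2)) ` vecs M (Q (t + 2))"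
proof -
  interpret reg: rmodule R "regular_module R" by (rule R.reg.rmodule_axioms)
  note U = vecs_UNIV
  let ?D1 = "DQ (t + 1)" and ?D2 = "DQ (t + 2)" and ?H = "h t"
  have D1: "?D1 \<in> Mat R (Q t) (Q (t + 1))" by (rule cxD'(1)[OF C])
  have D2: "?D2 \<in> Mat R (Q (t + 1)) (Q (t + 2))" using cxD'(1)[OF C, of "t + 1"] by (simp add: add.assoc)
  have H: "?H \<in> Mat R (Q (t + 1)) (Q t)" using h by (simp add: htpy_def)
  let ?P = "mm R ?H ?D1"
  have P: "?P \<in> Mat R (Q (t + 1)) (Q (t + 1))" by (rule R.Mat_mm[OF H D1])
  have Pv: "lin N ?P v = lin N ?H (lin N ?D1 v)" if "rmodule R N" "v \<in> vecs N UNIV" for N :: "('a, 'n) module" and v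
    by (rule rmodule.lin_mm[OF that H D1])
  have DP: "lin N ?D1 (lin N ?P v) = lin N ?D1 v" if N: "rmodule R N" and v: "v \<in> vecs N UNIV" for N :: "('a, 'n) module" and v
  proof -
    interpret N: rmodule R N by (rule N)
    interpret NW: module R "vspace N" by (rule N.vec_module_module)
    have w: "lin N ?D1 v \<in> vecs N (Q t)" by (rule N.lin_closed[OF v D1])
    have "lin N (DQ t) (lin N ?D1 v) = \<zero>\<^bsub>vspace N\<^esub>" by (rule N.lin_DD[OF C v])
    then have "lin N ?D1 (lin N ?H (lin N ?D1 v)) \<oplus>\<^bsub>vspace N\<^esub> \<zero>\<^bsub>vspace N\<^esub> = \<one> \<odot>\<^bsub>vspace N\<^esub> lin N ?D1 v"
      using N.htpy_apply[OF C h R.one_closed w] by (simp only: N.lin_zero)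
    then show ?thesis
      using N.lin_zero_sum(1)[OF U[OF N.lin_closed[OF U[OF N.lin_closed[OF w H]] D1]]] NW.smult_one U[OF w]
      by (simp add: Pv[OF N v])
  qed
  have "z \<noteq> rlin R ?D2 a \<oplus>\<^bsub>vspace (regular_module R)\<^esub> rlin R ?P b"
    if a: "a \<in> vecs (regular_module R) (Q (t + 2))" and b: "b \<in> vecs (regular_module R) (Q (t + 1))" for a b
  proof
    let ?W = "vspace (regular_module R)" and ?l = "rlin R"
    assume zab: "z = ?l ?D2 a \<oplus>\<^bsub>?W\<^esub> ?l ?P b"
    note Da = U[OF reg.lin_closed[OF a D2]] and Pb = U[OF reg.lin_closed[OF b P]]
    have "?l ?D1 (?l ?D2 a) = \<zero>\<^bsub>?W\<^esub>" using reg.lin_DD[OF C U[OF a], of "t + 1"] by (simp add: algebra_simps)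
    then have "\<zero>\<^bsub>?W\<^esub> = \<zero>\<^bsub>?W\<^esub> \<oplus>\<^bsub>?W\<^esub> ?l ?D1 b"
      using z(2) unfolding zab reg.lin_add[OF Da Pb D1] by (simp only: DP[OF reg.rmodule_axioms U[OF b]])
    then have "?l ?D1 b = \<zero>\<^bsub>?W\<^esub>" using reg.lin_zero_sum(2)[OF U[OF reg.lin_closed[OF b D1]]] by simp
    then have "?l ?P b = \<zero>\<^bsub>?W\<^esub>" by (simp only: Pv[OF reg.rmodule_axioms U[OF b]] reg.lin_zero)
    then have "z = ?l ?D2 a" using reg.lin_zero_sum(1)[OF Da] by (simp only: zab)
    then show False using z(3) a by blast
  qed
  from base_change_not_surjective[OF L ys nm cxD(1)[OF C] D2 P cxD(1)[OF C] cxD(1)[OF C] z(1) this]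
  obtain v where v: "v \<in> vecs M (Q (t + 1))" and
    nv: "\<And>a b. a \<in> vecs M (Q (t + 2)) \<Longrightarrow> b \<in> vecs M (Q (t + 1)) \<Longrightarrow> v \<noteq> lin M ?D2 a \<oplus>\<^bsub>vspace M\<^esub> lin M ?P b"
    by blast
  let ?V = "vspace M"
  interpret V: module R ?V by (rule vec_module_module)
  interpret V: rmodule R ?V by unfold_locales
  have Pc: "lin M ?P v \<in> vecs M (Q (t + 1))" by (rule lin_closed[OF v P])
  define u where "u = v \<ominus>\<^bsub>?V\<^esub> lin M ?P v"
  have u: "u \<in> vecs M (Q (t + 1))" unfolding u_def by (rule vecs_ops(3)[OF v Pc])
  have "lin M ?D1 u = lin M ?D1 v \<ominus>\<^bsub>?V\<^esub> lin M ?D1 v"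
    unfolding u_def by (simp only: lin_minus[OF U[OF v] U[OF Pc] D1] DP[OF rmodule_axioms U[OF v]])
  then have "lin M ?D1 u = \<zero>\<^bsub>?V\<^esub>"
    using V.minus_eq_zero_iff[of "lin M ?D1 v" "lin M ?D1 v"] U[OF lin_closed[OF v D1]] by simp
  moreover have "u \<notin> lin M ?D2 ` vecs M (Q (t + 2))"
  proof
    assume "u \<in> lin M ?D2 ` vecs M (Q (t + 2))"
    then obtain a where a: "a \<in> vecs M (Q (t + 2))" "u = lin M ?D2 a" by blast
    have "v = u \<oplus>\<^bsub>?V\<^esub> lin M ?P v"
      using U[OF v] U[OF Pc] by (simp add: u_def a_minus_def V.M.a_assoc V.M.l_neg)
    then show False using nv[OF a(1) v] a(2) by simp
  qed
  ultimately show ?thesis using u by blast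
qed

section \<open>The inequality\<close>

text \<open>
  The cokernel is realized as a quotient of \<open>R\<^sup>n\<close>, on the carrier type over which the modules
  \<open>B\<close> are indexed. The statement is phrased for the basis \<open>I k\<close> itself and hides the enumeration
  of the bases.
\<close>

lemma (in cring) tacyclic_cokernel_module:
  fixes I :: "int \<Rightarrow> 'i set"
  assumes T: "tacyclic I D" and m: "\<mm> \<subseteq> carrier R"
  shows "\<exists>N :: 'a fg_module. totally_reflexive R N \<and> (\<forall>(M :: ('a, 'd) module) v.
    rmodule R M \<longrightarrow> socle \<mm> (tensor_module R M N) = {\<zero>\<^bsub>tensor_module R M N\<^esub>} \<longrightarrow> v \<in> vecs M (I k) \<longrightarrow>
    (\<forall>a\<in>\<mm>. a \<odot>\<^bsub>vspace M\<^esub> v \<in> lin M (D (k + 1)) ` vecs M (I (k + 1))) \<longrightarrow>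
    v \<in> lin M (D (k + 1)) ` vecs M (I (k + 1)))"
proof -
  have C: "cx R I D" using T by (simp add: tacyclic_def)
  have fin: "finite (I j)" for j by (rule cxD(1)[OF C])
  define n where "n j = card (I j)" for j
  have "\<exists>h. bij_betw h {..<n j} (I j)" for j
    using ex_bij_betw_nat_finite[OF fin[of j]] by (simp add: n_def atLeast0LessThan)
  then obtain \<rho> where b: "\<And>j. bij_betw (\<rho> j) {..<n j} (I j)" by metis
  define E where "E = relabel R (\<lambda>j. {..<n j}) \<rho> D"
  have TE: "tacyclic (\<lambda>j. {..<n j}) E" unfolding E_def by (rule relabel_tacyclic[OF T b])
  have Em: "E (k + 1) \<in> Mat R {..<n k} {..<n (k + 1)}"
    using cxD'(1)[of R "\<lambda>j. {..<n j}" E k] TE by (simp add: tacyclic_def)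
  define N where "N = quot_module (free_module R {..<n k}) (rlin R (E (k + 1)) ` rvecs {..<n (k + 1)})"
  have key: "v \<in> lin M (D (k + 1)) ` vecs M (I (k + 1))"
    if M: "rmodule R M" and soc: "socle \<mm> (tensor_module R M N) = {\<zero>\<^bsub>tensor_module R M N\<^esub>}" and v: "v \<in> vecs M (I k)"
      and mv: "\<And>a. a \<in> \<mm> \<Longrightarrow> a \<odot>\<^bsub>vspace M\<^esub> v \<in> lin M (D (k + 1)) ` vecs M (I (k + 1))"
    for M :: "('a, 'd) module" and v
  proof -
    interpret M: rmodule R M by (rule M)
    let ?p = "\<lambda>j. pull M {..<n j} (\<rho> j)"
    have rel: "lin M (E (k + 1)) (?p (k + 1) w) = ?p k (lin M (D (k + 1)) w)" if "w \<in> vecs M (I (k + 1))" for w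
      using M.lin_mrelabel[OF cxD'(1)[OF C] b _ _ that, where \<rho>' = "\<rho> k" and K' = "{..<n k}"]
      by (simp add: E_def relabel_def)
    have "?p k v \<in> lin M (E (k + 1)) ` vecs M {..<n (k + 1)}"
    proof (rule M.tensor_cokernel_socle[OF Em finite_lessThan soc[unfolded N_def] m M.pull_vecs[OF v finite_lessThan]])
      fix a assume a: "a \<in> \<mm>"
      obtain w where w: "w \<in> vecs M (I (k + 1))" "a \<odot>\<^bsub>vspace M\<^esub> v = lin M (D (k + 1)) w" using mv[OF a] by blast
      have "a \<odot>\<^bsub>vspace M\<^esub> ?p k v = lin M (E (k + 1)) (?p (k + 1) w)"
        using M.pull_smult[of a "{..<n k}" "\<rho> k" v] a m by (auto simp: w(2) rel[OF w(1)])
      then show "a \<odot>\<^bsub>vspace M\<^esub> ?p k v \<in> lin M (E (k + 1)) ` vecs M {..<n (k + 1)}"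
        using M.pull_vecs[OF w(1), of "{..<n (k + 1)}" "\<rho> (k + 1)"] by simp
    qed
    then obtain w' where w': "w' \<in> vecs M {..<n (k + 1)}" "?p k v = lin M (E (k + 1)) w'" by blast
    obtain w where w: "w \<in> vecs M (I (k + 1))" "w' = ?p (k + 1) w"
      using M.pull_surj[OF b finite_lessThan w'(1)] by blast
    have "v = lin M (D (k + 1)) w"
      by (rule M.pull_inj[OF b v M.lin_closed[OF w(1) cxD'(1)[OF C]]]) (simp only: w'(2) w(2) rel[OF w(1)])
    then show ?thesis using w(1) by blast
  qed
  show ?thesis
  proof (rule exI[of _ N], intro conjI allI impI)
    show "totally_reflexive R N" unfolding N_def by (rule cokernel_totally_reflexive[OF TE])
    fix M :: "('a, 'd) module" and v
    assume a: "rmodule R M" "socle \<mm> (tensor_module R M N) = {\<zero>\<^bsub>tensor_module R M N\<^esub>}" "v \<in> vecs M (I k)"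
      "\<forall>a\<in>\<mm>. a \<odot>\<^bsub>vspace M\<^esub> v \<in> lin M (D (k + 1)) ` vecs M (I (k + 1))"
    show "v \<in> lin M (D (k + 1)) ` vecs M (I (k + 1))" by (rule key[OF a(1-3)]) (rule a(4)[THEN bspec])
  qed
qed

text \<open>
  A nonzero element of \<open>V / U\<close> annihilated by \<open>xs\<close> is torsion with respect to generators
  \<open>ys\<close> of the maximal ideal, because powers of these lie in the ideal of \<open>xs\<close>. A multiple of it
  is then a nonzero element of the socle.
\<close>

lemma (in rmodule) rdepth_one_of_socle:
  assumes xs: "set xs \<subseteq> carrier R" and ys: "set ys \<subseteq> carrier R"
    and rad: "\<And>y. y \<in> set ys \<Longrightarrow> \<exists>k::nat. y [^] k \<in> Idl (set xs)"
    and V: "submodule V R M" and U: "submodule U R M"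
    and soc: "\<And>v. v \<in> V \<Longrightarrow> (\<And>a. a \<in> Idl (set ys) \<Longrightarrow> a \<odot>\<^bsub>M\<^esub> v \<in> U) \<Longrightarrow> v \<in> U"
  shows "rdepth M V U xs 1"
  unfolding rdepth_1_iff[OF xs V U]
proof (intro ballI impI, rule ccontr)
  fix v assume v: "v \<in> V" and xv: "\<forall>x\<in>set xs. x \<odot>\<^bsub>M\<^esub> v \<in> U" and nv: "v \<notin> U"
  have vM: "v \<in> carrier M" by (rule submodD(1)[OF V v])
  have "\<exists>k::nat. (y [^] k) \<odot>\<^bsub>M\<^esub> v \<in> U" if "y \<in> set ys" for y
    using rad[OF that] idl_smult_mem[OF U vM xs] xv by blast
  from torsion_descent[OF U ys vM nv this] obtain r where r: "r \<in> carrier R" "r \<odot>\<^bsub>M\<^esub> v \<notin> U"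
    "\<forall>y\<in>set ys. y \<odot>\<^bsub>M\<^esub> (r \<odot>\<^bsub>M\<^esub> v) \<in> U" by blast
  have "r \<odot>\<^bsub>M\<^esub> v \<in> U"
    by (rule soc[OF submodD(6)[OF V r(1) v]], rule idl_smult_mem[OF U _ ys]) (use r vM in auto)
  then show False using r(2) by simp
qed

theorem theorem2p4:
  fixes R :: "('a, 'c) ring_scheme" (structure) and \<mm> :: "'a set"
    and B :: "'a fg_module \<Rightarrow> ('a, 'b) module"
    and G :: "int \<Rightarrow> ('a, 'g) module" and d :: "int \<Rightarrow> 'g \<Rightarrow> 'g" and s :: nat
  assumes "noetherian_local_ring R \<mm>"
    and "\<And>M :: 'a fg_module. totally_reflexive R M \<Longrightarrow>
           big_cohen_macaulay R \<mm> (B M) \<and>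
           socle \<mm> (tensor_module R (B M) M) = {\<zero>\<^bsub>tensor_module R (B M) M\<^esub>}"
    and "chain_complex R G d"
    and "\<And>i. 0 \<le> i \<Longrightarrow> i \<le> int s \<Longrightarrow> totally_reflexive R (G i)"
    and "\<And>i. i < 0 \<or> int s < i \<Longrightarrow> zero_module (G i)"
    and "\<exists>i. \<not> zero_module (homology G d i)"
    and "\<And>i. finite_length R (homology G d i)"
  shows "krull_dim R \<le> enat s"
proof (rule ccontr)
  note L = assms(1) and G = assms(3) and z = assms(5)
  assume "\<not> krull_dim R \<le> enat s"
  then have dim: "enat s < krull_dim R" by simp
  interpret L: noetherian_local_ring R \<mm> by (rule L)
  interpret mi: maximalideal \<mm> R by (rule L.maximal)
  have mR: "\<mm> \<subseteq> carrier R" using mi.Icarr by blast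
  have hz: "cycles G d i \<subseteq> boundaries G d i" if "i < 0 \<or> int s < i" for i
  proof -
    interpret Z: rmodule R "(G i)\<lparr>carrier := cycles G d i\<rparr>"
      unfolding rmodule_def by (rule cycles_boundaries_submodule(3)[OF G])
    show ?thesis using z[OF that] Z.submodD(2)[OF cycles_boundaries_submodule(2)[OF G]]
      by (auto simp: zero_module_def cycles_def)
  qed
  obtain i0 where i0: "\<not> cycles G d i0 \<subseteq> boundaries G d i0" using assms(6) homology_zero_iff[OF G] by blast
  then have "\<not> cycles G d (int (nat i0)) \<subseteq> boundaries G d (int (nat i0))" using hz[of i0] by (cases "0 \<le> i0") auto
  from LeastI[of "\<lambda>k. \<not> cycles G d (int k) \<subseteq> boundaries G d (int k)", OF this]
  obtain k where k: "\<not> cycles G d (int k) \<subseteq> boundaries G d (int k)"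
    "\<And>k'. k' < k \<Longrightarrow> cycles G d (int k') \<subseteq> boundaries G d (int k')"
    using not_less_Least[of _ "\<lambda>k. \<not> cycles G d (int k) \<subseteq> boundaries G d (int k)"] by blast
  \<comment> \<open>The least degree with nonzero homology. It is not negative because the modules \<open>G i\<close> with
    \<open>i < 0\<close> are zero.\<close>
  define t where "t = int k"
  have t: "0 \<le> t" "t \<le> int s" using hz[of t] k(1) by (auto simp: t_def)
  have low: "cycles G d i \<subseteq> boundaries G d i" if "i < t" for i
    using hz[of i] k(2)[of "nat i"] that by (cases "0 \<le> i") (auto simp: t_def)
  obtain x0 where x0: "x0 \<in> cycles G d t" "x0 \<notin> boundaries G d t" using k(1) by (auto simp: t_def)
  obtain I D \<epsilon> where C: "coresolves R G d (int s) I D \<epsilon>"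
    using L.coresolves_exists[OF G assms(5) assms(4), of "int s"] by auto
  note co = L.coresolvesD[OF C]
  define Q where "Q = (\<lambda>j. I j - copart I j)"
  define DL f DQ where "DL = (\<lambda>j. mres R (copart I (j - 1)) (copart I j) (D j))"
    and "f = (\<lambda>j. mres R (copart I (j - 1)) (Q j) (D j))" and "DQ = (\<lambda>j. mres R (Q (j - 1)) (Q j) (D j))"
  have cone: "cone R (copart I) DL f Q DQ" and cd: "cone_diff R DL f DQ = D" and un: "(\<lambda>j. copart I j \<union> Q j) = I"
    using L.copart_cone[OF co(1) co(4)] unfolding DL_def f_def DQ_def Q_def by auto
  have un': "copart I j \<union> Q j = I j" for j by (rule fun_cong[OF un])
  have ex: "kills R \<one> I D j" and exd: "kills R \<one> (dual_index I) (dual_diff D) j" for j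
    using co(1) by (auto simp: L.tacyclic_def)
  have Qlow: "Q j = {}" if "j < 1" for j
  proof -
    have "j \<le> fst a" if "a \<in> I j" for a using co(2)[OF that] \<open>j < 1\<close> by simp
    then show ?thesis by (auto simp: Q_def copart_def)
  qed
  have Lhigh: "copart I j = {}" if "j > int s" for j
  proof -
    have "fst a < j" if "a \<in> I j" for a using co(3)[OF that] \<open>j > int s\<close> by simp
    then show ?thesis by (force simp: copart_def)
  qed
  note hom' = L.cone_homotopies[OF cone, unfolded un cd, OF ex exd, where b = 1 and s = "int s"]
  have hom1: "\<exists>h (e::nat). \<forall>j\<le>q + 1. htpy R (c [^] e) Q DQ h j"
    if "c \<in> carrier R" "\<And>j. j \<le> q \<Longrightarrow> kills R c (copart I) DL j" for c q
    by (rule hom'(1)) (use Qlow Lhigh that in auto)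
  have hom2: "\<exists>h (e::nat). \<forall>j\<ge>q. htpy R (c [^] e) (copart I) DL h j"
    if "c \<in> carrier R" "\<And>j. kills R c (copart I) DL j" for c q
    by (rule hom'(2)) (use Qlow Lhigh that in auto)
  note kL = L.copart_kills[OF G C z, folded DL_def]
  \<comment> \<open>Below \<open>t\<close> the complex \<open>L\<close> is exact, so \<open>c = \<one>\<close> gives a contraction of
    \<open>Q\<close> up to degree \<open>t\<close>.\<close>
  have k1: "kills R \<one> (copart I) DL j" if "j \<le> t - 1" for j
  proof (rule kL)
    fix x assume x: "x \<in> cycles G d j"
    interpret Gj: rmodule R "G j" unfolding rmodule_def by (rule chain_complexD(1)[OF G])
    have "\<one> \<odot>\<^bsub>G j\<^esub> x = x" using x by (simp add: cycles_def)
    then show "\<one> \<odot>\<^bsub>G j\<^esub> x \<in> boundaries G d j" using low[of j] x that by auto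
  qed auto
  have "\<exists>h (e::nat). \<forall>j\<le>t - 1 + 1. htpy R (\<one> [^] e) Q DQ h j" by (rule hom1[OF L.one_closed k1])
  then obtain h1 where h1: "htpy R \<one> Q DQ h1 t" by auto
  obtain ys where ys: "set ys \<subseteq> carrier R" "\<mm> = Idl (set ys)"
    using L.finetely_gen[OF mi.is_ideal] finite_list by metis
  have "\<exists>N :: 'a fg_module. totally_reflexive R N \<and> (\<forall>(M :: ('a, 'b) module) v. rmodule R M \<longrightarrow>
      socle \<mm> (tensor_module R M N) = {\<zero>\<^bsub>tensor_module R M N\<^esub>} \<longrightarrow> v \<in> vecs M (I (t + 1)) \<longrightarrow>
      (\<forall>a\<in>\<mm>. a \<odot>\<^bsub>vspace M\<^esub> v \<in> lin M (D (t + 1 + 1)) ` vecs M (I (t + 1 + 1))) \<longrightarrow>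
      v \<in> lin M (D (t + 1 + 1)) ` vecs M (I (t + 1 + 1)))"
    by (rule L.tacyclic_cokernel_module[OF co(1) mR])
  then obtain N :: "'a fg_module" where N: "totally_reflexive R N" and
    Ns': "\<forall>(M :: ('a, 'b) module) v. rmodule R M \<longrightarrow>
      socle \<mm> (tensor_module R M N) = {\<zero>\<^bsub>tensor_module R M N\<^esub>} \<longrightarrow> v \<in> vecs M (I (t + 1)) \<longrightarrow>
      (\<forall>a\<in>\<mm>. a \<odot>\<^bsub>vspace M\<^esub> v \<in> lin M (D (t + 1 + 1)) ` vecs M (I (t + 1 + 1))) \<longrightarrow>
      v \<in> lin M (D (t + 1 + 1)) ` vecs M (I (t + 1 + 1))"
    by (elim exE conjE)
  note Ns = Ns'[rule_format]
  define M where "M = B N"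
  have M: "rmodule R M" and soc: "socle \<mm> (tensor_module R M N) = {\<zero>\<^bsub>tensor_module R M N\<^esub>}"
    using assms(2)[OF N] by (auto simp: M_def rmodule_def big_cohen_macaulay_def)
  obtain xs where sop: "system_of_parameters R \<mm> xs" and reg: "regular_sequence R M xs"
    using assms(2)[OF N] by (auto simp: M_def big_cohen_macaulay_def)
  interpret M: rmodule R M by (rule M)
  have "enat (length xs) = krull_dim R" using sop by (simp add: system_of_parameters_def)
  then have len: "int s < int (length xs)" using dim by (metis enat_ord_simps(2) of_nat_less_iff)
  have xm: "set xs \<subseteq> \<mm>" using sop by (simp add: system_of_parameters_def)
  note wr = M.regular_sequence_weakly_regular[OF reg]
  have rad: "\<exists>k::nat. y [^] k \<in> Idl (set xs)" if "y \<in> set ys" for y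
  proof -
    have "y \<in> radical R (Idl (set xs))"
      using that L.genideal_self[OF ys(1)] ys(2) sop by (simp add: system_of_parameters_def subset_iff)
    then show ?thesis by (auto simp: radical_def)
  qed
  \<comment> \<open>The module satisfies \<open>\<mm>M \<noteq> M\<close>: powers of the generators of \<open>\<mm>\<close> lie in the
    ideal of the system of parameters, so \<open>\<mm>M = M\<close> would imply \<open>(xs) M = M\<close>.\<close>
  have nm: "smult_sum M {\<zero>\<^bsub>M\<^esub>} ys \<noteq> carrier M"
  proof
    assume e: "smult_sum M {\<zero>\<^bsub>M\<^esub>} ys = carrier M"
    let ?K = "smult_sum M {\<zero>\<^bsub>M\<^esub>} xs"
    note p = M.smult_sum_props[OF M.zero_submodule wr(2)]
    note p' = M.smult_sum_props[OF p(1) ys(1)]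
    have "smult_sum M {\<zero>\<^bsub>M\<^esub>} ys \<subseteq> smult_sum M ?K ys"
      by (rule M.smult_sum_least[OF p'(1)]) (use p(2) p'(2,3) in auto)
    then have "smult_sum M ?K ys = carrier M" using e M.submodD(1)[OF p'(1)] by blast
    moreover have "\<exists>k::nat. \<forall>b\<in>carrier M. y [^] k \<odot>\<^bsub>M\<^esub> b \<in> ?K" if "y \<in> set ys" for y
      using rad[OF that] M.idl_smult_mem[OF p(1) _ wr(2)] p(3) by blast
    ultimately have "?K = carrier M" by (rule M.smult_sum_nilpotent[OF p(1) ys(1)])
    then show False using wr(3) by simp
  qed
  have cQ: "cx R Q DQ" by (rule coneD(2)[OF cone])
  obtain z0 where z0: "z0 \<in> vecs (regular_module R) (Q (t + 1))"
    "rlin R (DQ (t + 1)) z0 = \<zero>\<^bsub>vspace (regular_module R)\<^esub>"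
    "z0 \<notin> rlin R (DQ (t + 2)) ` vecs (regular_module R) (Q (t + 2))"
    using L.nonboundary_in_quotient[OF G C t(2) x0] unfolding DQ_def Q_def by blast
  obtain u where u: "u \<in> vecs M (Q (t + 1))" "lin M (DQ (t + 1)) u = \<zero>\<^bsub>vspace M\<^esub>"
    "u \<notin> lin M (DQ (t + 2)) ` vecs M (Q (t + 2))"
    using M.base_change_cycle[OF L ys nm cQ h1 z0] by blast
  have kx: "\<exists>l::nat. \<forall>j. kills R (x [^] l) (copart I) DL j" if x: "x \<in> set xs" for x
  proof -
    have xm': "x \<in> \<mm>" using x xm by blast
    obtain l where l: "\<forall>i. \<forall>x'\<in>cycles G d i. (x [^] (l::nat)) \<odot>\<^bsub>G i\<^esub> x' \<in> boundaries G d i"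
      using finite_length_homology_power[OF L G xm' z assms(7)] by blast
    have "kills R (x [^] l) (copart I) DL j" for j
      by (rule kL) (use l xm' mR in auto)
    then show ?thesis by blast
  qed
  have hL: "\<exists>h (e::nat). \<forall>j>t + 1. htpy R (x [^] e) (copart I) DL h j" if x: "x \<in> set xs" for x
  proof -
    have xc: "x \<in> carrier R" using x wr(2) by blast
    obtain l where l: "\<And>j. kills R (x [^] (l::nat)) (copart I) DL j" using kx[OF x] by blast
    have "\<exists>h (e::nat). \<forall>j\<ge>t + 2. htpy R ((x [^] l) [^] e) (copart I) DL h j" by (rule hom2[OF L.nat_pow_closed[OF xc] l])
    then obtain h e where "\<forall>j\<ge>t + 2. htpy R ((x [^] l) [^] (e::nat)) (copart I) DL h j" by blast
    then show ?thesis using xc by (intro exI[of _ h] exI[of _ "l * e"]) (auto simp: L.nat_pow_pow)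
  qed
  have hQ: "\<exists>h (e::nat). \<forall>j\<le>t + 2. htpy R (x [^] e) Q DQ h j" if x: "x \<in> set xs" for x
  proof -
    have xc: "x \<in> carrier R" using x wr(2) by blast
    obtain l where l: "\<And>j. kills R (x [^] (l::nat)) (copart I) DL j" using kx[OF x] by blast
    have "\<exists>h (e::nat). \<forall>j\<le>t + 1 + 1. htpy R ((x [^] l) [^] e) Q DQ h j" by (rule hom1[OF L.nat_pow_closed[OF xc] l])
    then obtain h e where "\<forall>j\<le>t + 2. htpy R ((x [^] l) [^] (e::nat)) Q DQ h j" by (auto simp: add.assoc)
    then show ?thesis using xc by (intro exI[of _ h] exI[of _ "l * e"]) (auto simp: L.nat_pow_pow)
  qed
  have tor: "\<exists>e::nat. x [^] e \<odot>\<^bsub>vspace M\<^esub> u \<in> lin M (DQ (t + 2)) ` vecs M (Q (t + 2))" if x: "x \<in> set xs" for x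
  proof -
    have xc: "x \<in> carrier R" using x wr(2) by blast
    obtain h e where "\<forall>j\<le>t + 2. htpy R (x [^] (e::nat)) Q DQ h j" using hQ[OF x] by blast
    then have h: "htpy R (x [^] e) Q DQ h (t + 1)" by simp
    have t2: "t + 1 + 1 = t + 2" by simp
    have hM: "h (t + 1) \<in> Mat R (Q (t + 2)) (Q (t + 1))" using h by (simp add: htpy_def t2)
    note hu = M.lin_closed[OF u(1) hM]
    have D2: "DQ (t + 2) \<in> Mat R (Q (t + 1)) (Q (t + 2))" using cxD'(1)[OF cQ, of "t + 1"] by (simp only: t2)
    have "lin M (DQ (t + 2)) (lin M (h (t + 1)) u) \<oplus>\<^bsub>vspace M\<^esub> \<zero>\<^bsub>vspace M\<^esub> = x [^] e \<odot>\<^bsub>vspace M\<^esub> u"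
      using M.htpy_apply[OF cQ h L.nat_pow_closed[OF xc] u(1)] by (simp only: u(2) M.lin_zero t2)
    then have "x [^] e \<odot>\<^bsub>vspace M\<^esub> u = lin M (DQ (t + 2)) (lin M (h (t + 1)) u)"
      using M.lin_zero_sum(1)[OF vecs_UNIV[OF M.lin_closed[OF hu D2]]] by simp
    then show ?thesis using hu by blast
  qed
  have d1: "rdepth (vspace M) (vecs M (copart I (t + 1) \<union> Q (t + 1)))
     (lin M (cone_diff R DL f DQ (t + 2)) ` vecs M (copart I (t + 2) \<union> Q (t + 2))) xs 1"
    unfolding un' cd
  proof -
    have t2: "t + 1 + 1 = t + 2" by simp
    have cI: "cx R I D" using co(1) by (simp add: L.tacyclic_def)
    interpret W: module R "vspace M" by (rule M.vec_module_module)
    interpret W: rmodule R "vspace M" by unfold_locales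
    show "rdepth (vspace M) (vecs M (I (t + 1))) (lin M (D (t + 2)) ` vecs M (I (t + 2))) xs 1"
      by (rule W.rdepth_one_of_socle[OF wr(2) ys(1) rad M.vecs_submodule M.lin_image_submodule[OF cxD(2)[OF cI]]])
         (use Ns[OF M soc] in \<open>auto simp: t2 ys(2)\<close>)
  qed
  have "u \<in> lin M (DQ (t + 2)) ` vecs M (Q (t + 2))"
  proof (rule M.acyclicity[OF cone wr(2) M.weakly_regular_rdepth[OF wr(2) M.zero_submodule wr(1)] Lhigh hL _ t len d1 u(1) tor])
    show "\<exists>h (e::nat). htpy R (x [^] e) Q DQ h (t + 2)" if "x \<in> set xs" for x using hQ[OF that] by blast
  qed
  then show False using u(3) by simp
qed

end
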